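(* Let $\mathbb I=[0,1]$, $Q=\mathbb I\times\mathbb I$, and let $F:Q\to Q$ be a map such that: (1) $F$ has the form $F(x,y)=(T(x),G(x,y))$; (2) there is $\lambda<1$ such that the restriction of $F$ to each vertical leaf $\gamma=\{x\}\times\mathbb I$ is $\lambda$-Lipschitz; (3) $\operatorname{var}^{\square}(G)<\infty$; (4) $T:\mathbb I\to\mathbb I$ is piecewise monotonic, with $n+1$ increasing $C^1$ branches on the intervals $(0,c_1),\dots,(c_i,c_{i+1}),\dots,(c_n,1)$, and $\inf_x|T'(x)|>1$ (infimum over the points where $T'$ is defined); (5) $\frac1{T'}$ has finite universal $p$-bounded variation, for some $1\le p<\infty$; (6) $T$ has only one invariant probability measure absolutely continuous with respect to Lebesgue measure on $\mathbb I$, and $T$ is weakly mixing for this measure. Then the unique physical measure $\mu_F$ of $F$ has exponential decay of correlations with respect to Lipschitz observables: there are $C,\Lambda\in\mathbb R^+$, $\Lambda<1$, such that for all $f,g\in\mathrm{Lip}(Q)$ and all $n\ge 1$ $$\left|\int f\cdot(g\circ F^{n})\,d\mu_F-\int g\,d\mu_F\int f\,d\mu_F\right|\le C\Lambda^{n}\,\|g\|_{lip}\,\|f\|_{lip}.$$ (In particular, $F$ has exactly one physical measure.)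
   Context: For $g:Q\to\mathbb R$, $L(g)=\sup_{p\ne q\in Q}\frac{|g(p)-g(q)|}{|p-q|}$ (Euclidean distance), $\|g\|_{lip}=\|g\|_\infty+L(g)$, and $\mathrm{Lip}(Q)=\{g:Q\to\mathbb R:\|g\|_{lip}<\infty\}$. Universal $p$-variation: for $g:[0,1]\to\mathbb R$, $\operatorname{var}_p(g)=\sup\big(\sum_{i=1}^{k-1}|g(x_i)-g(x_{i+1})|^p\big)^{1/p}$, the supremum over all finite ordered subdivisions $x_1\le\dots\le x_k$ of $[0,1]$; $g$ has finite universal $p$-bounded variation if $\operatorname{var}_p(g)<\infty$. (For $1/T'$ the finitely many points where $T'$ is undefined are disregarded.) For $f:Q\to\mathbb R$, $\operatorname{var}^{\square}(f)=\sup\sum_{i=1}^{k-1}|f(x_i,y_i)-f(x_{i+1},y_i)|$, the supremum over all $k$, all $x_1\le\dots\le x_k$ in $\mathbb I$ and all $y_1,\dots,y_k\in\mathbb I$. An $F$-invariant Borel probability measure $\mu_F$ is physical if its ergodic basin $B(\mu_F)=\{p\in Q:\lim_{n\to\infty}\frac1n\sum_{j=0}^{n-1}\varphi(F^j(p))=\int\varphi\,d\mu_F\text{ for all continuous }\varphi:Q\to\mathbb R\}$ has positive two-dimensional Lebesgue measure. *)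

theory Defs
  imports "HOL-Probability.Probability"
begin

abbreviation unit_square :: "(real \<times> real) set" where
  "unit_square \<equiv> {0..1} \<times> {0..1}"

text \<open>All suprema of nonnegative quantities are taken in \<open>ennreal\<close>, so that finiteness is
  expressed by \<open>< \<infinity>\<close>.  The distance on \<open>real \<times> real\<close> is the Euclidean one.\<close>

definition lip_seminorm :: "(real \<times> real \<Rightarrow> real) \<Rightarrow> ennreal" where
  "lip_seminorm g =
     (SUP (p, q)\<in>{(p, q). p \<in> unit_square \<and> q \<in> unit_square \<and> p \<noteq> q}.
        ennreal (\<bar>g p - g q\<bar> / dist p q))"

definition lip_norm :: "(real \<times> real \<Rightarrow> real) \<Rightarrow> ennreal" where
  "lip_norm g = (SUP p\<in>unit_square. ennreal \<bar>g p\<bar>) + lip_seminorm g"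

definition Lip :: "(real \<times> real \<Rightarrow> real) set" where
  "Lip = {g. lip_norm g < \<infinity>}"

text \<open>Universal \<open>p\<close>-variation along subdivisions \<open>x 1 \<le> \<dots> \<le> x k\<close> with points in \<open>A\<close>.  The set \<open>A\<close>
  is \<open>{0..1}\<close> for a function defined on the whole unit interval; a smaller \<open>A\<close> disregards the
  points where the function is undefined.\<close>

definition p_variation :: "real \<Rightarrow> real set \<Rightarrow> (real \<Rightarrow> real) \<Rightarrow> ennreal" where
  "p_variation p A g =
     (SUP (x, k)\<in>{(x :: nat \<Rightarrow> real, k). mono_on {1..k} x \<and> x ` {1..k} \<subseteq> A}.
        ennreal ((\<Sum>i = 1..<k. \<bar>g (x i) - g (x (Suc i))\<bar> powr p) powr (1 / p)))"

definition var_square :: "(real \<times> real \<Rightarrow> real) \<Rightarrow> ennreal" where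
  "var_square f =
     (SUP (x, y, k)\<in>{(x :: nat \<Rightarrow> real, y :: nat \<Rightarrow> real, k).
          mono_on {1..k} x \<and> x ` {1..k} \<subseteq> {0..1} \<and> y ` {1..k} \<subseteq> {0..1}}.
        ennreal (\<Sum>i = 1..<k. \<bar>f (x i, y i) - f (x (Suc i), y i)\<bar>))"

text \<open>Maps of the unit interval are total functions on \<open>real\<close> whose values outside \<open>{0..1}\<close> carry
  no information; hence derivatives are taken within \<open>{0..1}\<close> (one-sided at the endpoints).\<close>

definition diff_points :: "(real \<Rightarrow> real) \<Rightarrow> real set" where
  "diff_points T = {x \<in> {0..1}. T differentiable (at x within {0..1})}"

definition unit_deriv :: "(real \<Rightarrow> real) \<Rightarrow> real \<Rightarrow> real" where
  "unit_deriv T x = vector_derivative T (at x within {0..1})"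

definition invariant_prob ::
    "'a::topological_space set \<Rightarrow> ('a \<Rightarrow> 'a) \<Rightarrow> 'a measure \<Rightarrow> bool" where
  "invariant_prob X f \<mu> \<longleftrightarrow>
     prob_space \<mu> \<and> sets \<mu> = sets (restrict_space borel X) \<and>
     f \<in> measurable \<mu> \<mu> \<and> distr \<mu> \<mu> f = \<mu>"

text \<open>The reference measure is Lebesgue measure on the Borel sets of \<open>{0..1}\<close>: the library's
  \<open>absolutely_continuous\<close> compares null sets, so both measures must have the same sigma-algebra.\<close>

definition ac_invariant_prob :: "(real \<Rightarrow> real) \<Rightarrow> real measure \<Rightarrow> bool" where
  "ac_invariant_prob T \<nu> \<longleftrightarrow>
     invariant_prob {0..1} T \<nu> \<and> absolutely_continuous (restrict_space lborel {0..1}) \<nu>"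

definition weakly_mixing :: "('a \<Rightarrow> 'a) \<Rightarrow> 'a measure \<Rightarrow> bool" where
  "weakly_mixing f \<mu> \<longleftrightarrow>
     (\<forall>A\<in>sets \<mu>. \<forall>B\<in>sets \<mu>.
        (\<lambda>n. (\<Sum>j<n. \<bar>measure \<mu> (A \<inter> ((f ^^ j) -` B \<inter> space \<mu>)) - measure \<mu> A * measure \<mu> B\<bar>)
               / real n) \<longlonglongrightarrow> 0)"

definition ergodic_basin ::
    "(real \<times> real \<Rightarrow> real \<times> real) \<Rightarrow> (real \<times> real) measure \<Rightarrow> (real \<times> real) set" where
  "ergodic_basin F \<mu> =
     {p \<in> unit_square. \<forall>\<phi> :: real \<times> real \<Rightarrow> real. continuous_on unit_square \<phi> \<longrightarrow>
        (\<lambda>n. (\<Sum>j<n. \<phi> ((F ^^ j) p)) / real n) \<longlonglongrightarrow> (\<integral>q. \<phi> q \<partial>\<mu>)}"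

text \<open>\<open>emeasure\<close> vanishes on nonmeasurable sets, so the second conjunct below includes the
  measurability of the basin (which is automatic for a Borel map \<open>F\<close>).\<close>

definition physical_measure ::
    "(real \<times> real \<Rightarrow> real \<times> real) \<Rightarrow> (real \<times> real) measure \<Rightarrow> bool" where
  "physical_measure F \<mu> \<longleftrightarrow>
     invariant_prob unit_square F \<mu> \<and> 0 < emeasure lebesgue (ergodic_basin F \<mu>)"

end

theory Submission
  imports Defs
begin

text \<open>The argument is elementary: no spectral theory is used.  Write \<open>g = 1 / T'\<close> and let the weight of a
  cylinder of depth \<open>n\<close> be the supremum of \<open>g * (g \<circ> T) * \<dots> * (g \<circ> T\<^sup>n\<^sup>-\<^sup>1)\<close> over it.  The \<open>p\<close>-variation of \<open>g\<close>
  bounds the total weight of the cylinders of depth \<open>n\<close> uniformly in \<open>n\<close>.  In place of functions of bounded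
  variation one takes functions whose oscillations over the cylinders of depth \<open>n\<close>, summed against the weights,
  are \<open>O(r\<^sup>n)\<close>; on these the transfer operator satisfies a Lasota-Yorke inequality.  Uniqueness of the
  absolutely continuous invariant measure and weak mixing give convergence of the transfer operator in
  \<open>L\<^sup>1\<close>, uniformly over the unit ball of this class, and the inequality makes it exponential.

  For a Lipschitz function \<open>f\<close> of the square, \<open>x \<mapsto> f (F\<^sup>k (x, 0))\<close> belongs to the class with constant
  \<open>O(r\<^sup>-\<^sup>k)\<close>, because \<open>G\<close> has bounded \<open>var_square\<close>, and it is \<open>O(l\<^sup>k)\<close>-close to \<open>f \<circ> F\<^sup>k\<close> by contraction of
  the leaves.  With \<open>k\<close> a small multiple of \<open>n\<close> this transfers the decay from \<open>T\<close> to \<open>F\<close>.  The decay gives a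
  law of large numbers, so almost every leaf lies in the basin; the exceptional set of leaves is \<open>T\<close>-invariant,
  hence Lebesgue null, again by the decay.\<close>

text \<open>The obstacle is that \<open>1 / T'\<close> has only finite p-variation, so in general
  the distortion on cylinders is not controlled, and images of cylinders are cut by the branch
  points. What the p-variation does give is a count: at most \<open>V / t powr p\<close> disjoint
  intervals carry an oscillation of \<open>g\<close> above \<open>t\<close>. Boundedness of the
  total weight is then reached indirectly: the trivial bound is a power of
  \<open>N * \<kappa>\<close>, and a renewal inequality over a fine partition lowers the growth rate
  by a fixed factor until it is 1.

  Weak mixing, for its part, speaks of \<nu> only, whose density \<rho> may vanish on a set of
  positive length. The link to Lebesgue measure is uniqueness: as the powers of the transfer
  operator are uniformly bounded, every Cesaro cluster point of the images of a bounded density is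
  absolutely continuous and invariant, hence a multiple of \<nu>. So at some time nearly all mass
  lies where \<rho> is positive, and there the density can be divided by \<rho>.\<close>

definition sup0 :: "('a \<Rightarrow> real) \<Rightarrow> 'a set \<Rightarrow> real" where
  "sup0 f Y = Sup (insert 0 (f ` Y))"

text \<open>As in \<open>sup0\<close>, the inserted 0 gives the value 0 on the empty set, so empty
  cylinders drop out of all sums over words.\<close>

definition osc0 :: "('a \<Rightarrow> real) \<Rightarrow> 'a set \<Rightarrow> real" where
  "osc0 h Y = sup0 (\<lambda>(x, y). \<bar>h x - h y\<bar>) (Y \<times> Y)"

lemma sup0_ge:
  assumes "\<And>y. y \<in> Y \<Longrightarrow> f y \<le> B" "x \<in> Y"
  shows "f x \<le> sup0 f Y"
  unfolding sup0_def using assms by (intro cSup_upper) (auto intro!: bdd_aboveI[of _ B])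

lemma sup0_nonneg:
  assumes "\<And>y. y \<in> Y \<Longrightarrow> f y \<le> B"
  shows "0 \<le> sup0 f Y"
  unfolding sup0_def using assms by (intro cSup_upper) (auto intro!: bdd_aboveI[of _ B])

lemma sup0_le: "0 \<le> B \<Longrightarrow> (\<And>y. y \<in> Y \<Longrightarrow> f y \<le> B) \<Longrightarrow> sup0 f Y \<le> B"
  unfolding sup0_def by (intro cSup_least) auto

lemma sup0_empty [simp]: "sup0 f {} = 0"
  by (simp add: sup0_def)

lemma sup0_approx:
  assumes "t < sup0 f Y" "0 \<le> t"
  obtains x where "x \<in> Y" "t < f x"
proof -
  have "\<not> (\<forall>y\<in>Y. f y \<le> t)" using sup0_le[of t Y f] assms by force
  then show ?thesis using that by force
qed

lemma osc0_le: "0 \<le> B \<Longrightarrow> (\<And>x y. x \<in> Y \<Longrightarrow> y \<in> Y \<Longrightarrow> \<bar>h x - h y\<bar> \<le> B) \<Longrightarrow> osc0 h Y \<le> B"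
  unfolding osc0_def by (rule sup0_le) auto

lemma osc0_ge:
  assumes "\<And>y. y \<in> Y \<Longrightarrow> \<bar>h y\<bar> \<le> B" "x \<in> Y" "y \<in> Y"
  shows "\<bar>h x - h y\<bar> \<le> osc0 h Y"
proof -
  have "(\<lambda>(x, y). \<bar>h x - h y\<bar>) (x, y) \<le> osc0 h Y"
    unfolding osc0_def
  proof (rule sup0_ge[where B = "2 * B"])
    fix z assume "z \<in> Y \<times> Y"
    then obtain u v where "z = (u, v)" "u \<in> Y" "v \<in> Y" by auto
    then show "(case z of (x, y) \<Rightarrow> \<bar>h x - h y\<bar>) \<le> 2 * B"
      using assms(1)[of u] assms(1)[of v] by auto
  qed (use assms in auto)
  then show ?thesis by simp
qed

lemma osc0_nonneg:
  assumes "\<And>y. y \<in> Y \<Longrightarrow> \<bar>h y\<bar> \<le> B"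
  shows "0 \<le> osc0 h Y"
  unfolding osc0_def
proof (rule sup0_nonneg[where B = "2 * B"])
  fix z assume "z \<in> Y \<times> Y"
  then obtain u v where "z = (u, v)" "u \<in> Y" "v \<in> Y" by auto
  then show "(case z of (x, y) \<Rightarrow> \<bar>h x - h y\<bar>) \<le> 2 * B"
    using assms(1)[of u] assms(1)[of v] by auto
qed

lemma osc0_approx:
  assumes "t < osc0 h Y" "0 \<le> t"
  obtains x y where "x \<in> Y" "y \<in> Y" "t < \<bar>h x - h y\<bar>"
proof -
  obtain z where "z \<in> Y \<times> Y" "t < (\<lambda>(x, y). \<bar>h x - h y\<bar>) z"
    using sup0_approx[OF assms[unfolded osc0_def]] by blast
  then show ?thesis using that by (cases z) auto
qed

lemma osc0_empty [simp]: "osc0 h {} = 0"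
  by (simp add: osc0_def)

text \<open>A finite family of disjoint ordered pairs of points can be threaded on one increasing chain;
  this is how sums over cylinders are compared with variations along subdivisions.\<close>

lemma chain_of_pairs:
  fixes a b :: "'u \<Rightarrow> real"
  assumes fin: "finite U" and ab: "\<And>u. u \<in> U \<Longrightarrow> a u \<le> b u"
    and sep: "\<And>u v. u \<in> U \<Longrightarrow> v \<in> U \<Longrightarrow> u \<noteq> v \<Longrightarrow> b u < a v \<or> b v < a u"
  shows "\<exists>(e :: nat \<Rightarrow> 'u) (x :: nat \<Rightarrow> real).
    bij_betw e {..<card U} U \<and> mono_on {1..2 * card U} x \<and>
    (\<forall>j<card U. x (2 * j + 1) = a (e j)) \<and> (\<forall>j<card U. x (2 * j + 2) = b (e j)) \<and>
    x ` {1..2 * card U} \<subseteq> a ` U \<union> b ` U"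
proof -
  have inj: "inj_on a U"
  proof (rule inj_onI)
    fix u v assume "u \<in> U" "v \<in> U" "a u = a v"
    then show "u = v" using sep[of u v] ab[of u] ab[of v] by force
  qed
  define xs where "xs = sorted_list_of_set (a ` U)"
  have len: "length xs = card U" using inj fin by (simp add: xs_def card_image)
  define e where "e = (\<lambda>j. the_inv_into U a (xs ! j))"
  have aset: "set xs = a ` U" and dist: "distinct xs" using fin by (simp_all add: xs_def)
  have bj: "bij_betw e {..<card U} U"
  proof -
    have "bij_betw (\<lambda>j. xs ! j) {..<card U} (a ` U)"
      using aset len dist by (intro bij_betw_nth) auto
    moreover have "bij_betw (the_inv_into U a) (a ` U) U"
      using inj by (simp add: bij_betw_the_inv_into bij_betw_imageI)
    ultimately show ?thesis unfolding e_def
      using bij_betw_trans[of "\<lambda>j. xs ! j" _ _ "the_inv_into U a" U] by (simp add: comp_def)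
  qed
  have eU: "e j \<in> U" if "j < card U" for j using bj that by (auto simp: bij_betw_def)
  have ae: "a (e j) = xs ! j" if "j < card U" for j
    unfolding e_def using that aset len nth_mem[of j xs]
    by (intro f_the_inv_into_f[OF inj]) auto
  have lt: "b (e i) < a (e j)" if "i < j" "j < card U" for i j
  proof -
    have "sorted_wrt (<) xs" by (simp add: xs_def)
    then have "xs ! i < xs ! j" using that len by (simp add: sorted_wrt_nth_less)
    then have "a (e i) < a (e j)" using ae that by simp
    moreover have "e i \<noteq> e j" using calculation by auto
    ultimately show ?thesis using sep[of "e i" "e j"] eU[of i] eU[of j] that ab[of "e j"] ab[of "e i"]
      by force
  qed
  \<comment> \<open>Positions \<open>2 * j + 1\<close> and \<open>2 * j + 2\<close> hold the two
    ends of the j-th pair; counting starts at 1 because subdivisions do.\<close>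
  define x where "x = (\<lambda>k. if odd k then a (e ((k - 1) div 2)) else b (e ((k - 1) div 2)))"
  have x1: "x (2 * j + 1) = a (e j)" for j by (simp add: x_def)
  have x2: "x (2 * j + 2) = b (e j)" for j by (simp add: x_def)
  have mono: "mono_on {1..2 * card U} x"
  proof (rule mono_onI)
    fix k k' assume k: "k \<in> {1..2 * card U}" "k' \<in> {1..2 * card U}" "k \<le> k'"
    let ?i = "(k - 1) div 2" and ?j = "(k' - 1) div 2"
    have j: "?i \<le> ?j" "?j < card U" using k by (auto intro: div_le_mono)
    have bi: "x k \<le> b (e ?i)" using ab[OF eU, of ?i] j by (auto simp: x_def)
    have aj: "a (e ?j) \<le> x k'" using ab[OF eU, of ?j] j by (auto simp: x_def)
    show "x k \<le> x k'"
    proof (cases "?i = ?j")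
      case False
      then show ?thesis using lt[of ?i ?j] j bi aj by auto
    next
      case True
      show ?thesis
      proof (cases "odd k")
        case True
        then have "x k = a (e ?i)" by (simp add: x_def)
        then show ?thesis using aj \<open>?i = ?j\<close> by simp
      next
        case False
        then have "even k'" using \<open>?i = ?j\<close> k unfolding atLeastAtMost_iff by presburger
        then have "x k' = b (e ?j)" by (simp add: x_def)
        then show ?thesis using bi \<open>?i = ?j\<close> by simp
      qed
    qed
  qed
  have sub: "x ` {1..2 * card U} \<subseteq> a ` U \<union> b ` U"
  proof
    fix z assume "z \<in> x ` {1..2 * card U}"
    then obtain k where k: "k \<in> {1..2 * card U}" "z = x k" by auto
    have "(k - 1) div 2 < card U" using k by auto
    then show "z \<in> a ` U \<union> b ` U" using k(2) eU by (auto simp: x_def)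
  qed
  show ?thesis using bj mono x1 x2 sub by blast
qed

text \<open>The odd steps of a chain cross the pairs threaded on it; the even steps run between
  pairs and are dropped.\<close>

lemma chain_sum_le:
  fixes \<phi> :: "nat \<Rightarrow> real"
  assumes "\<And>i. 0 \<le> \<phi> i"
  shows "(\<Sum>j<n. \<phi> (2 * j + 1)) \<le> (\<Sum>i = 1..<2 * n. \<phi> i)"
proof -
  have "(\<Sum>j<n. \<phi> (2 * j + 1)) = sum \<phi> ((\<lambda>j. 2 * j + 1) ` {..<n})"
    by (subst sum.reindex) (auto simp: inj_on_def)
  also have "\<dots> \<le> sum \<phi> {1..<2 * n}" using assms by (intro sum_mono2) auto
  finally show ?thesis .
qed

subsection \<open>Cylinders of a piecewise expanding map\<close>

abbreviation LB :: "real measure" where "LB \<equiv> restrict_space lborel {0..1}"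

lemma prob_space_LB: "prob_space LB"
  by (rule prob_spaceI) (simp add: emeasure_restrict_space space_restrict_space)

lemma space_LB [simp]: "space LB = {0..1}"
  by (simp add: space_restrict_space)

lemma sets_LB: "sets LB = sets (restrict_space borel {0..1})"
  by (rule sets_restrict_space_cong) simp

text \<open>\<open>g\<close> stands for \<open>1 / T'\<close>, and \<open>V\<close> bounds the p-th
  power of its p-variation, so that no roots occur. \<open>N\<close> counts the branches. Nothing is
  prescribed about derivatives at the points \<open>c i\<close>.\<close>

locale pw_expanding =
  fixes T g :: "real \<Rightarrow> real" and c :: "nat \<Rightarrow> real" and N :: nat and \<kappa> p V :: real
  assumes T_maps: "\<And>x. x \<in> {0..1} \<Longrightarrow> T x \<in> {0..1}"
    and N_pos: "0 < N" and c_0: "c 0 = 0" and c_N: "c N = 1"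
    and c_less: "\<And>i. i < N \<Longrightarrow> c i < c (Suc i)"
    and T_der: "\<And>i x. i < N \<Longrightarrow> x \<in> {c i<..<c (Suc i)} \<Longrightarrow> (T has_real_derivative 1 / g x) (at x)"
    and g_pos': "\<And>i x. i < N \<Longrightarrow> x \<in> {c i<..<c (Suc i)} \<Longrightarrow> 0 < g x"
    and g_le': "\<And>i x. i < N \<Longrightarrow> x \<in> {c i<..<c (Suc i)} \<Longrightarrow> g x \<le> \<kappa>"
    and g_cont: "\<And>i. i < N \<Longrightarrow> continuous_on {c i<..<c (Suc i)} g"
    and kappa: "0 < \<kappa>" "\<kappa> < 1" and p_ge: "1 \<le> p"
    and pvar: "\<And>k x. mono_on {1..k} x \<Longrightarrow> x ` {1..k} \<subseteq> (\<Union>i<N. {c i<..<c (Suc i)}) \<Longrightarrow>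
       (\<Sum>i = 1..<k. \<bar>g (x i) - g (x (Suc i))\<bar> powr p) \<le> V"
    and T_meas: "T \<in> LB \<rightarrow>\<^sub>M LB"
begin

definition J :: "nat \<Rightarrow> real set" where "J i = {c i<..<c (Suc i)}"

lemma g_pos: "i < N \<Longrightarrow> x \<in> J i \<Longrightarrow> 0 < g x" and g_le: "i < N \<Longrightarrow> x \<in> J i \<Longrightarrow> g x \<le> \<kappa>"
  using g_pos' g_le' by (auto simp: J_def)

lemma V_nonneg: "0 \<le> V"
  using pvar[of 0 "\<lambda>_. 0"] by (simp add: mono_on_def)

lemma c_mono: "i \<le> j \<Longrightarrow> j \<le> N \<Longrightarrow> c i \<le> c j"
proof (induction j)
  case (Suc j)
  then show ?case using c_less[of j] by (cases "i = Suc j") force+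
qed auto

lemma J_sub: "i < N \<Longrightarrow> J i \<subseteq> {0<..<1}"
  using c_mono[of 0 i] c_mono[of "Suc i" N] c_0 c_N by (auto simp: J_def)

lemma J_disjoint: "i < N \<Longrightarrow> j < N \<Longrightarrow> x \<in> J i \<Longrightarrow> x \<in> J j \<Longrightarrow> i = j"
  using c_mono[of "Suc i" j] c_mono[of "Suc j" i] by (cases i j rule: linorder_cases) (auto simp: J_def)

lemma J_cover: assumes "x \<in> {0..1}" "x \<notin> c ` {..N}" shows "\<exists>i<N. x \<in> J i"
proof -
  have "c n < x \<or> (\<exists>i<n. x \<in> J i)" if "n \<le> N" for n
    using that
  proof (induction n)
    case 0 then show ?case using assms c_0 by (auto simp: image_iff intro: order_le_neq_trans)
  next
    case (Suc n)
    then have "c (Suc n) \<noteq> x" using assms by auto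
    then show ?case using Suc by (force simp: J_def less_Suc_eq)
  qed
  from this[of N] show ?thesis using assms c_N by auto
qed

lemma finite_not_J: "finite ({0..1} - (\<Union>i<N. J i))"
  by (rule finite_subset[of _ "c ` {..N}"]) (use J_cover in blast)+

lemma T_expand:
  assumes "i < N" "x \<in> J i" "y \<in> J i" "x < y"
  shows "y - x \<le> \<kappa> * (T y - T x)" "T x < T y"
proof -
  have "\<exists>z. x < z \<and> z < y \<and> T y - T x = (y - x) * (1 / g z)"
    using assms by (intro MVT2) (auto simp: J_def intro!: T_der)
  then obtain z where z: "x < z" "z < y" "T y - T x = (y - x) * (1 / g z)" by blast
  have "z \<in> J i" using z assms by (auto simp: J_def)
  then have gz: "0 < g z" "g z \<le> \<kappa>" using g_pos g_le assms by auto
  show "T x < T y" using z gz assms by (smt (verit) divide_pos_pos mult_pos_pos)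
  have "y - x = g z * (T y - T x)" using z gz by simp
  also have "\<dots> \<le> \<kappa> * (T y - T x)" using gz \<open>T x < T y\<close> by (intro mult_right_mono) auto
  finally show "y - x \<le> \<kappa> * (T y - T x)" .
qed

lemma T_expand_abs:
  assumes "i < N" "x \<in> J i" "y \<in> J i"
  shows "\<bar>x - y\<bar> \<le> \<kappa> * \<bar>T x - T y\<bar>"
  using T_expand[of i x y] T_expand[of i y x] assms by (cases x y rule: linorder_cases) force+

lemma T_inj: "i < N \<Longrightarrow> inj_on T (J i)"
  using T_expand by (intro inj_onI) (metis linorder_neqE_linordered_idom order_less_irrefl)

lemma T_cont: "i < N \<Longrightarrow> continuous_on (J i) T"
  by (intro continuous_at_imp_continuous_on ballI DERIV_isCont[OF T_der[of i]]) (simp_all add: J_def)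

lemma J_open: "open (J i)" and J_convex: "convex (J i)"
  by (auto simp: J_def)

lemma TJ_open: assumes "i < N" shows "open (T ` J i)"
  by (rule injective_eq_1d_open_map_UNIV[THEN iffD1, rule_format, of "J i"])
    (use assms T_cont T_inj J_open J_convex in \<open>auto simp: is_interval_convex_1\<close>)

lemma TJ_convex: "i < N \<Longrightarrow> convex (T ` J i)"
  using T_cont J_convex connected_continuous_image is_interval_connected_1 is_interval_convex_1 by blast

text \<open>\<open>D\<close> is a target for the last iterate: a point follows the itinerary
  \<open>w\<close> and lands in \<open>D\<close> after \<open>length w\<close> steps. The ordinary
  cylinder has the target \<open>{0..1}\<close>; smaller targets localise the weights and allow
  words to be split, as in \<open>cyl_append\<close>.\<close>

fun cyl :: "real set \<Rightarrow> nat list \<Rightarrow> real set" where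
  "cyl D [] = D"
| "cyl D (i # w) = {x \<in> J i. T x \<in> cyl D w}"

definition W :: "nat \<Rightarrow> nat list set" where "W n = {w. length w = n \<and> set w \<subseteq> {..<N}}"

lemma finite_W [simp]: "finite (W n)"
  using finite_lists_length_eq[of "{..<N}" n] by (simp add: W_def conj_commute)

lemma W_0 [simp]: "W 0 = {[]}" by (auto simp: W_def)

lemma W_Suc: "W (Suc n) = (\<lambda>(i, v). i # v) ` ({..<N} \<times> W n)"
  by (auto simp: W_def length_Suc_conv image_iff)

lemma Cons_in_W: "i # v \<in> W (Suc n) \<longleftrightarrow> i < N \<and> v \<in> W n"
  by (auto simp: W_def)

lemma sum_W_Suc: "(\<Sum>w\<in>W (Suc n). f w) = (\<Sum>i<N. \<Sum>v\<in>W n. f (i # v))"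
proof -
  have "(\<Sum>w\<in>W (Suc n). f w) = (\<Sum>q\<in>{..<N} \<times> W n. f (case q of (i, v) \<Rightarrow> i # v))"
    unfolding W_Suc by (subst sum.reindex) (auto simp: inj_on_def)
  then show ?thesis by (simp add: sum.cartesian_product split_def)
qed

lemma sum_W_add: "(\<Sum>w\<in>W (a + b). f w) = (\<Sum>u\<in>W a. \<Sum>v\<in>W b. f (u @ v))"
  by (induction a arbitrary: f) (simp_all add: sum_W_Suc)

lemma card_W: "card (W n) = N ^ n"
  using card_lists_length_eq[of "{..<N}" n] by (simp add: W_def conj_commute)

lemma cyl_append: "cyl D (a @ b) = cyl (cyl D b) a"
  by (induction a) auto

lemma cyl_mono: "D \<subseteq> D' \<Longrightarrow> cyl D w \<subseteq> cyl D' w"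
  by (induction w) auto

lemma cyl_T_pow: "x \<in> cyl D w \<Longrightarrow> (T ^^ length w) x \<in> D"
  by (induction w arbitrary: x) (auto simp: funpow_swap1)

lemma cyl_sub01: "D \<subseteq> {0..1} \<Longrightarrow> w \<in> W n \<Longrightarrow> cyl D w \<subseteq> {0..1}"
  using J_sub by (cases w) (force simp: W_def)+

lemma cyl_disjoint: "u \<in> W n \<Longrightarrow> v \<in> W n \<Longrightarrow> x \<in> cyl D u \<Longrightarrow> x \<in> cyl D' v \<Longrightarrow> u = v"
proof (induction n arbitrary: u v x)
  case (Suc n)
  then obtain i u' j v' where [simp]: "u = i # u'" "v = j # v'" by (auto simp: W_Suc)
  show ?case using Suc.prems Suc.IH[of u' v' "T x"] J_disjoint[of i j x] by (auto simp: Cons_in_W)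
qed auto

lemma cyl_convex: "convex D \<Longrightarrow> w \<in> W n \<Longrightarrow> convex (cyl D w)"
proof (induction n arbitrary: w)
  case (Suc n)
  then obtain i v where w: "w = i # v" "i < N" "v \<in> W n" by (auto simp: W_Suc)
  have "is_interval (cyl D v)" using Suc w is_interval_convex_1 by blast
  then have "is_interval (cyl D w)"
    unfolding is_interval_1
  proof (intro ballI allI impI, goal_cases)
    case (1 a b x)
    have x: "x \<in> J i" using 1 w by (auto simp: J_def)
    have ab: "a \<in> J i" "b \<in> J i" using 1 w by auto
    have "T a \<le> T x" using 1 T_expand(2)[OF w(2) ab(1) x] by (cases "a = x") auto
    moreover have "T x \<le> T b" using 1 T_expand(2)[OF w(2) x ab(2)] by (cases "x = b") auto
    ultimately show ?case using 1 w x by auto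
  qed
  then show ?case using is_interval_convex_1 by blast
qed auto

lemma cyl_contract:
  "w \<in> W n \<Longrightarrow> x \<in> cyl D w \<Longrightarrow> y \<in> cyl D w \<Longrightarrow> \<bar>x - y\<bar> \<le> \<kappa> ^ n * \<bar>(T ^^ n) x - (T ^^ n) y\<bar>"
proof (induction n arbitrary: w x y)
  case (Suc n)
  then obtain i v where w: "w = i # v" "i < N" "v \<in> W n" by (auto simp: W_Suc)
  have "\<bar>x - y\<bar> \<le> \<kappa> * \<bar>T x - T y\<bar>" using Suc w by (intro T_expand_abs[of i]) auto
  also have "\<bar>T x - T y\<bar> \<le> \<kappa> ^ n * \<bar>(T ^^ n) (T x) - (T ^^ n) (T y)\<bar>"
    using Suc w by (intro Suc.IH[of v]) auto
  finally show ?case using kappa by (simp add: funpow_swap1 mult_left_mono mult.assoc)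
qed auto

text \<open>On a cylinder of depth \<open>n\<close> this is the reciprocal of the derivative of
  \<open>T ^^ n\<close>, by the chain rule.\<close>

definition gn :: "nat \<Rightarrow> real \<Rightarrow> real" where "gn n x = (\<Prod>k<n. g ((T ^^ k) x))"

lemma gn_0 [simp]: "gn 0 x = 1" by (simp add: gn_def)

lemma gn_Suc: "gn (Suc n) x = g x * gn n (T x)"
  unfolding gn_def by (subst prod.lessThan_Suc_shift) (simp add: funpow_swap1)

lemma gn_pos: "w \<in> W n \<Longrightarrow> x \<in> cyl D w \<Longrightarrow> 0 < gn n x"
proof (induction n arbitrary: w x)
  case (Suc n)
  then obtain i v where w: "w = i # v" "i < N" "v \<in> W n" by (auto simp: W_Suc)
  show ?case using Suc w g_pos[of i x] by (auto simp: gn_Suc)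
qed auto

lemma gn_le: "w \<in> W n \<Longrightarrow> x \<in> cyl D w \<Longrightarrow> gn n x \<le> \<kappa> ^ n"
proof (induction n arbitrary: w x)
  case (Suc n)
  then obtain i v where w: "w = i # v" "i < N" "v \<in> W n" by (auto simp: W_Suc)
  have "gn n (T x) \<le> \<kappa> ^ n" "0 < gn n (T x)" using Suc w gn_pos[of v n "T x" D] by auto
  then show ?case using w Suc.prems g_le[of i x] g_pos[of i x] kappa by (auto simp: gn_Suc intro!: mult_mono)
qed auto

lemma gn_add: "gn (a + b) x = gn a x * gn b ((T ^^ a) x)"
  by (induction a arbitrary: x) (auto simp: gn_Suc funpow_swap1)

definition wt :: "real set \<Rightarrow> nat list \<Rightarrow> real" where
  "wt D w = sup0 (gn (length w)) (cyl D w)"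

lemma length_W: "w \<in> W n \<Longrightarrow> length w = n" by (simp add: W_def)

lemma wt_ge: "w \<in> W n \<Longrightarrow> x \<in> cyl D w \<Longrightarrow> gn n x \<le> wt D w"
  unfolding wt_def using gn_le by (auto simp: length_W intro!: sup0_ge[of _ "gn n"])

lemma wt_nonneg: "w \<in> W n \<Longrightarrow> 0 \<le> wt D w"
  unfolding wt_def using gn_le by (auto simp: length_W intro!: sup0_nonneg)

lemma wt_le: "w \<in> W n \<Longrightarrow> wt D w \<le> \<kappa> ^ n"
  unfolding wt_def using gn_le kappa by (auto simp: length_W intro!: sup0_le)

text \<open>For the target \<open>{0..1}\<close> this dominates the sup norm of the n-th power of
  the transfer operator applied to 1; a bound uniform in \<open>n\<close> takes the place of a
  distortion estimate.\<close>

definition wsum :: "real set \<Rightarrow> nat \<Rightarrow> real" where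
  "wsum D n = (\<Sum>w\<in>W n. wt D w)"

lemma wsum_nonneg: "0 \<le> wsum D n"
  unfolding wsum_def by (intro sum_nonneg) (auto intro: wt_nonneg)

text \<open>The last iterate of a point of \<open>cyl Y w\<close> lies in some member
  \<open>D\<close> of the cover, so the point itself lies in \<open>cyl D w\<close> and its
  \<open>gn\<close> is seen by \<open>wt D w\<close>.\<close>

lemma wt_Cover:
  assumes w: "w \<in> W n" and fin: "finite \<D>" and cov: "Y \<subseteq> \<Union>\<D>"
  shows "wt Y w \<le> (\<Sum>D\<in>\<D>. wt D w)"
  unfolding wt_def[of Y]
proof (rule sup0_le)
  show "0 \<le> (\<Sum>D\<in>\<D>. wt D w)" using wt_nonneg[OF w] by (intro sum_nonneg) auto
  fix x assume x: "x \<in> cyl Y w"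
  then have "(T ^^ n) x \<in> Y" using cyl_T_pow[OF x] length_W[OF w] by simp
  then obtain D where D: "D \<in> \<D>" "(T ^^ n) x \<in> D" using cov by auto
  have "x \<in> cyl D w" using x w D(2)
    by (induction w arbitrary: n x) (auto simp: W_def funpow_swap1)
  then have "gn n x \<le> wt D w" using w wt_ge by auto
  also have "\<dots> \<le> (\<Sum>D\<in>\<D>. wt D w)" using D fin wt_nonneg[OF w] by (intro member_le_sum) auto
  finally show "gn (length w) x \<le> (\<Sum>D\<in>\<D>. wt D w)" using length_W[OF w] by simp
qed

lemma wsum_cover:
  assumes "finite \<D>" "Y \<subseteq> \<Union>\<D>"
  shows "wsum Y n \<le> (\<Sum>D\<in>\<D>. wsum D n)"
proof -
  have "wsum Y n \<le> (\<Sum>w\<in>W n. \<Sum>D\<in>\<D>. wt D w)"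
    unfolding wsum_def by (intro sum_mono wt_Cover assms)
  then show ?thesis unfolding wsum_def by (subst sum.swap)
qed

text \<open>There are \<open>N ^ n\<close> words of weight at most \<open>\<kappa> ^ n\<close>. This
  is the starting rate that is improved later.\<close>

lemma wsum_trivial: "wsum D n \<le> (real N * \<kappa>) ^ n"
proof -
  have "wsum D n \<le> (\<Sum>w\<in>W n. \<kappa> ^ n)" unfolding wsum_def by (intro sum_mono wt_le) auto
  then show ?thesis by (simp add: card_W power_mult_distrib)
qed

text \<open>The only place where the \<open>p\<close>-variation enters.\<close>

lemma count_osc:
  assumes fin: "finite U" and conv: "\<And>u. u \<in> U \<Longrightarrow> convex (Y u)"
    and sub: "\<And>u. u \<in> U \<Longrightarrow> Y u \<subseteq> (\<Union>i<N. J i)"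
    and disj: "\<And>u v. u \<in> U \<Longrightarrow> v \<in> U \<Longrightarrow> u \<noteq> v \<Longrightarrow> Y u \<inter> Y v = {}"
    and t: "0 < t" and osc: "\<And>u. u \<in> U \<Longrightarrow> t < osc0 g (Y u)"
  shows "real (card U) * t powr p \<le> V"
proof -
  have "\<forall>u\<in>U. \<exists>a b. a \<in> Y u \<and> b \<in> Y u \<and> a \<le> b \<and> t < \<bar>g a - g b\<bar>"
  proof
    fix u assume "u \<in> U"
    from osc[OF this] t obtain x y where "x \<in> Y u" "y \<in> Y u" "t < \<bar>g x - g y\<bar>"
      by (auto elim: osc0_approx)
    then show "\<exists>a b. a \<in> Y u \<and> b \<in> Y u \<and> a \<le> b \<and> t < \<bar>g a - g b\<bar>"
      by (metis abs_minus_commute linear)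
  qed
  then obtain a b where ab: "\<And>u. u \<in> U \<Longrightarrow> a u \<in> Y u \<and> b u \<in> Y u \<and> a u \<le> b u \<and> t < \<bar>g (a u) - g (b u)\<bar>"
    by metis
  \<comment> \<open>By convexity the whole interval from \<open>a u\<close> to \<open>b u\<close>
    belongs to \<open>Y u\<close>, so disjointness of the sets separates the intervals.\<close>
  have mem: "x \<in> Y u" if "u \<in> U" "a u \<le> x" "x \<le> b u" for u x
    using conv[OF that(1)] ab[OF that(1)] that is_interval_convex_1[of "Y u"] unfolding is_interval_1 by blast
  have sep: "b u < a v \<or> b v < a u" if "u \<in> U" "v \<in> U" "u \<noteq> v" for u v
  proof (rule ccontr)
    assume "\<not> ?thesis"
    then have "max (a u) (a v) \<in> Y u \<inter> Y v"
      using mem[OF that(1), of "max (a u) (a v)"] mem[OF that(2), of "max (a u) (a v)"] ab[OF that(1)] ab[OF that(2)]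
      by (auto simp: max_def)
    then show False using disj[OF that] by auto
  qed
  obtain e :: "nat \<Rightarrow> 'a" and x where e: "bij_betw e {..<card U} U" "mono_on {1..2 * card U} x"
    "\<And>j. j < card U \<Longrightarrow> x (2 * j + 1) = a (e j)" "\<And>j. j < card U \<Longrightarrow> x (2 * j + 2) = b (e j)"
    "x ` {1..2 * card U} \<subseteq> a ` U \<union> b ` U"
    using chain_of_pairs[of U a b, OF fin _ sep] ab by auto
  let ?n = "card U"
  have eU: "e j \<in> U" if "j < ?n" for j using e(1) that by (auto simp: bij_betw_def)
  have "real ?n * t powr p = (\<Sum>j<?n. t powr p)" by simp
  also have "\<dots> \<le> (\<Sum>j<?n. \<bar>g (x (2 * j + 1)) - g (x (Suc (2 * j + 1)))\<bar> powr p)"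
  proof (intro sum_mono)
    fix j assume "j \<in> {..<?n}"
    then have "j < ?n" by simp
    then show "t powr p \<le> \<bar>g (x (2 * j + 1)) - g (x (Suc (2 * j + 1)))\<bar> powr p"
      using e(3)[of j] e(4)[of j] ab[OF eU, of j] t p_ge by (intro powr_mono2) auto
  qed
  also have "\<dots> \<le> (\<Sum>i = 1..<2 * ?n. \<bar>g (x i) - g (x (Suc i))\<bar> powr p)"
    by (rule chain_sum_le[of "\<lambda>i. \<bar>g (x i) - g (x (Suc i))\<bar> powr p"]) simp
  also have "\<dots> \<le> V"
  proof (rule pvar[OF e(2)])
    have "a ` U \<union> b ` U \<subseteq> (\<Union>i<N. J i)" using ab sub by blast
    then show "x ` {1..2 * card U} \<subseteq> (\<Union>i<N. {c i<..<c (Suc i)})"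
      using subset_trans[OF e(5)] by (simp add: J_def)
  qed
  finally show ?thesis .
qed

end

subsection \<open>The transfer operator\<close>

text \<open>The bound holds everywhere rather than almost everywhere: oscillations over cylinders
  are taken pointwise, and integrals against \<open>LB\<close> and \<nu> then share one
  bound.\<close>

definition bm :: "real \<Rightarrow> (real \<Rightarrow> real) \<Rightarrow> bool" where
  "bm A h \<longleftrightarrow> h \<in> borel_measurable LB \<and> (\<forall>x\<in>{0..1}. \<bar>h x\<bar> \<le> A)"

lemma bm_nonneg: "bm A h \<Longrightarrow> 0 \<le> A"
  unfolding bm_def by (auto dest: bspec[of _ _ 0])

lemma bm_mono: "bm A h \<Longrightarrow> A \<le> B \<Longrightarrow> bm B h"
  by (force simp: bm_def)

lemma finite_measure_LB: "finite_measure LB"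
  using prob_space_LB by (simp add: prob_space_def)

lemma measure_LB_space [simp]: "measure LB {0..1} = 1"
  using prob_space.prob_space[OF prob_space_LB] by simp

lemma bm_integrable: "bm A h \<Longrightarrow> integrable LB h"
  unfolding bm_def
  by (intro finite_measure.integrable_const_bound[OF finite_measure_LB, of _ A] AE_I2) auto

lemma bm_abs: "bm A h \<Longrightarrow> bm A (\<lambda>x. \<bar>h x\<bar>)"
  by (auto simp: bm_def)

lemma integral_le_bm:
  assumes "bm A h" "bm B f" "\<And>x. x \<in> {0..1} \<Longrightarrow> h x \<le> f x"
  shows "integral\<^sup>L LB h \<le> integral\<^sup>L LB f"
  by (rule integral_mono[OF bm_integrable[OF assms(1)] bm_integrable[OF assms(2)]]) (use assms in auto)

lemma bm_const: "bm \<bar>a\<bar> (\<lambda>_. a)"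
  by (auto simp: bm_def)

lemma bm_integral_bound:
  assumes "bm A h" shows "\<bar>integral\<^sup>L LB h\<bar> \<le> A"
proof -
  have "\<bar>integral\<^sup>L LB h\<bar> \<le> (\<integral>x. \<bar>h x\<bar> \<partial>LB)" by (rule integral_abs_bound)
  also have "\<dots> \<le> (\<integral>x. A \<partial>LB)"
    using assms bm_const[of A] by (intro integral_le_bm[OF bm_abs[OF assms] bm_const]) (auto simp: bm_def)
  finally show ?thesis by simp
qed

lemma bm_mult: "bm A h \<Longrightarrow> bm B f \<Longrightarrow> bm (A * B) (\<lambda>x. h x * f x)"
  by (auto simp: bm_def abs_mult intro!: mult_mono intro: order_trans[OF abs_ge_zero])

lemma bm_add: "bm A h \<Longrightarrow> bm B f \<Longrightarrow> bm (A + B) (\<lambda>x. h x + f x)"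
  by (force simp: bm_def)

lemma bm_diff: "bm A h \<Longrightarrow> bm B f \<Longrightarrow> bm (A + B) (\<lambda>x. h x - f x)"
  by (force simp: bm_def)

lemma bm_cmult: "bm A h \<Longrightarrow> bm (\<bar>a\<bar> * A) (\<lambda>x. a * h x)"
  by (auto simp: bm_def abs_mult intro!: mult_mono)

lemma bm_indicator: "A \<in> sets LB \<Longrightarrow> bm 1 (indicator A)"
  by (auto simp: bm_def indicator_def)

lemma bm_sum: "(\<And>i. i \<in> I \<Longrightarrow> bm (A i) (h i)) \<Longrightarrow> bm (\<Sum>i\<in>I. A i) (\<lambda>x. \<Sum>i\<in>I. h i x)"
  unfolding bm_def by (auto intro!: order_trans[OF sum_abs] sum_mono borel_measurable_sum)

lemma in_sets_LB: "S \<in> sets borel \<Longrightarrow> S \<subseteq> {0..1} \<Longrightarrow> S \<in> sets LB"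
  by (auto simp: sets_restrict_space_iff)

lemma AE_LB_finite: "finite S \<Longrightarrow> AE x in LB. x \<notin> S"
proof -
  assume S: "finite S"
  have "AE x in lborel. x \<notin> S"
    using S by (intro AE_not_in) (auto simp: null_sets_def emeasure_lborel_countable countable_finite finite_imp_closed borel_closed)
  then show ?thesis by (auto simp: AE_restrict_space_iff)
qed

text \<open>The bridge from the Bochner integral over \<open>LB\<close> to the gauge integral, for
  which the change of variables is formulated.\<close>

lemma LB_integral_lebesgue:
  fixes f :: "real \<Rightarrow> real"
  assumes "f \<in> borel_measurable LB" "S \<in> sets borel" "S \<subseteq> {0..1}"
    and "\<And>x. x \<in> {0..1} \<Longrightarrow> \<bar>f x\<bar> \<le> B"
  shows "f absolutely_integrable_on S" "integral\<^sup>L LB (\<lambda>x. indicator S x * f x) = integral S f"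
proof -
  have m: "(\<lambda>x. indicator {0..1} x * f x) \<in> borel_measurable lborel"
    using assms(1) borel_measurable_restrict_space_iff[of "{0..1}" lborel f] by simp
  have eq: "indicator S x * f x = indicator S x * (indicator {0..1} x * f x)" for x
    using assms(3) by (auto simp: indicator_def)
  have "(\<lambda>x. indicator S x * (indicator {0..1} x * f x)) \<in> borel_measurable lborel"
    by (rule borel_measurable_times[OF borel_measurable_indicator m]) (use assms(2) in simp)
  then have m2: "(\<lambda>x. indicator S x * f x) \<in> borel_measurable lborel"
    by (simp only: eq[symmetric])
  have "bm (1 * B) (\<lambda>x. indicator S x * f x)"
    using assms by (intro bm_mult bm_indicator in_sets_LB) (auto simp: bm_def)
  then have "integrable LB (\<lambda>x. indicator S x * f x)" by (rule bm_integrable)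
  then have "integrable lborel (\<lambda>x. indicator {0..1} x *\<^sub>R (indicator S x * f x))"
    using integrable_restrict_space[of "{0..1}" lborel "\<lambda>x. indicator S x * f x"]
    by (simp add: set_integrable_def)
  moreover have "(\<lambda>x. indicator {0..1} x *\<^sub>R (indicator S x * f x)) = (\<lambda>x. indicator S x * f x)"
    using assms(3) by (auto simp: indicator_def fun_eq_iff)
  ultimately have int: "integrable lborel (\<lambda>x. indicator S x * f x)" by simp
  then have "integrable lebesgue (\<lambda>x. indicator S x * f x)"
    using m2 by (simp add: integrable_completion)
  then show ai: "f absolutely_integrable_on S" by (simp add: set_integrable_def)
  have "integral\<^sup>L LB (\<lambda>x. indicator S x * f x) = (\<integral>x. indicator {0..1} x * (indicator S x * f x) \<partial>lborel)"
    by (subst integral_restrict_space) (auto simp: set_lebesgue_integral_def)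
  also have "\<dots> = (\<integral>x. indicator S x * f x \<partial>lborel)"
    using assms(3) by (intro Bochner_Integration.integral_cong) (auto simp: indicator_def)
  also have "\<dots> = (\<integral>x. indicator S x * f x \<partial>lebesgue)"
    using m2 by (simp add: integral_completion)
  also have "\<dots> = integral S f"
    using set_lebesgue_integral_eq_integral(2)[OF ai] by (simp add: set_lebesgue_integral_def)
  finally show "integral\<^sup>L LB (\<lambda>x. indicator S x * f x) = integral S f" .
qed

context pw_expanding
begin

text \<open>\<open>iv i\<close> inverts the branch \<open>i\<close> on \<open>T ` J i\<close>; as a supremum it is monotone, hence Borel, on the
  whole line.\<close>

definition iv :: "nat \<Rightarrow> real \<Rightarrow> real" where
  "iv i x = Sup (insert (c i) {y \<in> J i. T y \<le> x})"

lemma bdd_iv: "i < N \<Longrightarrow> bdd_above (insert (c i) {y \<in> J i. T y \<le> x})"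
  using c_less[of i] by (auto intro!: bdd_aboveI[of _ "c (Suc i)"] simp: J_def)

lemma iv_mono: "i < N \<Longrightarrow> mono (iv i)"
  unfolding iv_def by (intro monoI cSup_subset_mono bdd_iv) auto

lemma iv_T: assumes "i < N" "y \<in> J i" shows "iv i (T y) = y"
proof -
  have "{y' \<in> J i. T y' \<le> T y} = {y' \<in> J i. y' \<le> y}"
    using T_expand(2)[of i] assms by (metis (mono_tags, lifting) linorder_not_le nle_le order_le_less)
  also have "insert (c i) \<dots> = {c i..y}" using assms by (auto simp: J_def)
  finally show ?thesis using assms by (auto simp: iv_def J_def)
qed

lemma iv_measurable: "i < N \<Longrightarrow> iv i \<in> borel_measurable borel"
  by (intro borel_measurable_mono iv_mono)

text \<open>The summand of the transfer operator that belongs to branch \<open>i\<close>, extended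
  by 0 outside the image of the branch.\<close>

definition L1 :: "nat \<Rightarrow> (real \<Rightarrow> real) \<Rightarrow> real \<Rightarrow> real" where
  "L1 i h x = (if x \<in> T ` J i then h (iv i x) * g (iv i x) else 0)"

lemma L1_T: "i < N \<Longrightarrow> y \<in> J i \<Longrightarrow> L1 i h (T y) = h y * g y"
  by (auto simp: L1_def iv_T)

lemma J_meas: "J i \<in> sets borel" by (simp add: J_def)

lemma J_sets_LB: "i < N \<Longrightarrow> J i \<in> sets LB"
  using J_meas J_sub[of i] by (intro in_sets_LB) auto

lemma TJ_sub: "i < N \<Longrightarrow> T ` J i \<subseteq> {0..1}"
  using T_maps J_sub by force

lemma T_pow_maps: "x \<in> {0..1} \<Longrightarrow> (T ^^ n) x \<in> {0..1}"
  using T_maps by (induction n) auto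

lemma T_pow_meas: "T ^^ n \<in> LB \<rightarrow>\<^sub>M LB"
  using T_meas by (induction n) (auto intro: measurable_comp)

lemma bm_comp_T: "bm A h \<Longrightarrow> bm A (\<lambda>x. h ((T ^^ n) x))"
  using T_pow_maps measurable_comp[OF T_pow_meas, of h borel n] by (auto simp: bm_def comp_def)

lemma bm_comp_T1: "bm A h \<Longrightarrow> bm A (\<lambda>x. h (T x))"
  using bm_comp_T[of A h 1] by simp

lemma L1_bm:
  assumes i: "i < N" and h: "bm A h"
  shows "bm (A * \<kappa>) (L1 i h)"
  unfolding bm_def
proof
  have h0: "(\<lambda>x. indicator {0..1} x * h x) \<in> borel_measurable borel"
    using h by (simp add: bm_def borel_measurable_restrict_space_iff)
  have g0: "(\<lambda>x. indicator (J i) x * g x) \<in> borel_measurable borel"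
    using borel_measurable_continuous_on_indicator[OF J_meas g_cont[OF i, folded J_def]] by simp
  \<comment> \<open>On the image of the branch \<open>iv i\<close> takes values in
    \<open>J i\<close>, so the inserted indicators change nothing there; they make every factor
    Borel on the whole line.\<close>
  have "L1 i h = (\<lambda>x. indicator (T ` J i) x * ((indicator {0..1} (iv i x) * h (iv i x)) * (indicator (J i) (iv i x) * g (iv i x))))"
    using J_sub[OF i] by (intro ext) (force simp: L1_def iv_T[OF i] indicator_def)
  also have "\<dots> \<in> borel_measurable borel"
    using TJ_open[OF i]
    by (intro borel_measurable_times borel_measurable_indicator
        measurable_compose[OF iv_measurable[OF i] h0] measurable_compose[OF iv_measurable[OF i] g0]) auto
  finally show "L1 i h \<in> borel_measurable LB"
    by (simp add: measurable_restrict_space1)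
  show "\<forall>x\<in>{0..1}. \<bar>L1 i h x\<bar> \<le> A * \<kappa>"
  proof
    fix x :: real assume "x \<in> {0..1}"
    show "\<bar>L1 i h x\<bar> \<le> A * \<kappa>"
    proof (cases "x \<in> T ` J i")
      case True
      then obtain y where y: "y \<in> J i" "x = T y" by auto
      have "\<bar>h y\<bar> \<le> A" using h y J_sub[OF i] by (force simp: bm_def)
      then show ?thesis using y g_le[OF i y(1)] g_pos[OF i y(1)] bm_nonneg[OF h]
        by (auto simp: L1_T[OF i] abs_mult intro!: mult_mono)
    next
      case False
      then show ?thesis using bm_nonneg[OF h] kappa by (simp add: L1_def)
    qed
  qed
qed

text \<open>Substituting \<open>T y\<close> on \<open>J i\<close> produces the Jacobian
  \<open>1 / g\<close>, which cancels the weight \<open>g\<close> in \<open>L1\<close>.\<close>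

lemma dual1:
  assumes i: "i < N" and h: "bm A h" and f: "bm B f"
  shows "(\<integral>x. L1 i h x * f x \<partial>LB) = (\<integral>x. indicator (J i) x * (h x * f (T x)) \<partial>LB)"
proof -
  let ?F = "\<lambda>x. L1 i h x * f x"
  have F: "bm (A * \<kappa> * B) ?F" by (intro bm_mult L1_bm i h f)
  have TJ: "T ` J i \<in> sets borel" using TJ_open[OF i] by simp
  note FF = LB_integral_lebesgue[of ?F "T ` J i" "A * \<kappa> * B", OF _ TJ TJ_sub[OF i]]
  have H: "bm (A * B) (\<lambda>x. h x * f (T x))" by (intro bm_mult h bm_comp_T1[OF f])
  note HH = LB_integral_lebesgue[of "\<lambda>x. h x * f (T x)" "J i" "A * B", OF _ J_meas]
  have "(\<lambda>x. \<bar>1 / g x\<bar> * ?F (T x)) absolutely_integrable_on J i \<and>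
           integral (J i) (\<lambda>x. \<bar>1 / g x\<bar> * ?F (T x)) = integral (T ` J i) ?F
     \<longleftrightarrow> ?F absolutely_integrable_on (T ` J i) \<and> integral (T ` J i) ?F = integral (T ` J i) ?F"
    by (rule has_absolute_integral_change_of_variables_1'[of "J i" T "\<lambda>x. 1 / g x" ?F])
      (use J_meas T_inj[OF i] T_der[OF i] in \<open>auto simp: J_def intro: has_field_derivative_at_within\<close>)
  then have "integral (J i) (\<lambda>x. \<bar>1 / g x\<bar> * ?F (T x)) = integral (T ` J i) ?F"
    using FF F by (auto simp: bm_def)
  moreover have "integral (J i) (\<lambda>x. \<bar>1 / g x\<bar> * ?F (T x)) = integral (J i) (\<lambda>x. h x * f (T x))"
  proof (rule Henstock_Kurzweil_Integration.integral_cong)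
    fix x assume x: "x \<in> J i"
    show "\<bar>1 / g x\<bar> * ?F (T x) = h x * f (T x)"
      using g_pos[OF i x] by (simp add: L1_T[OF i x])
  qed
  moreover have "(\<integral>x. ?F x \<partial>LB) = (\<integral>x. indicator (T ` J i) x * ?F x \<partial>LB)"
    by (intro Bochner_Integration.integral_cong) (auto simp: L1_def indicator_def)
  moreover have "(\<integral>x. indicator (T ` J i) x * ?F x \<partial>LB) = integral (T ` J i) ?F"
    using F by (intro FF(2)) (auto simp: bm_def)
  moreover have "(\<integral>x. indicator (J i) x * (h x * f (T x)) \<partial>LB) = integral (J i) (\<lambda>x. h x * f (T x))"
    using H J_sub[OF i] by (intro HH(2)) (auto simp: bm_def subset_iff less_imp_le)
  ultimately show ?thesis by simp
qed

text \<open>The part of the power \<open>P ^^ length w\<close> that is carried by the cylinder of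
  \<open>w\<close>. The first letter acts first, since an orbit visits that branch first.\<close>

fun L :: "nat list \<Rightarrow> (real \<Rightarrow> real) \<Rightarrow> real \<Rightarrow> real" where
  "L [] h = h"
| "L (i # w) h = L w (L1 i h)"

definition P :: "(real \<Rightarrow> real) \<Rightarrow> real \<Rightarrow> real" where
  "P h x = (\<Sum>i<N. L1 i h x)"

lemma cyl_meas: "D \<in> sets LB \<Longrightarrow> w \<in> W n \<Longrightarrow> cyl D w \<in> sets LB"
proof (induction n arbitrary: w)
  case (Suc n)
  then obtain i v where w: "w = i # v" "i < N" "v \<in> W n" by (auto simp: W_Suc)
  have "cyl D w = J i \<inter> (T -` cyl D v \<inter> space LB)" using w J_sub[of i] by force
  then show ?case using Suc w J_sets_LB measurable_sets[OF T_meas] by auto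
qed auto

lemma L_bm: "w \<in> W n \<Longrightarrow> bm A h \<Longrightarrow> bm (A * \<kappa> ^ n) (L w h)"
proof (induction n arbitrary: w h A)
  case (Suc n)
  then obtain i v where w: "w = i # v" "i < N" "v \<in> W n" by (auto simp: W_Suc)
  show ?case using Suc.IH[OF w(3) L1_bm[OF w(2) Suc.prems(2)]] w by (simp add: mult.assoc)
qed auto

abbreviation Z :: "nat list \<Rightarrow> real set" where "Z w \<equiv> cyl {0..1} w"

lemma Z_sets: "w \<in> W n \<Longrightarrow> Z w \<in> sets LB"
  by (rule cyl_meas) (auto intro: in_sets_LB)

lemma dualL:
  "w \<in> W n \<Longrightarrow> bm A h \<Longrightarrow> bm B f \<Longrightarrow>
    (\<integral>x. L w h x * f x \<partial>LB) = (\<integral>x. indicator (Z w) x * (h x * f ((T ^^ n) x)) \<partial>LB)"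
proof (induction n arbitrary: w h A)
  case 0
  then show ?case by (auto intro!: Bochner_Integration.integral_cong)
next
  case (Suc n)
  then obtain i v where w: "w = i # v" "i < N" "v \<in> W n" by (auto simp: W_Suc)
  have b: "bm (1 * B) (\<lambda>x. indicator (Z v) x * f ((T ^^ n) x))"
    by (intro bm_mult bm_indicator Z_sets[OF w(3)] bm_comp_T Suc.prems)
  have "(\<integral>x. L w h x * f x \<partial>LB) = (\<integral>x. indicator (Z v) x * (L1 i h x * f ((T ^^ n) x)) \<partial>LB)"
    using Suc.IH[OF w(3) L1_bm[OF w(2) Suc.prems(2)] Suc.prems(3)] w by simp
  also have "\<dots> = (\<integral>x. L1 i h x * (indicator (Z v) x * f ((T ^^ n) x)) \<partial>LB)"
    by (simp add: mult_ac)
  also have "\<dots> = (\<integral>x. indicator (J i) x * (h x * (indicator (Z v) (T x) * f ((T ^^ n) (T x)))) \<partial>LB)"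
    by (rule dual1[OF w(2) Suc.prems(2) b])
  also have "\<dots> = (\<integral>x. indicator (Z w) x * (h x * f ((T ^^ Suc n) x)) \<partial>LB)"
    using w by (intro Bochner_Integration.integral_cong) (auto simp: indicator_def funpow_swap1)
  finally show ?case .
qed

lemma L_sum: "L w (\<lambda>x. \<Sum>i\<in>I. h i x) x = (\<Sum>i\<in>I. L w (h i) x)"
proof (induction w arbitrary: h x)
  case (Cons i w)
  have "L1 i (\<lambda>x. \<Sum>j\<in>I. h j x) = (\<lambda>x. \<Sum>j\<in>I. L1 i (h j) x)"
    by (auto simp: L1_def sum_distrib_right)
  then show ?case using Cons by simp
qed auto

lemma P_pow: "(P ^^ n) h x = (\<Sum>w\<in>W n. L w h x)"
proof (induction n arbitrary: h x)
  case (Suc n)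
  have "(P ^^ Suc n) h x = (P ^^ n) (P h) x" by (simp add: funpow_swap1)
  also have "\<dots> = (\<Sum>w\<in>W n. L w (\<lambda>x. \<Sum>i<N. L1 i h x) x)" using Suc by (simp add: P_def[abs_def])
  also have "\<dots> = (\<Sum>w\<in>W (Suc n). L w h x)"
    by (subst sum_W_Suc) (simp add: L_sum, rule sum.swap)
  finally show ?case .
qed auto

lemma P_bm: "bm A h \<Longrightarrow> bm (real N * (A * \<kappa>)) (P h)"
  using bm_sum[of "{..<N}" "\<lambda>_. A * \<kappa>" "\<lambda>i. L1 i h"] L1_bm by (simp add: P_def[abs_def])

lemma AE_J: "AE x in LB. (\<Sum>i<N. indicator (J i) x) = (1::real)"
proof -
  have "AE x in LB. x \<notin> {0..1} - (\<Union>i<N. J i)" by (rule AE_LB_finite[OF finite_not_J])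
  then show ?thesis
  proof (rule AE_mp, intro AE_I2 impI)
    fix x assume "x \<in> space LB" "x \<notin> {0..1} - (\<Union>i<N. J i)"
    then obtain i where i: "i < N" "x \<in> J i" by auto
    have "(\<Sum>j<N. indicator (J j) x) = (\<Sum>j<N. if j = i then 1 else (0::real))"
    proof (rule sum.cong[OF refl])
      fix j assume "j \<in> {..<N}"
      then show "indicator (J j) x = (if j = i then 1 else (0::real))"
        using i J_disjoint[of j i x] by (cases "j = i") (auto simp: indicator_def)
    qed
    then show "(\<Sum>i<N. indicator (J i) x) = (1::real)" using i by simp
  qed
qed

lemma dualP:
  assumes h: "bm A h" and f: "bm B f"
  shows "(\<integral>x. P h x * f x \<partial>LB) = (\<integral>x. h x * f (T x) \<partial>LB)"
proof -
  have b: "bm (A * B) (\<lambda>x. h x * f (T x))" by (intro bm_mult h bm_comp_T1[OF f])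
  have "(\<integral>x. P h x * f x \<partial>LB) = (\<Sum>i<N. \<integral>x. L1 i h x * f x \<partial>LB)"
    unfolding P_def sum_distrib_right
    by (intro Bochner_Integration.integral_sum bm_integrable[OF bm_mult[OF L1_bm[OF _ h] f]]) auto
  also have "\<dots> = (\<Sum>i<N. \<integral>x. indicator (J i) x * (h x * f (T x)) \<partial>LB)"
    using dual1[OF _ h f] by simp
  also have "\<dots> = (\<integral>x. (\<Sum>i<N. indicator (J i) x * (h x * f (T x))) \<partial>LB)"
    by (intro Bochner_Integration.integral_sum[symmetric] bm_integrable[OF bm_mult[OF bm_indicator b]]) (auto simp: J_sets_LB)
  also have "\<dots> = (\<integral>x. h x * f (T x) \<partial>LB)"
  proof (rule integral_cong_AE)
    show "(\<lambda>x. h x * f (T x)) \<in> borel_measurable LB" using b by (simp add: bm_def)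
    then show "(\<lambda>x. \<Sum>i<N. indicator (J i) x * (h x * f (T x))) \<in> borel_measurable LB"
      by (intro borel_measurable_sum borel_measurable_times[OF borel_measurable_indicator])
        (auto simp only: J_sets_LB lessThan_iff)
    show "AE x in LB. (\<Sum>i<N. indicator (J i) x * (h x * f (T x))) = h x * f (T x)"
      using AE_J by eventually_elim (simp add: sum_distrib_right[symmetric])
  qed
  finally show ?thesis .
qed

text \<open>Along a fixed word the branches are injective, so at most one preimage \<open>y\<close>
  of \<open>x\<close> lies in \<open>Z w\<close>, and \<open>L w h x\<close> is the single summand
  of the transfer operator at \<open>y\<close>.\<close>

lemma L_point:
  "w \<in> W n \<Longrightarrow> L w h x = 0 \<or> (\<exists>y\<in>Z w. (T ^^ n) y = x \<and> L w h x = h y * gn n y)" if "x \<in> {0..1}" 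
proof (induction n arbitrary: w h)
  case 0
  then show ?case using that by auto
next
  case (Suc n)
  then obtain i v where w: "w = i # v" "i < N" "v \<in> W n" by (auto simp: W_Suc)
  show ?case
  proof (cases "L w h x = 0")
    case False
    then obtain y where y: "y \<in> Z v" "(T ^^ n) y = x" "L v (L1 i h) x = L1 i h y * gn n y"
      using Suc.IH[OF w(3), of "L1 i h"] w by auto
    then have "y \<in> T ` J i" using False w by (auto simp: L1_def split: if_splits)
    then obtain z where z: "z \<in> J i" "y = T z" by auto
    have "z \<in> Z w" "(T ^^ Suc n) z = x" "L w h x = h z * gn (Suc n) z"
      using y z w by (auto simp: funpow_swap1 L1_T gn_Suc)
    then show ?thesis by blast
  qed auto
qed

text \<open>On \<open>Y\<close> the slope \<open>1 / g\<close> is at most \<open>1 / s\<close>, so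
  \<open>T\<close> stretches lengths by no more than that factor. In dual form:
  \<open>L1 i (indicator Y)\<close> is at least \<open>s\<close> on \<open>S\<close> and has the
  integral \<open>measure LB Y\<close>.\<close>

lemma measure_branch:
  assumes i: "i < N" and Y: "Y \<in> sets LB" "Y \<subseteq> J i" and S: "S \<in> sets LB" "S \<subseteq> T ` Y"
    and s: "0 \<le> s" "\<And>y. y \<in> Y \<Longrightarrow> s \<le> g y"
  shows "s * measure LB S \<le> measure LB Y"
proof -
  have "s * measure LB S = (\<integral>x. s * indicator S x \<partial>LB)"
    using S sets.sets_into_space[OF S(1)] by (simp add: Int_absorb2)
  also have "\<dots> \<le> (\<integral>x. L1 i (indicator Y) x \<partial>LB)"
  proof (rule integral_le_bm[OF bm_cmult[OF bm_indicator[OF S(1)]] L1_bm[OF i bm_indicator[OF Y(1)]]])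
    fix x :: real
    have nn: "0 \<le> L1 i (indicator Y) x"
      by (auto simp: L1_def iv_T[OF i] intro!: mult_nonneg_nonneg less_imp_le[OF g_pos[OF i]])
    show "s * indicator S x \<le> L1 i (indicator Y) x"
    proof (cases "x \<in> S")
      case True
      then obtain y where "y \<in> Y" "x = T y" using S by auto
      then show ?thesis using s Y True by (auto simp: L1_T[OF i])
    qed (use nn in auto)
  qed
  also have "\<dots> = (\<integral>x. L1 i (indicator Y) x * 1 \<partial>LB)" by simp
  also have "\<dots> = (\<integral>x. indicator (J i) x * (indicator Y x * 1) \<partial>LB)"
    by (rule dual1[OF i bm_indicator[OF Y(1)] bm_const])
  also have "\<dots> = (\<integral>x. indicator Y x \<partial>LB)"
    using Y by (intro Bochner_Integration.integral_cong) (auto simp: indicator_def)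
  finally show ?thesis using sets.sets_into_space[OF Y(1)] by (simp add: Int_absorb2)
qed

subsection \<open>Boundedness of the cylinder weights\<close>

lemma cyl_inj: "w \<in> W n \<Longrightarrow> inj_on (T ^^ n) (cyl D w)"
proof (rule inj_onI)
  fix x y assume "w \<in> W n" "x \<in> cyl D w" "y \<in> cyl D w" "(T ^^ n) x = (T ^^ n) y"
  then show "x = y" using cyl_contract[of w n x D y] by simp
qed

lemma cyl_cont: "w \<in> W n \<Longrightarrow> continuous_on (cyl D w) (T ^^ n)"
proof (induction n arbitrary: w)
  case (Suc n)
  then obtain i v where w: "w = i # v" "i < N" "v \<in> W n" by (auto simp: W_Suc)
  have "continuous_on (cyl D w) ((T ^^ n) \<circ> T)"
  proof (rule continuous_on_compose)
    show "continuous_on (cyl D w) T"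
      using continuous_on_subset[OF T_cont[OF w(2)]] w by auto
    show "continuous_on (T ` cyl D w) (T ^^ n)"
      by (rule continuous_on_subset[OF Suc.IH[OF w(3)]]) (use w in auto)
  qed
  then show ?case by (simp add: funpow_Suc_right del: funpow.simps)
qed auto

text \<open>Depth at least one is essential: the empty word gives the closed interval
  \<open>{0..1}\<close>.\<close>

lemma Z_open: "w \<in> W (Suc n) \<Longrightarrow> open (Z w)"
proof (induction n arbitrary: w)
  case 0
  then obtain i where w: "w = [i]" "i < N" by (auto simp: W_Suc)
  then have "Z w = J i" using T_maps J_sub[OF w(2)] by force
  then show ?case using J_open by simp
next
  case (Suc n)
  then obtain i v where w: "w = i # v" "i < N" "v \<in> W (Suc n)" by (auto simp: W_Suc)
  have "open (T -` Z v \<inter> J i)"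
    using continuous_on_open_vimage[OF J_open, THEN iffD1, OF T_cont[OF w(2)]] Suc.IH[OF w(3)] by blast
  moreover have "T -` Z v \<inter> J i = Z w" using w by auto
  ultimately show ?case by simp
qed

lemma Z_convex: "w \<in> W n \<Longrightarrow> convex (Z w)"
  by (rule cyl_convex) auto

lemma Z_sub: "w \<in> W n \<Longrightarrow> Z w \<subseteq> {0..1}"
  by (rule cyl_sub01) auto

lemma TZ_open_convex:
  assumes w: "w \<in> W (Suc n)"
  shows "open ((T ^^ Suc n) ` Z w)" "convex ((T ^^ Suc n) ` Z w)"
proof -
  show "open ((T ^^ Suc n) ` Z w)"
    by (rule injective_eq_1d_open_map_UNIV[THEN iffD1, rule_format, of "Z w"])
      (use Z_open[OF w] cyl_cont[OF w] cyl_inj[OF w] Z_convex[OF w] in \<open>auto simp: is_interval_convex_1\<close>)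
  show "convex ((T ^^ Suc n) ` Z w)"
    using cyl_cont[OF w, of "{0..1}"] Z_convex[OF w] connected_continuous_image is_interval_connected_1 is_interval_convex_1 by blast
qed

lemma open_convex_real:
  assumes "open I" "convex I" "I \<noteq> {}" "I \<subseteq> {0..1}"
  shows "I = {Inf I<..<Sup (I::real set)}"
proof -
  have bdd: "bdd_above I" "bdd_below I"
    using bdd_above_mono[OF _ assms(4)] bdd_below_mono[OF _ assms(4)] by simp_all
  have ends: "Inf I < x" "x < Sup I" if x: "x \<in> I" for x
  proof -
    obtain e where e: "e > 0" "ball x e \<subseteq> I" using assms(1) x openE by blast
    have "x - e / 2 \<in> I" "x + e / 2 \<in> I" using e by (auto simp: dist_real_def subset_iff)
    then have "Inf I \<le> x - e / 2" "x + e / 2 \<le> Sup I" using bdd by (auto intro: cInf_lower cSup_upper)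
    then show "Inf I < x" "x < Sup I" using e by auto
  qed
  have "x \<in> I" if x: "Inf I < x" "x < Sup I" for x
  proof -
    obtain a b where "a \<in> I" "a < x" "b \<in> I" "x < b"
      using x cInf_lessD[OF assms(3)] less_cSupD[OF assms(3)] by blast
    then show ?thesis using assms(2) is_interval_convex_1[of I] unfolding is_interval_1 by fastforce
  qed
  then show ?thesis using ends by auto
qed

lemma TJ_interval: assumes "i < N" shows "T ` J i = {Inf (T ` J i)<..<Sup (T ` J i)}"
  using assms c_less[OF assms] TJ_open TJ_convex TJ_sub
  by (intro open_convex_real) (auto simp: J_def)

text \<open>The image of a branch is an interval with two ends. A cylinder that meets it without
  lying inside contains one of these ends, and cylinders of equal depth are disjoint.\<close>

lemma cut_count:
  assumes i: "i < N" and D: "convex D"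
  shows "card {v \<in> W n. cyl D v \<inter> T ` J i \<noteq> {} \<and> \<not> cyl D v \<subseteq> T ` J i} \<le> 2"
proof -
  define s t where "s = Inf (T ` J i)" and "t = Sup (T ` J i)"
  have I: "T ` J i = {s<..<t}" using TJ_interval[OF i] by (simp add: s_def t_def)
  let ?A = "\<lambda>s. {v \<in> W n. s \<in> cyl D v}"
  have c1: "card (?A s) \<le> 1" for s
    using cyl_disjoint[of _ n _ s D D] by (intro card_le_Suc0_iff_eq[THEN iffD2, unfolded One_nat_def[symmetric]]) auto
  have "{v \<in> W n. cyl D v \<inter> T ` J i \<noteq> {} \<and> \<not> cyl D v \<subseteq> T ` J i} \<subseteq> ?A s \<union> ?A t"
  proof
    fix v assume v: "v \<in> {v \<in> W n. cyl D v \<inter> T ` J i \<noteq> {} \<and> \<not> cyl D v \<subseteq> T ` J i}"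
    then obtain x y where x: "x \<in> cyl D v" "s < x" "x < t" and y: "y \<in> cyl D v" "y \<le> s \<or> t \<le> y"
      unfolding I by fastforce
    have "is_interval (cyl D v)" using cyl_convex[OF D] v is_interval_convex_1 by blast
    then have "s \<in> cyl D v \<or> t \<in> cyl D v" using x y unfolding is_interval_1 by (metis less_imp_le)
    then show "v \<in> ?A s \<union> ?A t" using v by auto
  qed
  then have "card {v \<in> W n. cyl D v \<inter> T ` J i \<noteq> {} \<and> \<not> cyl D v \<subseteq> T ` J i} \<le> card (?A s \<union> ?A t)"
    by (intro card_mono) auto
  also have "\<dots> \<le> 2" using card_Un_le[of "?A s" "?A t"] c1[of s] c1[of t] by linarith
  finally show ?thesis .
qed

definition sg :: "real set \<Rightarrow> nat list \<Rightarrow> real" where "sg D y = sup0 g (cyl D y)"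

text \<open>If the branch \<open>hd y\<close> covers \<open>cyl D (tl y)\<close> up to finitely many points, then \<open>g\<close> contributes only its
  oscillation to \<open>dl\<close>; only at cut cylinders is the full supremum of \<open>g\<close> lost.  The weights \<open>iota\<close> are
  products of lower bounds of \<open>g\<close> and are therefore summable by comparison with lengths.\<close>

definition uncut :: "real set \<Rightarrow> nat list \<Rightarrow> bool" where
  "uncut D y \<longleftrightarrow> finite (cyl D (tl y) - T ` J (hd y))"

definition dl :: "real set \<Rightarrow> nat list \<Rightarrow> real" where
  "dl D y = (if uncut D y then osc0 g (cyl D y) else sg D y)"

fun iota :: "real set \<Rightarrow> nat list \<Rightarrow> real" where
  "iota D [] = 1"
| "iota D (i # v) = (sg D (i # v) - dl D (i # v)) * iota D v"

lemma abs_g_le: "i < N \<Longrightarrow> y \<in> cyl D (i # v) \<Longrightarrow> \<bar>g y\<bar> \<le> \<kappa>"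
  using g_pos g_le by force

lemma sg_ge: "i < N \<Longrightarrow> y \<in> cyl D (i # v) \<Longrightarrow> g y \<le> sg D (i # v)"
  unfolding sg_def using g_le by (intro sup0_ge[of _ g \<kappa>]) auto

lemma sg_le: "i < N \<Longrightarrow> sg D (i # v) \<le> \<kappa>"
  unfolding sg_def using g_le kappa by (intro sup0_le) auto

lemma sg_nonneg: "i < N \<Longrightarrow> 0 \<le> sg D (i # v)"
  unfolding sg_def using g_le by (intro sup0_nonneg[of _ g \<kappa>]) auto

lemma osc_nonneg: "i < N \<Longrightarrow> 0 \<le> osc0 g (cyl D (i # v))"
  by (rule osc0_nonneg[where B = \<kappa>]) (rule abs_g_le)

lemma osc_g_ge: "i < N \<Longrightarrow> x \<in> cyl D (i # v) \<Longrightarrow> y \<in> cyl D (i # v) \<Longrightarrow> \<bar>g x - g y\<bar> \<le> osc0 g (cyl D (i # v))"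
  by (rule osc0_ge[where B = \<kappa>]) (rule abs_g_le)

lemma dl_bounds: assumes i: "i < N" shows "0 \<le> dl D (i # v)" "dl D (i # v) \<le> sg D (i # v)"
proof -
  have "osc0 g (cyl D (i # v)) \<le> sg D (i # v)"
  proof (rule osc0_le[OF sg_nonneg[OF i]])
    fix x y assume "x \<in> cyl D (i # v)" "y \<in> cyl D (i # v)"
    then show "\<bar>g x - g y\<bar> \<le> sg D (i # v)"
      using sg_ge[OF i, of x D v] sg_ge[OF i, of y D v] g_pos[OF i, of x] g_pos[OF i, of y] by auto
  qed
  then show "0 \<le> dl D (i # v)" "dl D (i # v) \<le> sg D (i # v)"
    using osc_nonneg[OF i] sg_nonneg[OF i] by (auto simp: dl_def)
qed

text \<open>Supremum minus oscillation is a lower bound in the uncut case; in the cut case the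
  difference is 0.\<close>

lemma inf_le_g: assumes i: "i < N" and y: "y \<in> cyl D (i # v)" shows "sg D (i # v) - dl D (i # v) \<le> g y"
proof (cases "uncut D (i # v)")
  case True
  have "sg D (i # v) \<le> g y + osc0 g (cyl D (i # v))"
    unfolding sg_def
  proof (rule sup0_le)
    show "0 \<le> g y + osc0 g (cyl D (i # v))" using g_pos[OF i] y osc_nonneg[OF i, of D v] by (auto intro: add_nonneg_nonneg less_imp_le)
    fix z assume "z \<in> cyl D (i # v)"
    then show "g z \<le> g y + osc0 g (cyl D (i # v))" using osc_g_ge[OF i, of z D v y] y by auto
  qed
  then show ?thesis using True by (simp add: dl_def)
next
  case False
  then show ?thesis using g_pos[OF i, of y] y by (auto simp: dl_def)
qed

lemma iota_nonneg: "w \<in> W n \<Longrightarrow> 0 \<le> iota D w"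
proof (induction n arbitrary: w)
  case (Suc n)
  then obtain i v where w: "w = i # v" "i < N" "v \<in> W n" by (auto simp: W_Suc)
  show ?case using Suc.IH[OF w(3)] dl_bounds(2)[OF w(2), of D v] w by auto
qed auto

lemma iota_le_gn: "w \<in> W n \<Longrightarrow> x \<in> cyl D w \<Longrightarrow> iota D w \<le> gn n x"
proof (induction n arbitrary: w x)
  case (Suc n)
  then obtain i v where w: "w = i # v" "i < N" "v \<in> W n" by (auto simp: W_Suc)
  have "iota D v \<le> gn n (T x)" using Suc w by auto
  then show ?case using inf_le_g[OF w(2), of x D v] Suc.prems w iota_nonneg[OF w(3), of D] g_pos[OF w(2), of x]
    by (auto simp: gn_Suc intro!: mult_mono)
qed auto

text \<open>Telescoping of \<open>gn n = g * \<dots> * g\<close> against the product of the lower bounds.\<close>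

lemma gn_expand:
  "w \<in> W n \<Longrightarrow> x \<in> cyl D w \<Longrightarrow>
    gn n x \<le> iota D w + (\<Sum>k<n. gn k x * (dl D (drop k w) * iota D (drop (Suc k) w)))"
proof (induction n arbitrary: w x)
  case (Suc n)
  then obtain i v where w: "w = i # v" "i < N" "v \<in> W n" by (auto simp: W_Suc)
  let ?S = "\<Sum>k<n. gn k (T x) * (dl D (drop k v) * iota D (drop (Suc k) v))"
  have x: "x \<in> J i" "T x \<in> cyl D v" "x \<in> cyl D (i # v)" using Suc.prems w by auto
  have "gn (Suc n) x \<le> g x * (iota D v + ?S)"
    using Suc.IH[OF w(3) x(2)] g_pos[OF w(2) x(1)] by (simp add: gn_Suc)
  also have "\<dots> = g x * iota D v + g x * ?S" by (simp add: algebra_simps)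
  also have "g x * iota D v \<le> sg D (i # v) * iota D v"
    using sg_ge[OF w(2) x(3)] iota_nonneg[OF w(3)] by (intro mult_right_mono)
  also have "\<dots> + g x * ?S = iota D w + (\<Sum>k<Suc n. gn k x * (dl D (drop k w) * iota D (drop (Suc k) w)))"
    using w by (subst sum.lessThan_Suc_shift) (simp add: gn_Suc sum_distrib_left algebra_simps)
  finally show ?case by simp
qed auto

text \<open>The coefficients of the renewal inequality for \<open>wsum\<close>. The head of
  \<open>y\<close> is the letter at which \<open>g\<close> is compared with its lower bound; the
  letters after it already carry lower bounds.\<close>

definition eps :: "real set \<Rightarrow> nat \<Rightarrow> real" where
  "eps D d = (\<Sum>y\<in>W d. dl D y * iota D (tl y))"

lemma drop_W: "w \<in> W n \<Longrightarrow> drop k w \<in> W (n - k)"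
  by (auto simp: W_def dest: in_set_dropD)

lemma take_W: "w \<in> W n \<Longrightarrow> k \<le> n \<Longrightarrow> take k w \<in> W k"
  by (auto simp: W_def dest: in_set_takeD)

text \<open>Each term of \<open>gn_expand\<close> splits \<open>w\<close> at \<open>k\<close>: the
  first \<open>k\<close> letters keep their true weight over the target \<open>cyl D y\<close>, the
  next letter pays \<open>dl\<close>, and the rest contributes \<open>iota\<close>. Summing over the
  two halves separately makes it a renewal inequality.\<close>

lemma wsum_expand:
  "wsum D n \<le> (\<Sum>w\<in>W n. iota D w) + (\<Sum>k<n. \<Sum>y\<in>W (n - k). wsum (cyl D y) k * (dl D y * iota D (tl y)))"
proof -
  let ?t = "\<lambda>w k. wt (cyl D (drop k w)) (take k w) * (dl D (drop k w) * iota D (tl (drop k w)))"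
  have nn: "0 \<le> dl D (drop k w) * iota D (tl (drop k w))" if w: "w \<in> W n" "k < n" for w k
  proof -
    obtain i v where "drop k w = i # v" "i < N" "v \<in> W (n - Suc k)"
      using drop_W[OF w(1), of k] w(2) W_Suc[of "n - Suc k"] by (auto simp: Suc_diff_Suc)
    then show ?thesis using dl_bounds iota_nonneg by auto
  qed
  have "wsum D n \<le> (\<Sum>w\<in>W n. iota D w + (\<Sum>k<n. ?t w k))"
    unfolding wsum_def
  proof (rule sum_mono)
    fix w assume w: "w \<in> W n"
    show "wt D w \<le> iota D w + (\<Sum>k<n. ?t w k)"
      unfolding wt_def[of D] length_W[OF w]
    proof (rule sup0_le)
      show "0 \<le> iota D w + (\<Sum>k<n. ?t w k)"
        using iota_nonneg[OF w] nn[OF w] wt_nonneg[OF take_W[OF w]]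
        by (intro add_nonneg_nonneg sum_nonneg mult_nonneg_nonneg[of "wt _ _"]) auto
      fix x assume x: "x \<in> cyl D w"
      have "gn n x \<le> iota D w + (\<Sum>k<n. gn k x * (dl D (drop k w) * iota D (drop (Suc k) w)))"
        by (rule gn_expand[OF w x])
      also have "\<dots> \<le> iota D w + (\<Sum>k<n. ?t w k)"
      proof (intro add_left_mono sum_mono)
        fix k assume k: "k \<in> {..<n}"
        have "x \<in> cyl (cyl D (drop k w)) (take k w)" using x by (simp add: cyl_append[symmetric])
        then have "gn k x \<le> wt (cyl D (drop k w)) (take k w)" using wt_ge take_W[OF w] k by auto
        then show "gn k x * (dl D (drop k w) * iota D (drop (Suc k) w)) \<le> ?t w k"
          using nn[OF w] k by (auto simp: tl_drop drop_Suc intro!: mult_right_mono)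
      qed
      finally show "gn n x \<le> iota D w + (\<Sum>k<n. ?t w k)" .
    qed
  qed
  also have "\<dots> = (\<Sum>w\<in>W n. iota D w) + (\<Sum>k<n. \<Sum>w\<in>W n. ?t w k)"
    by (simp add: sum.distrib sum.swap[of _ "{..<n}"])
  also have "(\<Sum>k<n. \<Sum>w\<in>W n. ?t w k) = (\<Sum>k<n. \<Sum>y\<in>W (n - k). wsum (cyl D y) k * (dl D y * iota D (tl y)))"
  proof (rule sum.cong[OF refl])
    fix k assume "k \<in> {..<n}"
    then have "(\<Sum>w\<in>W n. ?t w k) = (\<Sum>w\<in>W (k + (n - k)). ?t w k)" by simp
    also have "\<dots> = (\<Sum>u\<in>W k. \<Sum>y\<in>W (n - k). wt (cyl D y) u * (dl D y * iota D (tl y)))"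
      unfolding sum_W_add by (intro sum.cong refl) (simp add: length_W)
    finally show "(\<Sum>w\<in>W n. ?t w k) = (\<Sum>y\<in>W (n - k). wsum (cyl D y) k * (dl D y * iota D (tl y)))"
      by (subst (asm) sum.swap) (simp add: wsum_def sum_distrib_right)
  qed
  finally show ?thesis .
qed

text \<open>An uncut letter covers its target up to finitely many points, so
  \<open>measure_branch\<close> applies with the lower bound of \<open>g\<close>. At a cut letter
  that factor is 0 and nothing is to be shown.\<close>

lemma iota_measure:
  assumes D: "D \<in> sets LB"
  shows "w \<in> W n \<Longrightarrow> iota D w * measure LB D \<le> measure LB (cyl D w)"
proof (induction n arbitrary: w)
  case (Suc n)
  then obtain i v where w: "w = i # v" "i < N" "v \<in> W n" by (auto simp: W_Suc)
  define s where "s = sg D (i # v) - dl D (i # v)"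
  have s: "0 \<le> s" using dl_bounds(2)[OF w(2)] by (simp add: s_def)
  have wv: "i # v \<in> W (Suc n)" using w by (simp add: Cons_in_W)
  have "iota D w * measure LB D = s * (iota D v * measure LB D)" using w by (simp add: s_def)
  also have "\<dots> \<le> s * measure LB (cyl D v)" using s Suc.IH[OF w(3)] by (rule mult_left_mono[rotated])
  also have "\<dots> \<le> measure LB (cyl D w)"
  proof (cases "uncut D (i # v)")
    case True
    let ?S = "cyl D v \<inter> T ` J i"
    have TJ: "T ` J i \<in> sets LB" using TJ_open[OF w(2)] TJ_sub[OF w(2)] by (intro in_sets_LB) auto
    have mS: "?S \<in> sets LB" using cyl_meas[OF D w(3)] TJ by auto
    have fin: "finite (cyl D v - ?S)" using True by (simp add: uncut_def Diff_Int)
    have "measure LB (cyl D v) = measure LB ?S"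
    proof (rule finite_measure.finite_measure_eq_AE[OF finite_measure_LB _ cyl_meas[OF D w(3)] mS])
      show "AE x in LB. (x \<in> cyl D v) = (x \<in> ?S)"
        using AE_LB_finite[OF fin] by eventually_elim auto
    qed
    also have "s * \<dots> \<le> measure LB (cyl D (i # v))"
      using inf_le_g[OF w(2)] by (intro measure_branch[OF w(2) cyl_meas[OF D wv] _ mS _ s]) (auto simp: s_def)
    finally show ?thesis using w by simp
  qed (simp add: s_def dl_def)
  finally show ?case .
qed auto

lemma sum_measure_cyl:
  assumes D: "D \<in> sets LB"
  shows "(\<Sum>w\<in>W n. measure LB (cyl D w)) \<le> 1"
proof -
  have "(\<Sum>w\<in>W n. measure LB (cyl D w)) = measure LB (\<Union>w\<in>W n. cyl D w)"
    using cyl_meas[OF D] cyl_disjoint[of _ n _ _ D D]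
    by (intro finite_measure.finite_measure_finite_Union[OF finite_measure_LB, symmetric])
      (auto simp: disjoint_family_on_def)
  also have "\<dots> \<le> 1" using prob_space.prob_le_1[OF prob_space_LB] by auto
  finally show ?thesis .
qed

text \<open>The cylinders are disjoint, so their lengths add up to at most 1, and each length is at
  least \<open>iota\<close> times that of \<open>D\<close>.\<close>

lemma sum_iota:
  assumes D: "D \<in> sets LB" "0 < measure LB D"
  shows "(\<Sum>w\<in>W n. iota D w) \<le> 1 / measure LB D"
proof -
  have "(\<Sum>w\<in>W n. iota D w) * measure LB D \<le> (\<Sum>w\<in>W n. measure LB (cyl D w))"
    unfolding sum_distrib_right by (intro sum_mono iota_measure D)
  also have "\<dots> \<le> 1" by (rule sum_measure_cyl[OF D(1)])
  finally show ?thesis using D by (simp add: field_simps)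
qed

section \<open>Oscillation of \<open>1 / T'\<close> on short intervals inside a branch\<close>

lemma no_osc_seq:
  assumes i: "i < N" and o: "0 < s" and ab: "\<And>k::nat. a k \<in> J i" "\<And>k. b k \<in> J i" "\<And>k. a k < b k"
    and osc: "\<And>k. s < \<bar>g (a k) - g (b k)\<bar>"
    and disj: "\<And>k k'. k < k' \<Longrightarrow> b k' < a k \<or> b k < a k'"
  shows False
proof -
  have sub: "{a k..b k} \<subseteq> J i" for k using ab[of k] by (auto simp: J_def)
  have "real n * s powr p \<le> V" for n
  proof -
    have "real (card {..<n}) * s powr p \<le> V"
    proof (rule count_osc[of "{..<n}" "\<lambda>k. {a k..b k}" s])
      fix k
      show "{a k..b k} \<subseteq> (\<Union>i<N. J i)" using sub i by auto
      have "\<bar>g (a k) - g (b k)\<bar> \<le> osc0 g {a k..b k}"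
      proof (rule osc0_ge[where B = \<kappa>])
        fix y assume "y \<in> {a k..b k}"
        then have "y \<in> J i" using sub[of k] by blast
        then show "\<bar>g y\<bar> \<le> \<kappa>" using g_pos[OF i] g_le[OF i] by force
      qed (use ab(3)[of k] in auto)
      then show "s < osc0 g {a k..b k}" using osc[of k] by linarith
      fix k' assume "k \<noteq> k'"
      then show "{a k..b k} \<inter> {a k'..b k'} = {}"
        using disj[of k k'] disj[of k' k] by (cases k k' rule: linorder_cases) force+
    qed (use o in auto)
    then show ?thesis by simp
  qed
  moreover obtain n where "V < real n * s powr p"
    using ex_less_of_nat_mult[of "s powr p" V] o by auto
  ultimately show False by (meson not_le)
qed

text \<open>Otherwise every point of the branch has, to its left, a pair with oscillation above
  \<open>s\<close>; choosing such pairs repeatedly gives infinitely many disjoint ones, against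
  finite p-variation.\<close>

lemma small_osc_left:
  assumes i: "i < N" and s: "0 < s"
  shows "\<exists>e\<in>J i. \<forall>x\<in>J i. \<forall>y\<in>J i. x < y \<longrightarrow> y < e \<longrightarrow> \<bar>g x - g y\<bar> \<le> s"
proof (rule ccontr)
  assume "\<not> ?thesis"
  then have "\<forall>e\<in>J i. \<exists>x y. x \<in> J i \<and> y \<in> J i \<and> x < y \<and> y < e \<and> s < \<bar>g x - g y\<bar>"
    by (meson not_le)
  then obtain a b where ab: "\<And>e. e \<in> J i \<Longrightarrow> a e \<in> J i \<and> b e \<in> J i \<and> a e < b e \<and> b e < e \<and> s < \<bar>g (a e) - g (b e)\<bar>"
    by metis
  define e0 where "e0 = (c i + c (Suc i)) / 2"
  have e0: "e0 \<in> J i" using c_less[OF i] by (simp add: e0_def J_def)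
  \<comment> \<open>The next pair is chosen to the left of the lower point of the present one, hence
    the pairs are disjoint.\<close>
  define e where "e = (\<lambda>k. (a ^^ k) e0)"
  have e: "e k \<in> J i" for k unfolding e_def by (induction k) (use e0 ab in auto)
  have es: "e (Suc k) = a (e k)" for k by (simp add: e_def)
  have dec: "e k' \<le> e k" if "k \<le> k'" for k k'
  proof (rule lift_Suc_antimono_le[OF _ that])
    show "e (Suc k) \<le> e k" for k using ab[OF e, of k] es[of k] by linarith
  qed
  show False
  proof (rule no_osc_seq[OF i s, of "\<lambda>k. a (e k)" "\<lambda>k. b (e k)"])
    fix k k' :: nat assume "k < k'"
    then have "e k' \<le> a (e k)" using dec[of "Suc k" k'] es by simp
    then show "b (e k') < a (e k) \<or> b (e k) < a (e k')" using ab[OF e, of k'] by auto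
  qed (use ab[OF e] in auto)
qed

lemma small_osc_right:
  assumes i: "i < N" and s: "0 < s"
  shows "\<exists>e\<in>J i. \<forall>x\<in>J i. \<forall>y\<in>J i. x < y \<longrightarrow> e < x \<longrightarrow> \<bar>g x - g y\<bar> \<le> s"
proof (rule ccontr)
  assume "\<not> ?thesis"
  then have "\<forall>e\<in>J i. \<exists>x y. x \<in> J i \<and> y \<in> J i \<and> x < y \<and> e < x \<and> s < \<bar>g x - g y\<bar>"
    by (meson not_le)
  then obtain a b where ab: "\<And>e. e \<in> J i \<Longrightarrow> a e \<in> J i \<and> b e \<in> J i \<and> a e < b e \<and> e < a e \<and> s < \<bar>g (a e) - g (b e)\<bar>"
    by metis
  define e0 where "e0 = (c i + c (Suc i)) / 2"
  have e0: "e0 \<in> J i" using c_less[OF i] by (simp add: e0_def J_def)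
  define e where "e = (\<lambda>k. (b ^^ k) e0)"
  have e: "e k \<in> J i" for k unfolding e_def by (induction k) (use e0 ab in auto)
  have es: "e (Suc k) = b (e k)" for k by (simp add: e_def)
  have inc: "e k \<le> e k'" if "k \<le> k'" for k k'
  proof (rule lift_Suc_mono_le[OF _ that])
    show "e k \<le> e (Suc k)" for k using ab[OF e, of k] es[of k] by linarith
  qed
  show False
  proof (rule no_osc_seq[OF i s, of "\<lambda>k. a (e k)" "\<lambda>k. b (e k)"])
    fix k k' :: nat assume "k < k'"
    then have "b (e k) \<le> e k'" using inc[of "Suc k" k'] es by simp
    then show "b (e k') < a (e k) \<or> b (e k) < a (e k')" using ab[OF e, of k'] by auto
  qed (use ab[OF e] in auto)
qed

text \<open>Continuity on the open branch is not uniform by itself; the neighbourhoods of the two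
  ends are covered by the one-sided statements and the compact middle by uniform continuity.\<close>

lemma small_osc_branch:
  assumes i: "i < N" and s: "0 < s"
  shows "\<exists>\<eta>>0. \<forall>x\<in>J i. \<forall>y\<in>J i. \<bar>x - y\<bar> < \<eta> \<longrightarrow> \<bar>g x - g y\<bar> \<le> s"
proof -
  obtain a b where a: "a \<in> J i" "\<And>x y. x \<in> J i \<Longrightarrow> y \<in> J i \<Longrightarrow> x < y \<Longrightarrow> y < a \<Longrightarrow> \<bar>g x - g y\<bar> \<le> s"
    and b: "b \<in> J i" "\<And>x y. x \<in> J i \<Longrightarrow> y \<in> J i \<Longrightarrow> x < y \<Longrightarrow> b < x \<Longrightarrow> \<bar>g x - g y\<bar> \<le> s"
    using small_osc_left[OF i s] small_osc_right[OF i s] by blast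
  define a' b' where "a' = (c i + a) / 2" and "b' = (b + c (Suc i)) / 2"
  have "{a'..b'} \<subseteq> J i" using a(1) b(1) by (auto simp: J_def a'_def b'_def)
  then have "uniformly_continuous_on {a'..b'} g"
    using g_cont[OF i] by (intro compact_uniformly_continuous) (auto simp: J_def intro: continuous_on_subset)
  then obtain d where d: "d > 0" "\<And>x y. x \<in> {a'..b'} \<Longrightarrow> y \<in> {a'..b'} \<Longrightarrow> \<bar>x - y\<bar> < d \<Longrightarrow> \<bar>g x - g y\<bar> < s"
    unfolding uniformly_continuous_on_def dist_real_def using s by metis
  \<comment> \<open>With this margin two points at distance below \<eta> both lie left of
    \<open>a\<close>, or both right of \<open>b\<close>, or both in \<open>{a'..b'}\<close>.\<close>
  define \<eta> where "\<eta> = Min {d, a - a', b' - b}"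
  have "0 < a - a'" "0 < b' - b" using a(1) b(1) by (auto simp: J_def a'_def b'_def)
  then have \<eta>: "\<eta> > 0" "\<eta> \<le> d" "\<eta> \<le> a - a'" "\<eta> \<le> b' - b" using d by (auto simp: \<eta>_def)
  have key: "\<bar>g x - g y\<bar> \<le> s" if "x \<in> J i" "y \<in> J i" "x < y" "y - x < \<eta>" for x y
    using a(2)[of x y] b(2)[of x y] d(2)[of x y] that \<eta> by (cases "y < a"; cases "b < x") auto
  have "\<bar>g x - g y\<bar> \<le> s" if "x \<in> J i" "y \<in> J i" "\<bar>x - y\<bar> < \<eta>" for x y
    using key[of x y] key[of y x] that s by (cases x y rule: linorder_cases) auto
  then show ?thesis using \<eta>(1) by blast
qed

lemma small_osc:
  assumes s: "0 < s"
  shows "\<exists>\<eta>>0. \<forall>i<N. \<forall>x\<in>J i. \<forall>y\<in>J i. \<bar>x - y\<bar> < \<eta> \<longrightarrow> \<bar>g x - g y\<bar> \<le> s"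
proof -
  obtain f where f: "\<And>i. i < N \<Longrightarrow> f i > 0 \<and> (\<forall>x\<in>J i. \<forall>y\<in>J i. \<bar>x - y\<bar> < f i \<longrightarrow> \<bar>g x - g y\<bar> \<le> s)"
    using small_osc_branch[OF _ s] by metis
  define \<eta> where "\<eta> = Min (f ` {..<N})"
  have "\<eta> > 0" unfolding \<eta>_def using f N_pos by (subst Min_gr_iff) auto
  moreover have "\<eta> \<le> f i" if "i < N" for i unfolding \<eta>_def using that by auto
  ultimately show ?thesis using f by (meson order_less_le_trans)
qed

end

section \<open>Partitions of the unit interval adapted to the images of cylinders\<close>

definition parts :: "real set \<Rightarrow> real set set" where
  "parts E = {{a..b} | a b. a \<in> E \<and> b \<in> E \<and> a < b \<and> E \<inter> {a<..<b} = {}}"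

lemma parts_Icc: "a < b \<Longrightarrow> {a..b} \<in> parts E \<longleftrightarrow> a \<in> E \<and> b \<in> E \<and> E \<inter> {a<..<b} = {}"
  unfolding parts_def by (auto simp: Icc_eq_Icc)

lemma parts_finite: "finite E \<Longrightarrow> finite (parts E)"
  by (rule finite_subset[of _ "(\<lambda>(a, b). {a..b}) ` (E \<times> E)"]) (auto simp: parts_def)

lemma parts_cover:
  assumes E: "finite E" "0 \<in> E" "1 \<in> E" and x: "x \<in> {0..1}"
  shows "\<exists>D\<in>parts E. x \<in> D"
proof (cases "x < 1")
  case True
  define a b where "a = Max {p \<in> E. p \<le> x}" and "b = Min {p \<in> E. x < p}"
  have "a \<in> {p \<in> E. p \<le> x}" unfolding a_def using E x by (intro Max_in) auto
  moreover have "b \<in> {p \<in> E. x < p}" unfolding b_def using E True by (intro Min_in) auto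
  moreover have "p \<le> a" if "p \<in> E" "p \<le> x" for p unfolding a_def using that E by auto
  moreover have "b \<le> p" if "p \<in> E" "x < p" for p unfolding b_def using that E by auto
  ultimately have ab: "a \<in> E" "b \<in> E" "a \<le> x" "x < b" and
    le: "\<And>p. p \<in> E \<Longrightarrow> p \<le> x \<Longrightarrow> p \<le> a" "\<And>p. p \<in> E \<Longrightarrow> x < p \<Longrightarrow> b \<le> p" by auto
  have "E \<inter> {a<..<b} = {}" using le by (force simp: disjoint_iff not_le)
  then have "{a..b} \<in> parts E" "x \<in> {a..b}" unfolding parts_def using ab by auto
  then show ?thesis by blast
next
  case False
  then have x1: "x = 1" using x by auto
  define a where "a = Max {p \<in> E. p < 1}"
  have "a \<in> {p \<in> E. p < 1}" unfolding a_def using E by (intro Max_in) auto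
  moreover have "p \<le> a" if "p \<in> E" "p < 1" for p unfolding a_def using that E by auto
  ultimately have "a \<in> E" "a < 1" and le: "\<And>p. p \<in> E \<Longrightarrow> p < 1 \<Longrightarrow> p \<le> a" by auto
  moreover have "E \<inter> {a<..<1} = {}" using le by (force simp: disjoint_iff not_le)
  ultimately have "{a..1} \<in> parts E" "x \<in> {a..1}" using E x1 by (auto simp: parts_Icc)
  then show ?thesis by blast
qed

text \<open>Cells that meet \<open>Y\<close> and have their left end in \<open>Y\<close> inject into
  \<open>E \<inter> Y\<close>. At most one further cell meets \<open>Y\<close>: one whose left end
  lies to the left of \<open>Y\<close>.\<close>

lemma parts_meet:
  assumes Y: "convex Y" and E: "finite E"
  shows "card {D \<in> parts E. D \<inter> Y \<noteq> {}} \<le> card (E \<inter> Y) + 1"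
proof -
  have iv: "x \<in> Y" if "a \<in> Y" "b \<in> Y" "a \<le> x" "x \<le> b" for a b x
    using Y that is_interval_convex_1[of Y] unfolding is_interval_1 by blast
  have det: "b \<le> b'" if "{a..b} \<in> parts E" "{a..b'} \<in> parts E" "a < b" "a < b'" for a b b'
  proof (rule ccontr)
    assume "\<not> b \<le> b'"
    then have "b' \<in> E \<inter> {a<..<b}" using that(2,4) parts_Icc[OF that(4)] by simp
    then show False using that(1) parts_Icc[OF that(3)] by blast
  qed
  let ?M = "{D \<in> parts E. D \<inter> Y \<noteq> {}}"
  let ?A = "{D \<in> ?M. Inf D \<in> Y}" and ?B = "{D \<in> ?M. Inf D \<notin> Y}"
  have fin: "finite ?M" using parts_finite[OF E] by auto
  have rep: "\<exists>a b. D = {a..b} \<and> a < b \<and> Inf D = a \<and> a \<in> E \<and> b \<in> E \<and> E \<inter> {a<..<b} = {}" if "D \<in> parts E" for D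
    using that unfolding parts_def by auto
  have uniq: "D = D'" if D: "D \<in> parts E" and D': "D' \<in> parts E" and eq: "Inf D = Inf D'" for D D'
  proof -
    obtain a b where 1: "D = {a..b}" "a < b" "Inf D = a" using rep[OF D] by blast
    obtain a' b' where 2: "D' = {a'..b'}" "a' < b'" "Inf D' = a'" using rep[OF D'] by blast
    have "a' = a" using 1 2 eq by simp
    then show ?thesis using det[of a b b'] det[of a b' b] 1 2 D D' by force
  qed
  have inj: "inj_on Inf ?A"
    by (rule inj_onI) (use uniq in blast)
  have "card ?A \<le> card (E \<inter> Y)"
    using rep E by (intro card_inj_on_le[OF inj]) force+
  moreover have "card ?B \<le> 1"
  proof -
    have lt: False if DB: "D \<in> ?B" "D' \<in> ?B" "Inf D < Inf D'" for D D'
    proof -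
      obtain a b where D: "D = {a..b}" "a < b" "Inf D = a" "a \<in> E" "b \<in> E" "E \<inter> {a<..<b} = {}"
        using rep[of D] \<open>D \<in> ?B\<close> by blast
      obtain a' b' where D': "D' = {a'..b'}" "a' < b'" "Inf D' = a'" "a' \<in> E" "b' \<in> E"
        using rep[of D'] \<open>D' \<in> ?B\<close> by blast
      have "a' \<notin> {a<..<b}" using D(6) D'(4) by blast
      then have "b \<le> a'" using D D' that(3) by auto
      moreover obtain y where "y \<in> Y" "y \<in> D" using DB(1) by blast
      moreover obtain y' where "y' \<in> Y" "y' \<in> D'" using DB(2) by blast
      ultimately have "a' \<in> Y" using iv[of y y' a'] D D' by auto
      then show False using D' that by auto
    qed
    have "D = D'" if "D \<in> ?B" "D' \<in> ?B" for D D'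
    proof (cases "Inf D" "Inf D'" rule: linorder_cases)
      case equal
      then show ?thesis using uniq that by blast
    qed (use lt[OF that] lt[OF that(2,1)] in auto)
    then have eq: "\<forall>x\<in>?B. \<forall>y\<in>?B. x = y" by blast
    have fB: "finite ?B" by (rule finite_subset[OF _ fin]) blast
    show ?thesis using card_le_Suc0_iff_eq[OF fB, THEN iffD2, OF eq] by simp
  qed
  moreover have "card ?M \<le> card ?A + card ?B"
  proof -
    have "card ?M \<le> card (?A \<union> ?B)"
      by (rule card_mono) (use fin in \<open>auto intro: finite_subset[OF _ fin]\<close>)
    then show ?thesis using card_Un_le[of ?A ?B] by linarith
  qed
  ultimately show ?thesis by linarith
qed

lemma finite_gap:
  assumes "finite (E :: real set)"
  shows "\<exists>\<eta>>0. \<forall>x\<in>E. \<forall>y\<in>E. x \<noteq> y \<longrightarrow> \<eta> \<le> \<bar>x - y\<bar>"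
proof -
  define S where "S = insert 1 ((\<lambda>(x, y). \<bar>x - y\<bar>) ` {(x, y) \<in> E \<times> E. x \<noteq> y})"
  have fin: "finite S" unfolding S_def using assms
    by (intro finite.insertI finite_imageI) (auto intro: finite_subset[of _ "E \<times> E"])
  have "Min S > 0" using fin by (subst Min_gr_iff) (auto simp: S_def)
  moreover have "Min S \<le> \<bar>x - y\<bar>" if "x \<in> E" "y \<in> E" "x \<noteq> y" for x y
    using fin that by (intro Min_le) (auto simp: S_def)
  ultimately show ?thesis by blast
qed

lemma card_gap_le_1:
  assumes "\<And>x y. x \<in> E \<Longrightarrow> y \<in> E \<Longrightarrow> x \<noteq> y \<Longrightarrow> \<eta> \<le> \<bar>x - y\<bar>" "\<And>x y. x \<in> Y \<Longrightarrow> y \<in> Y \<Longrightarrow> \<bar>x - y\<bar> < (\<eta>::real)"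
  shows "card (E \<inter> Y) \<le> 1"
proof (cases "finite (E \<inter> Y)")
  case True
  have "x = y" if "x \<in> E \<inter> Y" "y \<in> E \<inter> Y" for x y
    using assms(1)[of x y] assms(2)[of x y] that by force
  then show ?thesis using card_le_Suc0_iff_eq[OF True] by auto
qed auto

definition grid :: "nat \<Rightarrow> real set" where "grid M = (\<lambda>k. real k / real M) ` {..M}"

lemma grid_gap:
  assumes "x \<in> grid M" "y \<in> grid M" "x \<noteq> y" "0 < M" shows "1 / real M \<le> \<bar>x - y\<bar>"
proof -
  obtain j k where "x = real j / M" "y = real k / M" "j \<noteq> k" using assms by (auto simp: grid_def)
  then have "\<bar>x - y\<bar> = \<bar>real j - real k\<bar> / M" by (simp add: diff_divide_distrib[symmetric])
  moreover have "1 \<le> \<bar>real j - real k\<bar>" using \<open>j \<noteq> k\<close> by (cases j k rule: linorder_cases) auto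
  ultimately show ?thesis by (simp add: divide_right_mono)
qed

lemma grid_cell:
  assumes M: "0 < M" and sub: "grid M \<subseteq> E" and "E \<inter> {a<..<b} = {}" "a < b" "0 \<le> a" "b \<le> 1"
  shows "b - a \<le> 1 / real M"
proof -
  define k where "k = nat \<lfloor>a * M\<rfloor>"
  have k: "real k \<le> a * M" "a * M < real k + 1"
    using assms by (auto simp: k_def)
  have "a * M < M" using assms by (simp add: mult_less_cancel_right2)
  then have "k < M" using k by linarith
  then have "real (Suc k) / M \<in> grid M" unfolding grid_def by (intro imageI) simp
  then have "real (Suc k) / M \<in> E" using sub by blast
  moreover have "a < real (Suc k) / M" using k M by (simp add: field_simps)
  moreover have "real (Suc k) / M \<notin> {a<..<b}" using assms(3) calculation(1) by blast
  ultimately have "b \<le> real (Suc k) / M" by auto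
  also have "\<dots> \<le> a + 1 / M" using k M by (simp add: field_simps)
  finally show ?thesis by simp
qed

context pw_expanding
begin

text \<open>The ends of the images of all cylinders of depth 1 to \<open>d0\<close>. An empty
  cylinder contributes unspecified values, which only add harmless partition points.\<close>

definition ends :: "nat \<Rightarrow> real set" where
  "ends d0 = (\<Union>d<d0. \<Union>w\<in>W (Suc d). {Inf ((T ^^ Suc d) ` Z w), Sup ((T ^^ Suc d) ` Z w)})"

text \<open>The image of \<open>Z y\<close> is an interval that meets \<open>D\<close> and has no
  end inside \<open>{a<..<b}\<close>, so it contains \<open>{a<..<b}\<close>. Points of
  \<open>cyl D (tl y)\<close> missed by the branch must therefore reach \<open>a\<close> or
  \<open>b\<close>, and by injectivity there are at most two of them.\<close>

lemma uncut_cell: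
  assumes d: "d < d0" and y: "y \<in> W (Suc d)" and D: "D = {a..b}" "D \<subseteq> {0..1}" and E: "ends d0 \<inter> {a<..<b} = {}"
    and ne: "cyl D y \<noteq> {}"
  shows "uncut D y"
proof -
  obtain i v where w: "y = i # v" "i < N" "v \<in> W d" using y by (auto simp: W_Suc)
  define I where "I = (T ^^ Suc d) ` Z y"
  obtain x0 where x0: "x0 \<in> cyl D y" using ne by auto
  have x0': "x0 \<in> Z y" "(T ^^ Suc d) x0 \<in> D"
    using cyl_mono[OF D(2)] x0 cyl_T_pow[OF x0] length_W[OF y] by auto
  have I: "I = {Inf I<..<Sup I}"
    using TZ_open_convex[OF y] x0'(1) Z_sub[OF y] T_pow_maps[of _ "Suc d"]
    by (intro open_convex_real) (auto simp: I_def simp del: funpow.simps)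
  have endpt: "Inf I \<in> ends d0" "Sup I \<in> ends d0" using d y unfolding ends_def I_def by blast+
  have z: "(T ^^ Suc d) x0 \<in> I" "a \<le> (T ^^ Suc d) x0" "(T ^^ Suc d) x0 \<le> b"
    using x0' D by (auto simp: I_def simp del: funpow.simps)
  have z': "Inf I < (T ^^ Suc d) x0" "(T ^^ Suc d) x0 < Sup I" using z(1) I by (metis greaterThanLessThan_iff)+
  have "Inf I \<notin> {a<..<b}" "Sup I \<notin> {a<..<b}" using endpt E by blast+
  then have "Inf I \<le> a" using z z' by auto
  moreover have "b \<le> Sup I" using \<open>Sup I \<notin> {a<..<b}\<close> z z' by auto
  ultimately have sub: "{a<..<b} \<subseteq> I" by (subst I) auto
  have "cyl D v - T ` J i \<subseteq> {z \<in> cyl D v. (T ^^ d) z \<in> {a, b}}"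
  proof
    fix z assume z: "z \<in> cyl D v - T ` J i"
    have "(T ^^ d) z \<in> D" using cyl_T_pow[of z D v] z length_W[OF w(3)] by auto
    moreover have "(T ^^ d) z \<notin> {a<..<b}"
    proof
      assume "(T ^^ d) z \<in> {a<..<b}"
      then obtain x where x: "x \<in> Z y" "(T ^^ d) z = (T ^^ d) (T x)"
        using sub by (auto simp: I_def funpow_swap1)
      then have "z = T x"
        using inj_onD[OF cyl_inj[OF w(3), of "{0..1}"], of z "T x"] z cyl_mono[OF D(2), of v] w by auto
      then show False using x z w by auto
    qed
    ultimately show "z \<in> {z \<in> cyl D v. (T ^^ d) z \<in> {a, b}}" using z D by auto
  qed
  moreover have "finite {z \<in> cyl D v. (T ^^ d) z \<in> {a, b}}"
    using finite_vimage_IntI[OF _ cyl_inj[OF w(3), of D], of "{a, b}"] by (simp add: vimage_def Int_def conj_commute)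
  ultimately show ?thesis unfolding uncut_def using w finite_subset by auto
qed

text \<open>The last clause is uniform in the depth: a cylinder over a cell is covered by three
  cells again, which closes the recursion for \<open>wsum\<close>. Being uncut is demanded up to
  depth \<open>d0\<close> only; at larger depths the decay of \<open>eps\<close> suffices.\<close>

definition nice_part :: "nat \<Rightarrow> real \<Rightarrow> real set set \<Rightarrow> bool" where
  "nice_part d0 \<eta> \<D> \<longleftrightarrow> finite \<D> \<and> {0..1} \<subseteq> \<Union>\<D> \<and>
    (\<forall>D\<in>\<D>. convex D \<and> D \<in> sets LB \<and> D \<subseteq> {0..1} \<and> 0 < measure LB D \<and>
      (\<forall>x\<in>D. \<forall>y\<in>D. \<bar>x - y\<bar> < \<eta>) \<and>
      (\<forall>d<d0. \<forall>y\<in>W (Suc d). cyl D y \<noteq> {} \<longrightarrow> uncut D y) \<and>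
      (\<forall>d. \<forall>y\<in>W (Suc d). card {D' \<in> \<D>. D' \<inter> cyl D y \<noteq> {}} \<le> 3))"

text \<open>The mesh \<open>1 / M\<close> is smaller than \<eta> and than the least gap of
  \<open>ends d0\<close>. A cylinder over a cell is shorter than the mesh, so it contains at most
  one point of \<open>ends d0\<close> and one grid point, and meets at most 2 + 1 cells.\<close>

lemma ex_nice_part:
  assumes "0 < \<eta>" shows "\<exists>\<D>. nice_part d0 \<eta> \<D>"
proof -
  have finE: "finite (ends d0)" by (auto simp: ends_def)
  then obtain \<delta> where \<delta>: "\<delta> > 0" "\<And>x y. x \<in> ends d0 \<Longrightarrow> y \<in> ends d0 \<Longrightarrow> x \<noteq> y \<Longrightarrow> \<delta> \<le> \<bar>x - y\<bar>"
    using finite_gap by meson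
  obtain M where M: "0 < M" "1 / real M < min \<delta> \<eta>"
    using reals_Archimedean[of "min \<delta> \<eta>"] \<delta>(1) assms by (metis inverse_eq_divide min_less_iff_conj zero_less_Suc)
  define E where "E = (ends d0 \<union> grid M) \<inter> {0..1}"
  define \<D> where "\<D> = parts E"
  have g01: "grid M \<subseteq> {0..1}" using M by (auto simp: grid_def)
  have "0 \<in> grid M" "1 \<in> grid M" using M by (auto simp: grid_def image_iff intro: bexI[of _ 0] bexI[of _ M])
  then have E: "finite E" "0 \<in> E" "1 \<in> E" "grid M \<subseteq> E" using finE g01 by (auto simp: E_def grid_def)
  have rep: "\<exists>a b. D = {a..b} \<and> a < b \<and> 0 \<le> a \<and> b \<le> 1 \<and> ends d0 \<inter> {a<..<b} = {} \<and> b - a \<le> 1 / M" if D: "D \<in> \<D>" for D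
  proof -
    obtain a b where ab: "D = {a..b}" "a < b" "a \<in> E" "b \<in> E" "E \<inter> {a<..<b} = {}"
      using D by (auto simp: \<D>_def parts_def)
    have "0 \<le> a" "b \<le> 1" using ab by (auto simp: E_def)
    moreover have "ends d0 \<inter> {a<..<b} = {}" using ab calculation by (auto simp: E_def disjoint_iff)
    ultimately show ?thesis using ab grid_cell[OF M(1) E(4) ab(5,2)] by blast
  qed
  have "nice_part d0 \<eta> \<D>"
    unfolding nice_part_def
  proof (intro conjI ballI allI impI)
    show "finite \<D>" using parts_finite[OF E(1)] by (simp add: \<D>_def)
    show "{0..1} \<subseteq> \<Union>\<D>" using parts_cover[OF E(1-3)] by (auto simp: \<D>_def)
  next
    fix D assume D: "D \<in> \<D>"
    obtain a b where ab: "D = {a..b}" "a < b" "0 \<le> a" "b \<le> 1" "ends d0 \<inter> {a<..<b} = {}" "b - a \<le> 1 / M"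
      using rep[OF D] by auto
    show "convex D" "D \<subseteq> {0..1}" using ab by auto
    then show "D \<in> sets LB" using ab by (intro in_sets_LB) auto
    show "0 < measure LB D" using ab by (subst measure_restrict_space) auto
    have len: "\<bar>x - y\<bar> \<le> 1 / M" if "x \<in> D" "y \<in> D" for x y using that ab by auto
    show "\<bar>x - y\<bar> < \<eta>" if "x \<in> D" "y \<in> D" for x y using len[OF that] M by auto
    show "uncut D y" if "d < d0" "y \<in> W (Suc d)" "cyl D y \<noteq> {}" for d y
      using uncut_cell[OF that(1,2) ab(1) \<open>D \<subseteq> {0..1}\<close> ab(5) that(3)] .
    show "card {D' \<in> \<D>. D' \<inter> cyl D y \<noteq> {}} \<le> 3" if y: "y \<in> W (Suc d)" for d y
    proof -
      have diam: "\<bar>x - x'\<bar> < 1 / M" if x: "x \<in> cyl D y" "x' \<in> cyl D y" for x x'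
      proof -
        have "\<bar>x - x'\<bar> \<le> \<kappa> ^ Suc d * \<bar>(T ^^ Suc d) x - (T ^^ Suc d) x'\<bar>" by (rule cyl_contract[OF y x])
        also have "\<dots> \<le> \<kappa> ^ Suc d * (1 / M)"
          using len cyl_T_pow[OF x(1)] cyl_T_pow[OF x(2)] kappa length_W[OF y] by (intro mult_left_mono) auto
        also have "\<dots> < 1 * (1 / M)"
          using kappa M by (intro mult_strict_right_mono power_Suc_less_one) auto
        finally show ?thesis by simp
      qed
      have "card (ends d0 \<inter> cyl D y) \<le> 1"
        by (rule card_gap_le_1[OF \<delta>(2)]) (use diam M in force)+
      moreover have "card (grid M \<inter> cyl D y) \<le> 1"
        by (rule card_gap_le_1[OF grid_gap]) (use diam M in auto)
      moreover have "card (E \<inter> cyl D y) \<le> card ((ends d0 \<inter> cyl D y) \<union> (grid M \<inter> cyl D y))"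
        using finE by (intro card_mono) (auto simp: E_def grid_def)
      moreover have "card ((ends d0 \<inter> cyl D y) \<union> (grid M \<inter> cyl D y)) \<le> card (ends d0 \<inter> cyl D y) + card (grid M \<inter> cyl D y)"
        by (rule card_Un_le)
      ultimately have "card (E \<inter> cyl D y) \<le> 2" by linarith
      then show ?thesis using parts_meet[OF cyl_convex[OF \<open>convex D\<close> y] E(1)] by (simp add: \<D>_def)
    qed
  qed
  then show ?thesis by blast
qed

text \<open>The exponent is chosen to make \<open>r powr p = sqrt \<kappa>\<close>. So at most
  \<open>V / sqrt \<kappa> ^ d\<close> cylinders of depth \<open>d\<close> oscillate by more than
  \<open>r ^ d\<close>; at weight \<open>\<kappa> ^ d\<close> each they contribute at most
  \<open>V * sqrt \<kappa> ^ d\<close>, again below \<open>V * r ^ d\<close>.\<close>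

definition r :: real where "r = \<kappa> powr (1 / (2 * p))"

lemma r_bounds: "0 < r" "r < 1" "sqrt \<kappa> \<le> r" "\<kappa> \<le> r" "r powr p = sqrt \<kappa>"
proof -
  show "0 < r" using kappa by (simp add: r_def)
  show "r < 1" unfolding r_def using powr_less_mono2[of "1 / (2 * p)" \<kappa> 1] kappa p_ge by simp
  have s: "sqrt \<kappa> = \<kappa> powr (1 / 2)" using kappa by (simp add: powr_half_sqrt)
  show sr: "sqrt \<kappa> \<le> r" unfolding s r_def using kappa p_ge by (intro powr_mono') (auto simp: field_simps)
  have "\<kappa> = sqrt \<kappa> * sqrt \<kappa>" using kappa by simp
  also have "\<dots> \<le> sqrt \<kappa> * 1" using kappa by (intro mult_left_mono) auto
  finally show "\<kappa> \<le> r" using sr by simp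
  show "r powr p = sqrt \<kappa>" unfolding s r_def using p_ge by (simp add: powr_powr)
qed

text \<open>The threshold \<open>r ^ d\<close> balances the two contributions: oscillations below it are summed against
  the weights, the few above it (at most \<open>V / r powr (p * d)\<close>) against \<open>\<kappa> ^ d\<close>.\<close>

lemma threshold_sum:
  assumes b: "\<And>i v. i < N \<Longrightarrow> v \<in> W n \<Longrightarrow> 0 \<le> b i v \<and> b i v \<le> \<kappa> ^ n \<and> b i v \<le> wt D v"
    and D: "convex D"
  shows "(\<Sum>i<N. \<Sum>v\<in>W n. osc0 g (cyl D (i # v)) * b i v) \<le> r ^ Suc n * (real N * wsum D n + V)"
proof -
  let ?t = "r ^ Suc n" and ?I = "{..<N} \<times> W n"
  define osc where "osc = (\<lambda>(i, v). osc0 g (cyl D (i # v)))"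
  define U where "U = {u \<in> ?I. ?t < osc u}"
  have t: "0 < ?t" using r_bounds by simp
  have fin: "finite ?I" by simp
  have osc: "0 \<le> osc (i, v)" "osc (i, v) \<le> \<kappa>" if "i < N" for i v
  proof -
    show "0 \<le> osc (i, v)" using osc_nonneg[OF that, of D v] by (simp add: osc_def)
    have "osc0 g (cyl D (i # v)) \<le> \<kappa>"
    proof (rule osc0_le)
      fix x y assume "x \<in> cyl D (i # v)" "y \<in> cyl D (i # v)"
      then have "x \<in> J i" "y \<in> J i" by auto
      then show "\<bar>g x - g y\<bar> \<le> \<kappa>"
        using g_pos[OF that, of x] g_pos[OF that, of y] g_le[OF that, of x] g_le[OF that, of y] by linarith
    qed (use kappa in auto)
    then show "osc (i, v) \<le> \<kappa>" by (simp add: osc_def)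
  qed
  have count: "real (card U) * ?t powr p \<le> V"
  proof (rule count_osc[of U "\<lambda>(i, v). cyl D (i # v)" ?t])
    show "finite U" using fin by (auto simp: U_def)
    fix u assume u: "u \<in> U"
    then obtain i v where uv: "u = (i, v)" "i < N" "v \<in> W n" by (auto simp: U_def)
    then have iv: "i # v \<in> W (Suc n)" by (simp add: Cons_in_W)
    show "convex (case u of (i, v) \<Rightarrow> cyl D (i # v))" using cyl_convex[OF D iv] uv by simp
    show "(case u of (i, v) \<Rightarrow> cyl D (i # v)) \<subseteq> (\<Union>i<N. J i)" using uv by auto
    show "?t < osc0 g (case u of (i, v) \<Rightarrow> cyl D (i # v))" using u uv by (simp add: U_def osc_def)
    fix u' assume u': "u' \<in> U" "u \<noteq> u'"
    then obtain i' v' where uv': "u' = (i', v')" "i' < N" "v' \<in> W n" by (auto simp: U_def)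
    then have iv': "i' # v' \<in> W (Suc n)" by (simp add: Cons_in_W)
    show "(case u of (i, v) \<Rightarrow> cyl D (i # v)) \<inter> (case u' of (i, v) \<Rightarrow> cyl D (i # v)) = {}"
      using cyl_disjoint[OF iv iv', of _ D D] u' uv uv' by auto
  qed (use t in auto)
  have tp: "?t powr p = sqrt \<kappa> ^ Suc n"
    using r_bounds(1,5) by (metis powr_power powr_powr powr_realpow mult.commute less_irrefl)
  \<comment> \<open>One factor cancels against the count of exceptional cylinders, the other is at
    most the threshold.\<close>
  have kk: "\<kappa> ^ Suc n = sqrt \<kappa> ^ Suc n * sqrt \<kappa> ^ Suc n"
    using kappa by (simp add: power_mult_distrib[symmetric] del: power_Suc)
  have big: "real (card U) * \<kappa> ^ Suc n \<le> V * ?t"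
  proof -
    have "real (card U) * \<kappa> ^ Suc n = (real (card U) * ?t powr p) * sqrt \<kappa> ^ Suc n"
      unfolding kk tp by simp
    also have "\<dots> \<le> V * sqrt \<kappa> ^ Suc n" using count kappa by (intro mult_right_mono) auto
    also have "\<dots> \<le> V * ?t" using r_bounds kappa V_nonneg by (intro mult_left_mono power_mono) auto
    finally show ?thesis .
  qed
  have "(\<Sum>i<N. \<Sum>v\<in>W n. osc0 g (cyl D (i # v)) * b i v) = (\<Sum>u\<in>?I. osc u * (case u of (i, v) \<Rightarrow> b i v))"
    by (simp add: sum.cartesian_product osc_def split_def)
  also have "\<dots> \<le> (\<Sum>u\<in>?I. ?t * wt D (snd u) + (if u \<in> U then \<kappa> ^ Suc n else 0))"
  proof (rule sum_mono)
    fix u assume u: "u \<in> ?I"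
    then obtain i v where uv: "u = (i, v)" "i < N" "v \<in> W n" by auto
    have wn: "0 \<le> ?t * wt D v" using wt_nonneg[OF uv(3)] t by simp
    show "osc u * (case u of (i, v) \<Rightarrow> b i v) \<le> ?t * wt D (snd u) + (if u \<in> U then \<kappa> ^ Suc n else 0)"
    proof (cases "u \<in> U")
      case True
      have "osc u * b i v \<le> \<kappa> * \<kappa> ^ n" using osc[OF uv(2), of v] b[OF uv(2,3)] uv kappa by (intro mult_mono) auto
      then show ?thesis using True uv wn by auto
    next
      case False
      then have "osc u \<le> ?t" using u by (auto simp: U_def)
      then have "osc u * b i v \<le> ?t * wt D v" using b[OF uv(2,3)] t osc[OF uv(2), of v] uv by (intro mult_mono) auto
      then show ?thesis using False uv by auto
    qed
  qed
  also have "\<dots> = (\<Sum>u\<in>?I. ?t * wt D (snd u)) + (\<Sum>u\<in>?I. if u \<in> U then \<kappa> ^ Suc n else 0)"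
    by (rule sum.distrib)
  also have "(\<Sum>u\<in>?I. ?t * wt D (snd u)) = (\<Sum>i<N. \<Sum>v\<in>W n. ?t * wt D v)"
    by (subst sum.cartesian_product) (simp only: split_def)
  also have "\<dots> = ?t * (real N * wsum D n)"
    by (simp add: wsum_def sum_distrib_left[symmetric])
  also have "(\<Sum>u\<in>?I. if u \<in> U then \<kappa> ^ Suc n else 0) = real (card U) * \<kappa> ^ Suc n"
    using fin by (subst sum.inter_filter[symmetric]) (auto simp: U_def Int_def intro: arg_cong[where f = card])
  finally show ?thesis using big by (simp add: algebra_simps)
qed

lemma iota_le: "v \<in> W n \<Longrightarrow> cyl D v \<noteq> {} \<Longrightarrow> iota D v \<le> wt D v \<and> iota D v \<le> \<kappa> ^ n"
  using iota_le_gn[of v n _ D] wt_ge[of v n _ D] gn_le[of v n _ D] by fastforce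

text \<open>Uncut letters contribute oscillations, summed by \<open>threshold_sum\<close>. For each
  branch at most two cylinders are cut, and each costs at most \<open>\<kappa> ^ Suc n\<close>; this
  is the summand \<open>2 * real N\<close>.\<close>

lemma eps_bound:
  assumes D: "convex D"
  shows "eps D (Suc n) \<le> r ^ Suc n * (real N * wsum D n + V + 2 * real N)"
proof -
  \<comment> \<open>The comparison of \<open>iota\<close> with \<open>wt\<close> is available for
    nonempty cylinders. Where \<open>cyl D v\<close> is empty so is \<open>cyl D (i # v)\<close>,
    and the term vanishes through \<open>dl\<close>.\<close>
  define b where "b = (\<lambda>(i::nat) v. if cyl D v = {} then 0 else iota D v)"
  define cut where "cut = (\<lambda>i v. cyl D v \<inter> T ` J i \<noteq> {} \<and> \<not> cyl D v \<subseteq> T ` J i)"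
  have tm: "dl D (i # v) * iota D v \<le> osc0 g (cyl D (i # v)) * b i v + (if cut i v then \<kappa> ^ Suc n else 0)"
    if iv: "i < N" "v \<in> W n" for i v
  proof (cases "cyl D (i # v) = {}")
    case True
    have "dl D (i # v) = 0" unfolding dl_def sg_def True by simp
    moreover have "0 \<le> b i v" using iota_nonneg[OF iv(2)] by (simp add: b_def)
    ultimately show ?thesis using kappa osc_nonneg[OF iv(1), of D v] by auto
  next
    case False
    then have ne: "cyl D v \<noteq> {}" "cyl D v \<inter> T ` J i \<noteq> {}" by auto
    have i0: "0 \<le> iota D v" "iota D v \<le> \<kappa> ^ n" using iota_nonneg[OF iv(2)] iota_le[OF iv(2) ne(1)] by auto
    show ?thesis
    proof (cases "uncut D (i # v)")
      case True
      then show ?thesis using ne kappa by (auto simp: dl_def b_def)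
    next
      case False
      then have "cyl D v - T ` J i \<noteq> {}" unfolding uncut_def by force
      then have c: "cut i v" using ne(2) unfolding cut_def by blast
      have "dl D (i # v) * iota D v \<le> \<kappa> * \<kappa> ^ n"
        using i0 dl_bounds[OF iv(1), of D v] sg_le[OF iv(1), of D v] kappa by (intro mult_mono) auto
      moreover have "0 \<le> osc0 g (cyl D (i # v)) * b i v" using osc_nonneg[OF iv(1)] i0 by (auto simp: b_def)
      ultimately show ?thesis using c by auto
    qed
  qed
  have "eps D (Suc n) = (\<Sum>i<N. \<Sum>v\<in>W n. dl D (i # v) * iota D v)"
    unfolding eps_def by (simp add: sum_W_Suc)
  also have "\<dots> \<le> (\<Sum>i<N. \<Sum>v\<in>W n. osc0 g (cyl D (i # v)) * b i v + (if cut i v then \<kappa> ^ Suc n else 0))"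
    using tm by (intro sum_mono) auto
  also have "\<dots> = (\<Sum>i<N. \<Sum>v\<in>W n. osc0 g (cyl D (i # v)) * b i v) + (\<Sum>i<N. \<Sum>v\<in>W n. if cut i v then \<kappa> ^ Suc n else 0)"
    by (simp add: sum.distrib)
  also have "(\<Sum>i<N. \<Sum>v\<in>W n. osc0 g (cyl D (i # v)) * b i v) \<le> r ^ Suc n * (real N * wsum D n + V)"
    using iota_nonneg iota_le wt_nonneg kappa by (intro threshold_sum[OF _ D]) (auto simp: b_def)
  also have "(\<Sum>i<N. \<Sum>v\<in>W n. if cut i v then \<kappa> ^ Suc n else 0) \<le> (\<Sum>i<N. 2 * r ^ Suc n)"
  proof (intro sum_mono)
    fix i assume i: "i \<in> {..<N}"
    have "(\<Sum>v\<in>W n. if cut i v then \<kappa> ^ Suc n else 0) = real (card {v \<in> W n. cut i v}) * \<kappa> ^ Suc n"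
      by (subst sum.inter_filter[symmetric]) auto
    also have "\<dots> \<le> 2 * r ^ Suc n"
      using cut_count[OF _ D, of i n] i kappa r_bounds unfolding cut_def
      by (intro mult_mono power_mono) auto
    finally show "(\<Sum>v\<in>W n. if cut i v then \<kappa> ^ Suc n else 0) \<le> 2 * r ^ Suc n" .
  qed
  finally show ?thesis by (simp add: algebra_simps)
qed

text \<open>Over a cell of the partition, cylinders of these depths are uncut and shorter than
  \<eta>, so \<open>dl\<close> is a small oscillation. The crude count of words suffices because
  \<open>s\<close> can be chosen after \<open>d0\<close>.\<close>

lemma eps_small:
  assumes D: "nice_part d0 \<eta> \<D>" "D \<in> \<D>" and d: "d < d0" and s: "0 \<le> s"
    and osc: "\<And>i x y. i < N \<Longrightarrow> x \<in> J i \<Longrightarrow> y \<in> J i \<Longrightarrow> \<bar>x - y\<bar> < \<eta> \<Longrightarrow> \<bar>g x - g y\<bar> \<le> s"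
  shows "eps D (Suc d) \<le> real N ^ Suc d * s"
proof -
  have "eps D (Suc d) \<le> (\<Sum>y\<in>W (Suc d). s)"
    unfolding eps_def
  proof (rule sum_mono)
    fix y assume y: "y \<in> W (Suc d)"
    then obtain i v where w: "y = i # v" "i < N" "v \<in> W d" by (auto simp: W_Suc)
    show "dl D y * iota D (tl y) \<le> s"
    proof (cases "cyl D y = {}")
      case True then show ?thesis using s by (simp add: dl_def sg_def)
    next
      case False
      then have "uncut D y" using D d y by (auto simp: nice_part_def)
      then have "dl D y = osc0 g (cyl D y)" by (simp add: dl_def)
      also have "\<dots> \<le> s"
      proof (rule osc0_le[OF s])
        fix x x' assume x: "x \<in> cyl D y" "x' \<in> cyl D y"
        have "\<bar>x - x'\<bar> \<le> \<kappa> ^ Suc d * \<bar>(T ^^ Suc d) x - (T ^^ Suc d) x'\<bar>" by (rule cyl_contract[OF y x])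
        also have "\<dots> \<le> 1 * \<bar>(T ^^ Suc d) x - (T ^^ Suc d) x'\<bar>"
          using kappa by (intro mult_right_mono power_le_one) auto
        also have "\<dots> < \<eta>" using D cyl_T_pow[OF x(1)] cyl_T_pow[OF x(2)] length_W[OF y] by (auto simp: nice_part_def)
        finally show "\<bar>g x - g x'\<bar> \<le> s" using osc[of i x x'] w x by auto
      qed
      finally have "dl D y \<le> s" .
      moreover have "cyl D v \<noteq> {}" using False w by auto
      then have "iota D v \<le> 1" using iota_le[OF w(3)] kappa power_le_one[of \<kappa> d] by force
      ultimately show ?thesis using mult_mono[of "dl D y" s "iota D v" 1] s iota_nonneg[OF w(3)] w by auto
    qed
  qed
  then show ?thesis by (simp add: card_W)
qed

lemma wsum_mono: "D \<subseteq> D' \<Longrightarrow> wsum D n \<le> wsum D' n"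
  using wsum_cover[of "{D'}" D n] by auto

text \<open>\<open>cyl D y\<close> is covered by at most three cells, hence the factor 3; the term
  with lower bounds only is controlled by the length of \<open>D\<close>.\<close>

lemma wsum_recursion:
  assumes \<D>: "nice_part d0 \<eta> \<D>" "D \<in> \<D>" and b: "\<And>k D. k < n \<Longrightarrow> D \<in> \<D> \<Longrightarrow> wsum D k \<le> b k"
  shows "wsum D n \<le> 1 / measure LB D + (\<Sum>k<n. 3 * b k * eps D (n - k))"
proof -
  have D: "D \<in> sets LB" "0 < measure LB D" using \<D> by (auto simp: nice_part_def)
  have "wsum D n \<le> (\<Sum>w\<in>W n. iota D w) + (\<Sum>k<n. \<Sum>y\<in>W (n - k). wsum (cyl D y) k * (dl D y * iota D (tl y)))"
    by (rule wsum_expand)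
  also have "\<dots> \<le> 1 / measure LB D + (\<Sum>k<n. \<Sum>y\<in>W (n - k). (3 * b k) * (dl D y * iota D (tl y)))"
  proof (intro add_mono sum_iota D sum_mono)
    fix k y assume k: "k \<in> {..<n}" and y0: "y \<in> W (n - k)"
    then have y: "y \<in> W (Suc (n - Suc k))" by (simp add: Suc_diff_Suc)
    then obtain i v where w: "y = i # v" "i < N" "v \<in> W (n - Suc k)" by (auto simp: W_Suc)
    let ?C = "{D' \<in> \<D>. D' \<inter> cyl D y \<noteq> {}}"
    have fin: "finite \<D>" "finite ?C" using \<D> by (auto simp: nice_part_def)
    have card: "card ?C \<le> 3" using \<D> y by (auto simp: nice_part_def)
    have sub: "cyl D y \<subseteq> \<Union>?C"
    proof
      fix x assume x: "x \<in> cyl D y"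
      have "D \<subseteq> {0..1}" "{0..1} \<subseteq> \<Union>\<D>" using \<D> by (auto simp: nice_part_def)
      then have "x \<in> \<Union>\<D>" using cyl_sub01[OF _ y0, of D] x by blast
      then show "x \<in> \<Union>?C" using x by blast
    qed
    have b0: "0 \<le> b k" using b[of k D] \<D>(2) k wsum_nonneg[of D k] by auto
    have "wsum (cyl D y) k \<le> (\<Sum>D'\<in>?C. wsum D' k)" by (rule wsum_cover[OF fin(2) sub])
    also have "\<dots> \<le> (\<Sum>D'\<in>?C. b k)" using b k by (intro sum_mono) auto
    also have "\<dots> \<le> 3 * b k" using card b0 by (simp add: mult_right_mono)
    finally show "wsum (cyl D y) k * (dl D y * iota D (tl y)) \<le> (3 * b k) * (dl D y * iota D (tl y))"
      using w dl_bounds(1)[OF w(2), of D v] iota_nonneg[OF w(3), of D] by (intro mult_right_mono) auto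
  qed
  also have "\<dots> = 1 / measure LB D + (\<Sum>k<n. 3 * b k * eps D (n - k))"
    by (simp add: eps_def sum_distrib_left)
  finally show ?thesis .
qed

section \<open>Lowering the growth rate of the total weight\<close>

definition growth :: "real \<Rightarrow> bool" where
  "growth \<beta> \<longleftrightarrow> (\<exists>M\<ge>0. \<forall>n. wsum {0..1} n \<le> M * \<beta> ^ n)"

text \<open>With growth rate \<beta>, \<open>eps_bound\<close> makes the renewal coefficients at
  depth \<open>d\<close> at most a constant times \<open>(r * \<beta>) ^ d\<close>. Writing
  \<open>r = q * q\<close>, half of this decay lowers the rate to \<open>q * \<beta>\<close> and the
  other half makes the coefficients summable relative to the new rate. Once three times their sum is
  at most 1/2, the renewal inequality closes by induction.\<close>

lemma growth_step:
  assumes \<beta>: "1 \<le> \<beta>" and gr: "growth \<beta>"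
  shows "growth (max 1 (sqrt r * \<beta>))"
proof -
  define q where "q = sqrt r"
  have q: "0 < q" "q < 1" "q * q = r" using r_bounds by (auto simp: q_def)
  define \<beta>' where "\<beta>' = max 1 (q * \<beta>)"
  have \<beta>': "1 \<le> \<beta>'" "q * \<beta> \<le> \<beta>'" by (auto simp: \<beta>'_def)
  obtain M where M: "0 \<le> M" "\<And>n. wsum {0..1} n \<le> M * \<beta> ^ n" using gr by (auto simp: growth_def)
  define C where "C = real N * M + V + 2 * real N"
  have C: "0 \<le> C" using M V_nonneg by (simp add: C_def)
  have e1: "eps D d \<le> C * q ^ d * \<beta>' ^ d" if D: "convex D" "D \<subseteq> {0..1}" and d: "0 < d" for D d
  proof -
    obtain n where n: "d = Suc n" using d by (cases d) auto
    have "wsum D n \<le> M * \<beta> ^ n" using wsum_mono[OF D(2), of n] M(2)[of n] by linarith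
    also have "\<dots> \<le> M * \<beta> ^ d" using \<beta> M(1) n by (intro mult_left_mono power_increasing) auto
    finally have w: "wsum D n \<le> M * \<beta> ^ d" .
    have "real N * wsum D n + V + 2 * real N \<le> real N * (M * \<beta> ^ d) + V * \<beta> ^ d + 2 * real N * \<beta> ^ d"
      using w V_nonneg \<beta> by (intro add_mono mult_left_mono) (auto simp: mult_le_cancel_left1)
    also have "\<dots> = C * \<beta> ^ d" by (simp add: C_def algebra_simps)
    finally have "eps D d \<le> r ^ d * (C * \<beta> ^ d)"
      using eps_bound[OF D(1), of n] n r_bounds(1) by (smt (verit) mult_left_mono zero_less_power)
    also have "\<dots> = C * q ^ d * (q * \<beta>) ^ d" by (simp add: q(3)[symmetric] power_mult_distrib)
    also have "\<dots> \<le> C * q ^ d * \<beta>' ^ d" using C q \<beta> \<beta>' by (intro mult_left_mono power_mono) auto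
    finally show ?thesis .
  qed
  \<comment> \<open>The depth \<open>d0\<close> makes the tail of the coefficients at most 1/12; the
    finitely many coefficients before it are made small by refining the partition.\<close>
  have "summable (\<lambda>d. C * q ^ d)" using q by (intro summable_mult summable_geometric) auto
  then obtain d0 where "\<And>m n. m \<ge> d0 \<Longrightarrow> norm (\<Sum>d = m..<n. C * q ^ d) < 1 / 12"
    unfolding summable_Cauchy by (meson zero_less_divide_1_iff zero_less_numeral)
  then have tail: "(\<Sum>d = Suc d0..<n. C * q ^ d) \<le> 1 / 12" for n
    by (metis abs_le_D1 le_SucI less_imp_le order_refl real_norm_def)
  \<comment> \<open>With this tolerance each of the first \<open>d0\<close> coefficients is at most
    \<open>1 / (12 * (d0 + 1))\<close>, so together they stay below 1/12 as well.\<close>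
  define s where "s = 1 / (12 * (real d0 + 1) * real N ^ d0)"
  have s: "0 < s" using N_pos by (simp add: s_def)
  obtain \<eta> where \<eta>: "\<eta> > 0" "\<And>i x y. i < N \<Longrightarrow> x \<in> J i \<Longrightarrow> y \<in> J i \<Longrightarrow> \<bar>x - y\<bar> < \<eta> \<Longrightarrow> \<bar>g x - g y\<bar> \<le> s"
    using small_osc[OF s] by meson
  obtain \<D> where \<D>: "nice_part d0 \<eta> \<D>" using ex_nice_part[OF \<eta>(1)] by blast
  have D: "convex D" "D \<subseteq> {0..1}" "0 < measure LB D" if "D \<in> \<D>" for D
    using \<D> that by (auto simp: nice_part_def)
  have finD: "finite \<D>" "{0..1} \<subseteq> \<Union>\<D>" using \<D> by (auto simp: nice_part_def)
  define \<theta> where "\<theta> = (\<lambda>d. if d \<le> d0 then real N ^ d0 * s else C * q ^ d)"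
  have \<theta>nn: "0 \<le> \<theta> d" for d using s C q by (auto simp: \<theta>_def)
  have e2: "eps D d \<le> \<theta> d * \<beta>' ^ d" if DD: "D \<in> \<D>" and d: "0 < d" for D d
  proof (cases "d \<le> d0")
    case True
    obtain k where k: "d = Suc k" using d by (cases d) auto
    have "eps D d \<le> real N ^ d * s" using eps_small[OF \<D> DD _ _ \<eta>(2), of k] True k s by auto
    also have "\<dots> \<le> real N ^ d0 * s" using True N_pos s by (intro mult_right_mono power_increasing) auto
    also have "\<dots> \<le> \<theta> d * \<beta>' ^ d"
      using True mult_left_mono[OF one_le_power[OF \<beta>'(1), of d] \<theta>nn[of d]] by (simp add: \<theta>_def)
    finally show ?thesis .
  next
    case False
    then show ?thesis using e1[OF D(1,2)[OF DD] d] by (simp add: \<theta>_def)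
  qed
  have \<theta>sum: "(\<Sum>d = 1..n. \<theta> d) \<le> 1 / 6" for n
  proof -
    have "(\<Sum>d = 1..n. \<theta> d) \<le> (\<Sum>d\<in>{1..d0} \<union> {Suc d0..<Suc n}. \<theta> d)"
      using \<theta>nn by (intro sum_mono2) auto
    also have "\<dots> = (\<Sum>d = 1..d0. \<theta> d) + (\<Sum>d = Suc d0..<Suc n. \<theta> d)"
      by (rule sum.union_disjoint) auto
    also have "(\<Sum>d = 1..d0. \<theta> d) = real d0 * (real N ^ d0 * s)" by (simp add: \<theta>_def)
    also have "real N ^ d0 * s = 1 / (12 * (real d0 + 1))" using N_pos by (simp add: s_def)
    also have "real d0 * \<dots> \<le> 1 / 12" by (simp add: field_simps)
    also have "(\<Sum>d = Suc d0..<Suc n. \<theta> d) = (\<Sum>d = Suc d0..<Suc n. C * q ^ d)"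
      by (intro sum.cong) (auto simp: \<theta>_def)
    also have "\<dots> \<le> 1 / 12" by (rule tail)
    finally show ?thesis by simp
  qed
  \<comment> \<open>Chosen such that \<open>1 / measure LB D\<close> is at most \<open>B / 2\<close>
    for every cell; the renewal sum takes up the other half of \<open>B\<close>.\<close>
  define B where "B = (\<Sum>D\<in>\<D>. 2 / measure LB D)"
  have Bge: "2 / measure LB D \<le> B" if "D \<in> \<D>" for D
    unfolding B_def using D(3) finD that by (intro member_le_sum) (auto intro: less_imp_le)
  have B0: "0 \<le> B" unfolding B_def using D(3) by (intro sum_nonneg) (auto intro: less_imp_le)
  have main: "\<forall>D\<in>\<D>. wsum D n \<le> B * \<beta>' ^ n" for n
  proof (induction n rule: less_induct)
    case (less n)
    show ?case
    proof
      fix D assume DD: "D \<in> \<D>"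
      have "wsum D n \<le> 1 / measure LB D + (\<Sum>k<n. 3 * (B * \<beta>' ^ k) * eps D (n - k))"
        using less.IH by (intro wsum_recursion[OF \<D> DD]) auto
      also have "\<dots> \<le> B / 2 + (\<Sum>k<n. 3 * (B * \<beta>' ^ k) * (\<theta> (n - k) * \<beta>' ^ (n - k)))"
        using Bge[OF DD] B0 \<beta>' e2[OF DD] by (intro add_mono sum_mono mult_left_mono) auto
      also have "(\<Sum>k<n. 3 * (B * \<beta>' ^ k) * (\<theta> (n - k) * \<beta>' ^ (n - k))) = (\<Sum>k<n. 3 * B * \<beta>' ^ n * \<theta> (n - k))"
      proof (rule sum.cong[OF refl])
        fix k assume "k \<in> {..<n}"
        then have "\<beta>' ^ n = \<beta>' ^ k * \<beta>' ^ (n - k)" by (simp add: power_add[symmetric])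
        then show "3 * (B * \<beta>' ^ k) * (\<theta> (n - k) * \<beta>' ^ (n - k)) = 3 * B * \<beta>' ^ n * \<theta> (n - k)" by simp
      qed
      also have "\<dots> = 3 * B * \<beta>' ^ n * (\<Sum>k<n. \<theta> (n - k))" by (simp add: sum_distrib_left)
      also have "(\<Sum>k<n. \<theta> (n - k)) = (\<Sum>d = 1..n. \<theta> d)"
        by (rule sum.reindex_bij_witness[of _ "\<lambda>d. n - d" "\<lambda>k. n - k"]) auto
      also have "3 * B * \<beta>' ^ n * (\<Sum>d = 1..n. \<theta> d) \<le> 3 * B * \<beta>' ^ n * (1 / 6)"
        using \<theta>sum B0 \<beta>' by (intro mult_left_mono) auto
      also have "B / 2 \<le> B / 2 * \<beta>' ^ n" using B0 \<beta>' by (simp add: mult_le_cancel_left1)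
      finally show "wsum D n \<le> B * \<beta>' ^ n" by simp
    qed
  qed
  have "wsum {0..1} n \<le> (real (card \<D>) * B) * \<beta>' ^ n" for n
  proof -
    have "wsum {0..1} n \<le> (\<Sum>D\<in>\<D>. wsum D n)" by (rule wsum_cover[OF finD])
    also have "\<dots> \<le> (\<Sum>D\<in>\<D>. B * \<beta>' ^ n)" using main by (intro sum_mono) auto
    finally show ?thesis by simp
  qed
  then show ?thesis unfolding growth_def \<beta>'_def q_def using B0 by (intro exI[of _ "real (card \<D>) * B"]) auto
qed

text \<open>Each use of \<open>growth_step\<close> multiplies the rate by \<open>sqrt r\<close>,
  until the maximum with 1 is 1 itself.\<close>

lemma wsum_bounded: obtains K where "1 \<le> K" "\<And>n. wsum {0..1} n \<le> K"
proof -
  define \<beta> where "\<beta> = max 1 (real N * \<kappa>)"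
  have g0: "growth \<beta>" unfolding growth_def
  proof (intro exI[of _ 1] conjI allI)
    fix n
    have "(real N * \<kappa>) ^ n \<le> \<beta> ^ n" unfolding \<beta>_def using kappa by (intro power_mono) auto
    then show "wsum {0..1} n \<le> 1 * \<beta> ^ n" using wsum_trivial[of "{0..1}" n] by simp
  qed simp
  have q: "0 < sqrt r" "sqrt r < 1" using r_bounds by auto
  have "growth (max 1 (sqrt r ^ k * \<beta>))" for k
  proof (induction k)
    case 0 then show ?case using g0 by (simp add: \<beta>_def)
  next
    case (Suc k)
    have mx: "max 1 (s * max 1 x) = max 1 (s * x)" if "0 < s" "s < 1" for s x :: real
    proof (cases "x \<le> 1")
      case True
      then have "s * x \<le> s * 1" using that by (intro mult_left_mono) auto
      then have "s * x < 1" using that by linarith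
      then show ?thesis using True \<open>s < 1\<close> by (simp add: max_def)
    qed (simp add: max_def)
    have "max 1 (sqrt r * max 1 (sqrt r ^ k * \<beta>)) = max 1 (sqrt r ^ Suc k * \<beta>)"
      using mx[OF q] by (simp add: mult.assoc)
    then show ?case using growth_step[OF _ Suc] by simp
  qed
  moreover obtain k where "sqrt r ^ k < 1 / \<beta>"
    using real_arch_pow_inv[of "1 / \<beta>" "sqrt r"] q
    by (metis \<beta>_def max.strict_coboundedI1 zero_less_divide_1_iff zero_less_one)
  then have "sqrt r ^ k * \<beta> \<le> 1" by (simp add: \<beta>_def field_simps)
  ultimately have "growth 1" by (metis max.absorb1)
  then obtain M where "\<And>n. wsum {0..1} n \<le> M" by (auto simp: growth_def)
  then have "\<And>n. wsum {0..1} n \<le> max 1 M" by (simp add: max.coboundedI2)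
  then show ?thesis using that[of "max 1 M"] by simp
qed

end

lemma osc0_add:
  assumes "\<And>y. y \<in> Y \<Longrightarrow> \<bar>f y\<bar> \<le> A" "\<And>y. y \<in> Y \<Longrightarrow> \<bar>h y\<bar> \<le> B"
  shows "osc0 (\<lambda>x. f x + h x) Y \<le> osc0 f Y + osc0 h Y"
proof (rule osc0_le)
  show "0 \<le> osc0 f Y + osc0 h Y" using osc0_nonneg[of Y f A] osc0_nonneg[of Y h B] assms by simp
  fix x y assume xy: "x \<in> Y" "y \<in> Y"
  have "\<bar>f x - f y\<bar> \<le> osc0 f Y" "\<bar>h x - h y\<bar> \<le> osc0 h Y"
    using osc0_ge[of Y f A x y] osc0_ge[of Y h B x y] assms xy by auto
  then show "\<bar>f x + h x - (f y + h y)\<bar> \<le> osc0 f Y + osc0 h Y" by linarith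
qed

lemma osc0_sum:
  assumes "finite I" "\<And>i y. i \<in> I \<Longrightarrow> y \<in> Y \<Longrightarrow> \<bar>f i y\<bar> \<le> A"
  shows "osc0 (\<lambda>x. \<Sum>i\<in>I. f i x) Y \<le> (\<Sum>i\<in>I. osc0 (f i) Y)"
proof (rule osc0_le)
  show "0 \<le> (\<Sum>i\<in>I. osc0 (f i) Y)" using assms by (intro sum_nonneg osc0_nonneg) auto
  fix x y assume xy: "x \<in> Y" "y \<in> Y"
  have "\<bar>(\<Sum>i\<in>I. f i x) - (\<Sum>i\<in>I. f i y)\<bar> \<le> (\<Sum>i\<in>I. \<bar>f i x - f i y\<bar>)"
    unfolding sum_subtractf[symmetric] by (rule sum_abs)
  also have "\<dots> \<le> (\<Sum>i\<in>I. osc0 (f i) Y)" using assms xy by (intro sum_mono osc0_ge) auto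
  finally show "\<bar>(\<Sum>i\<in>I. f i x) - (\<Sum>i\<in>I. f i y)\<bar> \<le> (\<Sum>i\<in>I. osc0 (f i) Y)" .
qed

lemma osc0_mult:
  assumes "\<And>y. y \<in> Y \<Longrightarrow> \<bar>f y\<bar> \<le> A" "\<And>y. y \<in> Y \<Longrightarrow> \<bar>h y\<bar> \<le> B" "0 \<le> A" "0 \<le> B"
  shows "osc0 (\<lambda>x. f x * h x) Y \<le> osc0 f Y * B + A * osc0 h Y"
proof (rule osc0_le)
  have nn: "0 \<le> osc0 f Y" "0 \<le> osc0 h Y" using osc0_nonneg[of Y f A] osc0_nonneg[of Y h B] assms by simp_all
  then show "0 \<le> osc0 f Y * B + A * osc0 h Y" using assms by simp
  fix x y assume xy: "x \<in> Y" "y \<in> Y"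
  have o: "\<bar>f x - f y\<bar> \<le> osc0 f Y" "\<bar>h x - h y\<bar> \<le> osc0 h Y"
    using osc0_ge[of Y f A x y] osc0_ge[of Y h B x y] assms xy by auto
  have "f x * h x - f y * h y = (f x - f y) * h x + f y * (h x - h y)" by (simp add: algebra_simps)
  then have "\<bar>f x * h x - f y * h y\<bar> \<le> \<bar>f x - f y\<bar> * \<bar>h x\<bar> + \<bar>f y\<bar> * \<bar>h x - h y\<bar>"
    by (metis abs_mult abs_triangle_ineq)
  also have "\<dots> \<le> osc0 f Y * B + A * osc0 h Y"
    using o nn assms xy by (intro add_mono mult_mono) auto
  finally show "\<bar>f x * h x - f y * h y\<bar> \<le> osc0 f Y * B + A * osc0 h Y" .
qed

lemma osc0_cmult:
  assumes "\<And>y. y \<in> Y \<Longrightarrow> \<bar>h y\<bar> \<le> B"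
  shows "osc0 (\<lambda>x. a * h x) Y \<le> \<bar>a\<bar> * osc0 h Y"
proof (rule osc0_le)
  show "0 \<le> \<bar>a\<bar> * osc0 h Y" using osc0_nonneg[of Y h B] assms by simp
  fix x y assume xy: "x \<in> Y" "y \<in> Y"
  have "\<bar>h x - h y\<bar> \<le> osc0 h Y" using osc0_ge[of Y h B x y] assms xy by auto
  then show "\<bar>a * h x - a * h y\<bar> \<le> \<bar>a\<bar> * osc0 h Y"
    by (simp add: right_diff_distrib[symmetric] abs_mult mult_left_mono)
qed

context pw_expanding
begin

subsection \<open>Densities with decaying oscillation\<close>

abbreviation wZ :: "nat list \<Rightarrow> real" where "wZ w \<equiv> wt {0..1} w"

definition K :: real where "K = (SOME K. 1 \<le> K \<and> (\<forall>n. wsum {0..1} n \<le> K))"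

lemma K: "1 \<le> K" "wsum {0..1} n \<le> K"
proof -
  have "\<exists>K. 1 \<le> K \<and> (\<forall>n. wsum {0..1} n \<le> K)" using wsum_bounded by blast
  from someI_ex[OF this] show "1 \<le> K" "wsum {0..1} n \<le> K" unfolding K_def by auto
qed

definition ov :: "(real \<Rightarrow> real) \<Rightarrow> nat \<Rightarrow> real" where
  "ov h n = (\<Sum>w\<in>W n. wZ w * osc0 h (Z w))"

text \<open>The substitute for bounded variation.\<close>

definition sp :: "real \<Rightarrow> real \<Rightarrow> (real \<Rightarrow> real) \<Rightarrow> bool" where
  "sp A B h \<longleftrightarrow> bm A h \<and> 0 \<le> B \<and> (\<forall>n. ov h n \<le> B * r ^ n)"

lemma sp_bm: "sp A B h \<Longrightarrow> bm A h" by (simp add: sp_def)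

lemma bm_Z: "bm A h \<Longrightarrow> w \<in> W n \<Longrightarrow> y \<in> Z w \<Longrightarrow> \<bar>h y\<bar> \<le> A"
  using Z_sub unfolding bm_def by blast

lemma osc0_Z_nonneg: "bm A h \<Longrightarrow> w \<in> W n \<Longrightarrow> 0 \<le> osc0 h (Z w)"
  using bm_Z by (intro osc0_nonneg[of _ h A]) auto

lemma osc0_Z_ge: "bm A h \<Longrightarrow> w \<in> W n \<Longrightarrow> x \<in> Z w \<Longrightarrow> y \<in> Z w \<Longrightarrow> \<bar>h x - h y\<bar> \<le> osc0 h (Z w)"
  using bm_Z by (intro osc0_ge[of _ h A]) auto

lemma osc0_Z_le: "bm A h \<Longrightarrow> w \<in> W n \<Longrightarrow> osc0 h (Z w) \<le> 2 * A"
proof (rule osc0_le)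
  assume h: "bm A h" and w: "w \<in> W n"
  show "0 \<le> 2 * A" using bm_nonneg[OF h] by simp
  fix x y assume "x \<in> Z w" "y \<in> Z w"
  then show "\<bar>h x - h y\<bar> \<le> 2 * A" using bm_Z[OF h w, of x] bm_Z[OF h w, of y] by linarith
qed

lemma sp_mono: "sp A B h \<Longrightarrow> A \<le> A' \<Longrightarrow> B \<le> B' \<Longrightarrow> sp A' B' h"
  unfolding sp_def using r_bounds(1) bm_mono
  by (auto intro: order_trans[OF _ mult_right_mono])

lemma sp_add: assumes "sp A B h" "sp A' B' f" shows "sp (A + A') (B + B') (\<lambda>x. h x + f x)"
  unfolding sp_def
proof (intro conjI allI)
  have b: "bm A h" "bm A' f" using assms by (auto simp: sp_def)
  show "bm (A + A') (\<lambda>x. h x + f x)" by (rule bm_add[OF b])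
  show "0 \<le> B + B'" using assms by (simp add: sp_def)
  fix n
  have "ov (\<lambda>x. h x + f x) n \<le> (\<Sum>w\<in>W n. wZ w * (osc0 h (Z w) + osc0 f (Z w)))"
    unfolding ov_def using b by (intro sum_mono mult_left_mono osc0_add wt_nonneg) (auto intro: bm_Z)
  also have "\<dots> = ov h n + ov f n" by (simp add: ov_def algebra_simps sum.distrib)
  also have "\<dots> \<le> (B + B') * r ^ n" unfolding distrib_right using assms by (intro add_mono) (auto simp: sp_def)
  finally show "ov (\<lambda>x. h x + f x) n \<le> (B + B') * r ^ n" .
qed

lemma sp_cmult: assumes "sp A B h" shows "sp (\<bar>a\<bar> * A) (\<bar>a\<bar> * B) (\<lambda>x. a * h x)"
  unfolding sp_def
proof (intro conjI allI)
  have b: "bm A h" using assms by (auto simp: sp_def)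
  show "bm (\<bar>a\<bar> * A) (\<lambda>x. a * h x)" by (rule bm_cmult[OF b])
  show "0 \<le> \<bar>a\<bar> * B" using assms by (simp add: sp_def)
  fix n
  have "ov (\<lambda>x. a * h x) n \<le> (\<Sum>w\<in>W n. wZ w * (\<bar>a\<bar> * osc0 h (Z w)))"
    unfolding ov_def using b by (intro sum_mono mult_left_mono osc0_cmult wt_nonneg) (auto intro: bm_Z)
  also have "\<dots> = \<bar>a\<bar> * ov h n" by (simp add: ov_def sum_distrib_left mult_ac)
  also have "\<dots> \<le> \<bar>a\<bar> * (B * r ^ n)" using assms by (intro mult_left_mono) (auto simp: sp_def)
  finally show "ov (\<lambda>x. a * h x) n \<le> \<bar>a\<bar> * B * r ^ n" by (simp add: mult.assoc)
qed

lemma sp_mult: assumes "sp A B h" "sp A' B' f" shows "sp (A * A') (B * A' + A * B') (\<lambda>x. h x * f x)"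
  unfolding sp_def
proof (intro conjI allI)
  have b: "bm A h" "bm A' f" using assms by (auto simp: sp_def)
  note nn = bm_nonneg[OF b(1)] bm_nonneg[OF b(2)]
  show "bm (A * A') (\<lambda>x. h x * f x)" by (rule bm_mult[OF b])
  show "0 \<le> B * A' + A * B'" using assms nn by (simp add: sp_def)
  fix n
  have "ov (\<lambda>x. h x * f x) n \<le> (\<Sum>w\<in>W n. wZ w * (osc0 h (Z w) * A' + A * osc0 f (Z w)))"
    unfolding ov_def using b nn by (intro sum_mono mult_left_mono osc0_mult wt_nonneg) (auto intro: bm_Z)
  also have "\<dots> = A' * ov h n + A * ov f n"
    by (simp add: ov_def algebra_simps sum.distrib sum_distrib_left)
  also have "\<dots> \<le> A' * (B * r ^ n) + A * (B' * r ^ n)"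
    using assms nn by (intro add_mono mult_left_mono) (auto simp: sp_def)
  finally show "ov (\<lambda>x. h x * f x) n \<le> (B * A' + A * B') * r ^ n" by (simp add: algebra_simps)
qed

lemma sp_const: "sp \<bar>a\<bar> 0 (\<lambda>_. a)"
proof -
  have "osc0 (\<lambda>_. a) Y = 0" for Y :: "real set"
    using osc0_le[of 0 Y "\<lambda>_. a"] osc0_nonneg[of Y "\<lambda>_. a" "\<bar>a\<bar>"] by force
  then show ?thesis using bm_const by (simp add: sp_def ov_def)
qed

lemma L_bound: assumes "bm A h" "w \<in> W n" "x \<in> {0..1}" "0 \<le> s" "\<And>y. y \<in> Z w \<Longrightarrow> \<bar>h y\<bar> \<le> s"
  shows "\<bar>L w h x\<bar> \<le> wZ w * s"
  using L_point[OF assms(3,2), of h]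
proof
  assume "L w h x = 0"
  then show ?thesis using wt_nonneg[OF assms(2)] assms(4) by simp
next
  assume "\<exists>y\<in>Z w. (T ^^ n) y = x \<and> L w h x = h y * gn n y"
  then obtain y where y: "y \<in> Z w" "L w h x = h y * gn n y" by blast
  have "\<bar>h y * gn n y\<bar> \<le> s * wZ w"
    unfolding abs_mult using assms(5)[OF y(1)] wt_ge[OF assms(2) y(1)] gn_pos[OF assms(2) y(1)] assms(4)
    by (intro mult_mono) auto
  then show ?thesis using y by (simp add: mult.commute)
qed

lemma dualPn: "bm A h \<Longrightarrow> bm B f \<Longrightarrow> (\<integral>x. (P ^^ n) h x * f x \<partial>LB) = (\<integral>x. h x * f ((T ^^ n) x) \<partial>LB)"
proof (induction n arbitrary: h A)
  case (Suc n)
  have "(\<integral>x. (P ^^ Suc n) h x * f x \<partial>LB) = (\<integral>x. (P ^^ n) (P h) x * f x \<partial>LB)" by (simp add: funpow_swap1)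
  also have "\<dots> = (\<integral>x. P h x * f ((T ^^ n) x) \<partial>LB)" by (rule Suc.IH[OF P_bm[OF Suc.prems(1)] Suc.prems(2)])
  also have "\<dots> = (\<integral>x. h x * f ((T ^^ n) (T x)) \<partial>LB)" by (rule dualP[OF Suc.prems(1) bm_comp_T[OF Suc.prems(2)]])
  finally show ?case by (simp add: funpow_swap1)
qed simp

lemma Pn_meas: assumes "bm A h" shows "(P ^^ n) h \<in> borel_measurable LB"
  using assms
proof (induction n arbitrary: A h)
  case (Suc n)
  show ?case using Suc.IH[OF P_bm[OF Suc.prems]] by (simp add: funpow_swap1)
qed (simp add: bm_def)

text \<open>Here the bounded total weight enters: the sup bound does not depend on the number of
  iterations.\<close>

lemma Pn_bm: assumes h: "bm A h" shows "bm (K * A) ((P ^^ n) h)"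
  unfolding bm_def
proof (intro conjI ballI)
  show "(P ^^ n) h \<in> borel_measurable LB" by (rule Pn_meas[OF h])
  fix x :: real assume x: "x \<in> {0..1}"
  have "\<bar>(P ^^ n) h x\<bar> \<le> (\<Sum>w\<in>W n. \<bar>L w h x\<bar>)" unfolding P_pow by (rule sum_abs)
  also have "\<dots> \<le> (\<Sum>w\<in>W n. wZ w * A)"
    using bm_Z[OF h] bm_nonneg[OF h] by (intro sum_mono L_bound[OF h _ x]) auto
  also have "\<dots> = wsum {0..1} n * A" by (simp add: wsum_def sum_distrib_right)
  also have "\<dots> \<le> K * A" using K(2) bm_nonneg[OF h] by (intro mult_right_mono)
  finally show "\<bar>(P ^^ n) h x\<bar> \<le> K * A" .
qed

lemma sum_cells: assumes h: "bm A h"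
  shows "(\<Sum>w\<in>W n. \<integral>x. indicator (Z w) x * h x \<partial>LB) = (\<integral>x. h x \<partial>LB)"
proof -
  have "(\<Sum>w\<in>W n. \<integral>x. indicator (Z w) x * h x \<partial>LB) = (\<Sum>w\<in>W n. \<integral>x. L w h x \<partial>LB)"
    using dualL[OF _ h bm_const[of 1], of _ n] by (intro sum.cong) auto
  also have "\<dots> = (\<integral>x. (P ^^ n) h x * 1 \<partial>LB)"
    unfolding P_pow mult_1_right
    by (intro Bochner_Integration.integral_sum[symmetric] bm_integrable[OF L_bm[OF _ h]])
  also have "\<dots> = (\<integral>x. h x \<partial>LB)" using dualPn[OF h bm_const[of 1]] by simp
  finally show ?thesis .
qed

text \<open>The integral of \<open>L w (\<lambda>_. 1)\<close> is the length of \<open>Z w\<close>,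
  and the integrand is at most \<open>wZ w\<close> on an interval of length 1.\<close>

lemma measure_Z_le: assumes w: "w \<in> W n" shows "measure LB (Z w) \<le> wZ w"
proof -
  have one: "bm 1 (\<lambda>_. 1)" using bm_const[of 1] by simp
  have "measure LB (Z w) = (\<integral>x. indicator (Z w) x * (1 * 1) \<partial>LB)"
    using Z_sub[OF w] by (simp add: Int_absorb2)
  also have "\<dots> = (\<integral>x. L w (\<lambda>_. 1) x * 1 \<partial>LB)" using dualL[OF w one one] by simp
  also have "\<dots> \<le> \<bar>\<integral>x. L w (\<lambda>_. 1) x \<partial>LB\<bar>" by simp
  also have "\<dots> \<le> wZ w"
  proof (rule bm_integral_bound)
    show "bm (wZ w) (L w (\<lambda>_. 1))" using L_bm[OF w one] L_bound[OF one w, of _ 1] by (auto simp: bm_def)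
  qed
  finally show ?thesis .
qed

lemma Z_measure_pos: assumes w: "w \<in> W n" and ne: "Z w \<noteq> {}" shows "0 < measure LB (Z w)"
proof (cases n)
  case 0 then show ?thesis using w by simp
next
  case (Suc k)
  have o: "open (Z w)" using Z_open w Suc by simp
  obtain x where x: "x \<in> Z w" using ne by blast
  obtain e where e: "e > 0" "ball x e \<subseteq> Z w" using o x openE by blast
  have sub: "{x - e / 2..x + e / 2} \<subseteq> Z w" using e by (auto simp: dist_real_def subset_iff)
  have sub1: "{x - e / 2..x + e / 2} \<subseteq> {0..1}" using sub Z_sub[OF w] by (rule subset_trans)
  then have m: "{x - e / 2..x + e / 2} \<in> sets LB" by (intro in_sets_LB) auto
  have "0 < measure LB {x - e / 2..x + e / 2}"
    using e sub1 by (subst measure_restrict_space) simp_all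
  also have "\<dots> \<le> measure LB (Z w)"
    by (rule finite_measure.finite_measure_mono[OF finite_measure_LB sub Z_sets[OF w]])
  finally show ?thesis .
qed

section \<open>The Lasota-Yorke inequality\<close>

definition nrm1 :: "(real \<Rightarrow> real) \<Rightarrow> real" where "nrm1 h = (\<integral>x. \<bar>h x\<bar> \<partial>LB)"

lemma nrm1_nonneg: "0 \<le> nrm1 h" by (simp add: nrm1_def)

text \<open>On the cell of \<open>y\<close> the function \<open>\<bar>h\<bar>\<close> is at least
  \<open>\<bar>h y\<bar>\<close> minus the oscillation; integrate over the cell.\<close>

lemma cell_value_bound:
  assumes h: "bm A h" and w: "w \<in> W n" and y: "y \<in> Z w"
  shows "\<bar>h y\<bar> \<le> osc0 h (Z w) + nrm1 h / measure LB (Z w)"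
proof -
  let ?o = "osc0 h (Z w)" and ?m = "measure LB (Z w)"
  have m: "0 < ?m" using Z_measure_pos[OF w] y by auto
  have iZ: "bm 1 (indicator (Z w))" by (rule bm_indicator[OF Z_sets[OF w]])
  have "(\<bar>h y\<bar> - ?o) * ?m = (\<integral>x. (\<bar>h y\<bar> - ?o) * indicator (Z w) x \<partial>LB)"
    using Z_sub[OF w] by (simp add: Int_absorb2)
  also have "\<dots> \<le> (\<integral>x. \<bar>h x\<bar> \<partial>LB)"
  proof (rule integral_le_bm[OF bm_cmult[OF iZ] bm_abs[OF h]])
    fix x :: real
    show "(\<bar>h y\<bar> - ?o) * indicator (Z w) x \<le> \<bar>h x\<bar>"
      using osc0_Z_ge[OF h w y, of x] by (auto simp: indicator_def)
  qed
  finally show ?thesis using m by (simp add: nrm1_def field_simps)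
qed

text \<open>The price for passing from the L1 norm to the sup norm at depth \<open>k\<close>. It may
  be huge, but \<open>k\<close> is fixed before the L1 norm is made small. Empty cells contribute
  0.\<close>

definition Ck :: "nat \<Rightarrow> real" where "Ck k = (\<Sum>w\<in>W k. wZ w / measure LB (Z w))"

lemma Ck_nonneg: "0 \<le> Ck k"
  unfolding Ck_def by (intro sum_nonneg divide_nonneg_nonneg wt_nonneg) auto

lemma Pk_sup:
  assumes h: "sp A B h" and x: "x \<in> {0..1}"
  shows "\<bar>(P ^^ k) h x\<bar> \<le> B * r ^ k + Ck k * nrm1 h"
proof -
  have b: "bm A h" using h by (rule sp_bm)
  have "\<bar>(P ^^ k) h x\<bar> \<le> (\<Sum>w\<in>W k. \<bar>L w h x\<bar>)" unfolding P_pow by (rule sum_abs)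
  also have "\<dots> \<le> (\<Sum>w\<in>W k. wZ w * (osc0 h (Z w) + nrm1 h / measure LB (Z w)))"
    using cell_value_bound[OF b] osc0_Z_nonneg[OF b] nrm1_nonneg
    by (intro sum_mono L_bound[OF b _ x]) auto
  also have "\<dots> = ov h k + Ck k * nrm1 h"
    by (simp add: ov_def Ck_def algebra_simps sum.distrib sum_distrib_left)
  also have "\<dots> \<le> B * r ^ k + Ck k * nrm1 h" using h by (simp add: sp_def)
  finally show ?thesis .
qed

text \<open>The first summand comes from the oscillation of \<open>g\<close> summed by
  \<open>threshold_sum\<close>, the second from two cut cells per branch with oscillation at most
  \<open>2 * A\<close> each.\<close>

definition C1 :: real where "C1 = 3 * (real N * K + V) + 4 * real N"

lemma C1_nonneg: "0 \<le> C1"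
  using V_nonneg K(1) by (simp add: C1_def)

text \<open>A branch covering the cell gives a product rule in which the oscillation of
  \<open>h\<close> is multiplied by a lower bound of \<open>g\<close>, and this bound times
  \<open>wZ w\<close> is at most \<open>wZ (i # w)\<close>. So the main term has coefficient 1, and
  all losses are charged to the oscillation of \<open>g\<close>. A cell that is cut gets the crude
  bound; one that is missed gives 0.\<close>

lemma branch_osc:
  assumes h: "bm A h" and i: "i < N" and w: "w \<in> W n"
  defines "ct \<equiv> Z w \<inter> T ` J i \<noteq> {} \<and> \<not> Z w \<subseteq> T ` J i"
  shows "wZ w * osc0 (L1 i h) (Z w) \<le> wZ (i # w) * osc0 h (Z (i # w)) + 3 * A * (osc0 g (Z (i # w)) * wZ w)
     + (if ct then 2 * A * \<kappa> ^ n else 0)"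
proof -
  have A: "0 \<le> A" by (rule bm_nonneg[OF h])
  have iw: "i # w \<in> W (Suc n)" using i w by (simp add: Cons_in_W)
  have nn: "0 \<le> wZ (i # w) * osc0 h (Z (i # w))" "0 \<le> 3 * A * (osc0 g (Z (i # w)) * wZ w)"
    using wt_nonneg[OF iw] wt_nonneg[OF w] osc0_Z_nonneg[OF h iw] osc_nonneg[OF i] A by auto
  have kn: "0 \<le> 2 * A * \<kappa> ^ n" using A kappa by simp
  show ?thesis
  proof (cases "Z w \<inter> T ` J i = {}")
    case True
    have "osc0 (L1 i h) (Z w) \<le> 0"
      using True by (intro osc0_le) (auto simp: L1_def)
    then have "wZ w * osc0 (L1 i h) (Z w) \<le> 0" using wt_nonneg[OF w] by (simp add: mult_nonneg_nonpos)
    moreover have "0 \<le> (if ct then 2 * A * \<kappa> ^ n else 0)" using kn by simp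
    ultimately show ?thesis using nn by linarith
  next
    case ne: False
    show ?thesis
    proof (cases "Z w \<subseteq> T ` J i")
      case False
      then have c: "ct" using ne by (simp add: ct_def)
      have "A * \<kappa> \<le> A * 1" using kappa A by (intro mult_left_mono) auto
      then have "bm A (L1 i h)" using bm_mono[OF L1_bm[OF i h]] by simp
      then have "wZ w * osc0 (L1 i h) (Z w) \<le> \<kappa> ^ n * (2 * A)"
        using wt_le[OF w] wt_nonneg[OF w] osc0_Z_le[OF _ w] osc0_Z_nonneg[OF _ w] kappa
        by (intro mult_mono) auto
      also have "\<dots> = (if ct then 2 * A * \<kappa> ^ n else 0)" using c by simp
      finally show ?thesis using nn by linarith
    next
      case True
      define og oh s m where "og = osc0 g (Z (i # w))" and "oh = osc0 h (Z (i # w))"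
        and "s = sg {0..1} (i # w)" and "m = s - og"
      have u: "dl {0..1} (i # w) = og" using True by (simp add: dl_def uncut_def og_def Diff_eq_empty_iff[THEN iffD2])
      have m: "0 \<le> m" "\<And>y. y \<in> Z (i # w) \<Longrightarrow> m \<le> g y" "\<And>y. y \<in> Z (i # w) \<Longrightarrow> g y \<le> m + og"
        using dl_bounds[OF i, of "{0..1}" w] inf_le_g[OF i, of _ "{0..1}" w] sg_ge[OF i, of _ "{0..1}" w] u
        by (auto simp: m_def s_def)
      have og: "0 \<le> og" using osc_nonneg[OF i] by (simp add: og_def)
      have oh: "0 \<le> oh" "oh \<le> 2 * A" using osc0_Z_nonneg[OF h iw] osc0_Z_le[OF h iw] by (auto simp: oh_def)
      have lift: "\<exists>y\<in>Z (i # w). x = T y" if "x \<in> Z w" for x using that True by auto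
      \<comment> \<open>The product rule yields \<open>oh * (m + og) + A * og\<close>; bounding
        \<open>oh\<close> by \<open>2 * A\<close> in front of \<open>og\<close> explains the
        3.\<close>
      have "osc0 (L1 i h) (Z w) \<le> oh * m + 3 * A * og"
      proof (rule osc0_le)
        show "0 \<le> oh * m + 3 * A * og" using oh m og A by simp
        fix x x' assume "x \<in> Z w" "x' \<in> Z w"
        then obtain y y' where y: "y \<in> Z (i # w)" "x = T y" "y' \<in> Z (i # w)" "x' = T y'" using lift by meson
        then have J: "y \<in> J i" "y' \<in> J i" by auto
        have "L1 i h x - L1 i h x' = (h y - h y') * g y + h y' * (g y - g y')"
          using y J by (simp add: L1_T[OF i] algebra_simps)
        then have "\<bar>L1 i h x - L1 i h x'\<bar> \<le> \<bar>h y - h y'\<bar> * \<bar>g y\<bar> + \<bar>h y'\<bar> * \<bar>g y - g y'\<bar>"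
          by (metis abs_mult abs_triangle_ineq)
        also have "\<dots> \<le> oh * (m + og) + A * og"
          using osc0_Z_ge[OF h iw y(1,3)] osc_g_ge[OF i y(1,3)] m(3)[OF y(1)] g_pos[OF i J(1)] bm_Z[OF h iw y(3)] oh A
          by (intro add_mono mult_mono) (auto simp: oh_def og_def)
        also have "\<dots> \<le> oh * m + 3 * A * og" using mult_right_mono[OF oh(2) og] by (simp add: algebra_simps)
        finally show "\<bar>L1 i h x - L1 i h x'\<bar> \<le> oh * m + 3 * A * og" .
      qed
      then have "wZ w * osc0 (L1 i h) (Z w) \<le> wZ w * (oh * m + 3 * A * og)"
        using wt_nonneg[OF w] by (rule mult_left_mono)
      also have "\<dots> = oh * (m * wZ w) + 3 * A * (og * wZ w)" by (simp add: algebra_simps)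
      finally have *: "wZ w * osc0 (L1 i h) (Z w) \<le> oh * (m * wZ w) + 3 * A * (og * wZ w)" .
      \<comment> \<open>Prefixing a letter multiplies \<open>gn\<close> by a value of
        \<open>g\<close> that is at least \<open>m\<close>.\<close>
      have "m * wZ w \<le> wZ (i # w)"
      proof (cases "m = 0")
        case True then show ?thesis using wt_nonneg[OF iw] by simp
      next
        case False
        then have mp: "0 < m" using m by simp
        have "wZ w \<le> wZ (i # w) / m"
          unfolding wt_def[of _ w] length_W[OF w]
        proof (rule sup0_le)
          show "0 \<le> wZ (i # w) / m" using wt_nonneg[OF iw] mp by simp
          fix x assume x: "x \<in> Z w"
          then obtain y where y: "y \<in> Z (i # w)" "x = T y" using lift by blast
          have "m * gn n x \<le> g y * gn n x" using m(2)[OF y(1)] gn_pos[OF w x] by (intro mult_right_mono) auto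
          also have "\<dots> \<le> wZ (i # w)" using wt_ge[OF iw y(1)] y by (simp add: gn_Suc)
          finally show "gn n x \<le> wZ (i # w) / m" using mp by (simp add: field_simps)
        qed
        then show ?thesis using mp by (simp add: field_simps)
      qed
      then have "oh * (m * wZ w) \<le> wZ (i # w) * oh" using oh(1) by (metis mult.commute mult_left_mono)
      moreover have "0 \<le> (if ct then 2 * A * \<kappa> ^ n else 0)" using kn by simp
      ultimately show ?thesis using * unfolding oh_def og_def by linarith
    qed
  qed
qed

text \<open>The oscillation of \<open>P h\<close> over cells of depth \<open>n\<close> is that of
  \<open>h\<close> over cells of depth \<open>n + 1\<close>, up to errors controlled by the sup
  bound; the extra depth yields the factor \<open>r\<close>.\<close>

lemma P_ov: assumes h: "sp A B h" shows "ov (P h) n \<le> (r * B + C1 * A) * r ^ n"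
proof -
  have b: "bm A h" using h by (rule sp_bm)
  have A: "0 \<le> A" by (rule bm_nonneg[OF b])
  define ct where "ct = (\<lambda>i w. Z w \<inter> T ` J i \<noteq> {} \<and> \<not> Z w \<subseteq> T ` J i)"
  have "ov (P h) n \<le> (\<Sum>w\<in>W n. wZ w * (\<Sum>i<N. osc0 (L1 i h) (Z w)))"
    unfolding ov_def P_def[abs_def] using bm_Z[OF L1_bm[OF _ b]]
    by (intro sum_mono mult_left_mono osc0_sum[where A = "A * \<kappa>"] wt_nonneg) auto
  also have "\<dots> = (\<Sum>i<N. \<Sum>w\<in>W n. wZ w * osc0 (L1 i h) (Z w))"
    unfolding sum_distrib_left by (rule sum.swap)
  also have "\<dots> \<le> (\<Sum>i<N. \<Sum>w\<in>W n. wZ (i # w) * osc0 h (Z (i # w)) + 3 * A * (osc0 g (Z (i # w)) * wZ w)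
     + (if ct i w then 2 * A * \<kappa> ^ n else 0))"
    using branch_osc[OF b] unfolding ct_def by (intro sum_mono) (simp only: lessThan_iff)
  also have "\<dots> = ov h (Suc n) + 3 * A * (\<Sum>i<N. \<Sum>w\<in>W n. osc0 g (Z (i # w)) * wZ w)
     + (\<Sum>i<N. \<Sum>w\<in>W n. if ct i w then 2 * A * \<kappa> ^ n else 0)"
    by (simp only: sum.distrib ov_def sum_W_Suc sum_distrib_left)
  also have "ov h (Suc n) \<le> B * r ^ Suc n" using h unfolding sp_def by blast
  also have "3 * A * (\<Sum>i<N. \<Sum>w\<in>W n. osc0 g (Z (i # w)) * wZ w) \<le> 3 * A * ((real N * K + V) * r ^ n)"
  proof (rule mult_left_mono)
    have "(\<Sum>i<N. \<Sum>w\<in>W n. osc0 g (Z (i # w)) * wZ w) \<le> r ^ Suc n * (real N * wsum {0..1} n + V)"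
      using wt_nonneg wt_le by (intro threshold_sum) auto
    also have "\<dots> \<le> r ^ n * (real N * K + V)"
      using K(2) V_nonneg wsum_nonneg r_bounds by (intro mult_mono add_mono mult_left_mono) (auto simp: mult_left_le_one_le)
    finally show "(\<Sum>i<N. \<Sum>w\<in>W n. osc0 g (Z (i # w)) * wZ w) \<le> (real N * K + V) * r ^ n"
      by (simp add: mult.commute)
  qed (use A in simp)
  also have "(\<Sum>i<N. \<Sum>w\<in>W n. if ct i w then 2 * A * \<kappa> ^ n else 0) \<le> (\<Sum>i<N. 4 * A * r ^ n)"
  proof (intro sum_mono)
    fix i assume i: "i \<in> {..<N}"
    have "(\<Sum>w\<in>W n. if ct i w then 2 * A * \<kappa> ^ n else 0) = real (card {w \<in> W n. ct i w}) * (2 * A * \<kappa> ^ n)"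
      by (subst sum.inter_filter[symmetric]) auto
    also have "\<dots> \<le> 2 * (2 * A * r ^ n)"
      using cut_count[of i "{0..1}" n] i kappa r_bounds A unfolding ct_def
      by (intro mult_mono mult_left_mono power_mono) auto
    finally show "(\<Sum>w\<in>W n. if ct i w then 2 * A * \<kappa> ^ n else 0) \<le> 4 * A * r ^ n" by simp
  qed
  finally show ?thesis by (simp add: C1_def algebra_simps)
qed

text \<open>The fixed point of the recursion that sends \<open>B\<close> to
  \<open>r * B + C1 * K\<close>.\<close>

definition C2 :: real where "C2 = C1 * K / (1 - r)"

lemma C2_nonneg: "0 \<le> C2" and C2_eq: "r * C2 + C1 * K = C2"
  using C1_nonneg K(1) r_bounds by (auto simp: C2_def field_simps)

text \<open>The sup bound \<open>K * A\<close> holds at all times, so the errors of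
  \<open>P_ov\<close> form a geometric series bounded by \<open>C2 * A\<close>.\<close>

lemma Pn_sp: assumes h: "sp A B h" shows "sp (K * A) (B * r ^ n + C2 * A) ((P ^^ n) h)"
proof (induction n)
  case 0
  have "0 \<le> A" using bm_nonneg sp_bm[OF h] by blast
  then have "A \<le> K * A" "0 \<le> C2 * A" using K(1) C2_nonneg by (auto simp: mult_le_cancel_right1)
  then show ?case using sp_mono[OF h] by simp
next
  case (Suc n)
  have A: "0 \<le> A" "0 \<le> B" using bm_nonneg sp_bm[OF h] h by (auto simp: sp_def)
  have "sp (K * A) (r * (B * r ^ n + C2 * A) + C1 * (K * A)) (P ((P ^^ n) h))"
    unfolding sp_def
  proof (intro conjI allI)
    show "bm (K * A) (P ((P ^^ n) h))" using Pn_bm[OF sp_bm[OF h], of "Suc n"] by simp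
    show "0 \<le> r * (B * r ^ n + C2 * A) + C1 * (K * A)" using A C1_nonneg C2_nonneg K(1) r_bounds by auto
    show "ov (P ((P ^^ n) h)) k \<le> (r * (B * r ^ n + C2 * A) + C1 * (K * A)) * r ^ k" for k
      by (rule P_ov[OF Suc])
  qed
  moreover have "r * (B * r ^ n + C2 * A) + C1 * (K * A) = B * r ^ Suc n + C2 * A"
    using C2_eq by (simp add: algebra_simps) (metis distrib_left mult.assoc mult.commute)
  ultimately show ?case by simp
qed

definition C3 :: real where "C3 = K + 2 * C2 + 1"

text \<open>After \<open>k\<close> steps the sup bound is \<open>M * r ^ k\<close> plus an L1 term,
  but the oscillation constant still contains \<open>C2 * M\<close>, which does not shrink. Another
  \<open>k\<close> steps contract this constant by \<open>r ^ k\<close>, and the new errors are fed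
  by the improved sup bound only.\<close>

lemma lasota_yorke:
  fixes k :: nat
  assumes h: "sp M M h"
  defines "X \<equiv> C3 * r ^ k * M + (K + C2) * Ck k * nrm1 h"
  shows "sp X X ((P ^^ (k + k)) h)"
proof -
  have M: "0 \<le> M" using h by (auto simp: sp_def)
  define A1 where "A1 = M * r ^ k + Ck k * nrm1 h"
  have A1: "0 \<le> A1" using M Ck_nonneg nrm1_nonneg r_bounds by (simp add: A1_def)
  have "sp A1 ((1 + C2) * M) ((P ^^ k) h)"
  proof -
    have s: "sp (K * M) (M * r ^ k + C2 * M) ((P ^^ k) h)" by (rule Pn_sp[OF h])
    have "bm A1 ((P ^^ k) h)" using Pk_sup[OF h, of _ k] s by (auto simp: bm_def sp_def A1_def)
    moreover have "M * r ^ k + C2 * M \<le> (1 + C2) * M"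
      using mult_left_mono[OF power_le_one[of r k] M] r_bounds by (simp add: algebra_simps)
    then have "sp (K * M) ((1 + C2) * M) ((P ^^ k) h)" using s by (rule_tac sp_mono) auto
    ultimately show ?thesis by (auto simp: sp_def)
  qed
  from Pn_sp[OF this, of k]
  have "sp (K * A1) ((1 + C2) * M * r ^ k + C2 * A1) ((P ^^ (k + k)) h)" by (simp add: funpow_add)
  moreover have "X = (K + C2) * A1 + (1 + C2) * M * r ^ k" by (simp add: X_def A1_def C3_def algebra_simps)
  moreover have "0 \<le> (1 + C2) * M * r ^ k" "0 \<le> C2 * A1" "0 \<le> K * A1"
    using M A1 C2_nonneg K(1) r_bounds by auto
  ultimately show ?thesis by (rule_tac sp_mono) (auto simp: algebra_simps)
qed

text \<open>On a cell \<open>h\<close> differs from its mean by at most its oscillation, and the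
  length of the cell is at most its weight, so the total error is \<open>ov h j\<close>. Thus
  finitely many cell integrals control the L1 norm, uniformly over the class: this is the
  compactness used for mixing.\<close>

lemma cells_L1:
  assumes h: "sp A B h"
  shows "nrm1 h \<le> (\<Sum>w\<in>W j. \<bar>\<integral>x. indicator (Z w) x * h x \<partial>LB\<bar>) + B * r ^ j"
proof -
  have b: "bm A h" using h by (rule sp_bm)
  have "nrm1 h = (\<Sum>w\<in>W j. \<integral>x. indicator (Z w) x * \<bar>h x\<bar> \<partial>LB)"
    unfolding nrm1_def by (rule sum_cells[OF bm_abs[OF b], symmetric])
  also have "\<dots> \<le> (\<Sum>w\<in>W j. \<bar>\<integral>x. indicator (Z w) x * h x \<partial>LB\<bar> + wZ w * osc0 h (Z w))"
  proof (rule sum_mono)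
    fix w assume w: "w \<in> W j"
    let ?o = "osc0 h (Z w)" and ?m = "measure LB (Z w)" and ?I = "\<integral>x. indicator (Z w) x * h x \<partial>LB"
    have iZ: "bm 1 (indicator (Z w))" by (rule bm_indicator[OF Z_sets[OF w]])
    have int1: "(\<integral>x. a * indicator (Z w) x \<partial>LB) = a * ?m" for a
      using Z_sub[OF w] by (simp add: Int_absorb2)
    have o: "0 \<le> ?o" by (rule osc0_Z_nonneg[OF b w])
    show "(\<integral>x. indicator (Z w) x * \<bar>h x\<bar> \<partial>LB) \<le> \<bar>?I\<bar> + wZ w * ?o"
    proof (cases "Z w = {}")
      case True then show ?thesis using wt_nonneg[OF w] o by simp
    next
      case False
      have m: "0 < ?m" by (rule Z_measure_pos[OF w False])
      define av where "av = ?I / ?m"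
      have avb: "\<bar>h y - av\<bar> \<le> ?o" if y: "y \<in> Z w" for y
      proof -
        have "(h y - ?o) * ?m \<le> ?I"
          unfolding int1[symmetric]
          by (rule integral_le_bm[OF bm_cmult[OF iZ] bm_mult[OF iZ b]]) (use osc0_Z_ge[OF b w y] in \<open>auto simp: indicator_def abs_le_iff\<close>, smt (verit))
        moreover have "?I \<le> (h y + ?o) * ?m"
          unfolding int1[symmetric]
          by (rule integral_le_bm[OF bm_mult[OF iZ b] bm_cmult[OF iZ]]) (use osc0_Z_ge[OF b w y] in \<open>auto simp: indicator_def abs_le_iff\<close>, smt (verit))
        ultimately show ?thesis using m by (simp add: av_def abs_le_iff field_simps)
      qed
      have "(\<integral>x. indicator (Z w) x * \<bar>h x\<bar> \<partial>LB) \<le> (\<bar>av\<bar> + ?o) * ?m"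
        unfolding int1[symmetric]
      proof (rule integral_le_bm[OF bm_mult[OF iZ bm_abs[OF b]] bm_cmult[OF iZ]])
        fix x show "indicator (Z w) x * \<bar>h x\<bar> \<le> (\<bar>av\<bar> + ?o) * indicator (Z w) x"
          using avb[of x] by (auto simp: indicator_def)
      qed
      also have "\<dots> = \<bar>?I\<bar> + ?o * ?m" using m by (simp add: av_def abs_divide field_simps)
      also have "\<dots> \<le> \<bar>?I\<bar> + wZ w * ?o"
        using mult_left_mono[OF measure_Z_le[OF w] o] by (simp add: mult.commute[of "wZ w"])
      finally show ?thesis .
    qed
  qed
  also have "\<dots> = (\<Sum>w\<in>W j. \<bar>\<integral>x. indicator (Z w) x * h x \<partial>LB\<bar>) + ov h j"
    by (simp add: sum.distrib ov_def)
  also have "ov h j \<le> B * r ^ j" using h by (simp add: sp_def)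
  finally show ?thesis by simp
qed

text \<open>Sampling \<open>h\<close> at one point of each nonempty cell costs its oscillation
  there, weighed by the length of the cell.\<close>

lemma step_approx:
  assumes h: "sp A B h"
  obtains a where "\<And>w. w \<in> W j \<Longrightarrow> \<bar>a w\<bar> \<le> A" "nrm1 (\<lambda>x. h x - (\<Sum>w\<in>W j. a w * indicator (Z w) x)) \<le> B * r ^ j"
proof -
  have b: "bm A h" using h by (rule sp_bm)
  define a where "a = (\<lambda>w. if Z w = {} then 0 else h (SOME z. z \<in> Z w))"
  have pick: "(SOME z. z \<in> Z w) \<in> Z w" if "Z w \<noteq> {}" for w using that some_in_eq by blast
  have a: "\<bar>a w\<bar> \<le> A" if "w \<in> W j" for w
    using bm_Z[OF b that pick[of w]] bm_nonneg[OF b] by (auto simp: a_def)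
  have ad: "\<bar>h x - a w\<bar> \<le> osc0 h (Z w)" if "w \<in> W j" "x \<in> Z w" for w x
    using osc0_Z_ge[OF b that pick[of w]] that by (auto simp: a_def)
  let ?s = "\<lambda>x. \<Sum>w\<in>W j. a w * indicator (Z w) x"
  have sv: "?s x = a w" if "w \<in> W j" "x \<in> Z w" for w x
  proof -
    have "?s x = (\<Sum>v\<in>W j. if v = w then a w else 0)"
    proof (rule sum.cong[OF refl])
      fix v assume "v \<in> W j"
      then show "a v * indicator (Z v) x = (if v = w then a w else 0)"
      proof (cases "v = w")
        case False
        then have "x \<notin> Z v" using cyl_disjoint[OF that(1) \<open>v \<in> W j\<close> that(2)] by blast
        then show ?thesis using False by simp
      qed (use that in simp)
    qed
    then show ?thesis using that by simp
  qed
  have "bm (\<Sum>w\<in>W j. \<bar>a w\<bar> * 1) ?s" by (intro bm_sum bm_cmult bm_indicator Z_sets)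
  then have d: "bm (A + (\<Sum>w\<in>W j. \<bar>a w\<bar> * 1)) (\<lambda>x. h x - ?s x)" by (rule bm_diff[OF b])
  have "nrm1 (\<lambda>x. h x - ?s x) = (\<Sum>w\<in>W j. \<integral>x. indicator (Z w) x * \<bar>h x - ?s x\<bar> \<partial>LB)"
    unfolding nrm1_def by (rule sum_cells[OF bm_abs[OF d], symmetric])
  also have "\<dots> \<le> (\<Sum>w\<in>W j. wZ w * osc0 h (Z w))"
  proof (rule sum_mono)
    fix w assume w: "w \<in> W j"
    have iZ: "bm 1 (indicator (Z w))" by (rule bm_indicator[OF Z_sets[OF w]])
    have "(\<integral>x. indicator (Z w) x * \<bar>h x - ?s x\<bar> \<partial>LB) \<le> (\<integral>x. osc0 h (Z w) * indicator (Z w) x \<partial>LB)"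
    proof (rule integral_le_bm[OF bm_mult[OF iZ bm_abs[OF d]] bm_cmult[OF iZ]])
      fix x show "indicator (Z w) x * \<bar>h x - ?s x\<bar> \<le> osc0 h (Z w) * indicator (Z w) x"
        using ad[OF w] sv[OF w] by (cases "x \<in> Z w") auto
    qed
    also have "\<dots> = osc0 h (Z w) * measure LB (Z w)" using Z_sub[OF w] by (simp add: Int_absorb2)
    also have "\<dots> \<le> wZ w * osc0 h (Z w)"
      using mult_left_mono[OF measure_Z_le[OF w] osc0_Z_nonneg[OF b w]] by (simp add: mult.commute[of "wZ w"])
    finally show "(\<integral>x. indicator (Z w) x * \<bar>h x - ?s x\<bar> \<partial>LB) \<le> wZ w * osc0 h (Z w)" .
  qed
  also have "\<dots> \<le> B * r ^ j" using h by (simp add: sp_def ov_def)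
  finally show ?thesis using that a by blast
qed

lemma cyl_take: "x \<in> Z v \<Longrightarrow> x \<in> Z (take k v)" if "v \<in> W n"
proof -
  assume x: "x \<in> Z v"
  have "x \<in> cyl (Z (drop k v)) (take k v)" using x by (simp add: cyl_append[symmetric])
  then show "x \<in> Z (take k v)" using cyl_mono[OF Z_sub[OF drop_W[OF that]]] by blast
qed

text \<open>Only the one cylinder of depth \<open>n\<close> that contains \<open>x\<close> sees the
  jump, and its weight is at most \<open>r ^ n\<close>. These indicators generate the Borel sets,
  which yields density of the class in L1.\<close>

lemma sp_indicator_Icc: "sp 1 1 (indicator ({0..1} \<inter> {..x}))"
  unfolding sp_def
proof (intro conjI allI)
  show b: "bm 1 (indicator ({0..1} \<inter> {..x}))" by (intro bm_indicator in_sets_LB) auto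
  fix n
  have c1: "card {v \<in> W n. x \<in> Z v} \<le> 1"
    using cyl_disjoint[of _ n _ x "{0..1}" "{0..1}"]
    by (intro card_le_Suc0_iff_eq[THEN iffD2, unfolded One_nat_def[symmetric]]) auto
  have "ov (indicator ({0..1} \<inter> {..x})) n \<le> (\<Sum>v\<in>W n. if x \<in> Z v then r ^ n else 0)"
    unfolding ov_def
  proof (rule sum_mono)
    fix v assume v: "v \<in> W n"
    show "wZ v * osc0 (indicator ({0..1} \<inter> {..x})) (Z v) \<le> (if x \<in> Z v then r ^ n else 0)"
    proof (cases "x \<in> Z v")
      case True
      have "osc0 (indicator ({0..1} \<inter> {..x}) :: real \<Rightarrow> real) (Z v) \<le> 1"
        by (rule osc0_le) (auto simp: indicator_def)
      moreover have "wZ v \<le> r ^ n"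
        using wt_le[OF v, of "{0..1}"] power_mono[of \<kappa> r n] r_bounds kappa by linarith
      ultimately have "wZ v * osc0 (indicator ({0..1} \<inter> {..x})) (Z v) \<le> r ^ n * 1"
        using osc0_Z_nonneg[OF b v] r_bounds by (intro mult_mono) auto
      then show ?thesis using True by simp
    next
      case False
      have ivl: "is_interval (Z v)" using Z_convex[OF v] is_interval_convex_1 by blast
      have "osc0 (indicator ({0..1} \<inter> {..x}) :: real \<Rightarrow> real) (Z v) \<le> 0"
      proof (rule osc0_le)
        fix a b assume ab: "a \<in> Z v" "b \<in> Z v"
        have "a \<le> x \<longleftrightarrow> b \<le> x"
          using False ab ivl unfolding is_interval_1 by (metis linear)
        then show "\<bar>indicator ({0..1} \<inter> {..x}) a - indicator ({0..1} \<inter> {..x}) b\<bar> \<le> (0::real)"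
          using ab Z_sub[OF v] by (auto simp: indicator_def)
      qed simp
      then show ?thesis using False wt_nonneg[OF v] by (simp add: mult_nonneg_nonpos)
    qed
  qed
  also have "\<dots> = real (card {v \<in> W n. x \<in> Z v}) * r ^ n"
    by (subst sum.inter_filter[symmetric]) auto
  also have "\<dots> \<le> 1 * r ^ n" using c1 r_bounds by (intro mult_right_mono) auto
  finally show "ov (indicator ({0..1} \<inter> {..x})) n \<le> 1 * r ^ n" .
qed simp

end

subsection \<open>Mixing\<close>

text \<open>A bounded sequence of finitely additive set functions that are uniformly dominated by a finite
  measure has a cluster point in the product topology (Tychonoff), and domination makes it
  countably additive.\<close>

lemma cluster_measure:
  fixes a :: "nat \<Rightarrow> 'a set \<Rightarrow> real" and M :: "'a measure"
  assumes fin: "finite_measure M" and c0: "0 \<le> c"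
    and bnd: "\<And>n A. A \<in> sets M \<Longrightarrow> 0 \<le> a n A \<and> a n A \<le> c * measure M A"
    and add: "\<And>n A B. A \<in> sets M \<Longrightarrow> B \<in> sets M \<Longrightarrow> A \<inter> B = {} \<Longrightarrow> a n (A \<union> B) = a n A + a n B"
  shows "\<exists>\<eta> F. F \<noteq> bot \<and> F \<le> sequentially \<and> sets \<eta> = sets M \<and> finite_measure \<eta> \<and>
    (\<forall>A\<in>sets M. ((\<lambda>n. a n A) \<longlongrightarrow> measure \<eta> A) F \<and> measure \<eta> A \<le> c * measure M A)"
proof -
  interpret M: finite_measure M by fact
  \<comment> \<open>Extended by 0 to nonmeasurable sets, the set functions become points of a
    product of compact intervals over all sets.\<close>
  define s where "s = (\<lambda>n A. if A \<in> sets M then a n A else 0)"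
  define U where "U = (UNIV :: 'a set set) \<rightarrow>\<^sub>E {0..c * measure M (space M)}"
  have "compactin (product_topology (\<lambda>_. euclidean) UNIV) U"
    unfolding U_def by (subst compactin_PiE) auto
  then have "compact U" by (simp add: euclidean_product_topology)
  moreover have "s n \<in> U" for n
  proof -
    have "a n A \<le> c * measure M (space M)" if "A \<in> sets M" for A
      using bnd[OF that, of n] mult_left_mono[OF M.bounded_measure[of A] c0] by linarith
    then show ?thesis using bnd c0 by (auto simp: U_def s_def)
  qed
  ultimately obtain h where h: "inf (nhds h) (filtermap s sequentially) \<noteq> bot"
    unfolding compact_filter by (metis (no_types, lifting) always_eventually eventually_filtermap filtermap_bot_iff sequentially_bot)
  \<comment> \<open>A cluster point in this product need not be the limit of a subsequence, so
    convergence is expressed along the filter of indices at which \<open>s\<close> is close to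
    \<open>h\<close>.\<close>
  define F where "F = inf (filtercomap s (nhds h)) sequentially"
  have F: "F \<noteq> bot" "F \<le> sequentially"
  proof
    assume "F = bot"
    then have "eventually (\<lambda>_. False) F" by simp
    then obtain P Q where "eventually P (filtercomap s (nhds h))" "eventually Q sequentially" "\<And>x. P x \<Longrightarrow> Q x \<Longrightarrow> False"
      unfolding F_def eventually_inf by blast
    then obtain P' where P': "eventually P' (nhds h)" "\<And>x. P' (s x) \<Longrightarrow> Q x \<Longrightarrow> False"
      unfolding eventually_filtercomap by metis
    have "eventually (\<lambda>f. \<exists>n. f = s n \<and> Q n) (filtermap s sequentially)"
      unfolding eventually_filtermap using \<open>eventually Q sequentially\<close> by (rule eventually_mono) auto
    then have "eventually (\<lambda>_. False) (inf (nhds h) (filtermap s sequentially))"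
      unfolding eventually_inf using P' by blast
    then show False using h by (simp add: trivial_limit_def)
  qed (simp add: F_def)
  have conv: "((\<lambda>n. a n A) \<longlongrightarrow> h A) F" if A: "A \<in> sets M" for A
  proof -
    have "((\<lambda>f. f A) \<longlongrightarrow> h A) (nhds h)"
    proof -
      have c: "continuous_on UNIV (\<lambda>f. f A :: real)" by (rule continuous_on_product_coordinates)
      show ?thesis
      proof (rule topological_tendstoI)
        fix S assume "open S" "h A \<in> S"
        then have "open ((\<lambda>f. f A) -` S)" "h \<in> (\<lambda>f. f A) -` S" using open_vimage[OF _ c] by auto
        then show "eventually (\<lambda>f. f A \<in> S) (nhds h)" unfolding eventually_nhds by blast
      qed
    qed
    then have "((\<lambda>n. s n A) \<longlongrightarrow> h A) (filtercomap s (nhds h))"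
      by (rule filterlim_compose[OF _ filterlim_filtercomap])
    then have "((\<lambda>n. s n A) \<longlongrightarrow> h A) F" by (rule filterlim_mono) (auto simp: F_def)
    then show ?thesis using A by (simp add: s_def)
  qed
  have h_bnd: "0 \<le> h A" "h A \<le> c * measure M A" if A: "A \<in> sets M" for A
    using tendsto_lowerbound[OF conv[OF A] _ F(1), of 0] tendsto_upperbound[OF conv[OF A] _ F(1), of "c * measure M A"] bnd[OF A]
    by auto
  have h_add: "h (A \<union> B) = h A + h B" if A: "A \<in> sets M" and B: "B \<in> sets M" and d: "A \<inter> B = {}" for A B
  proof (rule tendsto_unique[OF F(1)])
    show "((\<lambda>n. a n (A \<union> B)) \<longlongrightarrow> h (A \<union> B)) F" using A B by (intro conv) auto
    show "((\<lambda>n. a n (A \<union> B)) \<longlongrightarrow> h A + h B) F"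
      unfolding add[OF A B d] by (intro tendsto_add conv A B)
  qed
  define \<eta> where "\<eta> = measure_of (space M) (sets M) (\<lambda>A. ennreal (h A))"
  have h0: "h {} = 0" using h_bnd[of "{}"] by simp
  have pos: "positive (sets M) (\<lambda>A. ennreal (h A))" by (simp add: positive_def h0)
  have cad: "countably_additive (sets M) (\<lambda>A. ennreal (h A))"
  proof (rule sets.empty_continuous_imp_countably_additive[OF pos])
    show "additive (sets M) (\<lambda>A. ennreal (h A))"
      unfolding additive_def using h_add h_bnd by (auto simp: ennreal_plus[symmetric] simp del: ennreal_plus)
    show "\<forall>A\<in>sets M. ennreal (h A) \<noteq> \<infinity>" by simp
    fix A :: "nat \<Rightarrow> 'a set" assume A: "range A \<subseteq> sets M" "decseq A" "(\<Inter>i. A i) = {}"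
    have "(\<lambda>i. c * measure M (A i)) \<longlonglongrightarrow> c * measure M (\<Inter>i. A i)"
      by (intro tendsto_mult tendsto_const M.finite_Lim_measure_decseq A)
    then have lim: "(\<lambda>i. c * measure M (A i)) \<longlonglongrightarrow> 0" using A by simp
    have "(\<lambda>i. h (A i)) \<longlonglongrightarrow> 0"
      by (rule tendsto_sandwich[OF _ _ tendsto_const lim]) (use h_bnd A in auto)
    then show "(\<lambda>i. ennreal (h (A i))) \<longlonglongrightarrow> 0" by (metis ennreal_0 tendsto_ennrealI)
  qed
  have em: "emeasure \<eta> A = ennreal (h A)" if "A \<in> sets M" for A
    unfolding \<eta>_def using that by (intro emeasure_measure_of_sigma pos cad sets.sigma_algebra_axioms)
  have sets: "sets \<eta> = sets M" by (simp add: \<eta>_def sets.sigma_sets_eq)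
  have "measure \<eta> A = h A" if "A \<in> sets M" for A using em[OF that] h_bnd[OF that] by (simp add: measure_def)
  moreover have "finite_measure \<eta>"
    using em[of "space M"] by (intro finite_measureI) (simp add: \<eta>_def)
  ultimately show ?thesis using F sets conv h_bnd by (intro exI[of _ \<eta>] exI[of _ F]) auto
qed

context pw_expanding
begin

lemma int_abs_triangle:
  fixes f h k :: "real \<Rightarrow> real"
  assumes "integrable LB f" "integrable LB h" "integrable LB k"
  shows "(\<integral>x. \<bar>f x - k x\<bar> \<partial>LB) \<le> (\<integral>x. \<bar>f x - h x\<bar> \<partial>LB) + (\<integral>x. \<bar>h x - k x\<bar> \<partial>LB)"
proof -
  have "(\<integral>x. \<bar>f x - k x\<bar> \<partial>LB) \<le> (\<integral>x. \<bar>f x - h x\<bar> + \<bar>h x - k x\<bar> \<partial>LB)"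
    using assms by (intro integral_mono) auto
  then show ?thesis using assms by simp
qed

text \<open>The L1-closure of the class, which turns out to be all of L1.\<close>

definition approx :: "(real \<Rightarrow> real) \<Rightarrow> bool" where
  "approx f \<longleftrightarrow> integrable LB f \<and> (\<forall>e>0. \<exists>A B h. sp A B h \<and> (\<integral>x. \<bar>f x - h x\<bar> \<partial>LB) \<le> e)"

lemma sp_integrable: "sp A B h \<Longrightarrow> integrable LB h"
  by (rule bm_integrable[OF sp_bm])

lemma approx_add: assumes "approx f" "approx k" shows "approx (\<lambda>x. f x + k x)"
  unfolding approx_def
proof (intro conjI allI impI)
  have i: "integrable LB f" "integrable LB k" using assms by (auto simp: approx_def)
  then show "integrable LB (\<lambda>x. f x + k x)" by simp
  fix e :: real assume "0 < e"
  then have "0 < e / 2" by simp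
  then obtain A B h A' B' h' where h: "sp A B h" "(\<integral>x. \<bar>f x - h x\<bar> \<partial>LB) \<le> e / 2"
    "sp A' B' h'" "(\<integral>x. \<bar>k x - h' x\<bar> \<partial>LB) \<le> e / 2" using assms unfolding approx_def by blast
  note hi = sp_integrable[OF h(1)] sp_integrable[OF h(3)]
  have "(\<integral>x. \<bar>f x + k x - (h x + h' x)\<bar> \<partial>LB) \<le> (\<integral>x. \<bar>f x - h x\<bar> + \<bar>k x - h' x\<bar> \<partial>LB)"
    using i hi by (intro integral_mono) auto
  also have "\<dots> \<le> e" using h i hi by simp
  finally show "\<exists>A B h. sp A B h \<and> (\<integral>x. \<bar>f x + k x - h x\<bar> \<partial>LB) \<le> e"
    using sp_add[OF h(1,3)] by blast
qed

lemma approx_cmult: assumes "approx f" shows "approx (\<lambda>x. a * f x)"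
  unfolding approx_def
proof (intro conjI allI impI)
  have i: "integrable LB f" using assms by (auto simp: approx_def)
  then show "integrable LB (\<lambda>x. a * f x)" by simp
  fix e :: real assume e: "0 < e"
  then obtain A B h where h: "sp A B h" "(\<integral>x. \<bar>f x - h x\<bar> \<partial>LB) \<le> e / (\<bar>a\<bar> + 1)"
    using assms unfolding approx_def by (meson abs_ge_zero add_nonneg_pos divide_pos_pos zero_less_one)
  have "(\<integral>x. \<bar>a * f x - a * h x\<bar> \<partial>LB) = \<bar>a\<bar> * (\<integral>x. \<bar>f x - h x\<bar> \<partial>LB)"
    by (simp add: right_diff_distrib[symmetric] abs_mult)
  also have "\<dots> \<le> \<bar>a\<bar> * (e / (\<bar>a\<bar> + 1))" using h by (intro mult_left_mono) auto
  also have "\<dots> \<le> e" using e by (simp add: field_simps)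
  finally show "\<exists>A B h. sp A B h \<and> (\<integral>x. \<bar>a * f x - h x\<bar> \<partial>LB) \<le> e"
    using sp_cmult[OF h(1)] by blast
qed

lemma approx_lim:
  assumes f: "integrable LB f" and s: "\<And>i. approx (s i)" and lim: "(\<lambda>i. \<integral>x. \<bar>f x - s i x\<bar> \<partial>LB) \<longlonglongrightarrow> 0"
  shows "approx f"
  unfolding approx_def
proof (intro conjI allI impI f)
  fix e :: real assume e: "0 < e"
  then have "eventually (\<lambda>i. (\<integral>x. \<bar>f x - s i x\<bar> \<partial>LB) < e / 2) sequentially"
    using lim by (intro order_tendstoD(2)) auto
  then obtain i where i: "(\<integral>x. \<bar>f x - s i x\<bar> \<partial>LB) < e / 2" by (meson eventually_sequentially order_refl)
  obtain A B h where h: "sp A B h" "(\<integral>x. \<bar>s i x - h x\<bar> \<partial>LB) \<le> e / 2"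
    using s[of i] e unfolding approx_def by (meson half_gt_zero)
  have "(\<integral>x. \<bar>f x - h x\<bar> \<partial>LB) \<le> e"
    using int_abs_triangle[OF f _ sp_integrable[OF h(1)], of "s i"] s[of i] h i by (auto simp: approx_def)
  then show "\<exists>A B h. sp A B h \<and> (\<integral>x. \<bar>f x - h x\<bar> \<partial>LB) \<le> e" using h by blast
qed

lemma approx_sp: "sp A B h \<Longrightarrow> approx h"
proof -
  assume h: "sp A B h"
  have "(\<integral>x. \<bar>h x - h x\<bar> \<partial>LB) \<le> e" if "0 < e" for e using that by simp
  then show "approx h" unfolding approx_def using sp_integrable[OF h] h by blast
qed

lemma sets_LB_sigma: "sets LB = sigma_sets {0..1} (range (\<lambda>x. {0..1} \<inter> {..x}))"
proof -
  have "sets (borel :: real measure) = sigma_sets UNIV (range atMost)"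
    by (subst borel_eq_atMost, rule sets_measure_of) simp
  then have "sets LB = (\<inter>) {0..1} ` sigma_sets UNIV (range atMost)"
    by (simp add: sets_restrict_space)
  also have "\<dots> = sigma_sets {0..1} ((\<inter>) {0..1} ` range atMost)"
    by (rule sigma_sets_Int) (auto simp: \<open>sets borel = _\<close>[symmetric])
  finally show ?thesis by (simp add: image_image)
qed

lemma indicator_integrable_LB: "A \<in> sets LB \<Longrightarrow> integrable LB (indicator A :: real \<Rightarrow> real)"
  by (rule bm_integrable[OF bm_indicator])

text \<open>The intervals \<open>{0..1} \<inter> {..x}\<close> form an intersection-stable
  generator, and the sets with approximable indicator are closed under complements and countable
  disjoint unions.\<close>

lemma approx_indicator: assumes "A \<in> sets LB" shows "approx (indicator A)"
proof -
  interpret LB: finite_measure LB by (rule finite_measure_LB)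
  have stable: "Int_stable (range (\<lambda>x::real. {0..1} \<inter> {..x}))"
    unfolding Int_stable_def
  proof (intro ballI)
    fix A B assume "A \<in> range (\<lambda>x::real. {0..1} \<inter> {..x})" "B \<in> range (\<lambda>x::real. {0..1} \<inter> {..x})"
    then obtain a b where "A = {0..1} \<inter> {..a}" "B = {0..1} \<inter> {..b}" by auto
    then have "A \<inter> B = {0..1} \<inter> {..min a b}" by auto
    then show "A \<inter> B \<in> range (\<lambda>x::real. {0..1} \<inter> {..x})" by blast
  qed
  have sub: "range (\<lambda>x::real. {0..1} \<inter> {..x}) \<subseteq> Pow {0..1}" by auto
  show ?thesis using stable sub assms unfolding sets_LB_sigma
  proof (induction rule: sigma_sets_induct_disjoint)
    case (basic A)
    then show ?case using approx_sp[OF sp_indicator_Icc] by auto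
  next
    case empty
    have "(indicator {} :: real \<Rightarrow> real) = (\<lambda>_. 0)" by auto
    then show ?case using approx_sp[OF sp_const[of 0]] by simp
  next
    case (compl A)
    have "sp 1 0 (\<lambda>_. 1)" using sp_const[of 1] by simp
    from approx_add[OF approx_sp[OF this] approx_cmult[OF compl(2), of "-1"]]
    have a: "approx (\<lambda>x. 1 + - 1 * indicator A x)" .
    have A: "A \<in> sets LB" using compl(1) by (simp add: sets_LB_sigma)
    show ?case
    proof (rule approx_lim[OF _ a])
      show "integrable LB (indicator ({0..1} - A) :: real \<Rightarrow> real)"
        using sets.compl_sets[OF A] by (intro indicator_integrable_LB) simp
      have "(\<integral>x. \<bar>indicator ({0..1} - A) x - (1 + - 1 * indicator A x)\<bar> \<partial>LB) = (\<integral>x. 0 \<partial>LB :: real)"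
        by (intro Bochner_Integration.integral_cong) (auto simp: indicator_def)
      then show "(\<lambda>i::nat. \<integral>x. \<bar>indicator ({0..1} - A) x - (1 + - 1 * indicator A x)\<bar> \<partial>LB) \<longlonglongrightarrow> (0::real)" by simp
    qed
  next
    case (union A)
    have A: "A i \<in> sets LB" for i using union(2) by (auto simp: sets_LB_sigma)
    define s where "s = (\<lambda>n x. \<Sum>i<n. indicator (A i) x :: real)"
    have s: "approx (s n)" for n
    proof (induction n)
      case 0 then show ?case using approx_sp[OF sp_const[of 0]] by (simp add: s_def)
    next
      case (Suc n) then show ?case using approx_add[OF Suc union(3)[of n]] by (simp add: s_def)
    qed
    have dj: "disjoint_family A" by (rule union(1))
    have sU: "s n x = indicator (\<Union>i<n. A i) x" for n x
      unfolding s_def using dj by (intro indicator_UN_disjoint[symmetric]) (auto simp: disjoint_family_on_def)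
    have UA: "(\<Union>i. A i) \<in> sets LB" using A by auto
    show ?case
    proof (rule approx_lim[OF indicator_integrable_LB[OF UA] s])
      have "(\<integral>x. \<bar>indicator (\<Union>i. A i) x - s n x\<bar> \<partial>LB) = measure LB (\<Union>i. A i) - measure LB (\<Union>i<n. A i)" for n
      proof -
        have UnA: "(\<Union>i<n. A i) \<in> sets LB" using A by auto
        have "(\<integral>x. \<bar>indicator (\<Union>i. A i) x - s n x\<bar> \<partial>LB) = (\<integral>x. indicator (\<Union>i. A i) x - indicator (\<Union>i<n. A i) x \<partial>LB :: real)"
          by (intro Bochner_Integration.integral_cong) (auto simp: sU indicator_def)
        also have "\<dots> = measure LB (\<Union>i. A i) - measure LB (\<Union>i<n. A i)"
          using sets.sets_into_space[OF UA] sets.sets_into_space[OF UnA]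
          by (subst Bochner_Integration.integral_diff) (auto simp: indicator_integrable_LB[OF UA] indicator_integrable_LB[OF UnA] Int_absorb2)
        finally show ?thesis .
      qed
      moreover have "(\<lambda>n. measure LB (\<Union>i<n. A i)) \<longlonglongrightarrow> measure LB (\<Union>n. \<Union>i<n. A i)"
      proof (rule LB.finite_Lim_measure_incseq)
        show "range (\<lambda>n. \<Union>i<n. A i) \<subseteq> sets LB" using A by blast
        show "incseq (\<lambda>n. \<Union>i<n. A i)" by (intro monoI UN_mono) auto
      qed
      moreover have "(\<Union>n. \<Union>i<n. A i) = (\<Union>i. A i)" by auto
      ultimately show "(\<lambda>n. \<integral>x. \<bar>indicator (\<Union>i. A i) x - s n x\<bar> \<partial>LB) \<longlonglongrightarrow> 0"
        using tendsto_diff[OF tendsto_const[of "measure LB (\<Union>i. A i)"], of "\<lambda>n. measure LB (\<Union>i<n. A i)" "measure LB (\<Union>i. A i)"]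
        by simp
    qed
  qed
qed

text \<open>The hypotheses, the factor 2 included, are those of the limit case of
  \<open>integrable_induct\<close>.\<close>

lemma L1_lim:
  fixes f :: "real \<Rightarrow> real"
  assumes s: "\<And>i. integrable M (s i)" "\<And>x. x \<in> space M \<Longrightarrow> (\<lambda>i. s i x) \<longlonglongrightarrow> f x"
    "\<And>i x. x \<in> space M \<Longrightarrow> norm (s i x) \<le> 2 * norm (f x)" and f: "integrable M f"
  shows "(\<lambda>i. \<integral>x. \<bar>f x - s i x\<bar> \<partial>M) \<longlonglongrightarrow> 0"
proof -
  have "(\<lambda>i. \<integral>x. \<bar>f x - s i x\<bar> \<partial>M) \<longlonglongrightarrow> (\<integral>x. 0 \<partial>M)"
  proof (rule integral_dominated_convergence[where w = "\<lambda>x. 3 * \<bar>f x\<bar>"])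
    show "(\<lambda>x. 0) \<in> borel_measurable M" by simp
    show "(\<lambda>x. \<bar>f x - s i x\<bar>) \<in> borel_measurable M" for i using s(1)[of i] f by auto
    show "integrable M (\<lambda>x. 3 * \<bar>f x\<bar>)" using f by simp
    show "AE x in M. (\<lambda>i. \<bar>f x - s i x\<bar>) \<longlonglongrightarrow> 0"
    proof (rule AE_I2)
      fix x assume "x \<in> space M"
      then have "(\<lambda>i. \<bar>f x - s i x\<bar>) \<longlonglongrightarrow> \<bar>f x - f x\<bar>" by (intro tendsto_intros s)
      then show "(\<lambda>i. \<bar>f x - s i x\<bar>) \<longlonglongrightarrow> 0" by simp
    qed
    show "AE x in M. norm \<bar>f x - s i x\<bar> \<le> 3 * \<bar>f x\<bar>" for i
    proof (rule AE_I2)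
      fix x assume "x \<in> space M"
      then show "norm \<bar>f x - s i x\<bar> \<le> 3 * \<bar>f x\<bar>" using s(3)[of x i] by auto
    qed
  qed
  then show ?thesis by simp
qed

lemma approx_integrable: assumes "integrable LB f" shows "approx f"
  using assms
proof (induction rule: integrable_induct)
  case (base A c)
  then show ?case using approx_cmult[OF approx_indicator[OF base(1)], of c] by (simp add: mult.commute)
next
  case (add f h)
  then show ?case by (intro approx_add)
next
  case (lim f s)
  show ?case by (rule approx_lim[OF lim(4) lim(5) L1_lim[OF lim(1-4)]])
qed

end

lemma integrable_mult_bm:
  fixes f k :: "real \<Rightarrow> real"
  assumes M: "sets M = sets LB" and f: "integrable M f" and k: "bm D k"
  shows "integrable M (\<lambda>x. f x * k x)" "\<bar>\<integral>x. f x * k x \<partial>M\<bar> \<le> D * (\<integral>x. \<bar>f x\<bar> \<partial>M)"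
proof -
  have sp: "space M = {0..1}" using sets_eq_imp_space_eq[OF M] by simp
  have km: "k \<in> borel_measurable M" using k measurable_cong_sets[OF M refl] by (auto simp: bm_def)
  have le: "\<bar>f x * k x\<bar> \<le> D * \<bar>f x\<bar>" if "x \<in> {0..1}" for x
  proof -
    have "\<bar>f x\<bar> * \<bar>k x\<bar> \<le> \<bar>f x\<bar> * D" using k that by (intro mult_left_mono) (auto simp: bm_def)
    then show ?thesis by (simp add: abs_mult mult.commute)
  qed
  show i: "integrable M (\<lambda>x. f x * k x)"
  proof (rule Bochner_Integration.integrable_bound[where f = "\<lambda>x. D * \<bar>f x\<bar>"])
    show "integrable M (\<lambda>x. D * \<bar>f x\<bar>)" using f by simp
    show "(\<lambda>x. f x * k x) \<in> borel_measurable M" using f km by auto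
    show "AE x in M. norm (f x * k x) \<le> norm (D * \<bar>f x\<bar>)"
    proof (rule AE_I2)
      fix x assume "x \<in> space M"
      then show "norm (f x * k x) \<le> norm (D * \<bar>f x\<bar>)" using le[of x] sp bm_nonneg[OF k] by simp
    qed
  qed
  have "\<bar>\<integral>x. f x * k x \<partial>M\<bar> \<le> (\<integral>x. \<bar>f x * k x\<bar> \<partial>M)" by (rule integral_abs_bound)
  also have "\<dots> \<le> (\<integral>x. D * \<bar>f x\<bar> \<partial>M)" using i f le sp by (intro Bochner_Integration.integral_mono) auto
  finally show "\<bar>\<integral>x. f x * k x \<partial>M\<bar> \<le> D * (\<integral>x. \<bar>f x\<bar> \<partial>M)" using f by simp
qed

text \<open>A Cesaro limit provides only single small terms. One good time is enough later, because
  the estimate obtained there persists at all later times.\<close>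

lemma small_term:
  fixes d :: "nat \<Rightarrow> real"
  assumes lim: "(\<lambda>n. (\<Sum>i<n. d i) / real n) \<longlonglongrightarrow> 0" and e: "0 < e"
  shows "\<exists>i. d i \<le> e"
proof (rule ccontr)
  assume "\<not> ?thesis"
  then have d: "e \<le> d i" for i by (meson less_imp_le not_le)
  have "e \<le> (\<Sum>i<n. d i) / real n" if "n \<ge> 1" for n
  proof -
    have "real n * e \<le> (\<Sum>i<n. d i)" using sum_mono[of "{..<n}" "\<lambda>_. e" d] d by simp
    then show ?thesis using that by (simp add: field_simps)
  qed
  then have "e \<le> 0" by (intro LIMSEQ_le_const[OF lim] exI[of _ 1]) auto
  then show False using e by simp
qed

locale pw_mixing = pw_expanding +
  fixes \<nu> :: "real measure"
  assumes acip: "ac_invariant_prob T \<nu>"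
    and acip_unique: "\<And>\<nu>'. ac_invariant_prob T \<nu>' \<Longrightarrow> \<nu>' = \<nu>"
    and mixing: "weakly_mixing T \<nu>"
begin

lemma nu_prob: "prob_space \<nu>" and sets_nu: "sets \<nu> = sets LB" and nu_T: "T \<in> \<nu> \<rightarrow>\<^sub>M \<nu>"
  and nu_inv: "distr \<nu> \<nu> T = \<nu>" and nu_ac: "absolutely_continuous LB \<nu>"
  using acip sets_LB by (auto simp: ac_invariant_prob_def invariant_prob_def)

lemma space_nu [simp]: "space \<nu> = {0..1}"
  using sets_eq_imp_space_eq[OF sets_nu] by simp

lemma meas_nu: "f \<in> borel_measurable \<nu> \<longleftrightarrow> f \<in> borel_measurable LB"
  by (simp add: measurable_cong_sets[OF sets_nu refl])

lemma nu_integrable: "bm A f \<Longrightarrow> integrable \<nu> f"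
  using nu_prob unfolding bm_def prob_space_def
  by (intro finite_measure.integrable_const_bound[of \<nu> _ A] AE_I2) (auto simp: meas_nu)

lemma nu_measure_space: "measure \<nu> {0..1} = 1"
  using prob_space.prob_space[OF nu_prob] by simp

lemma nu_bound: assumes "bm A f" shows "\<bar>\<integral>x. f x \<partial>\<nu>\<bar> \<le> A"
proof -
  have "\<bar>\<integral>x. 1 * f x \<partial>\<nu>\<bar> \<le> A * (\<integral>x. \<bar>1\<bar> \<partial>\<nu>)"
    using nu_integrable[OF bm_const] by (intro integrable_mult_bm[OF sets_nu _ assms])
  then show ?thesis by (simp add: nu_measure_space)
qed

lemma nu_invariant: "bm A f \<Longrightarrow> (\<integral>x. f ((T ^^ n) x) \<partial>\<nu>) = (\<integral>x. f x \<partial>\<nu>)"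
proof (induction n)
  case (Suc n)
  have m: "(\<lambda>x. f ((T ^^ n) x)) \<in> borel_measurable \<nu>"
    using bm_comp_T[OF Suc.prems] by (simp add: meas_nu bm_def)
  have "(\<integral>x. f ((T ^^ Suc n) x) \<partial>\<nu>) = (\<integral>x. f ((T ^^ n) (T x)) \<partial>\<nu>)" by (simp add: funpow_swap1)
  also have "\<dots> = (\<integral>x. f ((T ^^ n) x) \<partial>(distr \<nu> \<nu> T))" using integral_distr[OF nu_T m] by simp
  finally show ?case using Suc by (simp add: nu_inv)
qed simp

lemma rho_ex: "\<exists>\<rho>. \<rho> \<in> borel_measurable LB \<and> (\<forall>x. 0 \<le> \<rho> x) \<and> \<nu> = density LB (\<lambda>x. ennreal (\<rho> x)) \<and> (AE x in \<nu>. 0 < \<rho> x)"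
proof -
  interpret LB: prob_space LB by (rule prob_space_LB)
  have "finite_measure \<nu>" using nu_prob by (simp add: prob_space_def)
  from LB.real_RN_deriv[OF this nu_ac sets_nu] obtain D where D: "D \<in> borel_measurable LB"
    "AE x in LB. RN_deriv LB \<nu> x = ennreal (D x)" "AE x in \<nu>. 0 < D x" "\<And>x. 0 \<le> D x" by blast
  have "\<nu> = density LB (RN_deriv LB \<nu>)" using LB.density_RN_deriv[OF nu_ac sets_nu] by simp
  also have "\<dots> = density LB (\<lambda>x. ennreal (D x))" using D by (intro density_cong) auto
  finally show ?thesis using D by blast
qed

definition \<rho> :: "real \<Rightarrow> real" where
  "\<rho> = (SOME \<rho>. \<rho> \<in> borel_measurable LB \<and> (\<forall>x. 0 \<le> \<rho> x) \<and> \<nu> = density LB (\<lambda>x. ennreal (\<rho> x)) \<and> (AE x in \<nu>. 0 < \<rho> x))"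

lemma rho: "\<rho> \<in> borel_measurable LB" "0 \<le> \<rho> x" "\<nu> = density LB (\<lambda>x. ennreal (\<rho> x))" "AE x in \<nu>. 0 < \<rho> x"
  using someI_ex[OF rho_ex] unfolding \<rho>_def[symmetric] by auto

lemma nu_integral: "f \<in> borel_measurable LB \<Longrightarrow> (\<integral>x. f x \<partial>\<nu>) = (\<integral>x. \<rho> x * f x \<partial>LB)" for f :: "real \<Rightarrow> real"
  by (subst rho(3), subst integral_density) (auto simp: rho(1,2))

lemma nu_integrable_iff: "f \<in> borel_measurable LB \<Longrightarrow> integrable \<nu> f \<longleftrightarrow> integrable LB (\<lambda>x. \<rho> x * f x)" for f :: "real \<Rightarrow> real"
  by (subst rho(3), subst integrable_density) (auto simp: rho(1,2))

definition corr :: "(real \<Rightarrow> real) \<Rightarrow> nat \<Rightarrow> (real \<Rightarrow> real) \<Rightarrow> real" where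
  "corr \<phi> n \<psi> = (\<integral>x. \<phi> x * \<psi> ((T ^^ n) x) \<partial>\<nu>) - (\<integral>x. \<phi> x \<partial>\<nu>) * (\<integral>x. \<psi> x \<partial>\<nu>)"

text \<open>Weak mixing upgrades to mixing, uniformly in \<psi>. Approximate the centred density by
  \<open>h\<close> from the class. All \<open>(P ^^ i) h\<close> have uniformly decaying
  oscillations, so \<open>cells_L1\<close> reduces their L1 norms to finitely many cell integrals,
  which are close to correlations of \<open>A\<close> with cells. At one time all of these are
  small; then the L1 norm is small and serves every \<psi> at once.\<close>

lemma mix_indicator:
  assumes A: "A \<in> sets LB" and e: "0 < e"
  shows "\<exists>n0. \<forall>n\<ge>n0. \<forall>\<psi>. bm 1 \<psi> \<longrightarrow> \<bar>corr (indicator A) n \<psi>\<bar> \<le> e"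
proof -
  \<comment> \<open>\<open>f\<close> is the centred indicator, and \<xi> its density with respect to
    Lebesgue measure.\<close>
  define f where "f = (\<lambda>x. indicator A x - measure \<nu> A)"
  define \<xi> where "\<xi> = (\<lambda>x. \<rho> x * f x)"
  have iA: "bm 1 (indicator A)" by (rule bm_indicator[OF A])
  have fb: "bm (1 + \<bar>measure \<nu> A\<bar>) f" unfolding f_def by (intro bm_diff bm_const iA)
  have iAnu: "(\<integral>x. indicator A x \<partial>\<nu>) = measure \<nu> A"
    using sets.sets_into_space[OF A] by (simp add: Int_absorb2)
  have xi: "integrable LB \<xi>"
    using nu_integrable[OF fb] nu_integrable_iff[of f] fb by (simp add: \<xi>_def bm_def)
  have xi_corr: "(\<integral>x. \<xi> x * \<psi> ((T ^^ n) x) \<partial>LB) = corr (indicator A) n \<psi>" if \<psi>: "bm D \<psi>" for D \<psi> n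
  proof -
    have "(\<integral>x. \<xi> x * \<psi> ((T ^^ n) x) \<partial>LB) = (\<integral>x. f x * \<psi> ((T ^^ n) x) \<partial>\<nu>)"
      using bm_mult[OF fb bm_comp_T[OF \<psi>]] by (subst nu_integral) (auto simp: bm_def \<xi>_def mult.assoc)
    also have "\<dots> = (\<integral>x. indicator A x * \<psi> ((T ^^ n) x) - measure \<nu> A * \<psi> ((T ^^ n) x) \<partial>\<nu>)"
      by (simp add: f_def algebra_simps)
    also have "\<dots> = (\<integral>x. indicator A x * \<psi> ((T ^^ n) x) \<partial>\<nu>) - (\<integral>x. measure \<nu> A * \<psi> ((T ^^ n) x) \<partial>\<nu>)"
      by (intro Bochner_Integration.integral_diff nu_integrable[OF bm_mult[OF iA bm_comp_T[OF \<psi>]]]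
          nu_integrable[OF bm_cmult[OF bm_comp_T[OF \<psi>]]])
    finally have eq: "(\<integral>x. \<xi> x * \<psi> ((T ^^ n) x) \<partial>LB) =
      (\<integral>x. indicator A x * \<psi> ((T ^^ n) x) \<partial>\<nu>) - (\<integral>x. measure \<nu> A * \<psi> ((T ^^ n) x) \<partial>\<nu>)" .
    have "A \<inter> {0..1} = A" using sets.sets_into_space[OF A] by auto
    then show ?thesis using eq nu_invariant[OF \<psi>] by (simp add: corr_def)
  qed
  have "0 < e / 4" using e by simp
  then obtain A' B' h where h: "sp A' B' h" "(\<integral>x. \<bar>\<xi> x - h x\<bar> \<partial>LB) \<le> e / 4"
    using approx_integrable[OF xi] unfolding approx_def by blast
  have A'B': "0 \<le> A'" "0 \<le> B'" using bm_nonneg sp_bm[OF h(1)] h(1) by (auto simp: sp_def)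
  \<comment> \<open>One oscillation constant for all \<open>(P ^^ n) h\<close>, so that the depth
    \<open>j\<close> can be fixed before the time \<open>i\<close>.\<close>
  define D where "D = B' + C2 * A'"
  have D: "0 \<le> D" using A'B' C2_nonneg by (simp add: D_def)
  have Pnh: "sp (K * A') D ((P ^^ n) h)" for n
  proof (rule sp_mono[OF Pn_sp[OF h(1)] order_refl])
    show "B' * r ^ n + C2 * A' \<le> D"
      using mult_left_mono[OF power_le_one[of r n] A'B'(2)] r_bounds by (simp add: D_def)
  qed
  have "(\<lambda>j. D * r ^ j) \<longlonglongrightarrow> D * 0" using r_bounds by (intro tendsto_mult tendsto_const LIMSEQ_realpow_zero) auto
  then have "eventually (\<lambda>j. D * r ^ j < e / 4) sequentially" using e by (intro order_tendstoD(2)) auto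
  then obtain j where j: "D * r ^ j < e / 4" by (meson eventually_sequentially order_refl)
  \<comment> \<open>A finite sum of correlations still has Cesaro means tending to 0, which gives
    one time \<open>i\<close> common to all cells.\<close>
  define d where "d = (\<lambda>i. \<Sum>w\<in>W j. \<bar>corr (indicator A) i (indicator (Z w))\<bar>)"
  have "\<exists>i. d i \<le> e / 4"
  proof (rule small_term)
    have lim: "(\<lambda>n. (\<Sum>i<n. \<bar>corr (indicator A) i (indicator (Z w))\<bar>) / real n) \<longlonglongrightarrow> 0" if w: "w \<in> W j" for w
    proof -
      have ZA: "Z w \<in> sets \<nu>" "A \<in> sets \<nu>" using Z_sets[OF w] A by (auto simp: sets_nu)
      have "corr (indicator A) i (indicator (Z w)) =
          measure \<nu> (A \<inter> ((T ^^ i) -` Z w \<inter> space \<nu>)) - measure \<nu> A * measure \<nu> (Z w)" for i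
      proof -
        have "(\<integral>x. indicator A x * indicator (Z w) ((T ^^ i) x) \<partial>\<nu>) =
            (\<integral>x. indicator (A \<inter> ((T ^^ i) -` Z w \<inter> space \<nu>)) x \<partial>\<nu> :: real)"
          by (intro Bochner_Integration.integral_cong) (auto simp: indicator_def)
        also have "\<dots> = measure \<nu> (A \<inter> ((T ^^ i) -` Z w \<inter> space \<nu>))"
          using sets.sets_into_space[OF A] by (simp add: Int_absorb2 Int_assoc)
        finally show ?thesis
          using iAnu Z_sub[OF w] by (simp add: corr_def Int_absorb2)
      qed
      then show ?thesis using mixing ZA unfolding weakly_mixing_def by simp
    qed
    have "(\<lambda>n. \<Sum>w\<in>W j. (\<Sum>i<n. \<bar>corr (indicator A) i (indicator (Z w))\<bar>) / real n) \<longlonglongrightarrow> (\<Sum>w\<in>W j. 0)"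
      by (intro tendsto_sum lim)
    moreover have "(\<Sum>w\<in>W j. (\<Sum>i<n. \<bar>corr (indicator A) i (indicator (Z w))\<bar>) / real n) = (\<Sum>i<n. d i) / real n" for n
      unfolding d_def sum_divide_distrib[symmetric] by (subst sum.swap) simp
    ultimately show "(\<lambda>n. (\<Sum>i<n. d i) / real n) \<longlonglongrightarrow> 0" by simp
  qed (use e in simp)
  then obtain i where i: "d i \<le> e / 4" by blast
  have hi: "integrable LB h" by (rule sp_integrable[OF h(1)])
  have dif: "integrable LB (\<lambda>x. h x - \<xi> x)" "integrable LB (\<lambda>x. \<xi> x - h x)" using hi xi by auto
  have main: "\<bar>corr (indicator A) i \<psi>\<bar> \<le> e" if \<psi>: "bm 1 \<psi>" for \<psi>
  proof -
    have cells: "(\<Sum>w\<in>W j. \<bar>\<integral>x. indicator (Z w) x * (P ^^ i) h x \<partial>LB\<bar>) \<le> d i + e / 4"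
    proof -
      have "\<bar>\<integral>x. indicator (Z w) x * (P ^^ i) h x \<partial>LB\<bar> \<le>
        \<bar>corr (indicator A) i (indicator (Z w))\<bar> + (\<integral>x. \<bar>\<xi> x - h x\<bar> * indicator (Z w) ((T ^^ i) x) \<partial>LB)"
        if w: "w \<in> W j" for w
      proof -
        have iZ: "bm 1 (indicator (Z w))" by (rule bm_indicator[OF Z_sets[OF w]])
        note iZT = bm_comp_T[OF iZ, of i]
        have "(\<integral>x. indicator (Z w) x * (P ^^ i) h x \<partial>LB) = (\<integral>x. h x * indicator (Z w) ((T ^^ i) x) \<partial>LB)"
          using dualPn[OF sp_bm[OF h(1)] iZ] by (simp add: mult.commute)
        also have "\<dots> = (\<integral>x. \<xi> x * indicator (Z w) ((T ^^ i) x) - (\<xi> x - h x) * indicator (Z w) ((T ^^ i) x) \<partial>LB)"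
          by (simp add: algebra_simps)
        also have "\<dots> = corr (indicator A) i (indicator (Z w)) - (\<integral>x. (\<xi> x - h x) * indicator (Z w) ((T ^^ i) x) \<partial>LB)"
          using xi_corr[OF iZ] integrable_mult_bm(1)[OF refl xi iZT] integrable_mult_bm(1)[OF refl dif(2) iZT]
          by (subst Bochner_Integration.integral_diff) auto
        finally have eq: "(\<integral>x. indicator (Z w) x * (P ^^ i) h x \<partial>LB) = corr (indicator A) i (indicator (Z w))
           - (\<integral>x. (\<xi> x - h x) * indicator (Z w) ((T ^^ i) x) \<partial>LB)" .
        have "\<bar>\<integral>x. (\<xi> x - h x) * indicator (Z w) ((T ^^ i) x) \<partial>LB\<bar> \<le> (\<integral>x. \<bar>(\<xi> x - h x) * indicator (Z w) ((T ^^ i) x)\<bar> \<partial>LB)"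
          by (rule integral_abs_bound)
        also have "\<dots> = (\<integral>x. \<bar>\<xi> x - h x\<bar> * indicator (Z w) ((T ^^ i) x) \<partial>LB)" by (simp add: abs_mult)
        finally show ?thesis unfolding eq by linarith
      qed
      then have "(\<Sum>w\<in>W j. \<bar>\<integral>x. indicator (Z w) x * (P ^^ i) h x \<partial>LB\<bar>) \<le>
        d i + (\<Sum>w\<in>W j. \<integral>x. \<bar>\<xi> x - h x\<bar> * indicator (Z w) ((T ^^ i) x) \<partial>LB)"
        unfolding d_def sum.distrib[symmetric] by (intro sum_mono)
      also have "(\<Sum>w\<in>W j. \<integral>x. \<bar>\<xi> x - h x\<bar> * indicator (Z w) ((T ^^ i) x) \<partial>LB) =
        (\<integral>x. (\<Sum>w\<in>W j. \<bar>\<xi> x - h x\<bar> * indicator (Z w) ((T ^^ i) x)) \<partial>LB)"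
        by (intro Bochner_Integration.integral_sum[symmetric]
            integrable_mult_bm(1)[OF refl integrable_abs[OF dif(2)] bm_comp_T[OF bm_indicator[OF Z_sets]]])
      also have "\<dots> \<le> (\<integral>x. \<bar>\<xi> x - h x\<bar> \<partial>LB)"
      proof (rule Bochner_Integration.integral_mono)
        show "integrable LB (\<lambda>x. \<Sum>w\<in>W j. \<bar>\<xi> x - h x\<bar> * indicator (Z w) ((T ^^ i) x))"
          by (intro Bochner_Integration.integrable_sum
            integrable_mult_bm(1)[OF refl integrable_abs[OF dif(2)] bm_comp_T[OF bm_indicator[OF Z_sets]]])
        show "integrable LB (\<lambda>x. \<bar>\<xi> x - h x\<bar>)" using dif by simp
        fix x :: real
        have "(\<Sum>w\<in>W j. indicator (Z w) ((T ^^ i) x) :: real) \<le> 1"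
        proof (cases "\<exists>w\<in>W j. (T ^^ i) x \<in> Z w")
          case True
          then obtain w where w: "w \<in> W j" "(T ^^ i) x \<in> Z w" by blast
          have "(\<Sum>v\<in>W j. indicator (Z v) ((T ^^ i) x) :: real) = (\<Sum>v\<in>W j. if v = w then 1 else 0)"
          proof (rule sum.cong[OF refl])
            fix v assume v: "v \<in> W j"
            show "indicator (Z v) ((T ^^ i) x) = (if v = w then 1 else (0::real))"
              using cyl_disjoint[OF w(1) v w(2), of "{0..1}"] w by (cases "v = w") (auto simp: indicator_def)
          qed
          then show ?thesis using w by simp
        qed simp
        then have "\<bar>\<xi> x - h x\<bar> * (\<Sum>w\<in>W j. indicator (Z w) ((T ^^ i) x)) \<le> \<bar>\<xi> x - h x\<bar> * 1"
          by (intro mult_left_mono) auto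
        then show "(\<Sum>w\<in>W j. \<bar>\<xi> x - h x\<bar> * indicator (Z w) ((T ^^ i) x)) \<le> \<bar>\<xi> x - h x\<bar>"
          by (simp add: sum_distrib_left)
      qed
      finally show ?thesis using h(2) by linarith
    qed
    have "nrm1 ((P ^^ i) h) \<le> (\<Sum>w\<in>W j. \<bar>\<integral>x. indicator (Z w) x * (P ^^ i) h x \<partial>LB\<bar>) + D * r ^ j"
      by (rule cells_L1[OF Pnh])
    then have nrm: "nrm1 ((P ^^ i) h) \<le> 3 * e / 4" using cells i j by linarith
    have "(\<integral>x. h x * \<psi> ((T ^^ i) x) \<partial>LB) = (\<integral>x. (P ^^ i) h x * \<psi> x \<partial>LB)"
      using dualPn[OF sp_bm[OF h(1)] \<psi>] by simp
    also have "\<bar>\<dots>\<bar> \<le> 1 * nrm1 ((P ^^ i) h)"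
      unfolding nrm1_def by (rule integrable_mult_bm(2)[OF refl sp_integrable[OF Pnh] \<psi>])
    finally have 1: "\<bar>\<integral>x. h x * \<psi> ((T ^^ i) x) \<partial>LB\<bar> \<le> 3 * e / 4" using nrm by simp
    have 2: "\<bar>\<integral>x. (\<xi> x - h x) * \<psi> ((T ^^ i) x) \<partial>LB\<bar> \<le> e / 4"
      using integrable_mult_bm(2)[OF refl dif(2) bm_comp_T[OF \<psi>, of i]] h(2) by linarith
    have "corr (indicator A) i \<psi> = (\<integral>x. (\<xi> x - h x) * \<psi> ((T ^^ i) x) + h x * \<psi> ((T ^^ i) x) \<partial>LB)"
      unfolding xi_corr[OF \<psi>, symmetric] by (simp add: algebra_simps)
    also have "\<dots> = (\<integral>x. (\<xi> x - h x) * \<psi> ((T ^^ i) x) \<partial>LB) + (\<integral>x. h x * \<psi> ((T ^^ i) x) \<partial>LB)"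
      by (intro Bochner_Integration.integral_add integrable_mult_bm(1)[OF refl dif(2) bm_comp_T[OF \<psi>]]
          integrable_mult_bm(1)[OF refl hi bm_comp_T[OF \<psi>]])
    finally show ?thesis using 1 2 by linarith
  qed
  \<comment> \<open>Correlation at time \<open>n\<close> with \<psi> is correlation at time
    \<open>i\<close> with \<open>\<psi> \<circ> T ^^ (n - i)\<close>, by invariance of \<nu>, and
    the estimate at time \<open>i\<close> is uniform over test functions.\<close>
  have "\<bar>corr (indicator A) n \<psi>\<bar> \<le> e" if n: "n \<ge> i" and \<psi>: "bm 1 \<psi>" for n \<psi>
  proof -
    define k where "k = n - i"
    have nk: "n = k + i" using n by (simp add: k_def)
    have "corr (indicator A) n \<psi> = corr (indicator A) i (\<lambda>x. \<psi> ((T ^^ k) x))"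
      unfolding corr_def nk nu_invariant[OF \<psi>] by (simp add: funpow_add)
    then show ?thesis using main[OF bm_comp_T[OF \<psi>]] by simp
  qed
  then show ?thesis by blast
qed

lemma corr_bound:
  assumes f: "integrable \<nu> f" and \<psi>: "bm 1 \<psi>"
  shows "\<bar>corr f n \<psi>\<bar> \<le> 2 * (\<integral>x. \<bar>f x\<bar> \<partial>\<nu>)"
proof -
  have 1: "\<bar>\<integral>x. f x * \<psi> ((T ^^ n) x) \<partial>\<nu>\<bar> \<le> (\<integral>x. \<bar>f x\<bar> \<partial>\<nu>)"
    using integrable_mult_bm(2)[OF sets_nu f bm_comp_T[OF \<psi>, of n]] by simp
  have "\<bar>\<integral>x. f x \<partial>\<nu>\<bar> * \<bar>\<integral>x. \<psi> x \<partial>\<nu>\<bar> \<le> (\<integral>x. \<bar>f x\<bar> \<partial>\<nu>) * 1"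
    using integral_abs_bound[of \<nu> f] nu_bound[OF \<psi>] by (intro mult_mono) auto
  then show ?thesis using 1 unfolding corr_def by (simp add: abs_mult[symmetric])
qed

lemma corr_add:
  assumes "integrable \<nu> f" "integrable \<nu> k" and \<psi>: "bm 1 \<psi>"
  shows "corr (\<lambda>x. f x + k x) n \<psi> = corr f n \<psi> + corr k n \<psi>"
  using assms integrable_mult_bm(1)[OF sets_nu assms(1) bm_comp_T[OF \<psi>, of n]]
    integrable_mult_bm(1)[OF sets_nu assms(2) bm_comp_T[OF \<psi>, of n]]
  by (simp add: corr_def distrib_right algebra_simps)

lemma corr_cmult: "corr (\<lambda>x. a * f x) n \<psi> = a * corr f n \<psi>"
proof -
  have "(\<integral>x. a * f x * \<psi> ((T ^^ n) x) \<partial>\<nu>) = a * (\<integral>x. f x * \<psi> ((T ^^ n) x) \<partial>\<nu>)"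
    by (simp add: mult.assoc)
  then show ?thesis by (simp add: corr_def algebra_simps)
qed

text \<open>Indicators extend to integrable functions because \<open>corr_bound\<close> is uniform
  in the time and in \<psi>.\<close>

lemma mix_integrable:
  assumes "integrable \<nu> f"
  shows "\<forall>e>0. \<exists>n0. \<forall>n\<ge>n0. \<forall>\<psi>. bm 1 \<psi> \<longrightarrow> \<bar>corr f n \<psi>\<bar> \<le> e"
  using assms
proof (induction rule: integrable_induct)
  case (base A c)
  show ?case
  proof (intro allI impI)
    fix e :: real assume e: "0 < e"
    then have "0 < e / (\<bar>c\<bar> + 1)" by (intro divide_pos_pos) auto
    then obtain n0 where n0: "\<And>n \<psi>. n \<ge> n0 \<Longrightarrow> bm 1 \<psi> \<Longrightarrow> \<bar>corr (indicator A) n \<psi>\<bar> \<le> e / (\<bar>c\<bar> + 1)"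
      using mix_indicator[of A] base(1) sets_nu by blast
    have "\<bar>corr (\<lambda>x. indicator A x *\<^sub>R c) n \<psi>\<bar> \<le> e" if "n \<ge> n0" "bm 1 \<psi>" for n \<psi>
    proof -
      have "\<bar>corr (\<lambda>x. indicator A x *\<^sub>R c) n \<psi>\<bar> = \<bar>c\<bar> * \<bar>corr (indicator A) n \<psi>\<bar>"
        using corr_cmult[of c "indicator A" n \<psi>] by (simp add: mult.commute abs_mult)
      also have "\<dots> \<le> \<bar>c\<bar> * (e / (\<bar>c\<bar> + 1))" using n0[OF that] by (intro mult_left_mono) auto
      also have "\<dots> \<le> e" using e by (simp add: field_simps)
      finally show ?thesis .
    qed
    then show "\<exists>n0. \<forall>n\<ge>n0. \<forall>\<psi>. bm 1 \<psi> \<longrightarrow> \<bar>corr (\<lambda>x. indicator A x *\<^sub>R c) n \<psi>\<bar> \<le> e" by blast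
  qed
next
  case (add f k)
  show ?case
  proof (intro allI impI)
    fix e :: real assume "0 < e"
    then have "0 < e / 2" by simp
    then obtain n1 n2 where n: "\<And>n \<psi>. n \<ge> n1 \<Longrightarrow> bm 1 \<psi> \<Longrightarrow> \<bar>corr f n \<psi>\<bar> \<le> e / 2"
      "\<And>n \<psi>. n \<ge> n2 \<Longrightarrow> bm 1 \<psi> \<Longrightarrow> \<bar>corr k n \<psi>\<bar> \<le> e / 2" using add.IH by meson
    have "\<bar>corr (\<lambda>x. f x + k x) n \<psi>\<bar> \<le> e" if "n \<ge> max n1 n2" "bm 1 \<psi>" for n \<psi>
      unfolding corr_add[OF add.hyps(1,2) that(2)] using n(1)[of n \<psi>] n(2)[of n \<psi>] that by simp
    then show "\<exists>n0. \<forall>n\<ge>n0. \<forall>\<psi>. bm 1 \<psi> \<longrightarrow> \<bar>corr (\<lambda>x. f x + k x) n \<psi>\<bar> \<le> e" by blast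
  qed
next
  case (lim f s)
  show ?case
  proof (intro allI impI)
    fix e :: real assume e: "0 < e"
    have "(\<lambda>i. \<integral>x. \<bar>f x - s i x\<bar> \<partial>\<nu>) \<longlonglongrightarrow> 0" by (rule L1_lim[OF lim(1-4)])
    then have "eventually (\<lambda>i. (\<integral>x. \<bar>f x - s i x\<bar> \<partial>\<nu>) < e / 4) sequentially"
      using e by (intro order_tendstoD(2)) auto
    then obtain i where i: "(\<integral>x. \<bar>f x - s i x\<bar> \<partial>\<nu>) < e / 4" by (meson eventually_sequentially order_refl)
    have "0 < e / 2" using e by simp
    then obtain n0 where n0: "\<And>n \<psi>. n \<ge> n0 \<Longrightarrow> bm 1 \<psi> \<Longrightarrow> \<bar>corr (s i) n \<psi>\<bar> \<le> e / 2" using lim(5) by meson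
    have "\<bar>corr f n \<psi>\<bar> \<le> e" if "n \<ge> n0" "bm 1 \<psi>" for n \<psi>
    proof -
      have di: "integrable \<nu> (\<lambda>x. f x - s i x)" using lim(1,4) by simp
      have "corr f n \<psi> = corr (\<lambda>x. (f x - s i x) + s i x) n \<psi>" by simp
      also have "\<dots> = corr (\<lambda>x. f x - s i x) n \<psi> + corr (s i) n \<psi>"
        by (rule corr_add[OF di lim(1) that(2)])
      finally show ?thesis using corr_bound[OF di that(2), of n] i n0[OF that] by linarith
    qed
    then show "\<exists>n0. \<forall>n\<ge>n0. \<forall>\<psi>. bm 1 \<psi> \<longrightarrow> \<bar>corr f n \<psi>\<bar> \<le> e" by blast
  qed
qed

subsection \<open>Exponential decay for the base map\<close>

text \<open>The images of the density \<open>u\<close> are dominated by \<open>K * A\<close> times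
  Lebesgue measure, so their Cesaro means have a cluster measure that is absolutely continuous. It
  is invariant, and by uniqueness its normalisation is \<nu>; bounds on the mass in \<open>S\<close>
  pass to the limit.\<close>

lemma cesaro_cluster:
  assumes u: "bm A u" "\<And>x. x \<in> {0..1} \<Longrightarrow> 0 \<le> u x" and S: "S \<in> sets LB" and c: "0 < (\<integral>x. u x \<partial>LB)"
    and le: "\<And>k. (\<integral>x. u x * indicator S ((T ^^ k) x) \<partial>LB) \<le> s"
  shows "(\<integral>x. u x \<partial>LB) * measure \<nu> S \<le> s"
proof -
  define c0 where "c0 = (\<integral>x. u x \<partial>LB)"
  define \<eta>0 where "\<eta>0 = (\<lambda>k X. \<integral>x. u x * indicator X ((T ^^ k) x) \<partial>LB)"
  define a where "a = (\<lambda>n X. (\<Sum>k<Suc n. \<eta>0 k X) / real (Suc n))"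
  have A: "0 \<le> A" by (rule bm_nonneg[OF u(1)])
  have iX: "bm 1 (indicator X)" if "X \<in> sets LB" for X by (rule bm_indicator[OF that])
  have int: "integrable LB (\<lambda>x. u x * indicator X ((T ^^ k) x))" if "X \<in> sets LB" for X k
    by (rule bm_integrable[OF bm_mult[OF u(1) bm_comp_T[OF iX[OF that]]]])
  have nn: "0 \<le> \<eta>0 k X" for k X
    unfolding \<eta>0_def using u(2) by (intro integral_nonneg_AE AE_I2) auto
  have ub: "\<eta>0 k X \<le> K * A * measure LB X" if X: "X \<in> sets LB" for k X
  proof -
    have "\<eta>0 k X = (\<integral>x. (P ^^ k) u x * indicator X x \<partial>LB)"
      unfolding \<eta>0_def using dualPn[OF u(1) iX[OF X]] by simp
    also have "\<dots> \<le> (\<integral>x. (K * A) * indicator X x \<partial>LB)"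
    proof (rule integral_le_bm[OF bm_mult[OF Pn_bm[OF u(1)] iX[OF X]] bm_cmult[OF iX[OF X]]])
      fix x :: real assume "x \<in> {0..1}"
      then have "\<bar>(P ^^ k) u x\<bar> \<le> K * A" using Pn_bm[OF u(1), of k] unfolding bm_def by blast
      then have "(P ^^ k) u x \<le> K * A" by linarith
      then show "(P ^^ k) u x * indicator X x \<le> K * A * indicator X x" by (intro mult_right_mono) auto
    qed
    also have "\<dots> = K * A * measure LB X" using sets.sets_into_space[OF X] by (simp add: Int_absorb2)
    finally show ?thesis .
  qed
  have "\<exists>\<eta> F. F \<noteq> bot \<and> F \<le> sequentially \<and> sets \<eta> = sets LB \<and> finite_measure \<eta> \<and>
    (\<forall>X\<in>sets LB. ((\<lambda>n. a n X) \<longlongrightarrow> measure \<eta> X) F \<and> measure \<eta> X \<le> K * A * measure LB X)"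
  proof (rule cluster_measure[OF finite_measure_LB])
    show "0 \<le> K * A" using K(1) A by simp
    show "0 \<le> a n X \<and> a n X \<le> K * A * measure LB X" if X: "X \<in> sets LB" for n X
    proof
      show "0 \<le> a n X" unfolding a_def using nn by (intro divide_nonneg_nonneg sum_nonneg) auto
      have "(\<Sum>k<Suc n. \<eta>0 k X) \<le> (\<Sum>k<Suc n. K * A * measure LB X)" using ub[OF X] by (intro sum_mono) auto
      then show "a n X \<le> K * A * measure LB X" unfolding a_def by (simp add: field_simps)
    qed
    show "a n (X \<union> Y) = a n X + a n Y" if X: "X \<in> sets LB" and Y: "Y \<in> sets LB" and d: "X \<inter> Y = {}" for n X Y
    proof -
      have "\<eta>0 k (X \<union> Y) = \<eta>0 k X + \<eta>0 k Y" for k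
        unfolding \<eta>0_def indicator_disj_union[OF d] distrib_left
        by (rule Bochner_Integration.integral_add[OF int[OF X] int[OF Y]])
      then show ?thesis unfolding a_def by (simp add: sum.distrib add_divide_distrib)
    qed
  qed
  then obtain \<eta> F where F: "F \<noteq> bot" "F \<le> sequentially" and sets: "sets \<eta> = sets LB" and fin: "finite_measure \<eta>"
    and conv: "\<And>X. X \<in> sets LB \<Longrightarrow> ((\<lambda>n. a n X) \<longlongrightarrow> measure \<eta> X) F"
    and dom: "\<And>X. X \<in> sets LB \<Longrightarrow> measure \<eta> X \<le> K * A * measure LB X" by blast
  interpret e: finite_measure \<eta> by fact
  have sp: "space \<eta> = {0..1}" using sets_eq_imp_space_eq[OF sets] by simp
  have I: "{0..1} \<in> sets LB" using sets.top[of LB] by simp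
  have "\<eta>0 k {0..1} = c0" for k
    unfolding \<eta>0_def c0_def using T_pow_maps[of _ k] by (intro Bochner_Integration.integral_cong) (auto simp: indicator_def)
  then have "a n {0..1} = c0" for n by (simp add: a_def del: of_nat_Suc sum.lessThan_Suc)
  then have tot: "measure \<eta> {0..1} = c0" using tendsto_unique[OF F(1) conv[OF I]] by simp
  have inv: "measure \<eta> (T -` X \<inter> {0..1}) = measure \<eta> X" if X: "X \<in> sets LB" for X
  proof -
    have TX: "T -` X \<inter> {0..1} \<in> sets LB" using measurable_sets[OF T_meas X] by simp
    have shift: "\<eta>0 k (T -` X \<inter> {0..1}) = \<eta>0 (Suc k) X" for k
      unfolding \<eta>0_def
    proof (intro Bochner_Integration.integral_cong refl)
      fix x assume "x \<in> space LB"
      then have "(T ^^ k) x \<in> {0..1}" using T_pow_maps by simp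
      then show "u x * indicator (T -` X \<inter> {0..1}) ((T ^^ k) x) = u x * indicator X ((T ^^ Suc k) x)"
        by (simp add: indicator_def)
    qed
    \<comment> \<open>Shifting the averaging window by one changes the mean only by its two boundary
      terms, hence invariance of the limit.\<close>
    have "a n (T -` X \<inter> {0..1}) - a n X = (\<eta>0 (Suc n) X - \<eta>0 0 X) / real (Suc n)" for n
    proof -
      have "(\<Sum>k<Suc n. \<eta>0 (Suc k) X) - (\<Sum>k<Suc n. \<eta>0 k X) = \<eta>0 (Suc n) X - \<eta>0 0 X"
        by (subst sum_subtractf[symmetric]) (rule sum_lessThan_telescope)
      then show ?thesis unfolding a_def shift by (simp add: diff_divide_distrib[symmetric])
    qed
    moreover have "(\<lambda>n. (\<eta>0 (Suc n) X - \<eta>0 0 X) / real (Suc n)) \<longlonglongrightarrow> 0"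
    proof (rule Lim_null_comparison)
      have "\<bar>\<eta>0 (Suc n) X - \<eta>0 0 X\<bar> \<le> K * A * measure LB X" for n
        using nn[of "Suc n" X] nn[of 0 X] ub[OF X, of "Suc n"] ub[OF X, of 0] by linarith
      then show "eventually (\<lambda>n. norm ((\<eta>0 (Suc n) X - \<eta>0 0 X) / real (Suc n)) \<le> K * A * measure LB X / real (Suc n)) sequentially"
        by (intro always_eventually allI) (auto simp: divide_right_mono)
      show "(\<lambda>n. K * A * measure LB X / real (Suc n)) \<longlonglongrightarrow> 0"
        using LIMSEQ_Suc[OF lim_const_over_n[of "K * A * measure LB X"]] by simp
    qed
    ultimately have "((\<lambda>n. a n (T -` X \<inter> {0..1}) - a n X) \<longlongrightarrow> 0) F"
      using filterlim_mono[OF _ order_refl F(2)] by simp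
    moreover have "((\<lambda>n. a n (T -` X \<inter> {0..1}) - a n X) \<longlongrightarrow> measure \<eta> (T -` X \<inter> {0..1}) - measure \<eta> X) F"
      by (intro tendsto_diff conv X TX)
    ultimately show ?thesis using tendsto_unique[OF F(1)] by fastforce
  qed
  \<comment> \<open>All means give the unit interval the mass \<open>c0\<close>, so dividing by it
    yields a probability measure.\<close>
  define \<nu>' where "\<nu>' = scale_measure (ennreal (1 / c0)) \<eta>"
  have c0: "0 < c0" using c by (simp add: c0_def)
  have em: "emeasure \<nu>' X = ennreal (measure \<eta> X / c0)" for X
    unfolding \<nu>'_def using c0 by (simp add: e.emeasure_eq_measure ennreal_mult'[symmetric])
  have s1: "sets \<nu>' = sets LB" by (simp add: \<nu>'_def sets)
  have sets': "sets \<nu>' = sets LB" "space \<nu>' = {0..1}" using s1 sets_eq_imp_space_eq[OF s1] by simp_all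
  have Tm: "T \<in> \<nu>' \<rightarrow>\<^sub>M \<nu>'" using T_meas measurable_cong_sets[OF sets'(1) sets'(1)] by simp
  have "ac_invariant_prob T \<nu>'"
    unfolding ac_invariant_prob_def invariant_prob_def
  proof (intro conjI Tm)
    show "prob_space \<nu>'" using em[of "{0..1}"] tot c0 by (intro prob_spaceI) (simp add: sets')
    show "sets \<nu>' = sets (restrict_space borel {0..1})" using sets' sets_LB by simp
    show "distr \<nu>' \<nu>' T = \<nu>'"
    proof (rule measure_eqI)
      fix X assume "X \<in> sets (distr \<nu>' \<nu>' T)"
      then have X: "X \<in> sets LB" using sets' by simp
      have "emeasure (distr \<nu>' \<nu>' T) X = emeasure \<nu>' (T -` X \<inter> {0..1})"
        using X by (subst emeasure_distr[OF Tm]) (simp_all add: sets')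
      then show "emeasure (distr \<nu>' \<nu>' T) X = emeasure \<nu>' X" using inv[OF X] by (simp add: em)
    qed simp
    show "absolutely_continuous LB \<nu>'"
      unfolding absolutely_continuous_def
    proof
      fix X assume "X \<in> null_sets LB"
      then have X: "X \<in> sets LB" "measure LB X = 0" by (auto simp: null_sets_def measure_def)
      then have "measure \<eta> X = 0" using dom[OF X(1)] measure_nonneg[of \<eta> X] by simp
      then show "X \<in> null_sets \<nu>'" using X(1) by (simp add: null_sets_def sets' em)
    qed
  qed
  then have eq: "\<nu>' = \<nu>" by (rule acip_unique)
  have "measure \<nu> S = measure \<eta> S / c0"
    using em[of S] c0 unfolding eq measure_def[of \<nu>] by simp
  moreover have "measure \<eta> S \<le> s"
  proof (rule tendsto_upperbound[OF conv[OF S] _ F(1)])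
    have "a n S \<le> s" for n
    proof -
      have "(\<Sum>k<Suc n. \<eta>0 k S) \<le> (\<Sum>k<Suc n. s)" using le by (intro sum_mono) (simp add: \<eta>0_def)
      then show ?thesis unfolding a_def by (simp add: field_simps)
    qed
    then show "eventually (\<lambda>n. a n S \<le> s) F" by simp
  qed
  ultimately show ?thesis using c0 by (simp add: c0_def[symmetric])
qed

text \<open>At some time \<open>n1\<close> all but \<open>e / 3\<close> of the mass of
  \<open>u\<close> lies where \<rho> is positive; otherwise \<open>cesaro_cluster\<close> would
  bound the \<nu>-measure of that set away from 1. On this set mixing for \<nu> applies, with error
  \<open>e / 3\<close>. The remaining mass enters once in the integral and once in the limit value,
  each time with at most \<open>e / 3\<close>.\<close>

lemma limit_nonneg:
  assumes u: "bm A u" "\<And>x. x \<in> {0..1} \<Longrightarrow> 0 \<le> u x" and e: "0 < e"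
  shows "\<exists>n0. \<forall>n\<ge>n0. \<forall>\<psi>. bm 1 \<psi> \<longrightarrow> \<bar>(\<integral>x. u x * \<psi> ((T ^^ n) x) \<partial>LB) - (\<integral>x. u x \<partial>LB) * (\<integral>x. \<psi> x \<partial>\<nu>)\<bar> \<le> e"
proof -
  define c where "c = (\<integral>x. u x \<partial>LB)"
  have ui: "integrable LB u" by (rule bm_integrable[OF u(1)])
  have uabs: "(\<integral>x. \<bar>u x\<bar> \<partial>LB) = c" unfolding c_def using u(2) by (intro Bochner_Integration.integral_cong) auto
  have c0: "0 \<le> c" using uabs by (metis integral_nonneg_AE AE_I2 abs_ge_zero)
  define S where "S = {x \<in> space LB. 0 < \<rho> x}"
  have S: "S \<in> sets LB" unfolding S_def using rho(1) by measurable
  have Sc: "{0..1} - S \<in> sets LB" using sets.compl_sets[OF S] by simp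
  have nuS: "measure \<nu> S = 1"
  proof -
    have "AE x in \<nu>. x \<in> S" using rho(4) AE_space[of \<nu>] by eventually_elim (simp add: S_def)
    then show ?thesis using prob_space.prob_eq_1[OF nu_prob, of S] S sets_nu by simp
  qed
  have "\<exists>n1. c - e / 3 \<le> (\<integral>x. u x * indicator S ((T ^^ n1) x) \<partial>LB)"
  proof (rule ccontr)
    assume "\<not> ?thesis"
    then have lt: "(\<integral>x. u x * indicator S ((T ^^ k) x) \<partial>LB) < c - e / 3" for k by (simp add: not_le)
    have "0 \<le> (\<integral>x. u x * indicator S ((T ^^ 0) x) \<partial>LB)" using u(2) by (intro integral_nonneg_AE AE_I2) auto
    then have "0 < c" using lt[of 0] e by linarith
    then have "c * measure \<nu> S \<le> c - e / 3"
      unfolding c_def using lt by (intro cesaro_cluster[OF u S]) (auto simp: c_def intro: less_imp_le)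
    then show False using nuS e by simp
  qed
  then obtain n1 where n1: "c - e / 3 \<le> (\<integral>x. u x * indicator S ((T ^^ n1) x) \<partial>LB)" by blast
  define v where "v = (P ^^ n1) u"
  have v: "bm (K * A) v" unfolding v_def by (rule Pn_bm[OF u(1)])
  \<comment> \<open>The density of the good part of the mass relative to \<nu>. It may be unbounded
    where \<rho> is small, so mixing is needed for integrable functions and not just for bounded
    ones.\<close>
  define \<phi> where "\<phi> = (\<lambda>x. indicator S x * v x / \<rho> x)"
  have vS: "bm (1 * (K * A)) (\<lambda>x. indicator S x * v x)" by (intro bm_mult bm_indicator S v)
  have ph: "\<rho> x * \<phi> x = indicator S x * v x" for x by (auto simp: \<phi>_def S_def indicator_def)
  have \<phi>m: "\<phi> \<in> borel_measurable LB" unfolding \<phi>_def using vS rho(1) by (intro borel_measurable_divide) (auto simp: bm_def)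
  have \<phi>i: "integrable \<nu> \<phi>" unfolding nu_integrable_iff[OF \<phi>m] ph by (rule bm_integrable[OF vS])
  have "0 < e / 3" using e by simp
  then obtain n2 where n2: "\<And>n \<psi>. n \<ge> n2 \<Longrightarrow> bm 1 \<psi> \<Longrightarrow> \<bar>corr \<phi> n \<psi>\<bar> \<le> e / 3"
    using mix_integrable[OF \<phi>i] by blast
  have one: "bm 1 (\<lambda>_. 1)" using bm_const[of 1] by simp
  have split: "(\<integral>x. u x * \<psi> ((T ^^ n1) x) \<partial>LB) = (\<integral>x. (indicator S x * v x) * \<psi> x \<partial>LB) + (\<integral>x. u x * (indicator ({0..1} - S) ((T ^^ n1) x) * \<psi> ((T ^^ n1) x)) \<partial>LB)"
    if \<psi>: "bm 1 \<psi>" for \<psi>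
  proof -
    have i1: "bm (1 * 1) (\<lambda>x. indicator S x * \<psi> x)" and i2: "bm (1 * 1) (\<lambda>x. indicator ({0..1} - S) x * \<psi> x)"
      by (intro bm_mult bm_indicator S Sc \<psi>)+
    have "(\<integral>x. u x * \<psi> ((T ^^ n1) x) \<partial>LB) = (\<integral>x. v x * \<psi> x \<partial>LB)" unfolding v_def using dualPn[OF u(1) \<psi>] by simp
    also have "\<dots> = (\<integral>x. v x * (indicator S x * \<psi> x) + v x * (indicator ({0..1} - S) x * \<psi> x) \<partial>LB)"
      by (intro Bochner_Integration.integral_cong) (auto simp: indicator_def)
    also have "\<dots> = (\<integral>x. v x * (indicator S x * \<psi> x) \<partial>LB) + (\<integral>x. v x * (indicator ({0..1} - S) x * \<psi> x) \<partial>LB)"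
      by (intro Bochner_Integration.integral_add bm_integrable[OF bm_mult[OF v i1]] bm_integrable[OF bm_mult[OF v i2]])
    also have "(\<integral>x. v x * (indicator ({0..1} - S) x * \<psi> x) \<partial>LB) = (\<integral>x. u x * (indicator ({0..1} - S) ((T ^^ n1) x) * \<psi> ((T ^^ n1) x)) \<partial>LB)"
      unfolding v_def by (rule dualPn[OF u(1) i2])
    finally show ?thesis by (simp add: mult_ac)
  qed
  have cS: "(\<integral>x. indicator S x * v x \<partial>LB) = (\<integral>x. u x * indicator S ((T ^^ n1) x) \<partial>LB)"
    unfolding v_def using dualPn[OF u(1) bm_indicator[OF S]] by (simp add: mult.commute)
  have cSc: "(\<integral>x. u x * indicator ({0..1} - S) ((T ^^ n1) x) \<partial>LB) = c - (\<integral>x. indicator S x * v x \<partial>LB)"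
    using split[OF one] by (simp add: c_def)
  have main: "\<bar>(\<integral>x. u x * \<psi> ((T ^^ (n + n1)) x) \<partial>LB) - c * (\<integral>x. \<psi> x \<partial>\<nu>)\<bar> \<le> e" if n: "n \<ge> n2" and \<psi>: "bm 1 \<psi>" for n \<psi>
  proof -
    note \<psi>n = bm_comp_T[OF \<psi>, of n]
    define I where "I = (\<integral>x. indicator S x * v x \<partial>LB)"
    define J where "J = (\<integral>x. \<psi> x \<partial>\<nu>)"
    define E where "E = (\<integral>x. u x * (indicator ({0..1} - S) ((T ^^ n1) x) * \<psi> ((T ^^ n) ((T ^^ n1) x))) \<partial>LB)"
    have "(\<integral>x. u x * \<psi> ((T ^^ (n + n1)) x) \<partial>LB) = (\<integral>x. (indicator S x * v x) * \<psi> ((T ^^ n) x) \<partial>LB) + E"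
      using split[OF \<psi>n] by (simp add: funpow_add E_def)
    also have "(\<integral>x. (indicator S x * v x) * \<psi> ((T ^^ n) x) \<partial>LB) = (\<integral>x. \<phi> x * \<psi> ((T ^^ n) x) \<partial>\<nu>)"
      using \<phi>m \<psi>n by (subst nu_integral) (auto simp: bm_def ph mult.assoc[symmetric])
    also have "\<dots> = corr \<phi> n \<psi> + I * J"
      using nu_integral[OF \<phi>m] by (simp add: corr_def ph I_def J_def)
    finally have eq: "(\<integral>x. u x * \<psi> ((T ^^ (n + n1)) x) \<partial>LB) - c * J = corr \<phi> n \<psi> + E - (c - I) * J"
      by (simp add: algebra_simps)
    have cI: "0 \<le> c - I" "c - I \<le> e / 3"
    proof -
      show "c - I \<le> e / 3" using n1 cS by (simp add: I_def)
      show "0 \<le> c - I" unfolding I_def cSc[symmetric] using u(2) by (intro integral_nonneg_AE AE_I2) auto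
    qed
    have "\<bar>J\<bar> \<le> 1" using nu_bound[OF \<psi>] by (simp add: J_def)
    then have 1: "\<bar>(c - I) * J\<bar> \<le> e / 3" using cI mult_mono[of "c - I" "e / 3" "\<bar>J\<bar>" 1] by (simp add: abs_mult)
    have "bm (A * 1) (\<lambda>x. u x * indicator ({0..1} - S) ((T ^^ n1) x))"
      by (intro bm_mult u bm_comp_T[OF bm_indicator] Sc)
    then have "\<bar>\<integral>x. (u x * indicator ({0..1} - S) ((T ^^ n1) x)) * \<psi> ((T ^^ (n + n1)) x) \<partial>LB\<bar>
        \<le> 1 * (\<integral>x. \<bar>u x * indicator ({0..1} - S) ((T ^^ n1) x)\<bar> \<partial>LB)"
      by (intro integrable_mult_bm(2) bm_integrable bm_comp_T \<psi>) auto
    also have "(\<integral>x. \<bar>u x * indicator ({0..1} - S) ((T ^^ n1) x)\<bar> \<partial>LB) = c - I"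
      unfolding I_def cSc[symmetric] using u(2) by (intro Bochner_Integration.integral_cong) auto
    finally have 2: "\<bar>E\<bar> \<le> e / 3" using cI unfolding E_def by (simp add: mult.assoc funpow_add)
    show ?thesis unfolding J_def[symmetric] eq using 1 2 n2[OF n \<psi>] by linarith
  qed
  have "\<bar>(\<integral>x. u x * \<psi> ((T ^^ n) x) \<partial>LB) - c * (\<integral>x. \<psi> x \<partial>\<nu>)\<bar> \<le> e" if "n \<ge> n2 + n1" "bm 1 \<psi>" for n \<psi>
    using main[of "n - n1" \<psi>] that by simp
  then show ?thesis unfolding c_def by blast
qed

lemma integral_Pn: "bm A h \<Longrightarrow> (\<integral>x. (P ^^ n) h x \<partial>LB) = (\<integral>x. h x \<partial>LB)"
  using dualPn[of A h "\<bar>1\<bar>" "\<lambda>_. 1" n] bm_const[of 1] by simp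

text \<open>The L1 norm of \<open>(P ^^ n) h\<close> is attained by testing against its own
  sign.\<close>

lemma nrm1_dual:
  assumes h: "bm A h" and le: "\<And>\<psi>. bm 1 \<psi> \<Longrightarrow> \<bar>\<integral>x. h x * \<psi> ((T ^^ n) x) \<partial>LB\<bar> \<le> e"
  shows "nrm1 ((P ^^ n) h) \<le> e"
proof -
  have s: "bm 1 (\<lambda>x. sgn ((P ^^ n) h x))"
    using Pn_meas[OF h] by (auto simp: bm_def sgn_if)
  have "nrm1 ((P ^^ n) h) = (\<integral>x. (P ^^ n) h x * sgn ((P ^^ n) h x) \<partial>LB)"
    unfolding nrm1_def by (intro Bochner_Integration.integral_cong) (auto simp: sgn_if)
  also have "\<dots> = (\<integral>x. h x * sgn ((P ^^ n) h ((T ^^ n) x)) \<partial>LB)" by (rule dualPn[OF h s])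
  also have "\<dots> \<le> e" using le[OF s] by linarith
  finally show ?thesis .
qed

lemma nrm1_Pn: assumes h: "bm A h" shows "nrm1 ((P ^^ n) h) \<le> nrm1 h"
proof (rule nrm1_dual[OF h])
  fix \<psi> assume "bm 1 \<psi>"
  then show "\<bar>\<integral>x. h x * \<psi> ((T ^^ n) x) \<partial>LB\<bar> \<le> nrm1 h"
    using integrable_mult_bm(2)[OF refl bm_integrable[OF h] bm_comp_T[of 1 \<psi> n]] by (simp add: nrm1_def)
qed

text \<open>\<open>step_approx\<close> replaces all \<open>h\<close> by combinations of the same
  finitely many cell indicators with coefficients at most 1. Convergence for these indicators is
  therefore uniform, with a common time \<open>n\<close>; the three thirds of \<open>e\<close> are
  the approximation, the indicators, and the mean of the step function.\<close>

lemma uniform_mixing: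
  assumes e: "0 < e"
  shows "\<exists>n. \<forall>h. sp 1 1 h \<longrightarrow> (\<integral>x. h x \<partial>LB) = 0 \<longrightarrow> nrm1 ((P ^^ n) h) \<le> e"
proof -
  have "(\<lambda>j. r ^ j) \<longlonglongrightarrow> 0" using r_bounds by (intro LIMSEQ_realpow_zero) auto
  then have "eventually (\<lambda>j. r ^ j < e / 3) sequentially" using e by (intro order_tendstoD(2)) auto
  then obtain j where j: "r ^ j < e / 3" by (meson eventually_sequentially order_refl)
  define M where "M = real (card (W j))"
  have "0 < e / (3 * (M + 1))" using e by (simp add: M_def)
  then have "\<exists>n0. (\<forall>n\<ge>n0. \<forall>\<psi>. bm 1 \<psi> \<longrightarrow> \<bar>(\<integral>x. indicator (Z w) x * \<psi> ((T ^^ n) x) \<partial>LB)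
     - (\<integral>x. indicator (Z w) x \<partial>LB) * (\<integral>x. \<psi> x \<partial>\<nu>)\<bar> \<le> e / (3 * (M + 1)))" if "w \<in> W j" for w
    by (intro limit_nonneg[OF bm_indicator[OF Z_sets[OF that]]]) auto
  then have "\<forall>w\<in>W j. \<exists>n0. (\<forall>n\<ge>n0. \<forall>\<psi>. bm 1 \<psi> \<longrightarrow> \<bar>(\<integral>x. indicator (Z w) x * \<psi> ((T ^^ n) x) \<partial>LB)
     - (\<integral>x. indicator (Z w) x \<partial>LB) * (\<integral>x. \<psi> x \<partial>\<nu>)\<bar> \<le> e / (3 * (M + 1)))" by (rule ballI)
  from bchoice[OF this] obtain f where "\<forall>w\<in>W j. (\<forall>n\<ge>f w. \<forall>\<psi>. bm 1 \<psi> \<longrightarrow> \<bar>(\<integral>x. indicator (Z w) x * \<psi> ((T ^^ n) x) \<partial>LB)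
     - (\<integral>x. indicator (Z w) x \<partial>LB) * (\<integral>x. \<psi> x \<partial>\<nu>)\<bar> \<le> e / (3 * (M + 1)))" ..
  then have f: "\<And>w n \<psi>. w \<in> W j \<Longrightarrow> n \<ge> f w \<Longrightarrow> bm 1 \<psi> \<Longrightarrow> \<bar>(\<integral>x. indicator (Z w) x * \<psi> ((T ^^ n) x) \<partial>LB)
     - (\<integral>x. indicator (Z w) x \<partial>LB) * (\<integral>x. \<psi> x \<partial>\<nu>)\<bar> \<le> e / (3 * (M + 1))" by blast
  define n where "n = Max (insert 0 (f ` W j))"
  have fn: "f w \<le> n" if "w \<in> W j" for w unfolding n_def using that by (intro Max_ge) auto
  have "nrm1 ((P ^^ n) h) \<le> e" if h: "sp 1 1 h" and z: "(\<integral>x. h x \<partial>LB) = 0" for h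
  proof (rule nrm1_dual[OF sp_bm[OF h]])
    fix \<psi> assume \<psi>: "bm 1 \<psi>"
    obtain a where a: "\<And>w. w \<in> W j \<Longrightarrow> \<bar>a w\<bar> \<le> 1" "nrm1 (\<lambda>x. h x - (\<Sum>w\<in>W j. a w * indicator (Z w) x)) \<le> 1 * r ^ j"
      using step_approx[OF h, of j] by blast
    define s where "s = (\<lambda>x. \<Sum>w\<in>W j. a w * indicator (Z w) x)"
    have s: "bm (\<Sum>w\<in>W j. \<bar>a w\<bar> * 1) s" unfolding s_def by (intro bm_sum bm_cmult bm_indicator Z_sets)
    note hb = sp_bm[OF h]
    have si: "integrable LB s" "integrable LB h" "integrable LB (\<lambda>x. h x - s x)"
      using bm_integrable[OF s] bm_integrable[OF hb] by auto
    note \<psi>n = bm_comp_T[OF \<psi>, of n]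
    define Q where "Q = (\<integral>x. \<psi> x \<partial>\<nu>)"
    have Q: "\<bar>Q\<bar> \<le> 1" using nu_bound[OF \<psi>] by (simp add: Q_def)
    have iw: "integrable LB (\<lambda>x. a w * (indicator (Z w) x * \<psi> ((T ^^ n) x)))" if "w \<in> W j" for w
      using integrable_mult_bm(1)[OF refl bm_integrable[OF bm_indicator[OF Z_sets[OF that]]] \<psi>n] by simp
    have "(\<integral>x. s x * \<psi> ((T ^^ n) x) \<partial>LB) = (\<Sum>w\<in>W j. a w * (\<integral>x. indicator (Z w) x * \<psi> ((T ^^ n) x) \<partial>LB))"
      unfolding s_def sum_distrib_right mult.assoc using iw by (subst Bochner_Integration.integral_sum) auto
    moreover have "(\<integral>x. s x \<partial>LB) = (\<Sum>w\<in>W j. a w * (\<integral>x. indicator (Z w) x \<partial>LB))"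
      unfolding s_def
      by (subst Bochner_Integration.integral_sum) (auto intro!: integrable_mult_right bm_integrable[OF bm_indicator] Z_sets)
    ultimately have eq: "(\<integral>x. s x * \<psi> ((T ^^ n) x) \<partial>LB) - (\<integral>x. s x \<partial>LB) * Q =
      (\<Sum>w\<in>W j. a w * ((\<integral>x. indicator (Z w) x * \<psi> ((T ^^ n) x) \<partial>LB) - (\<integral>x. indicator (Z w) x \<partial>LB) * Q))"
      by (simp only: sum_distrib_right sum_subtractf right_diff_distrib mult.assoc)
    have "\<bar>(\<integral>x. s x * \<psi> ((T ^^ n) x) \<partial>LB) - (\<integral>x. s x \<partial>LB) * Q\<bar> \<le> (\<Sum>w\<in>W j. \<bar>a w * ((\<integral>x. indicator (Z w) x * \<psi> ((T ^^ n) x) \<partial>LB) - (\<integral>x. indicator (Z w) x \<partial>LB) * Q)\<bar>)"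
      unfolding eq by (rule sum_abs)
    also have "\<dots> \<le> (\<Sum>w\<in>W j. 1 * (e / (3 * (M + 1))))"
    proof (rule sum_mono)
      fix w assume w: "w \<in> W j"
      show "\<bar>a w * ((\<integral>x. indicator (Z w) x * \<psi> ((T ^^ n) x) \<partial>LB) - (\<integral>x. indicator (Z w) x \<partial>LB) * Q)\<bar> \<le> 1 * (e / (3 * (M + 1)))"
        unfolding abs_mult Q_def by (rule mult_mono[OF a(1)[OF w] f[OF w fn[OF w] \<psi>]]) auto
    qed
    also have "\<dots> = M * (e / (3 * (M + 1)))" by (simp add: M_def)
    also have "\<dots> \<le> e / 3"
    proof -
      have "0 \<le> M" by (simp add: M_def)
      then show ?thesis using e by (simp add: field_simps)
    qed
    finally have 1: "\<bar>(\<integral>x. s x * \<psi> ((T ^^ n) x) \<partial>LB) - (\<integral>x. s x \<partial>LB) * Q\<bar> \<le> e / 3" .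
    have d1: "\<bar>\<integral>x. (h x - s x) * \<psi> ((T ^^ n) x) \<partial>LB\<bar> \<le> e / 3"
      using integrable_mult_bm(2)[OF refl si(3) \<psi>n] a(2) j by (simp add: nrm1_def s_def)
    have "\<bar>\<integral>x. h x - s x \<partial>LB\<bar> \<le> e / 3"
    proof -
      have "(\<integral>x. \<bar>h x - s x\<bar> \<partial>LB) \<le> e / 3" using a(2) j unfolding nrm1_def s_def by linarith
      then show ?thesis using integral_abs_bound[of LB "\<lambda>x. h x - s x"] by linarith
    qed
    then have "\<bar>\<integral>x. s x \<partial>LB\<bar> \<le> e / 3" using z si by simp
    then have 2: "\<bar>(\<integral>x. s x \<partial>LB) * Q\<bar> \<le> e / 3"
      using Q mult_mono[of "\<bar>\<integral>x. s x \<partial>LB\<bar>" "e / 3" "\<bar>Q\<bar>" 1] e by (simp add: abs_mult)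
    have "(\<integral>x. h x * \<psi> ((T ^^ n) x) \<partial>LB) = (\<integral>x. (h x - s x) * \<psi> ((T ^^ n) x) + s x * \<psi> ((T ^^ n) x) \<partial>LB)"
      by (simp add: algebra_simps)
    also have "\<dots> = (\<integral>x. (h x - s x) * \<psi> ((T ^^ n) x) \<partial>LB) + (\<integral>x. s x * \<psi> ((T ^^ n) x) \<partial>LB)"
      by (intro Bochner_Integration.integral_add integrable_mult_bm(1)[OF refl _ \<psi>n] si)
    finally show "\<bar>\<integral>x. h x * \<psi> ((T ^^ n) x) \<partial>LB\<bar> \<le> e" using d1 1 2 by linarith
  qed
  then show ?thesis by blast
qed

lemma sp_scale: "sp M M h \<Longrightarrow> 0 < M \<Longrightarrow> sp 1 1 (\<lambda>x. (1 / M) * h x)"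
  using sp_cmult[of M M h "1 / M"] by simp

lemma P_cmult: "P (\<lambda>x. a * h x) = (\<lambda>x. a * P h x)"
  by (auto simp: P_def L1_def sum_distrib_left fun_eq_iff intro!: sum.cong)

lemma Pn_cmult: "(P ^^ n) (\<lambda>x. a * h x) = (\<lambda>x. a * (P ^^ n) h x)"
  by (induction n) (simp_all add: P_cmult)

text \<open>The order of the choices matters: \<open>k\<close> makes the part
  \<open>C3 * D * r ^ k\<close> smaller than 1/4, and only then \<open>uniform_mixing\<close>
  supplies a time at which the L1 norm outweighs the constant \<open>Ck k\<close>. The general
  \<open>M\<close> follows by scaling.\<close>

lemma contraction:
  "\<exists>n0>0. \<forall>M h. sp M M h \<longrightarrow> (\<integral>x. h x \<partial>LB) = 0 \<longrightarrow> sp (M / 2) (M / 2) ((P ^^ n0) h)"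
proof -
  define D where "D = K + 1 + C2"
  have D: "1 \<le> D" using K(1) C2_nonneg by (simp add: D_def)
  have C3: "0 \<le> C3" using K(1) C2_nonneg by (simp add: C3_def)
  have "(\<lambda>k. C3 * D * r ^ k) \<longlonglongrightarrow> C3 * D * 0" using r_bounds by (intro tendsto_mult tendsto_const LIMSEQ_realpow_zero) auto
  then have "eventually (\<lambda>k. C3 * D * r ^ k < 1 / 4) sequentially" by (intro order_tendstoD(2)) auto
  then obtain k where k: "C3 * D * r ^ k < 1 / 4" by (meson eventually_sequentially order_refl)
  define q where "q = (K + C2) * Ck k"
  have q: "0 \<le> q" using K(1) C2_nonneg Ck_nonneg by (simp add: q_def)
  have "0 < 1 / (4 * (q + 1))" using q by simp
  then obtain n where n: "\<And>h. sp 1 1 h \<Longrightarrow> (\<integral>x. h x \<partial>LB) = 0 \<Longrightarrow> nrm1 ((P ^^ n) h) \<le> 1 / (4 * (q + 1))"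
    using uniform_mixing by blast
  \<comment> \<open>The successor ensures a positive number of steps; the L1 norm does not grow
    under one more application of \<open>P\<close>.\<close>
  define n1 where "n1 = Suc n"
  have n1: "nrm1 ((P ^^ n1) h) \<le> 1 / (4 * (q + 1))" if h: "sp 1 1 h" "(\<integral>x. h x \<partial>LB) = 0" for h
    using nrm1_Pn[OF Pn_bm[OF sp_bm[OF h(1)], of n], of 1] n[OF h] by (simp add: n1_def)
  have unit: "sp (1 / 2) (1 / 2) ((P ^^ (k + k + n1)) h)" if h: "sp 1 1 h" "(\<integral>x. h x \<partial>LB) = 0" for h
  proof -
    have "sp D D ((P ^^ n1) h)"
    proof (rule sp_mono[OF Pn_sp[OF h(1)]])
      show "K * 1 \<le> D" using C2_nonneg by (simp add: D_def)
      show "1 * r ^ n1 + C2 * 1 \<le> D" using power_le_one[of r n1] r_bounds K(1) by (simp add: D_def)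
    qed
    from lasota_yorke[OF this, of k]
    have "sp (C3 * r ^ k * D + q * nrm1 ((P ^^ n1) h)) (C3 * r ^ k * D + q * nrm1 ((P ^^ n1) h)) ((P ^^ (k + k + n1)) h)"
      by (simp add: funpow_add q_def)
    moreover have "q * nrm1 ((P ^^ n1) h) \<le> 1 / 4"
    proof -
      have "q * nrm1 ((P ^^ n1) h) \<le> q * (1 / (4 * (q + 1)))" using n1[OF h] q by (rule mult_left_mono)
      also have "\<dots> \<le> 1 / 4" using q by (simp add: field_simps)
      finally show ?thesis .
    qed
    then have "C3 * r ^ k * D + q * nrm1 ((P ^^ n1) h) \<le> 1 / 2" using k by (simp add: mult_ac)
    ultimately show ?thesis by (rule_tac sp_mono) auto
  qed
  have "sp (M / 2) (M / 2) ((P ^^ (k + k + n1)) h)" if h: "sp M M h" "(\<integral>x. h x \<partial>LB) = 0" for M h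
  proof (cases "M = 0")
    case True
    then show ?thesis using Pn_sp[OF h(1), of "k + k + n1"] by simp
  next
    case False
    then have M: "0 < M" using h(1) by (auto simp: sp_def)
    have "sp (1 / 2) (1 / 2) ((P ^^ (k + k + n1)) (\<lambda>x. (1 / M) * h x))"
      using h(2) by (intro unit sp_scale[OF h(1) M]) simp
    then have "sp (1 / 2) (1 / 2) (\<lambda>x. (1 / M) * (P ^^ (k + k + n1)) h x)" unfolding Pn_cmult .
    from sp_cmult[OF this, of M] show ?thesis using M by simp
  qed
  moreover have "0 < k + k + n1" by (simp add: n1_def)
  ultimately show ?thesis by blast
qed

text \<open>The norm is halved every \<open>n0\<close> steps. The factor 2 pays for the remainder
  \<open>n mod n0\<close>, over which \<open>\<Lambda>\<close> loses at most one half.\<close>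

lemma exp_decay_zero_mean:
  "\<exists>\<Lambda>. 0 < \<Lambda> \<and> \<Lambda> < 1 \<and> (\<forall>M h n. sp M M h \<longrightarrow> (\<integral>x. h x \<partial>LB) = 0 \<longrightarrow> nrm1 ((P ^^ n) h) \<le> 2 * M * \<Lambda> ^ n)"
proof -
  obtain n0 where n0: "0 < n0" "\<And>M h. sp M M h \<Longrightarrow> (\<integral>x. h x \<partial>LB) = 0 \<Longrightarrow> sp (M / 2) (M / 2) ((P ^^ n0) h)"
    using contraction by blast
  define \<Lambda> where "\<Lambda> = root n0 (1 / 2)"
  have L: "0 < \<Lambda>" "\<Lambda> < 1" "\<Lambda> ^ n0 = 1 / 2" using n0(1) real_root_lt_1_iff[OF n0(1), of "1/2"] by (auto simp: \<Lambda>_def)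
  have it: "sp (M * (1 / 2) ^ q) (M * (1 / 2) ^ q) ((P ^^ (q * n0)) h)" if h: "sp M M h" "(\<integral>x. h x \<partial>LB) = 0" for M h q
  proof (induction q)
    case 0 then show ?case using h by simp
  next
    case (Suc q)
    have "sp (M * (1 / 2) ^ q / 2) (M * (1 / 2) ^ q / 2) ((P ^^ n0) ((P ^^ (q * n0)) h))"
      using integral_Pn[OF sp_bm[OF h(1)], of "q * n0"] h(2) by (intro n0(2) Suc) simp
    then show ?case by (simp add: funpow_add)
  qed
  have "nrm1 ((P ^^ n) h) \<le> 2 * M * \<Lambda> ^ n" if h: "sp M M h" "(\<integral>x. h x \<partial>LB) = 0" for M h n
  proof -
    have M: "0 \<le> M" using h(1) by (simp add: sp_def)
    define q where "q = n div n0"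
    have nq: "n = n mod n0 + q * n0" by (simp add: q_def)
    have s: "sp (M * (1 / 2) ^ q) (M * (1 / 2) ^ q) ((P ^^ (q * n0)) h)" by (rule it[OF h])
    have "nrm1 ((P ^^ n) h) \<le> nrm1 ((P ^^ (q * n0)) h)"
      using nrm1_Pn[OF sp_bm[OF s], of "n mod n0"] by (subst nq) (simp add: funpow_add)
    also have "\<dots> \<le> M * (1 / 2) ^ q"
      using bm_integral_bound[OF bm_abs[OF sp_bm[OF s]]] by (simp add: nrm1_def)
    also have "\<dots> = 2 * M * ((1 / 2) * (1 / 2) ^ q)" by simp
    also have "\<dots> \<le> 2 * M * \<Lambda> ^ n"
    proof (rule mult_left_mono)
      have "1 / 2 \<le> \<Lambda> ^ (n mod n0)"
        using power_decreasing[of "n mod n0" n0 \<Lambda>] L n0(1) by (auto intro: less_imp_le)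
      moreover have "\<Lambda> ^ (q * n0) = (1 / 2) ^ q" using L(3) by (metis power_mult mult.commute)
      ultimately have "1 / 2 * (1 / 2) ^ q \<le> \<Lambda> ^ (n mod n0) * \<Lambda> ^ (q * n0)" by (simp add: mult_right_mono)
      then show "1 / 2 * (1 / 2) ^ q \<le> \<Lambda> ^ n" using nq by (metis power_add)
    qed (use M in simp)
    finally show ?thesis .
  qed
  then show ?thesis using L by blast
qed

lemma one_sp: "sp 1 0 (\<lambda>_. 1)"
  using sp_const[of 1] by simp

text \<open>Split \<open>h\<close> into its mean and a part of zero mean. For the constant density
  1, the difference of \<open>(P ^^ n0) (\<lambda>_. 1)\<close> and 1 has zero mean and constants
  independent of \<open>n0\<close>; so the integrals of \<psi> at times \<open>n\<close> and
  \<open>n + n0\<close> are exponentially close in \<open>n\<close>, while for large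
  \<open>n0\<close> the latter approaches the \<nu>-integral by \<open>limit_nonneg\<close>.\<close>

lemma exp_decay_LB:
  "\<exists>\<Lambda> C. 0 < \<Lambda> \<and> \<Lambda> < 1 \<and> 0 < C \<and> (\<forall>A B D h \<psi> n. sp A B h \<longrightarrow> bm D \<psi> \<longrightarrow>
    \<bar>(\<integral>x. h x * \<psi> ((T ^^ n) x) \<partial>LB) - (\<integral>x. h x \<partial>LB) * (\<integral>x. \<psi> x \<partial>\<nu>)\<bar> \<le> C * \<Lambda> ^ n * (A + B) * D)"
proof -
  obtain \<Lambda> where L: "0 < \<Lambda>" "\<Lambda> < 1"
    and dec: "\<And>M h n. sp M M h \<Longrightarrow> (\<integral>x. h x \<partial>LB) = 0 \<Longrightarrow> nrm1 ((P ^^ n) h) \<le> 2 * M * \<Lambda> ^ n"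
    using exp_decay_zero_mean by blast
  have zero: "\<bar>\<integral>x. h x * \<psi> ((T ^^ n) x) \<partial>LB\<bar> \<le> 2 * M * \<Lambda> ^ n * D"
    if h: "sp M M h" "(\<integral>x. h x \<partial>LB) = 0" and \<psi>: "bm D \<psi>" for M h n D \<psi>
  proof -
    have "\<bar>\<integral>x. h x * \<psi> ((T ^^ n) x) \<partial>LB\<bar> = \<bar>\<integral>x. (P ^^ n) h x * \<psi> x \<partial>LB\<bar>"
      using dualPn[OF sp_bm[OF h(1)] \<psi>] by simp
    also have "\<dots> \<le> D * nrm1 ((P ^^ n) h)"
      unfolding nrm1_def by (rule integrable_mult_bm(2)[OF refl bm_integrable[OF Pn_bm[OF sp_bm[OF h(1)]]] \<psi>])
    also have "\<dots> \<le> D * (2 * M * \<Lambda> ^ n)" using dec[OF h] bm_nonneg[OF \<psi>] by (rule mult_left_mono)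
    finally show ?thesis by (simp add: mult_ac)
  qed
  define E where "E = K + 1 + C2"
  have E: "1 \<le> E" using K(1) C2_nonneg by (simp add: E_def)
  have lead: "\<bar>(\<integral>x. \<psi> ((T ^^ n) x) \<partial>LB) - (\<integral>x. \<psi> x \<partial>\<nu>)\<bar> \<le> 2 * E * \<Lambda> ^ n * D" if \<psi>: "bm D \<psi>" for n D \<psi>
  proof (rule field_le_epsilon)
    fix e :: real assume e: "0 < e"
    have D: "0 \<le> D" by (rule bm_nonneg[OF \<psi>])
    have oneb: "bm 1 (\<lambda>_. 1)" by (rule sp_bm[OF one_sp])
    have "0 < e / (D + 1)" using e D by simp
    then obtain n0 where n0: "\<And>n \<psi>. n \<ge> n0 \<Longrightarrow> bm 1 \<psi> \<Longrightarrow> \<bar>(\<integral>x. 1 * \<psi> ((T ^^ n) x) \<partial>LB) - (\<integral>x. 1 \<partial>LB) * (\<integral>x. \<psi> x \<partial>\<nu>)\<bar> \<le> e / (D + 1)"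
      using limit_nonneg[OF oneb] by (metis zero_le_one)
    \<comment> \<open>\<open>limit_nonneg\<close> is uniform over test functions bounded by 1; the
      divisor \<open>D + 1\<close> also covers \<open>D = 0\<close>.\<close>
    have \<psi>1: "bm 1 (\<lambda>x. (1 / (D + 1)) * \<psi> x)"
      by (rule bm_mono[OF bm_cmult[OF \<psi>]]) (use D in \<open>simp add: field_simps\<close>)
    have "\<bar>(1 / (D + 1)) * ((\<integral>x. \<psi> ((T ^^ (n + n0)) x) \<partial>LB) - (\<integral>x. \<psi> x \<partial>\<nu>))\<bar> \<le> e / (D + 1)"
      using n0[OF _ \<psi>1, of "n + n0"] by (simp add: diff_divide_distrib)
    then have 1: "\<bar>(\<integral>x. \<psi> ((T ^^ (n + n0)) x) \<partial>LB) - (\<integral>x. \<psi> x \<partial>\<nu>)\<bar> \<le> e"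
      using D by (simp add: abs_mult divide_le_cancel abs_divide)
    define u where "u = (\<lambda>x. (P ^^ n0) (\<lambda>_. 1) x + (- 1) * 1)"
    have P1: "sp K C2 ((P ^^ n0) (\<lambda>_. 1))" using Pn_sp[OF one_sp, of n0] by simp
    have "sp (K + \<bar>- 1\<bar> * 1) (C2 + \<bar>- 1\<bar> * 0) u" unfolding u_def by (intro sp_add P1 sp_cmult[OF one_sp])
    then have u: "sp E E u" using K(1) C2_nonneg by (rule_tac sp_mono) (auto simp: E_def)
    have P1i: "integrable LB ((P ^^ n0) (\<lambda>_. 1))" by (rule sp_integrable[OF P1])
    have u0: "(\<integral>x. u x \<partial>LB) = 0"
      using integral_Pn[OF oneb, of n0] P1i bm_integrable[OF oneb] unfolding u_def by (subst Bochner_Integration.integral_add) auto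
    have "(\<integral>x. u x * \<psi> ((T ^^ n) x) \<partial>LB) = (\<integral>x. (P ^^ n0) (\<lambda>_. 1) x * \<psi> ((T ^^ n) x) - \<psi> ((T ^^ n) x) \<partial>LB)"
      by (simp add: u_def algebra_simps)
    also have "\<dots> = (\<integral>x. (P ^^ n0) (\<lambda>_. 1) x * \<psi> ((T ^^ n) x) \<partial>LB) - (\<integral>x. \<psi> ((T ^^ n) x) \<partial>LB)"
      by (intro Bochner_Integration.integral_diff integrable_mult_bm(1)[OF refl P1i bm_comp_T[OF \<psi>]] bm_integrable[OF bm_comp_T[OF \<psi>]])
    also have "(\<integral>x. (P ^^ n0) (\<lambda>_. 1) x * \<psi> ((T ^^ n) x) \<partial>LB) = (\<integral>x. \<psi> ((T ^^ (n + n0)) x) \<partial>LB)"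
      using dualPn[OF oneb bm_comp_T[OF \<psi>, of n], of n0] by (simp add: funpow_add)
    finally have "\<bar>(\<integral>x. \<psi> ((T ^^ (n + n0)) x) \<partial>LB) - (\<integral>x. \<psi> ((T ^^ n) x) \<partial>LB)\<bar> \<le> 2 * E * \<Lambda> ^ n * D"
      using zero[OF u u0 \<psi>, of n] by simp
    then show "\<bar>(\<integral>x. \<psi> ((T ^^ n) x) \<partial>LB) - (\<integral>x. \<psi> x \<partial>\<nu>)\<bar> \<le> 2 * E * \<Lambda> ^ n * D + e" using 1 by linarith
  qed
  define C where "C = 4 + 2 * E"
  have "\<bar>(\<integral>x. h x * \<psi> ((T ^^ n) x) \<partial>LB) - (\<integral>x. h x \<partial>LB) * (\<integral>x. \<psi> x \<partial>\<nu>)\<bar> \<le> C * \<Lambda> ^ n * (A + B) * D"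
    if h: "sp A B h" and \<psi>: "bm D \<psi>" for A B D h \<psi> n
  proof -
    note hb = sp_bm[OF h]
    have AB: "0 \<le> A" "0 \<le> B" "0 \<le> D" using bm_nonneg[OF hb] bm_nonneg[OF \<psi>] h by (auto simp: sp_def)
    define c where "c = (\<integral>x. h x \<partial>LB)"
    have c: "\<bar>c\<bar> \<le> A" using bm_integral_bound[OF hb] by (simp add: c_def)
    define h0 where "h0 = (\<lambda>x. h x + (- c) * 1)"
    have "sp (A + \<bar>- c\<bar> * 1) (B + \<bar>- c\<bar> * 0) h0" unfolding h0_def by (intro sp_add h sp_cmult[OF one_sp])
    then have h0: "sp (2 * (A + B)) (2 * (A + B)) h0" using c AB by (rule_tac sp_mono) auto
    have i: "integrable LB h" by (rule bm_integrable[OF hb])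
    have z: "(\<integral>x. h0 x \<partial>LB) = 0"
      unfolding h0_def using i bm_integrable[OF bm_const[of "- c * 1"]] by (subst Bochner_Integration.integral_add) (auto simp: c_def)
    have "(\<integral>x. h0 x * \<psi> ((T ^^ n) x) \<partial>LB) = (\<integral>x. h x * \<psi> ((T ^^ n) x) - c * \<psi> ((T ^^ n) x) \<partial>LB)"
      by (simp add: h0_def algebra_simps)
    also have "\<dots> = (\<integral>x. h x * \<psi> ((T ^^ n) x) \<partial>LB) - (\<integral>x. c * \<psi> ((T ^^ n) x) \<partial>LB)"
      by (intro Bochner_Integration.integral_diff integrable_mult_bm(1)[OF refl i bm_comp_T[OF \<psi>]] bm_integrable[OF bm_cmult[OF bm_comp_T[OF \<psi>]]])
    finally have 1: "\<bar>(\<integral>x. h x * \<psi> ((T ^^ n) x) \<partial>LB) - c * (\<integral>x. \<psi> ((T ^^ n) x) \<partial>LB)\<bar> \<le> 4 * (A + B) * \<Lambda> ^ n * D"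
      using zero[OF h0 z \<psi>, of n] by simp
    have "\<bar>c * (\<integral>x. \<psi> ((T ^^ n) x) \<partial>LB) - c * (\<integral>x. \<psi> x \<partial>\<nu>)\<bar> \<le> (A + B) * (2 * E * \<Lambda> ^ n * D)"
      unfolding right_diff_distrib[symmetric] abs_mult using lead[OF \<psi>, of n] c AB by (intro mult_mono) auto
    then show ?thesis using 1 unfolding c_def[symmetric] C_def by (simp add: algebra_simps)
  qed
  moreover have "0 < C" using E by (simp add: C_def)
  ultimately show ?thesis using L by blast
qed

text \<open>The density \<rho> is known here only as an integrable function. Integrals against \<nu>
  are therefore obtained as limits of integrals against \<open>(P ^^ k) (\<lambda>_. 1)\<close>,
  whose constants \<open>K\<close> and \<open>C2\<close> do not depend on \<open>k\<close>; products
  with \<open>h\<close> stay in the class by \<open>sp_mult\<close>.\<close>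

lemma exp_decay_nu:
  "\<exists>\<Lambda> C. 0 < \<Lambda> \<and> \<Lambda> < 1 \<and> 0 < C \<and>
    (\<forall>A B D h \<psi> n. sp A B h \<longrightarrow> bm D \<psi> \<longrightarrow> \<bar>corr h n \<psi>\<bar> \<le> C * \<Lambda> ^ n * (A + B) * D) \<and>
    (\<forall>D \<psi> n. bm D \<psi> \<longrightarrow> \<bar>(\<integral>x. \<psi> ((T ^^ n) x) \<partial>LB) - (\<integral>x. \<psi> x \<partial>\<nu>)\<bar> \<le> C * \<Lambda> ^ n * D)"
proof -
  obtain \<Lambda> C where L: "0 < \<Lambda>" "\<Lambda> < 1" "0 < C" and dec: "\<And>A B D h \<psi> n. sp A B h \<Longrightarrow> bm D \<psi> \<Longrightarrow>
    \<bar>(\<integral>x. h x * \<psi> ((T ^^ n) x) \<partial>LB) - (\<integral>x. h x \<partial>LB) * (\<integral>x. \<psi> x \<partial>\<nu>)\<bar> \<le> C * \<Lambda> ^ n * (A + B) * D"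
    using exp_decay_LB by blast
  have lead: "\<bar>(\<integral>x. \<psi> ((T ^^ n) x) \<partial>LB) - (\<integral>x. \<psi> x \<partial>\<nu>)\<bar> \<le> C * \<Lambda> ^ n * D" if \<psi>: "bm D \<psi>" for n D \<psi>
    using dec[OF one_sp \<psi>, of n] by simp
  define C' where "C' = C * (K + C2)"
  have C': "0 < C'" using L(3) K(1) C2_nonneg by (simp add: C'_def)
  have main: "\<bar>corr h n \<psi>\<bar> \<le> C' * \<Lambda> ^ n * (A + B) * D" if h: "sp A B h" and \<psi>: "bm D \<psi>" for A B D h \<psi> n
  proof -
    note hb = sp_bm[OF h]
    have AB: "0 \<le> A" "0 \<le> B" "0 \<le> D" using bm_nonneg[OF hb] bm_nonneg[OF \<psi>] h by (auto simp: sp_def)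
    define Q where "Q = (\<integral>x. \<psi> x \<partial>\<nu>)"
    have Q: "\<bar>Q\<bar> \<le> D" using nu_bound[OF \<psi>] by (simp add: Q_def)
    define \<Psi> where "\<Psi> = (\<lambda>x. h x * \<psi> ((T ^^ n) x))"
    have Psi: "bm (A * D) \<Psi>" unfolding \<Psi>_def by (intro bm_mult hb bm_comp_T \<psi>)
    have oneb: "bm 1 (\<lambda>_. 1)" by (rule sp_bm[OF one_sp])
    have step: "\<bar>corr h n \<psi>\<bar> \<le> C' * \<Lambda> ^ n * (A + B) * D + (2 * C * A * D) * \<Lambda> ^ k" for k
    proof -
      define p1 where "p1 = (P ^^ k) (\<lambda>_. 1)"
      have p1: "sp K C2 p1" unfolding p1_def using Pn_sp[OF one_sp, of k] by simp
      have ph: "sp (K * A) (C2 * A + K * B) (\<lambda>x. p1 x * h x)" by (rule sp_mult[OF p1 h])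
      have a: "\<bar>(\<integral>x. \<Psi> ((T ^^ k) x) \<partial>LB) - (\<integral>x. \<Psi> x \<partial>\<nu>)\<bar> \<le> C * \<Lambda> ^ k * (A * D)" by (rule lead[OF Psi])
      have b: "(\<integral>x. \<Psi> ((T ^^ k) x) \<partial>LB) = (\<integral>x. p1 x * h x * \<psi> ((T ^^ n) x) \<partial>LB)"
        using dualPn[OF oneb Psi, of k] by (simp add: p1_def \<Psi>_def mult.assoc)
      have c: "\<bar>(\<integral>x. p1 x * h x * \<psi> ((T ^^ n) x) \<partial>LB) - (\<integral>x. p1 x * h x \<partial>LB) * Q\<bar> \<le> C * \<Lambda> ^ n * (K * A + (C2 * A + K * B)) * D"
        unfolding Q_def by (rule dec[OF ph \<psi>])
      have "(K * A + (C2 * A + K * B)) \<le> (K + C2) * (A + B)" using AB C2_nonneg by (simp add: algebra_simps)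
      then have c': "C * \<Lambda> ^ n * (K * A + (C2 * A + K * B)) * D \<le> C' * \<Lambda> ^ n * (A + B) * D"
        using L AB by (auto simp: C'_def mult_ac intro!: mult_left_mono mult_right_mono)
      have "(\<integral>x. p1 x * h x \<partial>LB) = (\<integral>x. h ((T ^^ k) x) \<partial>LB)"
        using dualPn[OF oneb hb, of k] by (simp add: p1_def)
      then have "\<bar>(\<integral>x. p1 x * h x \<partial>LB) - (\<integral>x. h x \<partial>\<nu>)\<bar> \<le> C * \<Lambda> ^ k * A" using lead[OF hb, of k] by simp
      then have "\<bar>(\<integral>x. p1 x * h x \<partial>LB) - (\<integral>x. h x \<partial>\<nu>)\<bar> * \<bar>Q\<bar> \<le> (C * \<Lambda> ^ k * A) * D"
        using Q by (intro mult_mono) auto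
      then have d: "\<bar>(\<integral>x. p1 x * h x \<partial>LB) * Q - (\<integral>x. h x \<partial>\<nu>) * Q\<bar> \<le> C * \<Lambda> ^ k * A * D"
        by (simp add: abs_mult[symmetric] left_diff_distrib)
      have e: "corr h n \<psi> = (\<integral>x. \<Psi> x \<partial>\<nu>) - (\<integral>x. h x \<partial>\<nu>) * Q" by (simp add: corr_def \<Psi>_def Q_def)
      have "2 * C * A * D * \<Lambda> ^ k = C * \<Lambda> ^ k * (A * D) + C * \<Lambda> ^ k * A * D" by simp
      then show ?thesis using a c c' d unfolding e b by linarith
    qed
    have "(\<lambda>k. C' * \<Lambda> ^ n * (A + B) * D + (2 * C * A * D) * \<Lambda> ^ k) \<longlonglongrightarrow> C' * \<Lambda> ^ n * (A + B) * D + (2 * C * A * D) * 0"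
      using L by (intro tendsto_intros LIMSEQ_realpow_zero) auto
    then show ?thesis using step by (intro LIMSEQ_le_const[where X = "\<lambda>k. C' * \<Lambda> ^ n * (A + B) * D + (2 * C * A * D) * \<Lambda> ^ k"]) auto
  qed
  have "C \<le> C'" using L(3) K(1) C2_nonneg by (simp add: C'_def)
  have lead': "\<bar>(\<integral>x. \<psi> ((T ^^ n) x) \<partial>LB) - (\<integral>x. \<psi> x \<partial>\<nu>)\<bar> \<le> C' * \<Lambda> ^ n * D" if \<psi>: "bm D \<psi>" for n D \<psi>
  proof -
    have "C * \<Lambda> ^ n * D \<le> C' * \<Lambda> ^ n * D" using \<open>C \<le> C'\<close> L bm_nonneg[OF \<psi>] by (intro mult_right_mono) auto
    then show ?thesis using lead[OF \<psi>, of n] by linarith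
  qed
  show ?thesis using L C' main lead' by blast
qed

end

subsection \<open>The skew product\<close>

abbreviation QB :: "(real \<times> real) measure" where "QB \<equiv> restrict_space borel unit_square"

lemma space_QB [simp]: "space QB = unit_square"
  by (simp add: space_restrict_space)

text \<open>Jordan decomposition: with \<open>v\<close> the variation up to \<open>t\<close>, both
  \<open>v\<close> and \<open>v + f\<close> are monotone, hence Borel.\<close>

lemma bounded_variation_measurable:
  fixes f :: "real \<Rightarrow> real"
  assumes bv: "\<And>x k. mono_on {1..k} x \<Longrightarrow> x ` {1..k} \<subseteq> {0..1} \<Longrightarrow> (\<Sum>i = 1..<k. \<bar>f (x i) - f (x (Suc i))\<bar>) \<le> C"
  shows "f \<in> borel_measurable (restrict_space borel {0..1})"
proof -
  define S where "S = (\<lambda>t. {(\<Sum>i = 1..<k. \<bar>f (x i) - f (x (Suc i))\<bar>) | x k. mono_on {1..k} x \<and> x ` {1..k} \<subseteq> {0..t}})"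
  define v where "v = (\<lambda>t. Sup (S t))"
  have bdd: "bdd_above (S t)" if "t \<le> 1" for t
  proof (rule bdd_aboveI)
    fix s assume "s \<in> S t"
    then obtain x k where "s = (\<Sum>i = 1..<k. \<bar>f (x i) - f (x (Suc i))\<bar>)" "mono_on {1..k} x" "x ` {1..k} \<subseteq> {0..t}"
      by (auto simp: S_def)
    then show "s \<le> C" using bv[of k x] that by fastforce
  qed
  have ne: "S t \<noteq> {}" for t
  proof -
    have "(\<Sum>i = 1..<0. \<bar>f ((\<lambda>_. 0) i) - f ((\<lambda>_. 0) (Suc i))\<bar>) \<in> S t"
      unfolding S_def by (intro CollectI exI[of _ "\<lambda>_. 0"] exI[of _ "0::nat"]) (auto simp: mono_on_def)
    then show ?thesis by blast
  qed
  have key: "v s + \<bar>f s - f t\<bar> \<le> v t" if st: "0 \<le> s" "s \<le> t" "t \<le> 1" for s t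
  proof -
    have "a \<le> v t - \<bar>f s - f t\<bar>" if "a \<in> S s" for a
    proof -
      obtain x k where a: "a = (\<Sum>i = 1..<k. \<bar>f (x i) - f (x (Suc i))\<bar>)" and x: "mono_on {1..k} x" "x ` {1..k} \<subseteq> {0..s}"
        using \<open>a \<in> S s\<close> by (auto simp: S_def)
      \<comment> \<open>The subdivision is prolonged by \<open>s\<close> and \<open>t\<close>. The
        connecting step from its last point to \<open>s\<close> is dropped below, so the empty
        subdivision needs no separate case.\<close>
      define y where "y = (\<lambda>i. if i \<le> k then x i else if i = Suc k then s else t)"
      have xr: "0 \<le> x i" "x i \<le> s" if "1 \<le> i" "i \<le> k" for i using x(2) that by (auto simp: image_subset_iff)
      have "mono_on {1..k + 2} y"
        using st x(1) xr by (intro mono_onI) (force simp: y_def mono_on_def)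
      moreover have "y ` {1..k + 2} \<subseteq> {0..t}"
      proof
        fix z assume "z \<in> y ` {1..k + 2}"
        then obtain i where "1 \<le> i" "z = y i" by auto
        then show "z \<in> {0..t}" using st xr[of i] by (auto simp: y_def)
      qed
      ultimately have "(\<Sum>i = 1..<k + 2. \<bar>f (y i) - f (y (Suc i))\<bar>) \<in> S t" unfolding S_def by blast
      then have le: "(\<Sum>i = 1..<k + 2. \<bar>f (y i) - f (y (Suc i))\<bar>) \<le> v t"
        unfolding v_def using bdd[of t] st by (intro cSup_upper) auto
      have "a + \<bar>f s - f t\<bar> = (\<Sum>i = 1..<k. \<bar>f (y i) - f (y (Suc i))\<bar>) + \<bar>f (y (k + 1)) - f (y (Suc (k + 1)))\<bar>"
        unfolding a by (intro arg_cong2[where f = "(+)"] sum.cong) (auto simp: y_def)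
      also have "\<dots> = (\<Sum>i\<in>{1..<k} \<union> {k + 1}. \<bar>f (y i) - f (y (Suc i))\<bar>)"
        by (subst sum.union_disjoint) auto
      also have "\<dots> \<le> (\<Sum>i = 1..<k + 2. \<bar>f (y i) - f (y (Suc i))\<bar>)"
        by (intro sum_mono2) auto
      finally show ?thesis using le by linarith
    qed
    then have "v s \<le> v t - \<bar>f s - f t\<bar>" unfolding v_def[of ] by (intro cSup_least ne) (auto simp: v_def)
    then show ?thesis by linarith
  qed
  have "mono_on {0..1} v" "mono_on {0..1} (\<lambda>t. v t + f t)"
    using key by (auto intro!: mono_onI) (smt (verit))+
  then have "v \<in> borel_measurable (restrict_space borel {0..1})" "(\<lambda>t. v t + f t) \<in> borel_measurable (restrict_space borel {0..1})"
    by (auto intro: borel_measurable_mono_on_fnc)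
  then have "(\<lambda>t. (v t + f t) - v t) \<in> borel_measurable (restrict_space borel {0..1})"
    by (rule borel_measurable_diff[rotated])
  then show ?thesis by simp
qed

locale skew = pw_mixing +
  fixes F :: "real \<times> real \<Rightarrow> real \<times> real" and G :: "real \<times> real \<Rightarrow> real" and l VG :: real
  assumes F_maps: "\<And>q. q \<in> unit_square \<Longrightarrow> F q \<in> unit_square"
    and F_form: "\<And>x y. x \<in> {0..1} \<Longrightarrow> y \<in> {0..1} \<Longrightarrow> F (x, y) = (T x, G (x, y))"
    and l_bounds: "0 \<le> l" "l < 1"
    and leaf: "\<And>x y y'. x \<in> {0..1} \<Longrightarrow> y \<in> {0..1} \<Longrightarrow> y' \<in> {0..1} \<Longrightarrow> \<bar>G (x, y) - G (x, y')\<bar> \<le> l * \<bar>y - y'\<bar>"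
    and G_var: "\<And>a b k. mono_on {1..k} a \<Longrightarrow> a ` {1..k} \<subseteq> {0..1} \<Longrightarrow> b ` {1..k} \<subseteq> {0..1} \<Longrightarrow>
      (\<Sum>i = 1..<(k::nat). \<bar>G (a i, b i) - G (a (Suc i), b i)\<bar>) \<le> VG"
begin

lemma G_range: "x \<in> {0..1} \<Longrightarrow> y \<in> {0..1} \<Longrightarrow> G (x, y) \<in> {0..1}"
  using F_maps[of "(x, y)"] F_form[of x y] by auto

lemma G_slice: "y \<in> {0..1} \<Longrightarrow> (\<lambda>x. G (x, y)) \<in> borel_measurable (restrict_space borel {0..1})"
proof -
  assume y: "y \<in> {0..1}"
  show ?thesis
  proof (rule bounded_variation_measurable[where C = VG])
    fix a :: "nat \<Rightarrow> real" and k assume a: "mono_on {1..k} a" "a ` {1..k} \<subseteq> {0..1}"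
    have "(\<lambda>_. y) ` {1..k} \<subseteq> {0..1}" using y by blast
    from G_var[OF a this] show "(\<Sum>i = 1..<k. \<bar>G (a i, y) - G (a (Suc i), y)\<bar>) \<le> VG" .
  qed
qed

lemma QB_fst: "fst \<in> QB \<rightarrow>\<^sub>M restrict_space borel {0..1}" and QB_snd: "snd \<in> borel_measurable QB"
proof -
  have b: "fst \<in> borel_measurable QB" "snd \<in> borel_measurable QB"
    by (intro borel_measurable_continuous_on_restrict continuous_intros)+
  show "snd \<in> borel_measurable QB" by (rule b)
  show "fst \<in> QB \<rightarrow>\<^sub>M restrict_space borel {0..1}"
    using b(1) by (intro measurable_restrict_space2) auto
qed

text \<open>Slices in x are Borel by bounded variation, and \<open>G\<close> is Lipschitz in y;
  rounding y down to multiples of \<open>1 / real (Suc n)\<close> gives measurable approximations.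
  The index \<open>k = Suc n\<close> takes care of y = 1.\<close>

lemma G_meas: "G \<in> borel_measurable QB"
proof -
  define Gn where "Gn = (\<lambda>n q. \<Sum>k\<le>Suc n. (if \<lfloor>real (Suc n) * snd q\<rfloor> = int k then G (fst q, real k / real (Suc n)) else 0))"
  have m: "Gn n \<in> borel_measurable QB" for n
    unfolding Gn_def
  proof (rule borel_measurable_sum)
    fix k assume k: "k \<in> {..Suc n}"
    have y: "real k / real (Suc n) \<in> {0..1}" using k by (auto simp: divide_le_eq_1)
    have g: "(\<lambda>q. G (fst q, real k / real (Suc n))) \<in> borel_measurable QB"
      by (rule measurable_compose[OF QB_fst G_slice[OF y]])
    have s: "(\<lambda>q. real (Suc n) * snd q) \<in> borel_measurable QB" using QB_snd by (intro borel_measurable_times) auto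
    have "{q \<in> space QB. \<lfloor>real (Suc n) * snd q\<rfloor> = int k} = {q \<in> space QB. real k \<le> real (Suc n) * snd q \<and> real (Suc n) * snd q < real k + 1}"
      by (auto simp: floor_eq_iff)
    also have "\<dots> \<in> sets QB" using s by measurable
    finally show "(\<lambda>q. if \<lfloor>real (Suc n) * snd q\<rfloor> = int k then G (fst q, real k / real (Suc n)) else 0) \<in> borel_measurable QB"
      using g by (intro measurable_If) auto
  qed
  have val: "\<bar>Gn n (x, y) - G (x, y)\<bar> \<le> 1 / real (Suc n)" if xy: "x \<in> {0..1}" "y \<in> {0..1}" for n x y
  proof -
    define k where "k = nat \<lfloor>real (Suc n) * y\<rfloor>"
    have fl: "\<lfloor>real (Suc n) * y\<rfloor> = int k" using xy by (simp add: k_def)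
    have kb: "real k \<le> real (Suc n) * y" "real (Suc n) * y < real k + 1" using fl by linarith+
    have "real (Suc n) * y \<le> real (Suc n) * 1" using xy by (intro mult_left_mono) auto
    from order_trans[OF kb(1) this] have "real k \<le> real (Suc n)" by (simp only: mult_1_right)
    then have kn: "k \<le> Suc n" by (rule of_nat_le_iff[THEN iffD1])
    have "Gn n (x, y) = (\<Sum>j\<le>Suc n. if j = k then G (x, real k / real (Suc n)) else 0)"
      unfolding Gn_def fst_conv snd_conv fl by (intro sum.cong) auto
    also have "\<dots> = G (x, real k / real (Suc n))" using kn by (subst sum.delta) auto
    finally have e: "Gn n (x, y) = G (x, real k / real (Suc n))" .
    have "\<bar>real k / real (Suc n) - y\<bar> = \<bar>real k - real (Suc n) * y\<bar> / real (Suc n)"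
      by (simp del: of_nat_Suc add: field_simps)
    also have "\<dots> \<le> 1 / real (Suc n)" using kb by (intro divide_right_mono) auto
    finally have d: "\<bar>real k / real (Suc n) - y\<bar> \<le> 1 / real (Suc n)" .
    have "\<bar>Gn n (x, y) - G (x, y)\<bar> \<le> l * \<bar>real k / real (Suc n) - y\<bar>"
      unfolding e using kn xy by (intro leaf) (auto simp: divide_le_eq_1)
    also have "\<dots> \<le> 1 * \<bar>real k / real (Suc n) - y\<bar>" using l_bounds by (intro mult_right_mono) auto
    finally show ?thesis using d by simp
  qed
  show ?thesis
  proof (rule borel_measurable_LIMSEQ_real[OF _ m])
    fix q assume "q \<in> space QB"
    then obtain x y where q: "q = (x, y)" "x \<in> {0..1}" "y \<in> {0..1}" by auto
    have "(\<lambda>n. Gn n q - G q) \<longlonglongrightarrow> 0"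
    proof (rule Lim_null_comparison)
      show "eventually (\<lambda>n. norm (Gn n q - G q) \<le> 1 / real (Suc n)) sequentially"
        using val[OF q(2,3)] q(1) by simp
      show "(\<lambda>n. 1 / real (Suc n)) \<longlonglongrightarrow> 0" using LIMSEQ_Suc[OF lim_1_over_n] by simp
    qed
    then show "(\<lambda>n. Gn n q) \<longlonglongrightarrow> G q" by (simp add: LIM_zero_iff)
  qed
qed

lemma F_meas: "F \<in> QB \<rightarrow>\<^sub>M QB"
proof (rule measurable_restrict_space2)
  show "F \<in> space QB \<rightarrow> unit_square" using F_maps by auto
  have "(\<lambda>q. (T (fst q), G q)) \<in> QB \<rightarrow>\<^sub>M borel \<Otimes>\<^sub>M borel"
  proof (rule measurable_Pair[OF _ G_meas])
    have "T \<in> borel_measurable (restrict_space borel {0..1})"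
      using T_meas unfolding measurable_cong_sets[OF sets_LB sets_LB] by (simp add: measurable_restrict_space2_iff)
    then show "(\<lambda>q. T (fst q)) \<in> borel_measurable QB" by (rule measurable_compose[OF QB_fst])
  qed
  then have "(\<lambda>q. (T (fst q), G q)) \<in> borel_measurable QB" by (simp add: borel_prod)
  then show "F \<in> borel_measurable QB"
    by (rule measurable_cong[THEN iffD1, rotated]) (use F_form in auto)
qed

lemma Fn_meas: "F ^^ n \<in> QB \<rightarrow>\<^sub>M QB"
  using F_meas by (induction n) (auto intro: measurable_comp)

lemma Fn_maps: "q \<in> unit_square \<Longrightarrow> (F ^^ n) q \<in> unit_square"
  using F_maps by (induction n) auto

lemma Fn_fst: "q \<in> unit_square \<Longrightarrow> fst ((F ^^ n) q) = (T ^^ n) (fst q)"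
proof (induction n)
  case (Suc n)
  obtain x y where xy: "(F ^^ n) q = (x, y)" "x \<in> {0..1}" "y \<in> {0..1}" using Fn_maps[OF Suc.prems, of n] by auto
  then show ?case using Suc F_form[of x y] by simp
qed simp

lemma Fn_Suc_snd: "q \<in> unit_square \<Longrightarrow> snd ((F ^^ Suc n) q) = G ((T ^^ n) (fst q), snd ((F ^^ n) q))"
proof -
  assume q: "q \<in> unit_square"
  obtain x y where xy: "(F ^^ n) q = (x, y)" "x \<in> {0..1}" "y \<in> {0..1}" using Fn_maps[OF q, of n] by auto
  then show ?thesis using Fn_fst[OF q, of n] F_form[of x y] by simp
qed

lemma Fn_contract:
  assumes x: "x \<in> {0..1}" and y: "y \<in> {0..1}" "y' \<in> {0..1}"
  shows "\<bar>snd ((F ^^ n) (x, y)) - snd ((F ^^ n) (x, y'))\<bar> \<le> l ^ n"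
proof (induction n)
  case 0 then show ?case using y by auto
next
  case (Suc n)
  have q: "(x, y) \<in> unit_square" "(x, y') \<in> unit_square" using x y by auto
  have s: "snd ((F ^^ n) (x, y)) \<in> {0..1}" "snd ((F ^^ n) (x, y')) \<in> {0..1}"
    using Fn_maps[OF q(1), of n] Fn_maps[OF q(2), of n] by (auto simp: mem_Times_iff)
  have "\<bar>snd ((F ^^ Suc n) (x, y)) - snd ((F ^^ Suc n) (x, y'))\<bar> \<le> l * \<bar>snd ((F ^^ n) (x, y)) - snd ((F ^^ n) (x, y'))\<bar>"
    unfolding Fn_Suc_snd[OF q(1)] Fn_Suc_snd[OF q(2)] fst_conv using s T_pow_maps[OF x] by (intro leaf)
  also have "\<dots> \<le> l * l ^ n" using Suc l_bounds by (intro mult_left_mono)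
  finally show ?case by simp
qed

text \<open>The Lipschitz constant refers to the sum of the coordinate distances, which separates
  base from fibre. It dominates the Euclidean distance, so a Euclidean Lipschitz constant may be
  used for \<open>B\<close>.\<close>

definition lipf :: "real \<Rightarrow> real \<Rightarrow> (real \<times> real \<Rightarrow> real) \<Rightarrow> bool" where
  "lipf A B f \<longleftrightarrow> 0 \<le> B \<and> (\<forall>q\<in>unit_square. \<bar>f q\<bar> \<le> A) \<and>
     (\<forall>q\<in>unit_square. \<forall>q'\<in>unit_square. \<bar>f q - f q'\<bar> \<le> B * (\<bar>fst q - fst q'\<bar> + \<bar>snd q - snd q'\<bar>))"

lemma lipf_abs: "lipf A B f \<Longrightarrow> q \<in> unit_square \<Longrightarrow> \<bar>f q\<bar> \<le> A"
  unfolding lipf_def by (rule bspec[OF conjunct1[OF conjunct2]])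

lemma lipf_lip:
  assumes "lipf A B f" "q \<in> unit_square" "q' \<in> unit_square"
  shows "\<bar>f q - f q'\<bar> \<le> B * (\<bar>fst q - fst q'\<bar> + \<bar>snd q - snd q'\<bar>)"
  using bspec[OF bspec[OF conjunct2[OF conjunct2[OF assms(1)[unfolded lipf_def]]] assms(2)] assms(3)] .

lemma lipf_meas: assumes "lipf A B f" shows "f \<in> borel_measurable QB"
proof (rule borel_measurable_continuous_on_restrict)
  show "continuous_on unit_square f"
    unfolding continuous_on_iff
  proof (intro ballI allI impI)
    fix q and e :: real assume q: "q \<in> unit_square" and e: "0 < e"
    have B: "0 \<le> B" using assms by (simp add: lipf_def)
    show "\<exists>d>0. \<forall>q'\<in>unit_square. dist q' q < d \<longrightarrow> dist (f q') (f q) < e"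
    proof (intro exI[of _ "e / (2 * B + 1)"] conjI ballI impI)
      show "0 < e / (2 * B + 1)" using e B by simp
      fix q' assume q': "q' \<in> unit_square" "dist q' q < e / (2 * B + 1)"
      have "\<bar>fst q' - fst q\<bar> \<le> dist q' q" "\<bar>snd q' - snd q\<bar> \<le> dist q' q"
        using dist_fst_le[of q' q] dist_snd_le[of q' q] by (auto simp: dist_real_def)
      then have "B * (\<bar>fst q' - fst q\<bar> + \<bar>snd q' - snd q\<bar>) \<le> B * (2 * dist q' q)"
        using B by (intro mult_left_mono) auto
      moreover have "\<bar>f q' - f q\<bar> \<le> B * (\<bar>fst q' - fst q\<bar> + \<bar>snd q' - snd q\<bar>)"
        using assms q q'(1) unfolding lipf_def by blast
      moreover have "B * (2 * dist q' q) \<le> 2 * B * (e / (2 * B + 1))"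
        using mult_left_mono[OF less_imp_le[OF q'(2)], of "2 * B"] B by (simp add: mult_ac)
      moreover have "2 * B * (e / (2 * B + 1)) < e" using e B by (simp add: field_simps)
      ultimately show "dist (f q') (f q) < e" by (simp add: dist_real_def)
    qed
  qed
qed

text \<open>The horizontal oscillation of \<open>G\<close> over a cylinder, at the worst height.
  Each cylinder may have its own worst height, which is why \<open>var_square\<close> lets the
  heights vary.\<close>

definition og :: "nat list \<Rightarrow> real" where
  "og u = sup0 (\<lambda>(x, x', y). \<bar>G (x, y) - G (x', y)\<bar>) (Z u \<times> Z u \<times> {0..1})"

lemma og_bound: assumes "u \<in> W n" "z \<in> Z u \<times> Z u \<times> {0..1}" shows "(\<lambda>(x, x', y). \<bar>G (x, y) - G (x', y)\<bar>) z \<le> 1"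
proof -
  obtain x x' y where z: "z = (x, x', y)" "x \<in> Z u" "x' \<in> Z u" "y \<in> {0..1}" using assms(2) by auto
  have "G (x, y) \<in> {0..1}" "G (x', y) \<in> {0..1}"
    using G_range[OF subsetD[OF Z_sub[OF assms(1)] z(2)] z(4)] G_range[OF subsetD[OF Z_sub[OF assms(1)] z(3)] z(4)] .
  then show ?thesis using z(1) by auto
qed

lemma og_nonneg: "u \<in> W n \<Longrightarrow> 0 \<le> og u"
  unfolding og_def using og_bound by (intro sup0_nonneg[where B = 1]) auto

lemma og_ge: "u \<in> W n \<Longrightarrow> x \<in> Z u \<Longrightarrow> x' \<in> Z u \<Longrightarrow> y \<in> {0..1} \<Longrightarrow> \<bar>G (x, y) - G (x', y)\<bar> \<le> og u"
  using sup0_ge[of "Z u \<times> Z u \<times> {0..1}" "\<lambda>(x, x', y). \<bar>G (x, y) - G (x', y)\<bar>" 1 "(x, x', y)"] og_bound[of u n]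
  unfolding og_def by auto

lemma VG_nonneg: "0 \<le> VG"
  using G_var[of 0 "\<lambda>_. 0" "\<lambda>_. 0"] by (simp add: mono_on_def)

text \<open>For each cylinder with positive \<open>og\<close> a pair of points at one height
  realises at least half of it, hence the factor 2. The pairs of different cylinders are disjoint
  and fit on one increasing chain.\<close>

lemma sum_og: "(\<Sum>u\<in>W n. og u) \<le> 2 * VG"
proof -
  define U where "U = {u \<in> W n. 0 < og u}"
  have fU: "finite U" by (simp add: U_def)
  have "\<forall>u\<in>U. \<exists>a b y. a \<in> Z u \<and> b \<in> Z u \<and> y \<in> {0..1} \<and> a \<le> b \<and> og u / 2 \<le> \<bar>G (a, y) - G (b, y)\<bar>"
  proof
    fix u assume "u \<in> U"
    then have "og u / 2 < og u" "0 \<le> og u / 2" by (auto simp: U_def)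
    then obtain z where "z \<in> Z u \<times> Z u \<times> {0..1}" "og u / 2 < (\<lambda>(x, x', y). \<bar>G (x, y) - G (x', y)\<bar>) z"
      unfolding og_def by (rule sup0_approx)
    then obtain x x' y where "x \<in> Z u" "x' \<in> Z u" "y \<in> {0..1}" "og u / 2 < \<bar>G (x, y) - G (x', y)\<bar>" by auto
    then show "\<exists>a b y. a \<in> Z u \<and> b \<in> Z u \<and> y \<in> {0..1} \<and> a \<le> b \<and> og u / 2 \<le> \<bar>G (a, y) - G (b, y)\<bar>"
      by (metis abs_minus_commute less_imp_le linear)
  qed
  then obtain a b y where aby: "\<And>u. u \<in> U \<Longrightarrow> a u \<in> Z u \<and> b u \<in> Z u \<and> y u \<in> {0..1} \<and> a u \<le> b u \<and> og u / 2 \<le> \<bar>G (a u, y u) - G (b u, y u)\<bar>"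
    by metis
  have ivl: "x \<in> Z u" if "u \<in> U" "a u \<le> x" "x \<le> b u" for u x
    using Z_convex[of u n] aby[OF that(1)] that is_interval_convex_1[of "Z u"] unfolding is_interval_1 U_def by blast
  have sep: "b u < a v \<or> b v < a u" if "u \<in> U" "v \<in> U" "u \<noteq> v" for u v
  proof (rule ccontr)
    assume "\<not> ?thesis"
    then have "max (a u) (a v) \<in> Z u" "max (a u) (a v) \<in> Z v"
      using ivl[OF that(1), of "max (a u) (a v)"] ivl[OF that(2), of "max (a u) (a v)"] aby[OF that(1)] aby[OF that(2)]
      by (auto simp: max_def)
    then show False using cyl_disjoint[of u n v] that by (auto simp: U_def)
  qed
  obtain e :: "nat \<Rightarrow> nat list" and x where e: "bij_betw e {..<card U} U" "mono_on {1..2 * card U} x"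
    "\<And>j. j < card U \<Longrightarrow> x (2 * j + 1) = a (e j)" "\<And>j. j < card U \<Longrightarrow> x (2 * j + 2) = b (e j)"
    "x ` {1..2 * card U} \<subseteq> a ` U \<union> b ` U"
    using chain_of_pairs[of U a b, OF fU _ sep] aby by auto
  let ?n = "card U"
  have eU: "e j \<in> U" if "j < ?n" for j using e(1) that by (auto simp: bij_betw_def)
  \<comment> \<open>In \<open>var_square\<close> both ends of step \<open>i\<close> are evaluated at
    the height with index \<open>i\<close>, so a pair needs its height only at the odd position;
    beyond the chain the height is a default.\<close>
  define t where "t = (\<lambda>i. if (i - 1) div 2 < ?n then y (e ((i - 1) div 2)) else 0)"
  have t01: "t i \<in> {0..1}" for i using aby[OF eU, of "(i - 1) div 2"] by (auto simp: t_def)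
  have x01: "x ` {1..2 * ?n} \<subseteq> {0..1}"
  proof -
    have "a ` U \<union> b ` U \<subseteq> {0..1}" using aby Z_sub[of _ n] unfolding U_def by blast
    then show ?thesis using e(5) by blast
  qed
  have "(\<Sum>u\<in>W n. og u) = (\<Sum>u\<in>U. og u)"
    unfolding U_def using og_nonneg by (intro sum.mono_neutral_right) (auto simp: not_less intro: antisym)
  also have "\<dots> = (\<Sum>j<?n. og (e j))" using e(1) by (intro sum.reindex_bij_betw[symmetric]) 
  also have "\<dots> \<le> (\<Sum>j<?n. 2 * \<bar>G (x (2 * j + 1), t (2 * j + 1)) - G (x (Suc (2 * j + 1)), t (2 * j + 1))\<bar>)"
  proof (rule sum_mono)
    fix j assume "j \<in> {..<?n}"
    then have j: "j < ?n" by simp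
    have "t (2 * j + 1) = y (e j)" using j by (simp add: t_def)
    then show "og (e j) \<le> 2 * \<bar>G (x (2 * j + 1), t (2 * j + 1)) - G (x (Suc (2 * j + 1)), t (2 * j + 1))\<bar>"
      using e(3)[OF j] e(4)[OF j] aby[OF eU[OF j]] by simp
  qed
  also have "\<dots> = 2 * (\<Sum>j<?n. \<bar>G (x (2 * j + 1), t (2 * j + 1)) - G (x (Suc (2 * j + 1)), t (2 * j + 1))\<bar>)"
    by (simp add: sum_distrib_left)
  also have "\<dots> \<le> 2 * (\<Sum>i = 1..<2 * ?n. \<bar>G (x i, t i) - G (x (Suc i), t i)\<bar>)"
    using chain_sum_le[of "\<lambda>i. \<bar>G (x i, t i) - G (x (Suc i), t i)\<bar>" ?n] by simp
  also have "\<dots> \<le> 2 * VG"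
  proof -
    have "t ` {1..2 * ?n} \<subseteq> {0..1}" using t01 by blast
    from G_var[OF e(2) x01 this] show ?thesis by simp
  qed
  finally show ?thesis .
qed

text \<open>The height 0 is an arbitrary choice: another one changes the value by at most the
  Lipschitz constant times \<open>l ^ k\<close>.\<close>

definition fk :: "(real \<times> real \<Rightarrow> real) \<Rightarrow> nat \<Rightarrow> real \<Rightarrow> real" where
  "fk f k x = f ((F ^^ k) (x, 0))"

lemma fk_bm: assumes f: "lipf A B f" shows "bm A (fk f k)"
  unfolding bm_def
proof
  have "(\<lambda>x. (x, 0::real)) \<in> restrict_space borel {0..1} \<rightarrow>\<^sub>M QB"
  proof (rule measurable_restrict_space2)
    have "(\<lambda>x. (x, 0::real)) \<in> borel_measurable (borel :: real measure)" by (intro borel_measurable_continuous_onI continuous_intros)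
    then show "(\<lambda>x. (x, 0::real)) \<in> borel_measurable (restrict_space (borel :: real measure) {0..1})"
      by (rule measurable_restrict_space1)
  qed (auto simp: space_restrict_space)
  from measurable_compose[OF measurable_compose[OF this Fn_meas[of k]] lipf_meas[OF f]]
  have "fk f k \<in> borel_measurable (restrict_space borel {0..1})" by (simp add: fk_def[abs_def])
  then show "fk f k \<in> borel_measurable LB" by (simp add: measurable_cong_sets[OF sets_LB refl])
  show "\<forall>x\<in>{0..1}. \<bar>fk f k x\<bar> \<le> A"
  proof
    fix x :: real assume "x \<in> {0..1}"
    then show "\<bar>fk f k x\<bar> \<le> A" using f Fn_maps[of "(x, 0)" k] by (auto simp: lipf_def fk_def)
  qed
qed

lemma cyl_drop: "w \<in> W n \<Longrightarrow> k \<le> n \<Longrightarrow> x \<in> Z w \<Longrightarrow> (T ^^ k) x \<in> Z (drop k w)"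
proof -
  assume w: "w \<in> W n" "k \<le> n" and x: "x \<in> Z w"
  have "x \<in> cyl (Z (drop k w)) (take k w)" using x by (simp add: cyl_append[symmetric])
  from cyl_T_pow[OF this] show ?thesis using length_W[OF w(1)] w(2) by simp
qed

text \<open>Each step adds the horizontal oscillation of \<open>G\<close> over the cylinder reached
  so far, and the previous difference of heights is passed on with a factor at most 1.\<close>

lemma snd_osc:
  assumes w: "w \<in> W n" and x: "x \<in> Z w" "x' \<in> Z w"
  shows "k \<le> n \<Longrightarrow> \<bar>snd ((F ^^ k) (x, 0)) - snd ((F ^^ k) (x', 0))\<bar> \<le> (\<Sum>i<k. og (drop i w))"
proof (induction k)
  case (Suc k)
  have q: "(x, 0) \<in> unit_square" "(x', 0) \<in> unit_square" using x Z_sub[OF w] by auto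
  define y y' where "y = snd ((F ^^ k) (x, 0))" and "y' = snd ((F ^^ k) (x', 0))"
  have y: "y \<in> {0..1}" "y' \<in> {0..1}"
    using Fn_maps[OF q(1), of k] Fn_maps[OF q(2), of k] by (auto simp: mem_Times_iff y_def y'_def)
  have t: "(T ^^ k) x \<in> Z (drop k w)" "(T ^^ k) x' \<in> Z (drop k w)" using cyl_drop[OF w _ x(1)] cyl_drop[OF w _ x(2)] Suc.prems by auto
  have t01: "(T ^^ k) x' \<in> {0..1}" by (rule subsetD[OF Z_sub[OF drop_W[OF w]] t(2)])
  have "\<bar>G ((T ^^ k) x, y) - G ((T ^^ k) x', y')\<bar> \<le> \<bar>G ((T ^^ k) x, y) - G ((T ^^ k) x', y)\<bar> + \<bar>G ((T ^^ k) x', y) - G ((T ^^ k) x', y')\<bar>"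
    by linarith
  also have "\<dots> \<le> og (drop k w) + l * \<bar>y - y'\<bar>"
    by (intro add_mono og_ge[OF drop_W[OF w] t y(1)] leaf[OF t01 y])
  also have "l * \<bar>y - y'\<bar> \<le> 1 * \<bar>y - y'\<bar>" using l_bounds by (intro mult_right_mono) auto
  also have "\<bar>y - y'\<bar> \<le> (\<Sum>i<k. og (drop i w))" using Suc by (simp add: y_def y'_def)
  finally show ?case unfolding Fn_Suc_snd[OF q(1)] Fn_Suc_snd[OF q(2)] fst_conv y_def y'_def by simp
qed simp

lemma wZ_append: "a \<in> W i \<Longrightarrow> u \<in> W j \<Longrightarrow> wZ (a @ u) \<le> wZ a * \<kappa> ^ j"
proof -
  assume a: "a \<in> W i" and u: "u \<in> W j"
  have au: "a @ u \<in> W (i + j)" using a u by (auto simp: W_def)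
  show ?thesis
    unfolding wt_def[of _ "a @ u"] length_W[OF au]
  proof (rule sup0_le)
    show "0 \<le> wZ a * \<kappa> ^ j" using wt_nonneg[OF a] kappa by simp
    fix x assume x: "x \<in> Z (a @ u)"
    have xa: "x \<in> Z a" using cyl_take[OF au x, of i] length_W[OF a] by simp
    have xu: "(T ^^ i) x \<in> Z u" using cyl_drop[OF au _ x, of i] length_W[OF a] by simp
    show "gn (i + j) x \<le> wZ a * \<kappa> ^ j"
      unfolding gn_add using wt_ge[OF a xa] gn_le[OF u xu] gn_pos[OF a xa] gn_pos[OF u xu] kappa
      by (intro mult_mono) auto
  qed
qed

text \<open>Split the word at \<open>i\<close>: its weight is at most that of the first part times
  \<open>r ^ (n - i)\<close>. The first parts sum to at most \<open>K\<close>, and \<open>og\<close>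
  over the second parts to at most \<open>2 * VG\<close>.\<close>

lemma sum_wZ_og: assumes "i \<le> n" shows "(\<Sum>w\<in>W n. wZ w * og (drop i w)) \<le> 2 * K * VG * r ^ (n - i)"
proof -
  have "(\<Sum>w\<in>W n. wZ w * og (drop i w)) = (\<Sum>w\<in>W (i + (n - i)). wZ w * og (drop i w))" using assms by simp
  also have "\<dots> = (\<Sum>a\<in>W i. \<Sum>u\<in>W (n - i). wZ (a @ u) * og u)"
    unfolding sum_W_add by (intro sum.cong refl) (simp add: length_W)
  also have "\<dots> \<le> (\<Sum>a\<in>W i. \<Sum>u\<in>W (n - i). (wZ a * r ^ (n - i)) * og u)"
  proof (intro sum_mono mult_right_mono)
    fix a u assume a: "a \<in> W i" and u: "u \<in> W (n - i)"
    have "wZ (a @ u) \<le> wZ a * \<kappa> ^ (n - i)" by (rule wZ_append[OF a u])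
    also have "\<dots> \<le> wZ a * r ^ (n - i)" using wt_nonneg[OF a] r_bounds kappa by (intro mult_left_mono power_mono) auto
    finally show "wZ (a @ u) \<le> wZ a * r ^ (n - i)" .
    show "0 \<le> og u" by (rule og_nonneg[OF u])
  qed
  also have "\<dots> = (wsum {0..1} i * r ^ (n - i)) * (\<Sum>u\<in>W (n - i). og u)"
    by (simp add: wsum_def sum_distrib_left sum_distrib_right sum_product mult_ac)
  also have "\<dots> \<le> (K * r ^ (n - i)) * (2 * VG)"
    using K(1) K(2)[of i] sum_og wsum_nonneg r_bounds og_nonneg by (intro mult_mono mult_right_mono sum_nonneg) auto
  finally show ?thesis by (simp add: mult_ac)
qed

text \<open>The term \<open>2 * K\<close> serves the depths \<open>n \<le> k\<close>, where only the
  bound on \<open>f\<close> is used; the other term is the geometric tail of the contributions of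
  \<open>G\<close>.\<close>

definition C6 :: real where "C6 = 2 * K + 2 * K * VG / (1 - r)"

lemma C6_pos: "0 < C6"
proof -
  have "0 \<le> 2 * K * VG / (1 - r)" using K(1) VG_nonneg r_bounds by (intro divide_nonneg_pos) auto
  then show ?thesis using K(1) by (simp add: C6_def)
qed

lemma geom_tail: assumes "k \<le> n" shows "(\<Sum>i<k. r ^ (n - i)) \<le> r ^ (n - k) / (1 - r)"
  using assms
proof (induction k)
  case (Suc k)
  have e: "n - k = Suc (n - Suc k)" using Suc.prems by simp
  have "(\<Sum>i<Suc k. r ^ (n - i)) \<le> r ^ (n - k) / (1 - r) + r ^ (n - k)" using Suc by simp
  also have "\<dots> \<le> r ^ (n - Suc k) / (1 - r)"
  proof -
    have "1 / (1 - r) = 1 + r / (1 - r)" using r_bounds by (simp add: field_simps)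
    then have "r / (1 - r) + r \<le> 1 / (1 - r)" using r_bounds by linarith
    from mult_left_mono[OF this, of "r ^ (n - Suc k)"] show ?thesis using r_bounds unfolding e by (simp add: algebra_simps)
  qed
  finally show ?case .
qed (use r_bounds in simp)

text \<open>Up to depth \<open>k\<close> the trivial oscillation \<open>2 * A\<close> is acceptable,
  because \<open>r ^ n / r ^ k\<close> is at least 1. At larger depth \<open>k\<close> steps leave a
  cylinder of depth \<open>n - k\<close>, which bounds the horizontal distance, and the weighted
  vertical distances sum to a geometric tail of order \<open>r ^ (n - k)\<close>.\<close>

lemma fk_sp: assumes f: "lipf A B f" shows "sp A (C6 * (A + B) / r ^ k) (fk f k)"
  unfolding sp_def
proof (intro conjI allI)
  show b: "bm A (fk f k)" by (rule fk_bm[OF f])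
  have AB: "0 \<le> A" "0 \<le> B" using bm_nonneg[OF b] f by (auto simp: lipf_def)
  show "0 \<le> C6 * (A + B) / r ^ k" using C6_pos AB r_bounds by simp
  have rk: "0 < r ^ k" using r_bounds by simp
  have V0: "0 \<le> 2 * K * VG / (1 - r)" using K(1) VG_nonneg r_bounds by (intro divide_nonneg_pos) auto
  fix n
  show "ov (fk f k) n \<le> C6 * (A + B) / r ^ k * r ^ n"
  proof (cases "n \<le> k")
    case True
    have "ov (fk f k) n \<le> (\<Sum>w\<in>W n. wZ w * (2 * A))"
      unfolding ov_def by (intro sum_mono mult_left_mono osc0_Z_le[OF b] wt_nonneg)
    also have "\<dots> = wsum {0..1} n * (2 * A)" by (simp add: wsum_def sum_distrib_right)
    also have "\<dots> \<le> K * (2 * A)" using K(2)[of n] AB by (intro mult_right_mono) auto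
    also have "\<dots> \<le> C6 * (A + B)"
    proof -
      have "K * (2 * A) \<le> (2 * K) * (A + B)" using K(1) AB by (simp add: algebra_simps)
      also have "\<dots> \<le> C6 * (A + B)" using V0 AB by (intro mult_right_mono) (auto simp: C6_def)
      finally show ?thesis .
    qed
    also have "\<dots> \<le> C6 * (A + B) * (r ^ n / r ^ k)"
    proof -
      have "1 \<le> r ^ n / r ^ k" using True power_decreasing[of n k r] r_bounds by simp
      from mult_left_mono[OF this, of "C6 * (A + B)"] show ?thesis using C6_pos AB by simp
    qed
    finally show ?thesis by simp
  next
    case False
    then have kn: "k \<le> n" by simp
    have osc: "osc0 (fk f k) (Z w) \<le> B * (r ^ (n - k) + (\<Sum>i<k. og (drop i w)))" if w: "w \<in> W n" for w
    proof (rule osc0_le)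
      show "0 \<le> B * (r ^ (n - k) + (\<Sum>i<k. og (drop i w)))"
        using AB r_bounds og_nonneg[OF drop_W[OF w]] by (intro mult_nonneg_nonneg add_nonneg_nonneg sum_nonneg) auto
      fix x x' assume x: "x \<in> Z w" "x' \<in> Z w"
      have q: "(x, 0) \<in> unit_square" "(x', 0) \<in> unit_square" using x Z_sub[OF w] by auto
      have t: "(T ^^ k) x \<in> Z (drop k w)" "(T ^^ k) x' \<in> Z (drop k w)" using cyl_drop[OF w kn x(1)] cyl_drop[OF w kn x(2)] .
      have "\<bar>(T ^^ k) x - (T ^^ k) x'\<bar> \<le> \<kappa> ^ (n - k) * \<bar>(T ^^ (n - k)) ((T ^^ k) x) - (T ^^ (n - k)) ((T ^^ k) x')\<bar>"
        by (rule cyl_contract[OF drop_W[OF w] t])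
      also have "\<dots> \<le> \<kappa> ^ (n - k) * 1"
        using kappa T_pow_maps[of x n] T_pow_maps[of x' n] T_pow_maps[of "(T ^^ k) x" "n - k"] T_pow_maps[of "(T ^^ k) x'" "n - k"] t Z_sub[OF drop_W[OF w], of k]
        by (intro mult_left_mono) (auto simp: abs_le_iff subset_iff intro: order_trans)
      also have "\<dots> \<le> r ^ (n - k)" using kappa r_bounds by (simp add: power_mono)
      finally have 1: "\<bar>fst ((F ^^ k) (x, 0)) - fst ((F ^^ k) (x', 0))\<bar> \<le> r ^ (n - k)"
        using Fn_fst[OF q(1), of k] Fn_fst[OF q(2), of k] by simp
      have "\<bar>fk f k x - fk f k x'\<bar> \<le> B * (\<bar>fst ((F ^^ k) (x, 0)) - fst ((F ^^ k) (x', 0))\<bar> + \<bar>snd ((F ^^ k) (x, 0)) - snd ((F ^^ k) (x', 0))\<bar>)"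
        unfolding fk_def by (rule lipf_lip[OF f Fn_maps[OF q(1)] Fn_maps[OF q(2)]])
      also have "\<dots> \<le> B * (r ^ (n - k) + (\<Sum>i<k. og (drop i w)))"
        using 1 snd_osc[OF w x kn] AB by (intro mult_left_mono add_mono)
      finally show "\<bar>fk f k x - fk f k x'\<bar> \<le> B * (r ^ (n - k) + (\<Sum>i<k. og (drop i w)))" .
    qed
    have "ov (fk f k) n \<le> (\<Sum>w\<in>W n. wZ w * (B * (r ^ (n - k) + (\<Sum>i<k. og (drop i w)))))"
      unfolding ov_def by (intro sum_mono mult_left_mono osc wt_nonneg)
    also have "\<dots> = B * (wsum {0..1} n * r ^ (n - k) + (\<Sum>i<k. \<Sum>w\<in>W n. wZ w * og (drop i w)))"
      by (subst sum.swap) (simp add: wsum_def sum_distrib_left sum_distrib_right distrib_left sum.distrib mult_ac)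
    also have "\<dots> \<le> B * (K * r ^ (n - k) + (\<Sum>i<k. 2 * K * VG * r ^ (n - i)))"
      using AB r_bounds K(2) kn by (intro mult_left_mono add_mono mult_right_mono sum_mono sum_wZ_og) auto
    also have "\<dots> = B * (K * r ^ (n - k) + 2 * K * VG * (\<Sum>i<k. r ^ (n - i)))" by (simp add: sum_distrib_left)
    also have "\<dots> \<le> B * (K * r ^ (n - k) + 2 * K * VG * (r ^ (n - k) / (1 - r)))"
      using AB K(1) VG_nonneg geom_tail[OF kn] by (intro mult_left_mono add_left_mono) auto
    also have "\<dots> = B * ((K + 2 * K * VG / (1 - r)) * r ^ (n - k))" by (simp add: algebra_simps)
    also have "\<dots> \<le> (A + B) * (C6 * r ^ (n - k))"
      using AB K(1) V0 r_bounds C6_pos by (intro mult_mono mult_right_mono) (auto simp: C6_def)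
    also have "r ^ (n - k) = r ^ n / r ^ k" using kn r_bounds by (simp add: power_diff)
    finally show ?thesis by (simp add: mult_ac)
  qed
qed

end

subsection \<open>The invariant lift\<close>

text \<open>The natural extension: backward orbits \<open>\<omega> 0 = T (\<omega> 1)\<close>, \<open>\<omega> 1 = T (\<omega> 2)\<close>, \<dots> with the
  stationary law, as a Daniell-Kolmogorov limit.\<close>

lemma natural_extension:
  fixes \<nu> :: "real measure" and T :: "real \<Rightarrow> real"
  assumes prob: "prob_space \<nu>" and sets: "sets \<nu> = sets borel" and T: "T \<in> borel_measurable borel"
    and inv: "distr \<nu> \<nu> T = \<nu>"
  shows "\<exists>\<Omega>. prob_space \<Omega> \<and> sets \<Omega> = sets (PiM (UNIV :: nat set) (\<lambda>_. borel)) \<and>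
    (\<forall>n. distr \<Omega> borel (\<lambda>\<omega>. \<omega> n) = \<nu>) \<and> distr \<Omega> \<Omega> (\<lambda>\<omega> n. \<omega> (Suc n)) = \<Omega> \<and>
    (\<forall>n. AE \<omega> in \<Omega>. T (\<omega> (Suc n)) = \<omega> n)"
proof -
  interpret prob_space \<nu> by fact
  have sp: "space \<nu> = UNIV" using sets_eq_imp_space_eq[OF sets] by simp
  have Tn: "T ^^ n \<in> borel_measurable borel" for n
    using T by (induction n) (auto intro: measurable_comp)
  have meas: "f \<in> \<nu> \<rightarrow>\<^sub>M N \<longleftrightarrow> f \<in> borel \<rightarrow>\<^sub>M N" for f and N :: "'z measure"
    by (rule arg_cong[where f = "\<lambda>S. f \<in> S"]) (rule measurable_cong_sets[OF sets refl])
  have invn: "distr \<nu> \<nu> (T ^^ n) = \<nu>" for n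
  proof (induction n)
    case 0
    show ?case using distr_id2[OF refl, of \<nu>] by (simp add: id_def)
  next
    case (Suc n)
    have "distr \<nu> \<nu> (T ^^ Suc n) = distr (distr \<nu> \<nu> (T ^^ n)) \<nu> T"
      unfolding funpow.simps(2) using Tn[of n] T measurable_cong_sets[OF sets sets] by (intro distr_distr[symmetric]) auto
    also have "\<dots> = \<nu>" unfolding Suc by (rule inv)
    finally show ?case .
  qed
  let ?M = "\<lambda>J. PiM J (\<lambda>_::nat. borel :: real measure)"
  \<comment> \<open>A finite block of coordinates is determined by its oldest one, with index
    \<open>Max J\<close>: that one has the law \<open>\<nu>\<close>, and the others are its images
    under \<open>T\<close>.\<close>
  define q where "q = (\<lambda>J x. \<lambda>j\<in>J. (T ^^ (Max J - j)) x)"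
  define P where "P = (\<lambda>J. distr \<nu> (?M J) (q J))"
  have qm: "q J \<in> \<nu> \<rightarrow>\<^sub>M ?M J" for J
    unfolding q_def meas by (intro measurable_restrict) (rule Tn)
  interpret pp: polish_projective UNIV P
  proof (intro polish_projective.intro projective_family.intro)
    fix J H :: "nat set" assume J: "J \<subseteq> H" "finite H"
    show "P J = distr (P H) (?M J) (\<lambda>f. restrict f J)"
    proof (cases "J = {}")
      case True
      have "distr (P H) (?M J) (\<lambda>f. restrict f J) = distr \<nu> (?M J) ((\<lambda>f. restrict f J) \<circ> q H)"
        unfolding P_def using J qm by (intro distr_distr measurable_restrict_subset) auto
      also have "(\<lambda>f. restrict f J) \<circ> q H = q J" using True by (auto simp: q_def fun_eq_iff)
      finally show ?thesis unfolding P_def by (rule sym)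
    next
      case False
      \<comment> \<open>The oldest coordinate of \<open>H\<close> is \<open>d\<close> steps older
        than that of \<open>J\<close>; consistency is the invariance of \<open>\<nu>\<close> under
        \<open>T ^^ d\<close>.\<close>
      define d where "d = Max H - Max J"
      have fJ: "finite J" using J finite_subset by auto
      have le: "Max J \<le> Max H" using J False by (intro Max_mono) auto
      have "distr (P H) (?M J) (\<lambda>f. restrict f J) = distr \<nu> (?M J) ((\<lambda>f. restrict f J) \<circ> q H)"
        unfolding P_def using J qm by (intro distr_distr measurable_restrict_subset) auto
      also have "(\<lambda>f. restrict f J) \<circ> q H = q J \<circ> (T ^^ d)"
      proof
        fix x
        have "(T ^^ (Max H - j)) x = (T ^^ (Max J - j)) ((T ^^ d) x)" if "j \<in> J" for j
        proof -
          have "j \<le> Max J" using that fJ by auto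
          then have "Max H - j = (Max J - j) + d" using le by (simp add: d_def)
          then show ?thesis by (simp add: funpow_add)
        qed
        then show "((\<lambda>f. restrict f J) \<circ> q H) x = (q J \<circ> (T ^^ d)) x"
          using J by (auto simp: q_def fun_eq_iff restrict_def)
      qed
      also have "distr \<nu> (?M J) (q J \<circ> (T ^^ d)) = distr (distr \<nu> \<nu> (T ^^ d)) (?M J) (q J)"
        using Tn[of d] measurable_cong_sets[OF sets sets] by (intro distr_distr[symmetric] qm) auto
      finally show ?thesis unfolding P_def invn by (rule sym)
    qed
  next
    fix J :: "nat set" assume "finite J"
    show "prob_space (P J)" unfolding P_def by (rule prob_space_distr[OF qm])
  qed
  define \<Omega> where "\<Omega> = pp.lim"
  have sO: "sets \<Omega> = sets (?M UNIV)" by (simp add: \<Omega>_def)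
  have spO: "space \<Omega> = UNIV" using sets_eq_imp_space_eq[OF sO] by (simp add: space_PiM)
  have comp: "(\<lambda>\<omega>. \<omega> n) \<in> \<Omega> \<rightarrow>\<^sub>M borel" for n
    using measurable_component_singleton[of n UNIV "\<lambda>_. borel :: real measure"] by (simp add: measurable_cong_sets[OF sO refl])
  have rest: "(\<lambda>\<omega>. restrict \<omega> J) \<in> \<Omega> \<rightarrow>\<^sub>M ?M J" for J
    using measurable_restrict_subset[of J UNIV "\<lambda>_. borel :: real measure"] by (simp add: measurable_cong_sets[OF sO refl])
  have fd: "distr \<Omega> (?M J) (\<lambda>\<omega>. restrict \<omega> J) = P J" if J: "finite J" for J
  proof (rule measure_eqI)
    show "sets (distr \<Omega> (?M J) (\<lambda>\<omega>. restrict \<omega> J)) = sets (P J)" by (simp add: P_def)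
    fix X assume "X \<in> sets (distr \<Omega> (?M J) (\<lambda>\<omega>. restrict \<omega> J))"
    then have X: "X \<in> sets (?M J)" by simp
    have "emeasure (distr \<Omega> (?M J) (\<lambda>\<omega>. restrict \<omega> J)) X = emeasure \<Omega> (prod_emb UNIV (\<lambda>_. borel) J X)"
      using X by (subst emeasure_distr[OF rest]) (auto simp: prod_emb_def spO space_PiM)
    also have "\<dots> = P J X" unfolding \<Omega>_def by (rule pp.emeasure_lim_emb) (use J X in auto)
    finally show "emeasure (distr \<Omega> (?M J) (\<lambda>\<omega>. restrict \<omega> J)) X = emeasure (P J) X" .
  qed
  have emb: "emeasure \<Omega> (prod_emb UNIV (\<lambda>_. borel) J (Pi\<^sub>E J A)) = emeasure \<nu> {x. \<forall>j\<in>J. (T ^^ (Max J - j)) x \<in> A j}"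
    if J: "finite J" and A: "\<And>j. j \<in> J \<Longrightarrow> A j \<in> sets borel" for J A
  proof -
    have "emeasure \<Omega> (prod_emb UNIV (\<lambda>_. borel) J (Pi\<^sub>E J A)) = P J (Pi\<^sub>E J A)"
      unfolding \<Omega>_def using J A by (intro pp.emeasure_lim_emb sets_PiM_I_finite) auto
    also have "\<dots> = emeasure \<nu> (q J -` Pi\<^sub>E J A \<inter> space \<nu>)"
      unfolding P_def using J A by (intro emeasure_distr qm sets_PiM_I_finite) auto
    also have "q J -` Pi\<^sub>E J A \<inter> space \<nu> = {x. \<forall>j\<in>J. (T ^^ (Max J - j)) x \<in> A j}"
      by (auto simp: q_def sp PiE_iff)
    finally show ?thesis .
  qed
  have 1: "distr \<Omega> borel (\<lambda>\<omega>. \<omega> n) = \<nu>" for n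
  proof (rule measure_eqI)
    fix X assume "X \<in> sets (distr \<Omega> borel (\<lambda>\<omega>. \<omega> n))"
    then have X: "X \<in> sets borel" by simp
    have "emeasure (distr \<Omega> borel (\<lambda>\<omega>. \<omega> n)) X = emeasure \<Omega> (prod_emb UNIV (\<lambda>_. borel) {n} (Pi\<^sub>E {n} (\<lambda>_. X)))"
      using X by (subst emeasure_distr[OF comp]) (auto simp: prod_emb_def spO space_PiM PiE_iff restrict_def extensional_def intro!: arg_cong[where f = "emeasure \<Omega>"])
    also have "\<dots> = emeasure \<nu> X" using X by (subst emb) auto
    finally show "emeasure (distr \<Omega> borel (\<lambda>\<omega>. \<omega> n)) X = emeasure \<nu> X" .
  qed (simp add: sets)
  have shm: "(\<lambda>\<omega> n. \<omega> (Suc n)) \<in> \<Omega> \<rightarrow>\<^sub>M \<Omega>"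
  proof -
    have "(\<lambda>\<omega> n. \<omega> (Suc n)) \<in> \<Omega> \<rightarrow>\<^sub>M ?M UNIV"
      by (rule measurable_PiM_single') (auto simp: comp space_PiM)
    then show ?thesis by (simp add: measurable_cong_sets[OF refl sO])
  qed
  have 2: "distr \<Omega> \<Omega> (\<lambda>\<omega> n. \<omega> (Suc n)) = \<Omega>"
  proof (rule measure_eqI_PiM_infinite[where I = UNIV and M = "\<lambda>_. borel :: real measure"])
    show "sets (distr \<Omega> \<Omega> (\<lambda>\<omega> n. \<omega> (Suc n))) = sets (?M UNIV)" "sets \<Omega> = sets (?M UNIV)" by (simp_all add: sO)
    show "finite_measure (distr \<Omega> \<Omega> (\<lambda>\<omega> n. \<omega> (Suc n)))"
      using pp.P.prob_space_distr[of "\<lambda>\<omega> n. \<omega> (Suc n)" \<Omega>] shm unfolding \<Omega>_def prob_space_def by blast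
    fix A :: "nat \<Rightarrow> real set" and J assume J: "finite J" "J \<subseteq> UNIV" and A: "\<And>i. i \<in> J \<Longrightarrow> A i \<in> sets borel"
    have Xm: "prod_emb UNIV (\<lambda>_. borel) J (Pi\<^sub>E J A) \<in> sets \<Omega>"
      unfolding sO using J A by (intro sets_PiM_I) auto
    let ?A = "\<lambda>i. A (i - 1)"
    have "emeasure (distr \<Omega> \<Omega> (\<lambda>\<omega> n. \<omega> (Suc n))) (prod_emb UNIV (\<lambda>_. borel) J (Pi\<^sub>E J A)) =
       emeasure \<Omega> ((\<lambda>\<omega> n. \<omega> (Suc n)) -` prod_emb UNIV (\<lambda>_. borel) J (Pi\<^sub>E J A) \<inter> space \<Omega>)"
      by (rule emeasure_distr[OF shm Xm])
    also have "(\<lambda>\<omega> n. \<omega> (Suc n)) -` prod_emb UNIV (\<lambda>_. borel) J (Pi\<^sub>E J A) \<inter> space \<Omega> =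
       prod_emb UNIV (\<lambda>_. borel) (Suc ` J) (Pi\<^sub>E (Suc ` J) ?A)"
      by (auto simp: prod_emb_def spO space_PiM PiE_iff)
    also have "emeasure \<Omega> \<dots> = emeasure \<nu> {x. \<forall>j\<in>Suc ` J. (T ^^ (Max (Suc ` J) - j)) x \<in> ?A j}"
      using J A by (intro emb) auto
    also have "{x. \<forall>j\<in>Suc ` J. (T ^^ (Max (Suc ` J) - j)) x \<in> ?A j} = {x. \<forall>j\<in>J. (T ^^ (Max J - j)) x \<in> A j}"
    proof (cases "J = {}")
      case False
      have "Max (Suc ` J) = Suc (Max J)" using mono_Max_commute[of Suc J] J False by (simp add: mono_Suc)
      then show ?thesis by auto
    qed auto
    also have "emeasure \<nu> \<dots> = emeasure \<Omega> (prod_emb UNIV (\<lambda>_. borel) J (Pi\<^sub>E J A))"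
      using J A by (intro emb[symmetric]) auto
    finally show "emeasure (distr \<Omega> \<Omega> (\<lambda>\<omega> n. \<omega> (Suc n))) (prod_emb UNIV (\<lambda>_. borel) J (Pi\<^sub>E J A)) =
       emeasure \<Omega> (prod_emb UNIV (\<lambda>_. borel) J (Pi\<^sub>E J A))" .
  qed
  have 3: "AE \<omega> in \<Omega>. T (\<omega> (Suc n)) = \<omega> n" for n
  proof -
    let ?J = "{n, Suc n}"
    have "AE x in \<nu>. T (q ?J x (Suc n)) = q ?J x n" by (simp add: q_def max_def)
    moreover have "Measurable.pred (?M ?J) (\<lambda>f. T (f (Suc n)) = f n)"
    proof -
      have c1: "(\<lambda>f. f (Suc n)) \<in> ?M ?J \<rightarrow>\<^sub>M (borel :: real measure)" and c2: "(\<lambda>f. f n) \<in> ?M ?J \<rightarrow>\<^sub>M (borel :: real measure)"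
        by (rule measurable_component_singleton, simp)+
      show ?thesis using measurable_compose[OF c1 T] c2 by (rule borel_measurable_eq[THEN pred_def[THEN iffD2], rotated 2, simplified])
    qed
    ultimately have "AE f in P ?J. T (f (Suc n)) = f n"
      unfolding P_def by (subst AE_distr_iff[OF qm]) (auto simp: pred_def)
    then have "AE f in distr \<Omega> (?M ?J) (\<lambda>\<omega>. restrict \<omega> ?J). T (f (Suc n)) = f n" by (subst fd) auto
    from AE_distrD[OF rest this] show ?thesis by simp
  qed
  have "prob_space \<Omega>" unfolding \<Omega>_def by (rule pp.P.prob_space_axioms)
  then show ?thesis using sO 1 2 3 by blast
qed

context skew
begin

text \<open>The fibre coordinate of a backward orbit \<open>\<omega>\<close> is the limit of \<open>snd (F\<^sup>n (\<omega> n, 0))\<close>,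
  which exists by contraction along the leaves; \<open>clip\<close> only serves measurability.\<close>

definition clip :: "real \<Rightarrow> real" where "clip x = max 0 (min 1 x)"

lemma clip_in [simp]: "clip x \<in> {0..1}" by (auto simp: clip_def)
lemma clip_id: "x \<in> {0..1} \<Longrightarrow> clip x = x" by (auto simp: clip_def)

lemma clip_meas: "clip \<in> borel \<rightarrow>\<^sub>M restrict_space borel {0..1}"
proof (rule measurable_restrict_space2)
  show "clip \<in> borel_measurable borel" unfolding clip_def[abs_def] by measurable
  show "clip \<in> space borel \<rightarrow> {0..1}" by (rule Pi_I) (rule clip_in)
qed

definition hist :: "nat \<Rightarrow> (nat \<Rightarrow> real) \<Rightarrow> real" where
  "hist n \<omega> = snd ((F ^^ n) (clip (\<omega> n), 0))"

definition proj :: "(nat \<Rightarrow> real) \<Rightarrow> real \<times> real" where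
  "proj \<omega> = (clip (\<omega> 0), clip (lim (\<lambda>n. hist n \<omega>)))"

definition orbits :: "(nat \<Rightarrow> real) set" where
  "orbits = {\<omega>. \<forall>n. \<omega> n \<in> {0..1} \<and> T (\<omega> (Suc n)) = \<omega> n}"

lemma orbits_pow: "\<omega> \<in> orbits \<Longrightarrow> (T ^^ n) (\<omega> (n + k)) = \<omega> k"
proof (induction n arbitrary: k)
  case (Suc n)
  have "(T ^^ Suc n) (\<omega> (Suc n + k)) = T ((T ^^ n) (\<omega> (n + Suc k)))" by simp
  also have "\<dots> = T (\<omega> (Suc k))" using Suc.IH[OF Suc.prems, of "Suc k"] by simp
  finally show ?case using Suc.prems by (simp add: orbits_def)
qed simp

lemma hist_range: "hist n \<omega> \<in> {0..1}"
proof -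
  have "(clip (\<omega> n), 0) \<in> unit_square" using clip_in[of "\<omega> n"] by simp
  from Fn_maps[OF this, of n] show ?thesis by (auto simp: hist_def mem_Times_iff)
qed

text \<open>One step from \<open>(\<omega> (Suc n), 0)\<close> leads to the leaf over
  \<open>\<omega> n\<close>. So consecutive terms arise from two points of one leaf after
  \<open>n\<close> steps and differ by at most \<open>l ^ n\<close>.\<close>

lemma hist_tendsto:
  assumes w: "\<omega> \<in> orbits" shows "(\<lambda>n. hist n \<omega>) \<longlonglongrightarrow> snd (proj \<omega>)"
proof -
  have wn: "\<omega> n \<in> {0..1}" for n using w by (simp add: orbits_def)
  have step: "\<bar>hist (Suc n) \<omega> - hist n \<omega>\<bar> \<le> l ^ n" for n
  proof -
    have "(F ^^ Suc n) (\<omega> (Suc n), 0) = (F ^^ n) (\<omega> n, G (\<omega> (Suc n), 0))"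
      using F_form[OF wn[of "Suc n"], of 0] w by (simp add: funpow_swap1 orbits_def)
    moreover have "G (\<omega> (Suc n), 0) \<in> {0..1}" using G_range[OF wn[of "Suc n"], of 0] by simp
    ultimately show ?thesis
      using Fn_contract[OF wn[of n], of "G (\<omega> (Suc n), 0)" 0 n] by (simp add: hist_def clip_id[OF wn])
  qed
  have "summable (\<lambda>n. hist (Suc n) \<omega> - hist n \<omega>)"
  proof (rule summable_comparison_test'[of _ 0])
    show "summable (\<lambda>n. l ^ n)" using l_bounds by (intro summable_geometric) simp
    show "norm (hist (Suc n) \<omega> - hist n \<omega>) \<le> l ^ n" for n using step[of n] by (simp only: real_norm_def)
  qed
  then have "(\<lambda>n. \<Sum>i<n. hist (Suc i) \<omega> - hist i \<omega>) \<longlonglongrightarrow> (\<Sum>n. hist (Suc n) \<omega> - hist n \<omega>)"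
    by (rule summable_LIMSEQ)
  then have "(\<lambda>n. hist n \<omega> - hist 0 \<omega>) \<longlonglongrightarrow> (\<Sum>n. hist (Suc n) \<omega> - hist n \<omega>)"
    unfolding sum_lessThan_telescope[of "\<lambda>n. hist n \<omega>"] .
  then have "(\<lambda>n. (hist n \<omega> - hist 0 \<omega>) + hist 0 \<omega>) \<longlonglongrightarrow> (\<Sum>n. hist (Suc n) \<omega> - hist n \<omega>) + hist 0 \<omega>"
    by (rule tendsto_add[OF _ tendsto_const])
  then have "convergent (\<lambda>n. hist n \<omega>)" by (auto simp: convergent_def)
  then have L: "(\<lambda>n. hist n \<omega>) \<longlonglongrightarrow> lim (\<lambda>n. hist n \<omega>)" by (simp add: convergent_LIMSEQ_iff)
  have "lim (\<lambda>n. hist n \<omega>) \<in> {0..1}"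
    by (rule closed_sequentially[OF closed_atLeastAtMost hist_range L])
  then show ?thesis using L by (simp add: proj_def clip_id)
qed

lemma proj_range: "proj \<omega> \<in> unit_square"
  using clip_in unfolding proj_def by blast

text \<open>Dropping the first entry of a backward orbit gives the past of its preimage
  \<open>\<omega> 1\<close>. For finite pasts, \<open>hist (Suc n) \<omega>\<close> is
  \<open>G\<close> applied over \<open>\<omega> 1\<close> to the \<open>hist n\<close> of the
  shifted orbit, and continuity of \<open>G\<close> along the leaf passes this to the limit.\<close>

lemma proj_shift:
  assumes w: "\<omega> \<in> orbits" shows "F (proj (\<lambda>n. \<omega> (Suc n))) = proj \<omega>"
proof -
  let ?s = "\<lambda>n. \<omega> (Suc n)"
  have wn: "\<omega> n \<in> {0..1}" for n using w by (simp add: orbits_def)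
  have s: "?s \<in> orbits" using w by (simp add: orbits_def)
  have p1: "fst (proj ?s) = \<omega> 1" by (simp add: proj_def clip_id[OF wn])
  have p2: "snd (proj ?s) \<in> {0..1}" using proj_range[of ?s] by (simp add: mem_Times_iff)
  have e: "hist (Suc n) \<omega> = G (\<omega> 1, hist n ?s)" for n
  proof -
    have q: "(\<omega> (Suc n), 0) \<in> unit_square" using wn[of "Suc n"] by simp
    show ?thesis
      using Fn_Suc_snd[OF q, of n] orbits_pow[OF w, of n 1] by (simp add: hist_def clip_id[OF wn])
  qed
  have "(\<lambda>n. hist (Suc n) \<omega> - G (\<omega> 1, snd (proj ?s))) \<longlonglongrightarrow> 0"
  proof (rule Lim_null_comparison)
    show "eventually (\<lambda>n. norm (hist (Suc n) \<omega> - G (\<omega> 1, snd (proj ?s))) \<le> l * \<bar>hist n ?s - snd (proj ?s)\<bar>) sequentially"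
      using leaf[OF wn[of 1] hist_range p2] unfolding e by simp
    have "(\<lambda>n. l * \<bar>hist n ?s - snd (proj ?s)\<bar>) \<longlonglongrightarrow> l * \<bar>snd (proj ?s) - snd (proj ?s)\<bar>"
      by (intro tendsto_intros hist_tendsto[OF s])
    then show "(\<lambda>n. l * \<bar>hist n ?s - snd (proj ?s)\<bar>) \<longlonglongrightarrow> 0" by simp
  qed
  then have "(\<lambda>n. hist (Suc n) \<omega>) \<longlonglongrightarrow> G (\<omega> 1, snd (proj ?s))" by (simp add: LIM_zero_iff)
  from LIMSEQ_unique[OF this LIMSEQ_Suc[OF hist_tendsto[OF w]]]
  have "G (\<omega> 1, snd (proj ?s)) = snd (proj \<omega>)" .
  moreover have "proj ?s = (\<omega> 1, snd (proj ?s))" using p1 by (metis prod.collapse)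
  moreover have "fst (proj \<omega>) = \<omega> 0" by (simp add: proj_def clip_id[OF wn])
  moreover have "T (\<omega> 1) = \<omega> 0" using w by (simp add: orbits_def)
  ultimately show ?thesis using F_form[OF wn[of 1] p2] by (metis prod.collapse)
qed

text \<open>\<mu> is the image of the natural extension under \<open>proj\<close>. By
  \<open>proj_shift\<close> the shift invariance of the law of backward orbits becomes invariance
  under \<open>F\<close>.\<close>

lemma invariant_lift:
  "\<exists>\<mu>. prob_space \<mu> \<and> sets \<mu> = sets QB \<and> F \<in> \<mu> \<rightarrow>\<^sub>M \<mu> \<and> distr \<mu> \<mu> F = \<mu> \<and>
    (\<forall>A f. bm A f \<longrightarrow> (\<integral>q. f (fst q) \<partial>\<mu>) = (\<integral>x. f x \<partial>\<nu>))"
proof -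
  define \<nu>b where "\<nu>b = distr \<nu> borel (\<lambda>x. x)"
  \<comment> \<open>\<open>natural_extension\<close> deals with measures and maps on the whole line;
    \<open>\<nu>b\<close> gives no mass to the outside of \<open>{0..1}\<close>, where
    \<open>T'\<close> is the identity.\<close>
  define T' where "T' = (\<lambda>x. if x \<in> {0..1} then T x else x)"
  have rb: "sets \<nu> = sets (restrict_space borel {0..1})" using sets_nu sets_LB by simp
  have idm: "(\<lambda>x. x) \<in> \<nu> \<rightarrow>\<^sub>M borel"
    unfolding measurable_cong_sets[OF rb refl] by (rule measurable_restrict_space1) simp
  have T': "T' \<in> borel_measurable borel"
  proof -
    have "T \<in> borel_measurable (restrict_space borel {0..1})"
      using T_meas unfolding measurable_cong_sets[OF sets_LB sets_LB] by (simp add: measurable_restrict_space2_iff)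
    then have a: "T \<in> borel_measurable (restrict_space borel {x. x \<in> {0..1}})" by (simp only: Collect_mem_eq)
    have b: "(\<lambda>x. x) \<in> borel_measurable (restrict_space borel {x. x \<notin> {0..1::real}})"
      by (rule measurable_restrict_space1) simp
    have "{x \<in> space borel. x \<in> {0..1::real}} = {0..1}" by auto
    then show ?thesis
      unfolding T'_def by (intro measurable_If_restrict_space_iff[THEN iffD2, OF _ conjI[OF a b]]) simp
  qed
  have sb: "sets \<nu>b = sets borel" by (simp add: \<nu>b_def)
  have pb: "prob_space \<nu>b" unfolding \<nu>b_def by (rule prob_space.prob_space_distr[OF nu_prob idm])
  have "distr \<nu>b \<nu>b T' = distr \<nu>b borel T'" by (rule distr_cong) (simp_all add: sb)
  also have "\<dots> = distr \<nu> borel (T' \<circ> (\<lambda>x. x))" unfolding \<nu>b_def by (rule distr_distr[OF T' idm])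
  also have "\<dots> = distr \<nu> borel ((\<lambda>x. x) \<circ> T)" by (rule distr_cong) (auto simp: T'_def)
  also have "\<dots> = distr (distr \<nu> \<nu> T) borel (\<lambda>x. x)" by (rule distr_distr[OF idm nu_T, symmetric])
  also have "\<dots> = \<nu>b" unfolding nu_inv \<nu>b_def by (rule refl)
  finally have inv: "distr \<nu>b \<nu>b T' = \<nu>b" .
  obtain \<Omega> where O: "prob_space \<Omega>" "sets \<Omega> = sets (PiM (UNIV :: nat set) (\<lambda>_. borel :: real measure))"
    "\<And>n. distr \<Omega> borel (\<lambda>\<omega>. \<omega> n) = \<nu>b" "distr \<Omega> \<Omega> (\<lambda>\<omega> n. \<omega> (Suc n)) = \<Omega>"
    "\<And>n. AE \<omega> in \<Omega>. T' (\<omega> (Suc n)) = \<omega> n"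
    using natural_extension[OF pb sb T' inv] by blast
  have comp: "(\<lambda>\<omega>. \<omega> n) \<in> \<Omega> \<rightarrow>\<^sub>M borel" for n
    unfolding measurable_cong_sets[OF O(2) refl] by (rule measurable_component_singleton) simp
  have sh: "(\<lambda>\<omega> n. \<omega> (Suc n)) \<in> \<Omega> \<rightarrow>\<^sub>M \<Omega>"
    unfolding measurable_cong_sets[OF refl O(2)]
    by (rule measurable_PiM_single') (auto simp: comp space_PiM)
  have "AE x in \<nu>b. x \<in> {0..1}"
    unfolding \<nu>b_def by (subst AE_distr_iff[OF idm]) (auto intro!: AE_I2)
  then have "AE x in distr \<Omega> borel (\<lambda>\<omega>. \<omega> n). x \<in> {0..1}" for n by (simp only: O(3))
  then have "AE \<omega> in \<Omega>. \<omega> n \<in> {0..1}" for n by (rule AE_distrD[OF comp])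
  then have "AE \<omega> in \<Omega>. \<forall>n. \<omega> n \<in> {0..1} \<and> T' (\<omega> (Suc n)) = \<omega> n"
    using O(5) by (simp add: AE_all_countable)
  then have orb: "AE \<omega> in \<Omega>. \<omega> \<in> orbits"
  proof eventually_elim
    case (elim \<omega>)
    have "\<omega> n \<in> {0..1}" "T (\<omega> (Suc n)) = \<omega> n" for n
      using elim[rule_format, of n] elim[rule_format, of "Suc n"] unfolding T'_def by simp_all
    then show ?case by (simp add: orbits_def)
  qed
  have Q0: "(\<lambda>x. (x, 0::real)) \<in> restrict_space borel {0..1} \<rightarrow>\<^sub>M QB"
  proof (rule measurable_restrict_space2)
    show "(\<lambda>x. (x, 0::real)) \<in> borel_measurable (restrict_space (borel :: real measure) {0..1})"
      by (intro measurable_restrict_space1 borel_measurable_continuous_onI continuous_intros)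
  qed (auto simp: space_restrict_space)
  have hm: "hist n \<in> borel_measurable \<Omega>" for n
    using measurable_compose[OF measurable_compose[OF measurable_compose[OF measurable_compose[OF comp clip_meas] Q0] Fn_meas] QB_snd]
    unfolding hist_def[abs_def] .
  have cb: "clip \<in> borel_measurable borel" unfolding clip_def[abs_def] by measurable
  have pm: "proj \<in> \<Omega> \<rightarrow>\<^sub>M QB"
  proof (rule measurable_restrict_space2)
    show "proj \<in> space \<Omega> \<rightarrow> unit_square" by (rule Pi_I) (rule proj_range)
    have "(\<lambda>\<omega>. lim (\<lambda>n. hist n \<omega>)) \<in> borel_measurable \<Omega>"
      by (rule borel_measurable_lim_metric) (rule hm)
    from measurable_Pair[OF measurable_compose[OF comp cb] measurable_compose[OF this cb]]
    show "proj \<in> borel_measurable \<Omega>" unfolding proj_def[abs_def] borel_prod .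
  qed
  define \<mu> where "\<mu> = distr \<Omega> QB proj"
  have s: "sets \<mu> = sets QB" by (simp add: \<mu>_def)
  have p: "prob_space \<mu>" unfolding \<mu>_def by (rule prob_space.prob_space_distr[OF O(1) pm])
  have Fm: "F \<in> \<mu> \<rightarrow>\<^sub>M \<mu>" unfolding measurable_cong_sets[OF s s] by (rule F_meas)
  have Fp: "F \<circ> proj \<in> \<Omega> \<rightarrow>\<^sub>M QB" by (rule measurable_comp[OF pm F_meas])
  have "distr \<mu> \<mu> F = distr \<mu> QB F" by (rule distr_cong) (simp_all add: s)
  also have "\<dots> = distr \<Omega> QB (F \<circ> proj)" unfolding \<mu>_def by (rule distr_distr[OF F_meas pm])
  also have "\<dots> = distr (distr \<Omega> \<Omega> (\<lambda>\<omega> n. \<omega> (Suc n))) QB (F \<circ> proj)" by (simp only: O(4))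
  also have "\<dots> = distr \<Omega> QB ((F \<circ> proj) \<circ> (\<lambda>\<omega> n. \<omega> (Suc n)))" by (rule distr_distr[OF Fp sh])
  also have "\<dots> = distr \<Omega> QB proj"
  proof (rule distr_cong_AE)
    show "AE \<omega> in \<Omega>. ((F \<circ> proj) \<circ> (\<lambda>\<omega> n. \<omega> (Suc n))) \<omega> = proj \<omega>"
      using orb by eventually_elim (simp add: proj_shift)
  qed (auto intro: measurable_comp[OF sh Fp] pm)
  also have "\<dots> = \<mu>" by (simp add: \<mu>_def)
  finally have i: "distr \<mu> \<mu> F = \<mu>" .
  have "(\<integral>q. f (fst q) \<partial>\<mu>) = (\<integral>x. f x \<partial>\<nu>)" if f: "bm A f" for A f
  proof -
    have fL: "f \<in> borel_measurable (restrict_space borel {0..1})"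
      using f unfolding bm_def measurable_cong_sets[OF sets_LB refl] by blast
    have fc: "(\<lambda>x. f (clip x)) \<in> borel_measurable borel" by (rule measurable_compose[OF clip_meas fL])
    have "(\<integral>q. f (fst q) \<partial>\<mu>) = (\<integral>\<omega>. f (fst (proj \<omega>)) \<partial>\<Omega>)"
      unfolding \<mu>_def by (rule integral_distr[OF pm measurable_compose[OF QB_fst fL]])
    also have "\<dots> = (\<integral>\<omega>. f (clip (\<omega> 0)) \<partial>\<Omega>)" by (simp add: proj_def)
    also have "\<dots> = (\<integral>x. f (clip x) \<partial>distr \<Omega> borel (\<lambda>\<omega>. \<omega> 0))" by (rule integral_distr[OF comp fc, symmetric])
    also have "\<dots> = (\<integral>x. f (clip x) \<partial>\<nu>b)" by (simp only: O(3))
    also have "\<dots> = (\<integral>x. f (clip x) \<partial>\<nu>)" unfolding \<nu>b_def by (rule integral_distr[OF idm fc])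
    also have "\<dots> = (\<integral>x. f x \<partial>\<nu>)" by (rule Bochner_Integration.integral_cong) (auto simp: clip_id)
    finally show ?thesis .
  qed
  then show ?thesis using p s Fm i by blast
qed

end

subsection \<open>Decay of correlations for the lift\<close>

locale skew_lift = skew +
  fixes \<mu> :: "(real \<times> real) measure"
  assumes mu_prob: "prob_space \<mu>" and sets_mu: "sets \<mu> = sets QB"
    and F_mu: "F \<in> \<mu> \<rightarrow>\<^sub>M \<mu>" and mu_inv: "distr \<mu> \<mu> F = \<mu>"
    and mu_fst: "\<And>A f. bm A f \<Longrightarrow> (\<integral>q. f (fst q) \<partial>\<mu>) = (\<integral>x. f x \<partial>\<nu>)"
begin

lemma space_mu [simp]: "space \<mu> = unit_square"
  using sets_eq_imp_space_eq[OF sets_mu] by simp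

lemma meas_mu: "f \<in> borel_measurable \<mu> \<longleftrightarrow> f \<in> borel_measurable QB"
  by (simp add: measurable_cong_sets[OF sets_mu refl])

definition bq :: "real \<Rightarrow> (real \<times> real \<Rightarrow> real) \<Rightarrow> bool" where
  "bq A h \<longleftrightarrow> h \<in> borel_measurable QB \<and> (\<forall>q\<in>unit_square. \<bar>h q\<bar> \<le> A)"

lemma bqI: "h \<in> borel_measurable QB \<Longrightarrow> (\<And>q. q \<in> unit_square \<Longrightarrow> \<bar>h q\<bar> \<le> A) \<Longrightarrow> bq A h"
  unfolding bq_def by blast

lemma bq_abs: "bq A h \<Longrightarrow> q \<in> unit_square \<Longrightarrow> \<bar>h q\<bar> \<le> A"
  unfolding bq_def by (rule bspec[OF conjunct2])

lemma bq_meas: "bq A h \<Longrightarrow> h \<in> borel_measurable QB"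
  by (simp only: bq_def)

lemma unit_0: "(0, 0) \<in> unit_square" by simp

lemma bq_nonneg: "bq A h \<Longrightarrow> 0 \<le> A"
  using bq_abs[OF _ unit_0] abs_ge_zero order_trans by blast

lemma bq_integrable: assumes "bq A h" shows "integrable \<mu> h"
proof -
  have "finite_measure \<mu>" using mu_prob by (simp add: prob_space_def)
  moreover have "AE q in \<mu>. norm (h q) \<le> A" using bq_abs[OF assms] by (intro AE_I2) (simp only: space_mu real_norm_def)
  ultimately show ?thesis using bq_meas[OF assms] by (intro finite_measure.integrable_const_bound) (auto simp: meas_mu)
qed

lemma bq_bound: assumes h: "bq A h" shows "\<bar>\<integral>q. h q \<partial>\<mu>\<bar> \<le> A"
proof -
  interpret prob_space \<mu> by (rule mu_prob)
  have "\<bar>\<integral>q. h q \<partial>\<mu>\<bar> \<le> (\<integral>q. \<bar>h q\<bar> \<partial>\<mu>)" by (rule integral_abs_bound)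
  also have "\<dots> \<le> (\<integral>q. A \<partial>\<mu>)"
  proof (rule integral_mono)
    show "integrable \<mu> (\<lambda>q. \<bar>h q\<bar>)" by (rule integrable_abs[OF bq_integrable[OF h]])
    show "\<bar>h q\<bar> \<le> A" if "q \<in> space \<mu>" for q using bq_abs[OF h] that by (simp only: space_mu)
  qed simp
  also have "\<dots> = A" using prob_space by simp
  finally show ?thesis .
qed

lemma bq_lip: "lipf A B f \<Longrightarrow> bq A f"
  by (intro bqI lipf_meas lipf_abs)

lemma bq_Fn: assumes "bq A h" shows "bq A (\<lambda>q. h ((F ^^ n) q))"
proof (rule bqI)
  show "(\<lambda>q. h ((F ^^ n) q)) \<in> borel_measurable QB" by (rule measurable_compose[OF Fn_meas bq_meas[OF assms]])
  show "\<bar>h ((F ^^ n) q)\<bar> \<le> A" if "q \<in> unit_square" for q by (rule bq_abs[OF assms Fn_maps[OF that]])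
qed

lemma bq_mult: assumes f: "bq A f" and f': "bq B f'" shows "bq (A * B) (\<lambda>q. f q * f' q)"
proof (rule bqI)
  show "(\<lambda>q. f q * f' q) \<in> borel_measurable QB" using bq_meas[OF f] bq_meas[OF f'] by (rule borel_measurable_times)
  show "\<bar>f q * f' q\<bar> \<le> A * B" if "q \<in> unit_square" for q
    unfolding abs_mult using bq_abs[OF f that] bq_abs[OF f' that] bq_nonneg[OF f] by (intro mult_mono) auto
qed

lemma bq_diff: assumes f: "bq A f" and f': "bq B f'" shows "bq (A + B) (\<lambda>q. f q - f' q)"
proof (rule bqI)
  show "(\<lambda>q. f q - f' q) \<in> borel_measurable QB" using bq_meas[OF f] bq_meas[OF f'] by (rule borel_measurable_diff)
  show "\<bar>f q - f' q\<bar> \<le> A + B" if "q \<in> unit_square" for q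
    using bq_abs[OF f that] bq_abs[OF f' that] by linarith
qed

lemma bq_fst: assumes h: "bm A h" shows "bq A (\<lambda>q. h (fst q))"
proof (rule bqI)
  have "h \<in> borel_measurable (restrict_space borel {0..1})"
    using h unfolding bm_def measurable_cong_sets[OF sets_LB refl] by blast
  then show "(\<lambda>q. h (fst q)) \<in> borel_measurable QB" by (rule measurable_compose[OF QB_fst])
  show "\<bar>h (fst q)\<bar> \<le> A" if "q \<in> unit_square" for q
    using h that by (auto simp: bm_def)
qed

lemma mu_invariant: assumes h: "bq A h" shows "(\<integral>q. h ((F ^^ n) q) \<partial>\<mu>) = (\<integral>q. h q \<partial>\<mu>)"
proof (induction n)
  case (Suc n)
  have m: "(\<lambda>q. h ((F ^^ n) q)) \<in> borel_measurable \<mu>" using bq_meas[OF bq_Fn[OF h]] by (simp add: meas_mu)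
  have "(\<integral>q. h ((F ^^ Suc n) q) \<partial>\<mu>) = (\<integral>q. h ((F ^^ n) (F q)) \<partial>\<mu>)" by (simp add: funpow_swap1)
  also have "\<dots> = (\<integral>q. h ((F ^^ n) q) \<partial>distr \<mu> \<mu> F)" by (rule integral_distr[OF F_mu m, symmetric])
  finally show ?case using Suc by (simp add: mu_inv)
qed simp

lemma integral_diff_bound:
  assumes f: "bq A f" and f': "bq B f'" and d: "\<And>q. q \<in> unit_square \<Longrightarrow> \<bar>f q - f' q\<bar> \<le> D"
  shows "\<bar>(\<integral>q. f q \<partial>\<mu>) - (\<integral>q. f' q \<partial>\<mu>)\<bar> \<le> D"
proof -
  have "bq D (\<lambda>q. f q - f' q)" using bq_meas[OF bq_diff[OF f f']] d by (rule bqI)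
  from bq_bound[OF this] show ?thesis
    using bq_integrable[OF f] bq_integrable[OF f'] by (simp add: Bochner_Integration.integral_diff)
qed

lemma fk_approx:
  assumes f: "lipf A B f" and q: "q \<in> unit_square" shows "\<bar>f ((F ^^ k) q) - fk f k (fst q)\<bar> \<le> B * l ^ k"
proof -
  obtain x y where xy: "q = (x, y)" "x \<in> {0..1}" "y \<in> {0..1}" using q by blast
  have q0: "(x, 0) \<in> unit_square" using xy by simp
  have "\<bar>f ((F ^^ k) q) - fk f k (fst q)\<bar> \<le>
    B * (\<bar>fst ((F ^^ k) q) - fst ((F ^^ k) (x, 0))\<bar> + \<bar>snd ((F ^^ k) q) - snd ((F ^^ k) (x, 0))\<bar>)"
    unfolding fk_def using lipf_lip[OF f Fn_maps[OF q] Fn_maps[OF q0]] xy by simp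
  also have "\<dots> \<le> B * (0 + l ^ k)"
  proof (intro mult_left_mono add_mono)
    show "\<bar>fst ((F ^^ k) q) - fst ((F ^^ k) (x, 0))\<bar> \<le> 0" unfolding Fn_fst[OF q] Fn_fst[OF q0] using xy by simp
    show "\<bar>snd ((F ^^ k) q) - snd ((F ^^ k) (x, 0))\<bar> \<le> l ^ k"
      unfolding xy(1) by (rule Fn_contract[OF xy(2,3)]) simp
    show "0 \<le> B" using f by (simp add: lipf_def)
  qed
  finally show ?thesis by simp
qed

text \<open>Put \<open>F ^^ k\<close> in front of both factors by invariance of \<mu>. Then
  \<open>f\<close> may be replaced by \<open>fk f k\<close>, and \<open>f'\<close>, at total time
  \<open>n + k = j + m\<close>, by \<open>fk f' j\<close> after \<open>T ^^ m\<close>. What remains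
  is a correlation of the base map at time \<open>m\<close>. The second function needs only a sup
  bound, so \<open>j\<close> costs nothing there; \<open>k\<close> costs
  \<open>1 / r ^ k\<close>.\<close>

lemma decay_split:
  assumes dec: "\<And>A B D h \<psi> n. sp A B h \<Longrightarrow> bm D \<psi> \<Longrightarrow> \<bar>corr h n \<psi>\<bar> \<le> C * \<Lambda> ^ n * (A + B) * D"
    and L: "0 < \<Lambda>" "0 < C"
    and f: "lipf A B f" and f': "lipf A' B' f'" and j: "j \<le> n + k"
  shows "\<bar>(\<integral>q. f q * f' ((F ^^ n) q) \<partial>\<mu>) - (\<integral>q. f q \<partial>\<mu>) * (\<integral>q. f' q \<partial>\<mu>)\<bar>
    \<le> (A + B) * (A' + B') * (2 * l ^ j + 2 * l ^ k + C * (1 + C6) * (\<Lambda> ^ (n + k - j) / r ^ k))"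
proof -
  define m where "m = n + k - j"
  let ?\<phi> = "fk f k" and ?\<psi> = "fk f' j"
  have bf: "bq A f" and bg: "bq A' f'" by (rule bq_lip[OF f] bq_lip[OF f'])+
  have p: "bm A ?\<phi>" and s: "bm A' ?\<psi>" by (rule fk_bm[OF f] fk_bm[OF f'])+
  have nn: "0 \<le> A" "0 \<le> A'" "0 \<le> B" "0 \<le> B'"
    using bq_nonneg[OF bf] bq_nonneg[OF bg] f f' by (auto simp: lipf_def)
  have lk: "0 \<le> l ^ k" "0 \<le> l ^ j" using l_bounds by auto
  have ef: "\<bar>(\<integral>q. f q \<partial>\<mu>) - (\<integral>x. ?\<phi> x \<partial>\<nu>)\<bar> \<le> B * l ^ k"
    using integral_diff_bound[OF bq_Fn[OF bf] bq_fst[OF p] fk_approx[OF f]] by (simp add: mu_invariant[OF bf] mu_fst[OF p])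
  have eg: "\<bar>(\<integral>q. f' q \<partial>\<mu>) - (\<integral>x. ?\<psi> x \<partial>\<nu>)\<bar> \<le> B' * l ^ j"
    using integral_diff_bound[OF bq_Fn[OF bg] bq_fst[OF s] fk_approx[OF f']] by (simp add: mu_invariant[OF bg] mu_fst[OF s])
  have prod: "\<bar>a * b - c * d\<bar> \<le> A * (B' * l ^ j) + A' * (B * l ^ k)"
    if "\<bar>a - c\<bar> \<le> B * l ^ k" "\<bar>b - d\<bar> \<le> B' * l ^ j" "\<bar>a\<bar> \<le> A" "\<bar>d\<bar> \<le> A'" for a b c d
  proof -
    have "\<bar>a * b - c * d\<bar> \<le> \<bar>a\<bar> * \<bar>b - d\<bar> + \<bar>d\<bar> * \<bar>a - c\<bar>"
      unfolding abs_mult[symmetric] by (rule order_trans[OF _ abs_triangle_ineq]) (simp add: algebra_simps)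
    also have "\<dots> \<le> A * (B' * l ^ j) + A' * (B * l ^ k)"
      using that nn by (intro add_mono mult_mono) auto
    finally show ?thesis .
  qed
  have e1: "\<bar>(\<integral>q. f q \<partial>\<mu>) * (\<integral>q. f' q \<partial>\<mu>) - (\<integral>x. ?\<phi> x \<partial>\<nu>) * (\<integral>x. ?\<psi> x \<partial>\<nu>)\<bar> \<le> A * (B' * l ^ j) + A' * (B * l ^ k)"
    by (rule prod[OF ef eg bq_bound[OF bf] nu_bound[OF s]])
  have fg: "bq (A * A') (\<lambda>q. f q * f' ((F ^^ n) q))" by (rule bq_mult[OF bf bq_Fn[OF bg]])
  have ps: "bm (A * A') (\<lambda>x. ?\<phi> x * ?\<psi> ((T ^^ m) x))" by (rule bm_mult[OF p bm_comp_T[OF s]])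
  have "\<bar>(\<integral>q. f ((F ^^ k) q) * f' ((F ^^ n) ((F ^^ k) q)) \<partial>\<mu>) - (\<integral>q. ?\<phi> (fst q) * ?\<psi> ((T ^^ m) (fst q)) \<partial>\<mu>)\<bar>
    \<le> A * (B' * l ^ j) + A' * (B * l ^ k)"
  proof (rule integral_diff_bound[OF bq_Fn[OF fg] bq_fst[OF ps]])
    fix q :: "real \<times> real" assume q: "q \<in> unit_square"
    have "(F ^^ n) ((F ^^ k) q) = (F ^^ j) ((F ^^ m) q)"
      using j by (simp add: m_def funpow_add[THEN fun_cong, unfolded comp_apply, symmetric])
    then have "\<bar>f' ((F ^^ n) ((F ^^ k) q)) - ?\<psi> ((T ^^ m) (fst q))\<bar> \<le> B' * l ^ j"
      using fk_approx[OF f' Fn_maps[OF q], of j m] by (simp add: Fn_fst[OF q])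
    moreover have "\<bar>?\<psi> ((T ^^ m) (fst q))\<bar> \<le> A'"
      using bq_abs[OF bq_fst[OF bm_comp_T[OF s]] q] .
    ultimately show "\<bar>f ((F ^^ k) q) * f' ((F ^^ n) ((F ^^ k) q)) - ?\<phi> (fst q) * ?\<psi> ((T ^^ m) (fst q))\<bar>
      \<le> A * (B' * l ^ j) + A' * (B * l ^ k)"
      by (rule prod[OF fk_approx[OF f q] _ bq_abs[OF bq_Fn[OF bf] q]])
  qed
  then have e2: "\<bar>(\<integral>q. f q * f' ((F ^^ n) q) \<partial>\<mu>) - (\<integral>x. ?\<phi> x * ?\<psi> ((T ^^ m) x) \<partial>\<nu>)\<bar>
    \<le> A * (B' * l ^ j) + A' * (B * l ^ k)"
    unfolding mu_invariant[OF fg] mu_fst[OF ps] .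
  have e3: "\<bar>corr ?\<phi> m ?\<psi>\<bar> \<le> C * \<Lambda> ^ m * (A + C6 * (A + B) / r ^ k) * A'"
    by (rule dec[OF fk_sp[OF f] s])
  have rk: "0 < r ^ k" "r ^ k \<le> 1" using r_bounds by (auto simp: power_le_one)
  have "A \<le> (A + B) / r ^ k"
  proof -
    have "A * r ^ k \<le> (A + B) * 1" using nn rk by (intro mult_mono) auto
    then show ?thesis using rk by (simp add: le_divide_eq)
  qed
  then have "A + C6 * (A + B) / r ^ k \<le> (1 + C6) * (A + B) / r ^ k" by (simp add: algebra_simps add_divide_distrib)
  then have "C * \<Lambda> ^ m * (A + C6 * (A + B) / r ^ k) * A' \<le> C * \<Lambda> ^ m * ((1 + C6) * (A + B) / r ^ k) * (A' + B')"
    using nn L C6_pos rk by (intro mult_mono mult_left_mono) auto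
  also have "\<dots> = (A + B) * (A' + B') * (C * (1 + C6) * (\<Lambda> ^ m / r ^ k))" by (simp add: mult_ac)
  finally have e4: "\<bar>corr ?\<phi> m ?\<psi>\<bar> \<le> (A + B) * (A' + B') * (C * (1 + C6) * (\<Lambda> ^ m / r ^ k))" using e3 by linarith
  have "A * (B' * l ^ j) + A' * (B * l ^ k) \<le> (A + B) * (A' + B') * (l ^ j + l ^ k)"
  proof -
    have "(A * B') * l ^ j \<le> ((A + B) * (A' + B')) * l ^ j" "(B * A') * l ^ k \<le> ((A + B) * (A' + B')) * l ^ k"
      using nn lk by (auto intro!: mult_right_mono mult_mono)
    then show ?thesis by (simp add: algebra_simps)
  qed
  then have "\<bar>(\<integral>q. f q * f' ((F ^^ n) q) \<partial>\<mu>) - (\<integral>q. f q \<partial>\<mu>) * (\<integral>q. f' q \<partial>\<mu>)\<bar>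
    \<le> (A + B) * (A' + B') * (l ^ j + l ^ k) + (A + B) * (A' + B') * (l ^ j + l ^ k) + (A + B) * (A' + B') * (C * (1 + C6) * (\<Lambda> ^ m / r ^ k))"
    using e1 e2 e4 unfolding corr_def by linarith
  also have "\<dots> = (A + B) * (A' + B') * (2 * l ^ j + 2 * l ^ k + C * (1 + C6) * (\<Lambda> ^ m / r ^ k))"
    by (simp add: algebra_simps)
  finally show ?thesis by (simp add: m_def)
qed

text \<open>\<open>s\<close> is chosen such that \<open>\<Lambda> ^ s\<close> is at most the square
  of \<open>r\<close>. With \<open>j\<close> about half of \<open>n\<close> and \<open>k\<close>
  about \<open>j / s\<close>, the time \<open>n + k - j\<close> is at least \<open>s * k\<close>, so
  the base decay absorbs \<open>1 / r ^ k\<close> and leaves a factor \<open>r ^ k\<close>.\<close>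

lemma mu_decay:
  "\<exists>C \<Lambda>. 0 < \<Lambda> \<and> \<Lambda> < 1 \<and> 0 < C \<and> (\<forall>A B A' B' f f' n. lipf A B f \<longrightarrow> lipf A' B' f' \<longrightarrow>
    \<bar>(\<integral>q. f q * f' ((F ^^ n) q) \<partial>\<mu>) - (\<integral>q. f q \<partial>\<mu>) * (\<integral>q. f' q \<partial>\<mu>)\<bar> \<le> C * \<Lambda> ^ n * (A + B) * (A' + B'))"
proof -
  obtain \<Lambda> C where L: "0 < \<Lambda>" "\<Lambda> < 1" "0 < C" and dec: "\<And>A B D h \<psi> n. sp A B h \<Longrightarrow> bm D \<psi> \<Longrightarrow>
    \<bar>corr h n \<psi>\<bar> \<le> C * \<Lambda> ^ n * (A + B) * D"
    using exp_decay_nu by blast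
  obtain s0 where s0: "\<Lambda> ^ s0 < r\<^sup>2" using real_arch_pow_inv[of "r\<^sup>2" \<Lambda>] L r_bounds by auto
  define s where "s = Suc s0"
  have s: "0 < s" "\<Lambda> ^ s \<le> r\<^sup>2"
    using s0 power_decreasing[of s0 s \<Lambda>] L by (simp add: s_def, simp only: s_def) linarith
  define \<theta> where "\<theta> = max l r"
  have t: "0 < \<theta>" "\<theta> < 1" "l \<le> \<theta>" "r \<le> \<theta>" using l_bounds r_bounds by (auto simp: \<theta>_def)
  define \<Lambda>' where "\<Lambda>' = root (2 * s) \<theta>"
  have L': "0 < \<Lambda>'" "\<Lambda>' < 1" "\<Lambda>' ^ (2 * s) = \<theta>" using s t by (auto simp: \<Lambda>'_def)
  \<comment> \<open>Division by \<theta> pays for the rounding in \<open>k\<close>: \<open>n\<close>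
    can be as large as \<open>2 * s * Suc k\<close>, one period more than \<open>k\<close> accounts
    for.\<close>
  define C' where "C' = (4 + C * (1 + C6)) / \<theta>"
  have C': "0 < C'" using L C6_pos t by (simp add: C'_def add_pos_pos)
  have "\<bar>(\<integral>q. f q * f' ((F ^^ n) q) \<partial>\<mu>) - (\<integral>q. f q \<partial>\<mu>) * (\<integral>q. f' q \<partial>\<mu>)\<bar> \<le> C' * \<Lambda>' ^ n * (A + B) * (A' + B')"
    if f: "lipf A B f" and f': "lipf A' B' f'" for A B A' B' f f' n
  proof -
    define j where "j = n div 2"
    define k where "k = j div s"
    have kj: "k \<le> j" and sk: "s * k \<le> n + k - j" using s by (auto simp: k_def j_def)
      (metis add.commute add_le_imp_le_diff add_mono_thms_linordered_semiring(1) div_le_dividend div_times_less_eq_dividend mult.commute mult_2 times_div_less_eq_dividend trans_le_add1 le_trans)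
    have nn: "0 \<le> (A + B) * (A' + B')"
      using bq_nonneg[OF bq_lip[OF f]] bq_nonneg[OF bq_lip[OF f']] f f' by (auto simp: lipf_def)
    have "l ^ k \<le> \<theta> ^ k" "r ^ k \<le> \<theta> ^ k" using t l_bounds r_bounds by (auto intro: power_mono)
    moreover have "l ^ j \<le> l ^ k" using kj l_bounds by (intro power_decreasing) auto
    moreover have "\<Lambda> ^ (n + k - j) / r ^ k \<le> r ^ k"
    proof -
      have "\<Lambda> ^ (n + k - j) \<le> \<Lambda> ^ (s * k)" using sk L by (intro power_decreasing) auto
      also have "\<dots> = (\<Lambda> ^ s) ^ k" by (simp add: power_mult)
      also have "\<dots> \<le> (r\<^sup>2) ^ k" using s L by (intro power_mono) auto
      also have "\<dots> = r ^ k * r ^ k" by (simp add: power2_eq_square power_mult_distrib)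
      finally show ?thesis using r_bounds by (simp add: divide_le_eq)
    qed
    moreover from this have "C * (1 + C6) * (\<Lambda> ^ (n + k - j) / r ^ k) \<le> C * (1 + C6) * \<theta> ^ k"
      using calculation L C6_pos by (intro mult_left_mono) auto
    ultimately have b: "2 * l ^ j + 2 * l ^ k + C * (1 + C6) * (\<Lambda> ^ (n + k - j) / r ^ k) \<le> (4 + C * (1 + C6)) * \<theta> ^ k"
      by (simp add: algebra_simps)
    have "n \<le> 2 * s * Suc k"
    proof -
      have "j < s * Suc k" using dividend_less_times_div[OF s(1), of j] by (simp add: k_def)
      then show ?thesis by (simp add: j_def)
    qed
    then have "\<Lambda>' ^ (2 * s * Suc k) \<le> \<Lambda>' ^ n" using L' by (intro power_decreasing) auto
    then have "\<theta> * \<theta> ^ k \<le> \<Lambda>' ^ n" by (simp only: power_mult[of \<Lambda>' "2 * s" "Suc k"] L'(3) power_Suc)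
    then have "\<theta> ^ k \<le> \<Lambda>' ^ n / \<theta>" using t by (simp add: le_divide_eq mult.commute)
    then have "(4 + C * (1 + C6)) * \<theta> ^ k \<le> (4 + C * (1 + C6)) * (\<Lambda>' ^ n / \<theta>)" using L C6_pos by (intro mult_left_mono) auto
    then have "2 * l ^ j + 2 * l ^ k + C * (1 + C6) * (\<Lambda> ^ (n + k - j) / r ^ k) \<le> C' * \<Lambda>' ^ n" using b by (simp add: C'_def)
    note mult_left_mono[OF this nn]
    moreover have "j \<le> n + k" by (simp add: j_def)
    note decay_split[OF dec L(1,3) f f' this]
    ultimately have "\<bar>(\<integral>q. f q * f' ((F ^^ n) q) \<partial>\<mu>) - (\<integral>q. f q \<partial>\<mu>) * (\<integral>q. f' q \<partial>\<mu>)\<bar>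
      \<le> (A + B) * (A' + B') * (C' * \<Lambda>' ^ n)" by linarith
    then show ?thesis by (simp only: mult_ac)
  qed
  then show ?thesis using L'(1,2) C' by blast
qed

end

subsection \<open>Birkhoff averages\<close>

text \<open>Continuous functions decrease to the indicator of a closed set, and the closed sets form
  an intersection-stable generator of the Borel sets.\<close>

lemma measure_eq_continuous:
  fixes M N :: "'a::metric_space measure"
  assumes S: "S \<in> sets borel" and M: "sets M = sets (restrict_space borel S)" and N: "sets N = sets (restrict_space borel S)"
    and fin: "finite_measure M" "finite_measure N"
    and eq: "\<And>\<phi> :: 'a \<Rightarrow> real. continuous_on UNIV \<phi> \<Longrightarrow> (\<integral>x. \<phi> x \<partial>M) = (\<integral>x. \<phi> x \<partial>N)"
  shows "M = N"
proof -
  let ?h = "\<lambda>C n x. max 0 (1 - real n * infdist x C)"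
  have conth: "continuous_on UNIV (?h C n)" for C :: "'a set" and n by (intro continuous_intros)
  have lim: "(\<lambda>n. \<integral>x. ?h C n x \<partial>L) \<longlonglongrightarrow> measure L (C \<inter> S)"
    if C: "closed C" "C \<noteq> {}" and L: "sets L = sets (restrict_space borel S)" "finite_measure L" for C and L :: "'a measure"
  proof -
    have sp: "space L = S" using sets_eq_imp_space_eq[OF L(1)] by (simp add: space_restrict_space)
    have CL: "C \<inter> S \<in> sets L" using C S unfolding L(1) by (auto simp: sets_restrict_space_iff)
    have "(\<lambda>n. \<integral>x. ?h C n x \<partial>L) \<longlonglongrightarrow> (\<integral>x. indicator (C \<inter> S) x \<partial>L)"
    proof (rule integral_dominated_convergence[where w = "\<lambda>_. 1"])
      show "indicator (C \<inter> S) \<in> borel_measurable L" using CL by simp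
      show "?h C n \<in> borel_measurable L" for n
        unfolding measurable_cong_sets[OF L(1) refl]
        by (intro measurable_restrict_space1 borel_measurable_continuous_onI conth)
      show "integrable L (\<lambda>_. 1::real)" by (rule finite_measure.integrable_const[OF L(2)])
      show "AE x in L. norm (?h C n x) \<le> 1" for n by (rule AE_I2) (simp add: infdist_nonneg)
      show "AE x in L. (\<lambda>n. ?h C n x) \<longlonglongrightarrow> indicator (C \<inter> S) x"
      proof (rule AE_I2)
        fix x assume x: "x \<in> space L"
        show "(\<lambda>n. ?h C n x) \<longlonglongrightarrow> indicator (C \<inter> S) x"
        proof (cases "x \<in> C")
          case True
          then show ?thesis using x sp by simp
        next
          case False
          then have d: "0 < infdist x C" using C in_closed_iff_infdist_zero[of C x] infdist_nonneg[of x C] by auto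
          then obtain n0 where n0: "1 < real n0 * infdist x C" using ex_less_of_nat_mult by blast
          have "?h C n x = 0" if "n0 \<le> n" for n
          proof -
            have "real n0 * infdist x C \<le> real n * infdist x C" using that d by (intro mult_right_mono) auto
            then show ?thesis using n0 by simp
          qed
          then have "eventually (\<lambda>n. ?h C n x = 0) sequentially" by (auto simp: eventually_sequentially)
          then show ?thesis using False by (simp add: tendsto_eventually)
        qed
      qed
    qed
    then show ?thesis using CL by simp
  qed
  have spM: "space M = S" "space N = S" using sets_eq_imp_space_eq[OF M] sets_eq_imp_space_eq[OF N] by (simp_all add: space_restrict_space)
  have idM: "(\<lambda>x. x) \<in> L \<rightarrow>\<^sub>M borel" if "sets L = sets (restrict_space borel S)" for L :: "'a measure"
    unfolding measurable_cong_sets[OF that refl] by (rule measurable_restrict_space1) simp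
  have eqd: "distr M borel (\<lambda>x. x) = distr N borel (\<lambda>x. x)"
  proof (rule measure_eqI_generator_eq[where E = "Collect closed" and \<Omega> = UNIV and A = "\<lambda>_. UNIV"])
    show "Int_stable (Collect closed :: 'a set set)" by (auto simp: Int_stable_def)
    show "sets (distr M borel (\<lambda>x. x)) = sigma_sets UNIV (Collect closed)" "sets (distr N borel (\<lambda>x. x)) = sigma_sets UNIV (Collect closed)"
      by (simp_all add: borel_eq_closed)
    fix X :: "'a set" assume "X \<in> Collect closed"
    then have X: "closed X" by simp
    have "emeasure M (X \<inter> S) = emeasure N (X \<inter> S)"
    proof (cases "X = {}")
      case False
      have "measure M (X \<inter> S) = measure N (X \<inter> S)"
        using lim[OF X False M fin(1)] lim[OF X False N fin(2)] by (intro LIMSEQ_unique) (simp_all add: eq[OF conth])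
      then show ?thesis using fin by (simp add: finite_measure.emeasure_eq_measure)
    qed simp
    then show "emeasure (distr M borel (\<lambda>x. x)) X = emeasure (distr N borel (\<lambda>x. x)) X"
      using X by (simp add: emeasure_distr[OF idM[OF M]] emeasure_distr[OF idM[OF N]] spM vimage_def)
  next
    show "emeasure (distr M borel (\<lambda>x. x)) UNIV \<noteq> \<infinity>"
      using fin by (simp add: emeasure_distr[OF idM[OF M]] finite_measure.emeasure_eq_measure)
  qed auto
  show ?thesis
  proof (rule measure_eqI)
    show "sets M = sets N" using M N by simp
    fix X assume X: "X \<in> sets M"
    then have "X \<in> sets borel" "X \<subseteq> S" unfolding M using S by (auto simp: sets_restrict_space_iff)
    then show "emeasure M X = emeasure N X"
      using arg_cong[OF eqd, of "\<lambda>L. emeasure L X"]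
      by (simp add: emeasure_distr[OF idM[OF M]] emeasure_distr[OF idM[OF N]] spM vimage_def Int_absorb2)
  qed
qed

text \<open>The sum of the squares has a finite integral, hence is finite almost everywhere, and the
  terms of a convergent series tend to 0.\<close>

lemma AE_tendsto_zero_of_squares:
  fixes f :: "nat \<Rightarrow> 'a \<Rightarrow> real"
  assumes i: "\<And>n. integrable M (\<lambda>x. (f n x)\<^sup>2)" and s: "summable (\<lambda>n. \<integral>x. (f n x)\<^sup>2 \<partial>M)"
  shows "AE x in M. (\<lambda>n. f n x) \<longlonglongrightarrow> 0"
proof -
  have m: "(\<lambda>x. ennreal ((f n x)\<^sup>2)) \<in> borel_measurable M" for n
    using borel_measurable_integrable[OF i[of n]] by (rule measurable_compose) simp
  have "(\<integral>\<^sup>+x. (\<Sum>n. ennreal ((f n x)\<^sup>2)) \<partial>M) = (\<Sum>n. \<integral>\<^sup>+x. ennreal ((f n x)\<^sup>2) \<partial>M)"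
    by (rule nn_integral_suminf[OF m])
  also have "\<dots> = (\<Sum>n. ennreal (\<integral>x. (f n x)\<^sup>2 \<partial>M))"
    by (intro suminf_cong nn_integral_eq_integral i) auto
  also have "\<dots> \<noteq> \<infinity>" 
    unfolding infinity_ennreal_def
    by (rule ennreal_suminf_neq_top[OF s]) (rule Bochner_Integration.integral_nonneg, rule zero_le_power2)
  finally have "AE x in M. (\<Sum>n. ennreal ((f n x)\<^sup>2)) \<noteq> \<infinity>"
    by (intro nn_integral_PInf_AE borel_measurable_suminf_order m)
  then show ?thesis
  proof eventually_elim
    case (elim x)
    then have "summable (\<lambda>n. (f n x)\<^sup>2)" by (intro summable_suminf_not_top) auto
    from tendsto_real_sqrt[OF summable_LIMSEQ_zero[OF this]]
    have "(\<lambda>n. \<bar>f n x\<bar>) \<longlonglongrightarrow> 0" by simp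
    then show ?case by (rule tendsto_rabs_zero_cancel)
  qed
qed

text \<open>Between the square of \<open>k\<close> and the next one there are at most
  \<open>2 * k\<close> further terms, which change the mean by at most
  \<open>2 * A / k\<close>.\<close>

lemma cesaro_squares:
  fixes a :: "nat \<Rightarrow> real"
  assumes b: "\<And>j. \<bar>a j\<bar> \<le> A" and sq: "(\<lambda>n. (\<Sum>j<n\<^sup>2. a j) / real (n\<^sup>2)) \<longlonglongrightarrow> 0"
  shows "(\<lambda>n. (\<Sum>j<n. a j) / real n) \<longlonglongrightarrow> 0"
proof -
  define n where "n = (\<lambda>m::nat. nat \<lfloor>sqrt (real m)\<rfloor>)"
  have lim: "filterlim n at_top sequentially"
    unfolding filterlim_at_top
  proof
    fix Z
    have "Z \<le> n m" if "Z\<^sup>2 \<le> m" for m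
    proof -
      have "(real Z)\<^sup>2 \<le> real m" using that by (metis of_nat_le_iff of_nat_power)
      then show ?thesis unfolding n_def by (intro le_nat_floor real_le_rsqrt)
    qed
    then show "eventually (\<lambda>m. Z \<le> n m) sequentially" by (auto simp: eventually_sequentially)
  qed
  have A: "0 \<le> A" using b[of 0] abs_ge_zero order_trans by blast
  let ?b = "\<lambda>n. \<bar>(\<Sum>j<n\<^sup>2. a j) / real (n\<^sup>2)\<bar> + 2 * A * (1 / real n)"
  have "(\<lambda>n. ?b n) \<longlonglongrightarrow> 0 + 2 * A * 0"
    using tendsto_rabs_zero[OF sq] lim_1_over_n by (intro tendsto_intros)
  then have bl: "(\<lambda>m. ?b (n m)) \<longlonglongrightarrow> 0" using filterlim_compose[OF _ lim, of ?b "nhds 0"] by simp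
  show ?thesis
  proof (rule Lim_null_comparison[OF _ bl])
    have "norm ((\<Sum>j<m. a j) / real m) \<le> ?b (n m)" if m: "1 \<le> m" for m
    proof -
      define k where "k = n m"
      have "real k = of_int \<lfloor>sqrt (real m)\<rfloor>" by (simp add: k_def n_def)
      then have fl: "real k \<le> sqrt (real m)" "sqrt (real m) < real k + 1" by linarith+
      have "1 \<le> sqrt (real m)" using m by simp
      then have k: "1 \<le> k" unfolding k_def n_def by (simp add: le_nat_floor)
      have "(real k)\<^sup>2 \<le> real m" using fl power_mono[of "real k" "sqrt (real m)" 2] by simp
      then have k1: "k\<^sup>2 \<le> m" by (metis of_nat_le_iff of_nat_power)
      have "real m < (real k + 1)\<^sup>2" using fl power_strict_mono[of "sqrt (real m)" "real k + 1" 2] by simp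
      then have "real m < real ((k + 1)\<^sup>2)" by (simp add: add.commute)
      then have "m < (k + 1)\<^sup>2" by (simp only: of_nat_less_iff)
      then have k2: "m - k\<^sup>2 \<le> 2 * k" by (simp add: power2_eq_square)
      have "(\<Sum>j<m. a j) = (\<Sum>j<k\<^sup>2. a j) + (\<Sum>j=k\<^sup>2..<m. a j)"
        using sum.atLeastLessThan_concat[of 0 "k\<^sup>2" m a] k1 by (simp add: atLeast0LessThan)
      moreover have "\<bar>\<Sum>j=k\<^sup>2..<m. a j\<bar> \<le> 2 * real k * A"
      proof -
        have "\<bar>\<Sum>j=k\<^sup>2..<m. a j\<bar> \<le> (\<Sum>j=k\<^sup>2..<m. A)" by (rule order_trans[OF sum_abs sum_mono]) (rule b)
        also have "\<dots> = real (m - k\<^sup>2) * A" by simp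
        also have "\<dots> \<le> real (2 * k) * A" using k2 A by (intro mult_right_mono) (simp_all only: of_nat_le_iff)
        finally show ?thesis by simp
      qed
      ultimately have "\<bar>\<Sum>j<m. a j\<bar> \<le> \<bar>\<Sum>j<k\<^sup>2. a j\<bar> + 2 * real k * A" by linarith
      then have "\<bar>\<Sum>j<m. a j\<bar> / real m \<le> (\<bar>\<Sum>j<k\<^sup>2. a j\<bar> + 2 * real k * A) / real (k\<^sup>2)"
        using k1 k A by (intro frac_le) (auto simp: of_nat_le_iff[symmetric] simp del: of_nat_le_iff of_nat_power)
      also have "\<dots> = ?b k" using k by (simp add: add_divide_distrib abs_divide power2_eq_square)
      finally show ?thesis by (simp add: k_def abs_divide)
    qed
    then show "eventually (\<lambda>m. norm ((\<Sum>j<m. a j) / real m) \<le> ?b (n m)) sequentially"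
      by (auto simp: eventually_sequentially)
  qed
qed

text \<open>Countably many test functions whose combinations are uniformly dense: the exceptional
  sets then have a measurable null union, and convergence for monomials implies it for all
  continuous functions.\<close>

definition monom2 :: "nat \<Rightarrow> nat \<Rightarrow> real \<times> real \<Rightarrow> real" where
  "monom2 a b q = fst q ^ a * snd q ^ b"

definition poly2 :: "(real \<times> nat \<times> nat) list \<Rightarrow> real \<times> real \<Rightarrow> real" where
  "poly2 xs q = (\<Sum>(c, a, b)\<leftarrow>xs. c * monom2 a b q)"

lemma poly2_Nil [simp]: "poly2 [] q = 0" and poly2_Cons [simp]: "poly2 ((c, a, b) # xs) q = c * monom2 a b q + poly2 xs q"
  and poly2_append: "poly2 (xs @ ys) q = poly2 xs q + poly2 ys q"
  by (simp_all add: poly2_def)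

lemma poly2_mult: "\<exists>zs. \<forall>q. poly2 zs q = poly2 xs q * poly2 ys q"
proof -
  have 1: "poly2 (map (\<lambda>(c', a', b'). (c * c', a + a', b + b')) ys) q = c * monom2 a b q * poly2 ys q" for c a b q
    by (induction ys) (auto simp: monom2_def power_add algebra_simps)
  show ?thesis
  proof (induction xs)
    case Nil
    show ?case by (rule exI[of _ "[]"]) simp
  next
    case (Cons x xs)
    then obtain zs where zs: "\<forall>q. poly2 zs q = poly2 xs q * poly2 ys q" by blast
    obtain c a b where x: "x = (c, a, b)" by (cases x)
    show ?case
      by (rule exI[of _ "map (\<lambda>(c', a', b'). (c * c', a + a', b + b')) ys @ zs"])
        (simp only: poly2_append 1 zs x poly2_Cons distrib_right simp_thms)
  qed
qed

lemma real_polynomial_function_poly2: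
  fixes f :: "real \<times> real \<Rightarrow> real"
  shows "real_polynomial_function f \<Longrightarrow> \<exists>xs. \<forall>q. f q = poly2 xs q"
proof (induction rule: real_polynomial_function.induct)
  case (linear f)
  interpret bounded_linear f by fact
  have "f q = poly2 [(f (1, 0), 1, 0), (f (0, 1), 0, 1)] q" for q
  proof -
    have "f q = f (fst q *\<^sub>R (1, 0) + snd q *\<^sub>R (0, 1))" by (simp add: prod_eq_iff)
    also have "\<dots> = fst q *\<^sub>R f (1, 0) + snd q *\<^sub>R f (0, 1)" unfolding add scaleR by (rule refl)
    finally show ?thesis by (simp add: monom2_def)
  qed
  then show ?case by blast
next
  case (const c)
  have "c = poly2 [(c, 0, 0)] q" for q by (simp add: monom2_def)
  then show ?case by blast
next
  case (add f g)
  then obtain xs ys where "\<forall>q. f q = poly2 xs q" "\<forall>q. g q = poly2 ys q" by blast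
  then have "\<forall>q. f q + g q = poly2 (xs @ ys) q" by (simp add: poly2_append)
  then show ?case by blast
next
  case (mult f g)
  then obtain xs ys where "\<forall>q. f q = poly2 xs q" "\<forall>q. g q = poly2 ys q" by blast
  moreover obtain zs where "\<forall>q. poly2 zs q = poly2 xs q * poly2 ys q" using poly2_mult by blast
  ultimately have "\<forall>q. f q * g q = poly2 zs q" by simp
  then show ?case by blast
qed

lemma geometric_sum_le:
  fixes \<Lambda> :: real
  assumes "0 < \<Lambda>" "\<Lambda> < 1" shows "(\<Sum>i<n. \<Lambda> ^ (n - i)) \<le> 1 / (1 - \<Lambda>)"
proof (induction n)
  case 0
  show ?case using assms by simp
next
  case (Suc n)
  have "(\<Sum>i<Suc n. \<Lambda> ^ (Suc n - i)) = \<Lambda> * (\<Sum>i<n. \<Lambda> ^ (n - i)) + \<Lambda>"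
    by (simp add: sum_distrib_left Suc_diff_le)
  also have "\<dots> \<le> \<Lambda> * (1 / (1 - \<Lambda>)) + \<Lambda>" using mult_left_mono[OF Suc, of \<Lambda>] assms by simp
  also have "\<dots> \<le> 1 / (1 - \<Lambda>)"
  proof -
    have "1 / (1 - \<Lambda>) = 1 + \<Lambda> * (1 / (1 - \<Lambda>))" using assms by (simp add: field_simps)
    then show ?thesis using assms by linarith
  qed
  finally show ?case .
qed

context skew_lift
begin

definition birk :: "(real \<times> real \<Rightarrow> real) \<Rightarrow> nat \<Rightarrow> real \<times> real \<Rightarrow> real" where
  "birk f n q = (\<Sum>j<n. f ((F ^^ j) q)) / real n"

text \<open>Adding one term to the sum adds a cross term, which the decay of correlations bounds by
  a geometric series independent of \<open>n\<close>.\<close>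

lemma variance_bound:
  assumes f: "lipf A B f" and f0: "(\<integral>q. f q \<partial>\<mu>) = 0"
  shows "\<exists>D\<ge>0. \<forall>n. (\<integral>q. (\<Sum>j<n. f ((F ^^ j) q))\<^sup>2 \<partial>\<mu>) \<le> D * real n"
proof -
  obtain C \<Lambda> where L: "0 < \<Lambda>" "\<Lambda> < 1" "0 < C" and
    dec: "\<And>A B A' B' f g n. lipf A B f \<Longrightarrow> lipf A' B' g \<Longrightarrow>
      \<bar>(\<integral>q. f q * g ((F ^^ n) q) \<partial>\<mu>) - (\<integral>q. f q \<partial>\<mu>) * (\<integral>q. g q \<partial>\<mu>)\<bar> \<le> C * \<Lambda> ^ n * (A + B) * (A' + B')"
    using mu_decay by blast
  define M where "M = C * (A + B) * (A + B)"
  have b: "bq A f" by (rule bq_lip[OF f])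
  have M: "0 \<le> M" using L by (simp add: M_def mult.assoc)
  have c: "\<bar>\<integral>q. f q * f ((F ^^ n) q) \<partial>\<mu>\<bar> \<le> M * \<Lambda> ^ n" for n
    using dec[OF f f, of n] f0 by (simp add: M_def mult_ac)
  define D where "D = 3 * M / (1 - \<Lambda>)"
  have D: "0 \<le> D" using M L by (simp add: D_def)
  define S where "S = (\<lambda>n q. \<Sum>j<n. f ((F ^^ j) q))"
  have bS: "bq (real n * A) (S n)" for n
  proof (rule bqI)
    show "S n \<in> borel_measurable QB" unfolding S_def by (intro borel_measurable_sum bq_meas[OF bq_Fn[OF b]])
    show "\<bar>S n q\<bar> \<le> real n * A" if "q \<in> unit_square" for q
    proof -
      have "\<bar>S n q\<bar> \<le> (\<Sum>j<n. A)"
        unfolding S_def by (rule order_trans[OF sum_abs sum_mono]) (rule bq_abs[OF bq_Fn[OF b] that])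
      then show ?thesis by simp
    qed
  qed
  have "(\<integral>q. (S n q)\<^sup>2 \<partial>\<mu>) \<le> D * real n" for n
  proof (induction n)
    case 0
    show ?case by (simp add: S_def)
  next
    case (Suc n)
    let ?fn = "\<lambda>q. f ((F ^^ n) q)"
    have bn: "bq A ?fn" by (rule bq_Fn[OF b])
    have i: "integrable \<mu> (\<lambda>q. S n q * S n q)" "integrable \<mu> (\<lambda>q. S n q * ?fn q)" "integrable \<mu> (\<lambda>q. ?fn q * ?fn q)"
      by (rule bq_integrable[OF bq_mult[OF bS bS]] bq_integrable[OF bq_mult[OF bS bn]] bq_integrable[OF bq_mult[OF bn bn]])+
    have "(\<integral>q. (S (Suc n) q)\<^sup>2 \<partial>\<mu>) = (\<integral>q. S n q * S n q + 2 * (S n q * ?fn q) + ?fn q * ?fn q \<partial>\<mu>)"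
      by (intro Bochner_Integration.integral_cong refl) (simp add: S_def power2_eq_square algebra_simps)
    also have "\<dots> = (\<integral>q. S n q * S n q \<partial>\<mu>) + 2 * (\<integral>q. S n q * ?fn q \<partial>\<mu>) + (\<integral>q. ?fn q * ?fn q \<partial>\<mu>)"
      using i by simp
    also have "\<dots> \<le> D * real n + 2 * (M * (1 / (1 - \<Lambda>))) + M"
    proof (intro add_mono mult_left_mono)
      show "(\<integral>q. S n q * S n q \<partial>\<mu>) \<le> D * real n" using Suc by (simp add: power2_eq_square)
      have "(\<integral>q. S n q * ?fn q \<partial>\<mu>) = (\<integral>q. (\<Sum>j<n. f ((F ^^ j) q) * ?fn q) \<partial>\<mu>)"
        by (simp add: S_def sum_distrib_right)
      also have "\<dots> = (\<Sum>j<n. \<integral>q. f ((F ^^ j) q) * ?fn q \<partial>\<mu>)"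
        by (rule Bochner_Integration.integral_sum) (rule bq_integrable[OF bq_mult[OF bq_Fn[OF b] bn]])
      also have "\<dots> \<le> (\<Sum>j<n. M * \<Lambda> ^ (n - j))"
      proof (rule sum_mono)
        fix j assume "j \<in> {..<n}"
        then have j: "n = (n - j) + j" by simp
        have "(\<integral>q. f ((F ^^ j) q) * ?fn q \<partial>\<mu>) = (\<integral>q. f ((F ^^ j) q) * f ((F ^^ (n - j)) ((F ^^ j) q)) \<partial>\<mu>)"
          by (subst (1) j) (simp add: funpow_add)
        also have "\<dots> = (\<integral>q. f q * f ((F ^^ (n - j)) q) \<partial>\<mu>)"
          by (rule mu_invariant[OF bq_mult[OF b bq_Fn[OF b]]])
        finally show "(\<integral>q. f ((F ^^ j) q) * ?fn q \<partial>\<mu>) \<le> M * \<Lambda> ^ (n - j)" using c[of "n - j"] by linarith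
      qed
      also have "\<dots> \<le> M * (1 / (1 - \<Lambda>))"
        unfolding sum_distrib_left[symmetric] using M geometric_sum_le[OF L(1,2)] by (intro mult_left_mono)
      finally show "(\<integral>q. S n q * ?fn q \<partial>\<mu>) \<le> M * (1 / (1 - \<Lambda>))" .
      have "(\<integral>q. ?fn q * ?fn q \<partial>\<mu>) = (\<integral>q. f q * f q \<partial>\<mu>)" by (rule mu_invariant[OF bq_mult[OF b b]])
      then show "(\<integral>q. ?fn q * ?fn q \<partial>\<mu>) \<le> M" using c[of 0] by simp
    qed simp
    also have "\<dots> \<le> D * real (Suc n)"
    proof -
      have "M * 1 \<le> M * (1 / (1 - \<Lambda>))" using M L by (intro mult_left_mono) (auto simp: le_divide_eq)
      then have "2 * (M * (1 / (1 - \<Lambda>))) + M \<le> D" by (simp add: D_def)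
      then show ?thesis by (simp add: algebra_simps)
    qed
    finally show ?case .
  qed
  then show ?thesis using D unfolding S_def by blast
qed

lemma lipf_centre:
  assumes f: "lipf A B f" and c: "\<bar>c0\<bar> \<le> A" shows "lipf (2 * A) B (\<lambda>q. f q - c0)"
  unfolding lipf_def
proof (intro conjI ballI)
  show "0 \<le> B" using f by (simp add: lipf_def)
  show "\<bar>f q - c0\<bar> \<le> 2 * A" if "q \<in> unit_square" for q using lipf_abs[OF f that] c by linarith
  show "\<bar>(f q - c0) - (f q' - c0)\<bar> \<le> B * (\<bar>fst q - fst q'\<bar> + \<bar>snd q - snd q'\<bar>)"
    if "q \<in> unit_square" "q' \<in> unit_square" for q q' using lipf_lip[OF f that] by simp
qed

text \<open>The variance of the averages is of order \<open>1 / n\<close>, hence summable along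
  squares; \<open>cesaro_squares\<close> fills the gaps between them.\<close>

lemma birk_AE:
  assumes f: "lipf A B f" shows "AE q in \<mu>. (\<lambda>n. birk f n q) \<longlonglongrightarrow> (\<integral>q. f q \<partial>\<mu>)"
proof -
  define I where "I = (\<integral>q. f q \<partial>\<mu>)"
  let ?f = "\<lambda>q. f q - I"
  have bf: "bq A f" by (rule bq_lip[OF f])
  have I: "\<bar>I\<bar> \<le> A" unfolding I_def by (rule bq_bound[OF bf])
  have l0: "lipf (2 * A) B ?f" by (rule lipf_centre[OF f I])
  interpret prob_space \<mu> by (rule mu_prob)
  have z: "(\<integral>q. ?f q \<partial>\<mu>) = 0" using bq_integrable[OF bf] prob_space by (simp add: I_def)
  obtain D where D: "0 \<le> D" "\<And>n. (\<integral>q. (\<Sum>j<n. ?f ((F ^^ j) q))\<^sup>2 \<partial>\<mu>) \<le> D * real n"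
    using variance_bound[OF l0 z] by blast
  let ?S = "\<lambda>n q. (\<Sum>j<n\<^sup>2. ?f ((F ^^ j) q)) / real (n\<^sup>2)"
  have bS: "bq (2 * A) (?S n)" for n
  proof (rule bqI)
    show "?S n \<in> borel_measurable QB"
      by (intro borel_measurable_divide borel_measurable_sum borel_measurable_const bq_meas[OF bq_Fn[OF bq_lip[OF l0]]])
    show "\<bar>?S n q\<bar> \<le> 2 * A" if "q \<in> unit_square" for q
    proof (cases "n = 0")
      case True
      then show ?thesis using I by simp
    next
      case False
      have "\<bar>\<Sum>j<n\<^sup>2. ?f ((F ^^ j) q)\<bar> \<le> (\<Sum>j<n\<^sup>2. 2 * A)"
        by (rule order_trans[OF sum_abs sum_mono]) (rule bq_abs[OF bq_Fn[OF bq_lip[OF l0]] that])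
      then have "\<bar>\<Sum>j<n\<^sup>2. ?f ((F ^^ j) q)\<bar> \<le> 2 * A * real (n\<^sup>2)" by (simp add: mult_ac)
      then show ?thesis using False by (simp add: abs_divide divide_le_eq)
    qed
  qed
  have "AE q in \<mu>. (\<lambda>n. ?S n q) \<longlonglongrightarrow> 0"
  proof (rule AE_tendsto_zero_of_squares)
    show "integrable \<mu> (\<lambda>q. (?S n q)\<^sup>2)" for n
      unfolding power2_eq_square[of "_ / _"] by (rule bq_integrable[OF bq_mult[OF bS bS]])
    show "summable (\<lambda>n. \<integral>q. (?S n q)\<^sup>2 \<partial>\<mu>)"
    proof (rule summable_comparison_test'[where N = 0 and g = "\<lambda>n. D * inverse (real n ^ 2)"])
      show "summable (\<lambda>n. D * inverse (real n ^ 2))"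
        by (intro summable_mult inverse_power_summable) simp
      fix n
      have "(\<integral>q. (?S n q)\<^sup>2 \<partial>\<mu>) = (\<integral>q. (\<Sum>j<n\<^sup>2. ?f ((F ^^ j) q))\<^sup>2 / (real (n\<^sup>2))\<^sup>2 \<partial>\<mu>)" by (simp add: power_divide)
      also have "\<dots> = (\<integral>q. (\<Sum>j<n\<^sup>2. ?f ((F ^^ j) q))\<^sup>2 \<partial>\<mu>) / (real (n\<^sup>2))\<^sup>2" by simp
      also have "\<dots> \<le> D * real (n\<^sup>2) / (real (n\<^sup>2))\<^sup>2" by (intro divide_right_mono D) simp
      also have "\<dots> = D * inverse (real n ^ 2)" by (cases "n = 0") (simp_all add: power2_eq_square field_simps)
      finally have "(\<integral>q. (?S n q)\<^sup>2 \<partial>\<mu>) \<le> D * inverse (real n ^ 2)" .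
      moreover have "0 \<le> (\<integral>q. (?S n q)\<^sup>2 \<partial>\<mu>)" by (rule Bochner_Integration.integral_nonneg) (rule zero_le_power2)
      ultimately show "norm (\<integral>q. (?S n q)\<^sup>2 \<partial>\<mu>) \<le> D * inverse (real n ^ 2)" by simp
    qed
  qed
  moreover have "AE q in \<mu>. q \<in> unit_square" by (rule AE_I2) (simp only: space_mu)
  ultimately show ?thesis
  proof eventually_elim
    case (elim q)
    have "(\<lambda>n. (\<Sum>j<n. ?f ((F ^^ j) q)) / real n) \<longlonglongrightarrow> 0"
      by (rule cesaro_squares[OF bq_abs[OF bq_Fn[OF bq_lip[OF l0]] elim(2)] elim(1)])
    then have "(\<lambda>n. (\<Sum>j<n. ?f ((F ^^ j) q)) / real n + I) \<longlonglongrightarrow> 0 + I" by (intro tendsto_intros)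
    then have "(\<lambda>n. (\<Sum>j<n. ?f ((F ^^ j) q)) / real n + I) \<longlonglongrightarrow> I" by simp
    then show ?case unfolding I_def[symmetric]
    proof (rule Lim_transform_eventually)
      have "(\<Sum>j<n. ?f ((F ^^ j) q)) / real n + I = birk f n q" if "1 \<le> n" for n
        using that by (simp add: birk_def sum_subtractf diff_divide_distrib)
      then show "eventually (\<lambda>n. (\<Sum>j<n. ?f ((F ^^ j) q)) / real n + I = birk f n q) sequentially"
        by (auto simp: eventually_sequentially)
    qed
  qed
qed

text \<open>Along two orbits on one leaf the differences of \<open>f\<close> sum to at most
  \<open>B / (1 - l)\<close>, so the averages differ by that constant divided by
  \<open>n\<close>.\<close>

lemma birk_leaf:
  assumes f: "lipf A B f" and x: "x \<in> {0..1}" "y \<in> {0..1}" "y' \<in> {0..1}"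
    and lim: "(\<lambda>n. birk f n (x, y)) \<longlonglongrightarrow> z"
  shows "(\<lambda>n. birk f n (x, y')) \<longlonglongrightarrow> z"
proof -
  have q: "(x, y) \<in> unit_square" "(x, y') \<in> unit_square" using x by auto
  have B: "0 \<le> B" using f by (simp add: lipf_def)
  have d: "\<bar>f ((F ^^ j) (x, y')) - f ((F ^^ j) (x, y))\<bar> \<le> B * l ^ j" for j
  proof -
    have "\<bar>f ((F ^^ j) (x, y')) - f ((F ^^ j) (x, y))\<bar>
      \<le> B * (\<bar>fst ((F ^^ j) (x, y')) - fst ((F ^^ j) (x, y))\<bar> + \<bar>snd ((F ^^ j) (x, y')) - snd ((F ^^ j) (x, y))\<bar>)"
      by (rule lipf_lip[OF f Fn_maps[OF q(2)] Fn_maps[OF q(1)]])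
    also have "\<dots> \<le> B * (0 + l ^ j)"
      using Fn_contract[OF x(1) x(3,2), of j] B by (intro mult_left_mono add_mono) (simp_all add: Fn_fst[OF q(1)] Fn_fst[OF q(2)])
    finally show ?thesis by simp
  qed
  have "(\<lambda>n. birk f n (x, y') - birk f n (x, y)) \<longlonglongrightarrow> 0"
  proof (rule Lim_null_comparison)
    have "\<bar>birk f n (x, y') - birk f n (x, y)\<bar> \<le> (B / (1 - l)) * (1 / real n)" for n
    proof -
      have "birk f n (x, y') - birk f n (x, y) = (\<Sum>j<n. f ((F ^^ j) (x, y')) - f ((F ^^ j) (x, y))) / real n"
        by (simp add: birk_def sum_subtractf diff_divide_distrib)
      moreover have "\<bar>\<Sum>j<n. f ((F ^^ j) (x, y')) - f ((F ^^ j) (x, y))\<bar> \<le> (\<Sum>j<n. B * l ^ j)"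
        by (rule order_trans[OF sum_abs sum_mono]) (rule d)
      moreover have "(\<Sum>j<n. B * l ^ j) \<le> B / (1 - l)"
      proof -
        have "(\<Sum>j<n. l ^ j) = (1 - l ^ n) / (1 - l)" using l_bounds by (simp add: sum_gp_strict)
        also have "\<dots> \<le> 1 / (1 - l)" using l_bounds by (intro divide_right_mono) auto
        finally show ?thesis using mult_left_mono[of _ "1 / (1 - l)" B] B by (simp add: sum_distrib_left[symmetric])
      qed
      ultimately have "\<bar>birk f n (x, y') - birk f n (x, y)\<bar> \<le> (B / (1 - l)) / real n"
        unfolding abs_divide by (simp only: abs_divide abs_of_nat) (intro divide_right_mono, linarith, simp)
      then show ?thesis by simp
    qed
    then show "eventually (\<lambda>n. norm (birk f n (x, y') - birk f n (x, y)) \<le> (B / (1 - l)) * (1 / real n)) sequentially"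
      by (simp only: real_norm_def always_eventually simp_thms)
    have "(\<lambda>n. (B / (1 - l)) * (1 / real n)) \<longlonglongrightarrow> (B / (1 - l)) * 0" by (intro tendsto_intros lim_1_over_n)
    then show "(\<lambda>n. (B / (1 - l)) * (1 / real n)) \<longlonglongrightarrow> 0" by simp
  qed
  from tendsto_add[OF this lim] show ?thesis by simp
qed

lemma birk_shift:
  assumes f: "bq A f" and q: "q \<in> unit_square"
  shows "(\<lambda>n. birk f n (F q)) \<longlonglongrightarrow> z \<longleftrightarrow> (\<lambda>n. birk f n q) \<longlonglongrightarrow> z"
proof -
  have "(\<lambda>n. birk f n (F q) - birk f n q) \<longlonglongrightarrow> 0"
  proof (rule Lim_null_comparison)
    have "\<bar>birk f n (F q) - birk f n q\<bar> \<le> 2 * A * (1 / real n)" for n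
    proof -
      have "birk f n (F q) - birk f n q = (\<Sum>j<n. f ((F ^^ Suc j) q) - f ((F ^^ j) q)) / real n"
        by (simp add: birk_def sum_subtractf diff_divide_distrib funpow_swap1)
      also have "\<dots> = (f ((F ^^ n) q) - f ((F ^^ 0) q)) / real n"
        by (simp only: sum_lessThan_telescope[of "\<lambda>j. f ((F ^^ j) q)"])
      finally have "\<bar>birk f n (F q) - birk f n q\<bar> = \<bar>f ((F ^^ n) q) - f ((F ^^ 0) q)\<bar> / real n"
        by (simp add: abs_divide)
      moreover have "\<bar>f ((F ^^ n) q) - f ((F ^^ 0) q)\<bar> \<le> 2 * A"
        using bq_abs[OF bq_Fn[OF f] q, of n] bq_abs[OF bq_Fn[OF f] q, of 0] by linarith
      ultimately show ?thesis by (simp add: divide_right_mono)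
    qed
    then show "eventually (\<lambda>n. norm (birk f n (F q) - birk f n q) \<le> 2 * A * (1 / real n)) sequentially"
      by (simp only: real_norm_def always_eventually simp_thms)
    have "(\<lambda>n. 2 * A * (1 / real n)) \<longlonglongrightarrow> 2 * A * 0" by (intro tendsto_intros lim_1_over_n)
    then show "(\<lambda>n. 2 * A * (1 / real n)) \<longlonglongrightarrow> 0" by simp
  qed
  then show ?thesis by (rule Lim_transform_eq)
qed

lemma lipf_monom2: "lipf 1 (real a + real b) (monom2 a b)"
  unfolding lipf_def
proof (intro conjI ballI)
  fix q :: "real \<times> real" assume q: "q \<in> unit_square"
  have "\<bar>fst q ^ a\<bar> \<le> 1" "\<bar>snd q ^ b\<bar> \<le> 1" using q by (auto simp: power_abs[symmetric] power_le_one)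
  then show "\<bar>monom2 a b q\<bar> \<le> 1" 
    unfolding monom2_def abs_mult using mult_mono[of "\<bar>fst q ^ a\<bar>" 1 "\<bar>snd q ^ b\<bar>" 1] by simp
  fix q' :: "real \<times> real" assume q': "q' \<in> unit_square"
  have "norm (fst q) \<le> 1" "norm (fst q') \<le> 1" "norm (snd q) \<le> 1" "norm (snd q') \<le> 1" using q q' by auto
  then have d: "\<bar>fst q ^ a - fst q' ^ a\<bar> \<le> real a * \<bar>fst q - fst q'\<bar>" "\<bar>snd q ^ b - snd q' ^ b\<bar> \<le> real b * \<bar>snd q - snd q'\<bar>"
    using norm_power_diff[of "fst q" "fst q'" a] norm_power_diff[of "snd q" "snd q'" b] by auto
  have u: "\<bar>fst q' ^ a\<bar> \<le> 1" "\<bar>snd q ^ b\<bar> \<le> 1" using q q' by (auto simp: power_abs[symmetric] power_le_one)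
  have "monom2 a b q - monom2 a b q' = (fst q ^ a - fst q' ^ a) * snd q ^ b + fst q' ^ a * (snd q ^ b - snd q' ^ b)"
    by (simp add: monom2_def algebra_simps)
  then have "\<bar>monom2 a b q - monom2 a b q'\<bar> \<le> \<bar>fst q ^ a - fst q' ^ a\<bar> * \<bar>snd q ^ b\<bar> + \<bar>fst q' ^ a\<bar> * \<bar>snd q ^ b - snd q' ^ b\<bar>"
    unfolding abs_mult[symmetric] by (simp only: abs_triangle_ineq)
  also have "\<dots> \<le> (real a * \<bar>fst q - fst q'\<bar>) * 1 + 1 * (real b * \<bar>snd q - snd q'\<bar>)"
    using d u by (intro add_mono mult_mono) auto
  also have "\<dots> \<le> (real a + real b) * (\<bar>fst q - fst q'\<bar> + \<bar>snd q - snd q'\<bar>)" by (simp add: algebra_simps)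
  finally show "\<bar>monom2 a b q - monom2 a b q'\<bar> \<le> (real a + real b) * (\<bar>fst q - fst q'\<bar> + \<bar>snd q - snd q'\<bar>)" .
qed simp

lemma birk_poly2:
  assumes "\<And>a b. (\<lambda>n. birk (monom2 a b) n q) \<longlonglongrightarrow> (\<integral>q. monom2 a b q \<partial>\<mu>)"
  shows "integrable \<mu> (poly2 xs) \<and> (\<lambda>n. birk (poly2 xs) n q) \<longlonglongrightarrow> (\<integral>q. poly2 xs q \<partial>\<mu>)"
proof (induction xs)
  case Nil
  show ?case by (simp add: birk_def poly2_def[abs_def])
next
  case (Cons x xs)
  obtain c a b where x: "x = (c, a, b)" by (cases x)
  have e: "poly2 (x # xs) = (\<lambda>q. c * monom2 a b q + poly2 xs q)" by (simp add: x fun_eq_iff)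
  have i: "integrable \<mu> (monom2 a b)" "integrable \<mu> (poly2 xs)"
    using bq_integrable[OF bq_lip[OF lipf_monom2]] Cons by auto
  have "(\<lambda>n. c * birk (monom2 a b) n q + birk (poly2 xs) n q) \<longlonglongrightarrow> c * (\<integral>q. monom2 a b q \<partial>\<mu>) + (\<integral>q. poly2 xs q \<partial>\<mu>)"
    using Cons assms by (intro tendsto_intros) auto
  also have "(\<lambda>n. c * birk (monom2 a b) n q + birk (poly2 xs) n q) = (\<lambda>n. birk (poly2 (x # xs)) n q)"
    by (simp add: e birk_def fun_eq_iff sum.distrib sum_distrib_left add_divide_distrib)
  finally show ?case using i by (simp add: e)
qed

text \<open>A polynomial uniformly within \<open>e / 3\<close> of the function changes all averages
  and the integral by at most \<open>e / 3\<close>.\<close>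

lemma birk_continuous:
  assumes q: "q \<in> unit_square" and m: "\<And>a b. (\<lambda>n. birk (monom2 a b) n q) \<longlonglongrightarrow> (\<integral>q. monom2 a b q \<partial>\<mu>)"
    and phi: "continuous_on unit_square \<phi>"
  shows "(\<lambda>n. birk \<phi> n q) \<longlonglongrightarrow> (\<integral>q. \<phi> q \<partial>\<mu>)"
proof (rule LIMSEQ_I)
  fix e :: real assume e: "0 < e"
  have cpt: "compact unit_square" by (intro compact_Times compact_Icc)
  obtain h where h: "real_polynomial_function h" "\<And>q. q \<in> unit_square \<Longrightarrow> \<bar>\<phi> q - h q\<bar> < e / 3"
    using Stone_Weierstrass_real_polynomial_function[OF cpt phi, of "e / 3"] e by auto
  obtain xs where "\<forall>q. h q = poly2 xs q" using real_polynomial_function_poly2[OF h(1)] by blast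
  then have hx: "h = poly2 xs" by (simp add: fun_eq_iff)
  have ph: "integrable \<mu> h" "(\<lambda>n. birk h n q) \<longlonglongrightarrow> (\<integral>q. h q \<partial>\<mu>)" using birk_poly2[OF m] unfolding hx by blast+
  have "bounded (\<phi> ` unit_square)" by (rule compact_imp_bounded[OF compact_continuous_image[OF phi cpt]])
  then obtain A where "\<forall>z\<in>\<phi> ` unit_square. norm z \<le> A" by (auto simp only: bounded_iff)
  then have "\<bar>\<phi> q\<bar> \<le> A" if "q \<in> unit_square" for q using imageI[OF that, of \<phi>] unfolding real_norm_def by (rule bspec)
  then have bp: "bq A \<phi>" by (intro bqI borel_measurable_continuous_on_restrict phi)
  have hm: "h \<in> borel_measurable QB" using borel_measurable_integrable[OF ph(1)] by (simp only: meas_mu)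
  have bd: "bq (e / 3) (\<lambda>q. \<phi> q - h q)"
    by (intro bqI borel_measurable_diff bq_meas[OF bp] hm less_imp_le[OF h(2)])
  have "\<bar>\<integral>q. \<phi> q - h q \<partial>\<mu>\<bar> \<le> e / 3" by (rule bq_bound[OF bd])
  then have 1: "\<bar>(\<integral>q. \<phi> q \<partial>\<mu>) - (\<integral>q. h q \<partial>\<mu>)\<bar> \<le> e / 3"
    using bq_integrable[OF bp] ph(1) by (simp add: Bochner_Integration.integral_diff)
  have 2: "\<bar>birk \<phi> n q - birk h n q\<bar> \<le> e / 3" for n
  proof (cases "n = 0")
    case True
    then show ?thesis using e by (simp add: birk_def)
  next
    case False
    have "birk \<phi> n q - birk h n q = (\<Sum>j<n. \<phi> ((F ^^ j) q) - h ((F ^^ j) q)) / real n"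
      by (simp add: birk_def sum_subtractf diff_divide_distrib)
    moreover have "\<bar>\<Sum>j<n. \<phi> ((F ^^ j) q) - h ((F ^^ j) q)\<bar> \<le> (\<Sum>j<n. e / 3)"
      by (rule order_trans[OF sum_abs sum_mono]) (rule bq_abs[OF bd Fn_maps[OF q]])
    ultimately show ?thesis using False by (simp add: abs_divide divide_le_eq mult_ac)
  qed
  obtain n0 where n0: "\<forall>n\<ge>n0. norm (birk h n q - (\<integral>q. h q \<partial>\<mu>)) < e / 3"
    using LIMSEQ_D[OF ph(2), of "e / 3"] e by auto
  have "norm (birk \<phi> n q - (\<integral>q. \<phi> q \<partial>\<mu>)) < e" if "n0 \<le> n" for n
    using n0[rule_format, OF that] 1 2[of n] unfolding real_norm_def by linarith
  then show "\<exists>n0. \<forall>n\<ge>n0. norm (birk \<phi> n q - (\<integral>q. \<phi> q \<partial>\<mu>)) < e" by blast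
qed

subsection \<open>The ergodic basin\<close>

text \<open>The base points whose leaf lies outside the basin. Testing at height 0 is enough, as
  convergence of the averages depends only on the leaf.\<close>

definition bad :: "real set" where
  "bad = {x \<in> {0..1}. \<exists>a b. \<not> (\<lambda>n. birk (monom2 a b) n (x, 0)) \<longlonglongrightarrow> (\<integral>q. monom2 a b q \<partial>\<mu>)}"

lemma bad_sub: "bad \<subseteq> {0..1}"
  unfolding bad_def by blast

lemma good_leaf:
  assumes x: "x \<in> {0..1}" "y \<in> {0..1}" "y' \<in> {0..1}"
  shows "(\<lambda>n. birk (monom2 a b) n (x, y)) \<longlonglongrightarrow> z \<longleftrightarrow> (\<lambda>n. birk (monom2 a b) n (x, y')) \<longlonglongrightarrow> z"
  using birk_leaf[OF lipf_monom2 x] birk_leaf[OF lipf_monom2 x(1,3,2)] by blast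

lemma bad_iff:
  assumes q: "q \<in> unit_square"
  shows "fst q \<notin> bad \<longleftrightarrow> (\<forall>a b. (\<lambda>n. birk (monom2 a b) n q) \<longlonglongrightarrow> (\<integral>q. monom2 a b q \<partial>\<mu>))"
proof -
  obtain x y where xy: "q = (x, y)" "x \<in> {0..1}" "y \<in> {0..1}" using q by blast
  have "(0::real) \<in> {0..1}" by simp
  from good_leaf[OF xy(2,3) this] show ?thesis unfolding xy(1) bad_def using xy(2) by simp
qed

lemma bad_sets: "bad \<in> sets LB"
proof -
  have m: "(\<lambda>x. birk (monom2 a b) n (x, 0)) \<in> borel_measurable LB" for a b n
  proof -
    have "fk (monom2 a b) j \<in> borel_measurable LB" for j using fk_bm[OF lipf_monom2] by (simp add: bm_def)
    then have "(\<lambda>x. (\<Sum>j<n. fk (monom2 a b) j x) / real n) \<in> borel_measurable LB"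
      by (intro borel_measurable_divide borel_measurable_sum borel_measurable_const)
    then show ?thesis by (simp add: birk_def fk_def)
  qed
  have "{x \<in> space LB. (\<lambda>n. birk (monom2 a b) n (x, 0)) \<longlonglongrightarrow> (\<integral>q. monom2 a b q \<partial>\<mu>)} \<in> sets LB" for a b
    using measurable_limit[OF m] unfolding pred_def .
  then have "{x \<in> space LB. \<exists>a b. \<not> (\<lambda>n. birk (monom2 a b) n (x, 0)) \<longlonglongrightarrow> (\<integral>q. monom2 a b q \<partial>\<mu>)} \<in> sets LB"
    by (intro sets.sets_Collect_countable_Ex sets.sets_Collect_neg)
  then show ?thesis by (simp only: bad_def space_LB)
qed

lemma bad_T: assumes x: "x \<in> {0..1}" shows "T x \<in> bad \<longleftrightarrow> x \<in> bad"
proof -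
  have q: "(x, 0) \<in> unit_square" and z: "(0::real) \<in> {0..1}" using x by simp_all
  have Fq: "F (x, 0) \<in> unit_square" by (rule F_maps[OF q])
  have "fst (F (x, 0)) \<notin> bad \<longleftrightarrow> fst (x, 0::real) \<notin> bad"
    unfolding bad_iff[OF q] bad_iff[OF Fq] birk_shift[OF bq_lip[OF lipf_monom2] q] by (rule refl)
  then show ?thesis unfolding F_form[OF x z] by simp
qed

lemma bad_T_pow: "x \<in> {0..1} \<Longrightarrow> (T ^^ n) x \<in> bad \<longleftrightarrow> x \<in> bad"
  using bad_T[OF T_pow_maps] by (induction n) auto

lemma bad_null_nu: "(\<integral>x. indicator bad x \<partial>\<nu>) = (0::real)"
proof -
  have "AE q in \<mu>. \<forall>a b. (\<lambda>n. birk (monom2 a b) n q) \<longlonglongrightarrow> (\<integral>q. monom2 a b q \<partial>\<mu>)"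
    using birk_AE[OF lipf_monom2] by (simp add: AE_all_countable)
  moreover have "AE q in \<mu>. q \<in> unit_square" by (rule AE_I2) (simp only: space_mu)
  ultimately have "AE q in \<mu>. indicator bad (fst q) = (0::real)"
  proof eventually_elim
    case (elim q)
    then have "fst q \<notin> bad" using bad_iff[OF elim(2)] by blast
    then show ?case by simp
  qed
  then have "(\<integral>q. indicator bad (fst q) \<partial>\<mu>) = (0::real)" by (rule integral_eq_zero_AE)
  then show ?thesis unfolding mu_fst[OF bm_indicator[OF bad_sets]] .
qed

text \<open>Being null for \<nu> says nothing about points where \<rho> vanishes. But by invariance
  of the set the Lebesgue integral of \<open>indicator bad\<close> after \<open>T ^^ n\<close> does
  not depend on \<open>n\<close>, while it converges to the measure under \<nu>, which is 0.\<close>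

lemma bad_null: "emeasure lborel bad = 0"
proof -
  obtain \<Lambda> C where L: "0 < \<Lambda>" "\<Lambda> < 1" "0 < C" and
    dec: "\<And>D \<psi> n. bm D \<psi> \<Longrightarrow> \<bar>(\<integral>x. \<psi> ((T ^^ n) x) \<partial>LB) - (\<integral>x. \<psi> x \<partial>\<nu>)\<bar> \<le> C * \<Lambda> ^ n * D"
    using exp_decay_nu by blast
  have "\<bar>measure LB bad\<bar> \<le> C * \<Lambda> ^ n" for n
  proof -
    have "(\<integral>x. indicator bad ((T ^^ n) x) \<partial>LB) = (\<integral>x. indicator bad x \<partial>LB :: real)"
      by (intro Bochner_Integration.integral_cong refl) (simp add: indicator_def bad_T_pow)
    also have "\<dots> = measure LB bad" using bad_sets bad_sub by (simp add: Int_absorb2)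
    finally show ?thesis using dec[OF bm_indicator[OF bad_sets], of n] bad_null_nu by simp
  qed
  moreover have "(\<lambda>n. C * \<Lambda> ^ n) \<longlonglongrightarrow> C * 0" using L by (intro tendsto_intros LIMSEQ_realpow_zero) auto
  ultimately have "\<bar>measure LB bad\<bar> \<le> C * 0" by (intro LIMSEQ_le_const) auto
  then have "measure LB bad = 0" using measure_nonneg[of LB bad] by linarith
  then have "emeasure LB bad = 0" using finite_measure.emeasure_eq_measure[OF finite_measure_LB, of bad] by simp
  then show ?thesis using bad_sub by (simp add: emeasure_restrict_space)
qed

lemma bad_borel: "bad \<in> sets borel"
  using bad_sets by (simp add: sets_restrict_space_iff)

lemma basin_iff: "q \<in> ergodic_basin F \<mu> \<longleftrightarrow> q \<in> unit_square \<and> fst q \<notin> bad"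
proof
  assume q: "q \<in> ergodic_basin F \<mu>"
  then have q1: "q \<in> unit_square" unfolding ergodic_basin_def by blast
  have "(\<lambda>n. birk (monom2 a b) n q) \<longlonglongrightarrow> (\<integral>q. monom2 a b q \<partial>\<mu>)" for a b
  proof -
    have "continuous_on unit_square (monom2 a b)" unfolding monom2_def[abs_def] by (intro continuous_intros)
    then show ?thesis using q unfolding ergodic_basin_def birk_def by blast
  qed
  then show "q \<in> unit_square \<and> fst q \<notin> bad" using q1 bad_iff[OF q1] by blast
next
  assume q: "q \<in> unit_square \<and> fst q \<notin> bad"
  then have q1: "q \<in> unit_square" by blast
  have "\<forall>a b. (\<lambda>n. birk (monom2 a b) n q) \<longlonglongrightarrow> (\<integral>q. monom2 a b q \<partial>\<mu>)" using q bad_iff[OF q1] by blast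
  then have "(\<lambda>n. birk \<phi> n q) \<longlonglongrightarrow> (\<integral>q. \<phi> q \<partial>\<mu>)" if "continuous_on unit_square \<phi>" for \<phi>
    using birk_continuous[OF q1 _ that] by blast
  then show "q \<in> ergodic_basin F \<mu>" using q1 unfolding ergodic_basin_def birk_def by blast
qed

lemma basin_eq: "ergodic_basin F \<mu> = ({0..1} - bad) \<times> {0..1}"
  using basin_iff by (auto simp: set_eq_iff)

lemma bad_strip: "bad \<times> {0..1::real} \<in> sets lborel" "emeasure lborel (bad \<times> {0..1::real}) = 0"
proof -
  show "bad \<times> {0..1::real} \<in> sets lborel"
    using pair_measureI[OF bad_borel, of "{0..1::real}" borel] unfolding borel_prod by simp
  have "emeasure (lborel \<Otimes>\<^sub>M lborel) (bad \<times> {0..1::real}) = emeasure lborel bad * emeasure lborel {0..1::real}"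
    using bad_borel by (intro lborel.emeasure_pair_measure_Times) auto
  then show "emeasure lborel (bad \<times> {0..1::real}) = 0" by (simp add: lborel_prod bad_null)
qed

lemma physical_mu: "physical_measure F \<mu>"
  unfolding physical_measure_def invariant_prob_def
proof (intro conjI mu_prob sets_mu F_mu mu_inv)
  have "{0..1} - bad \<in> sets borel" using bad_borel by simp
  from pair_measureI[OF this, of "{0..1::real}" borel]
  have s: "({0..1} - bad) \<times> {0..1::real} \<in> sets lborel" unfolding borel_prod by simp
  have "emeasure lborel ({0..1} - bad) = emeasure lborel {0..1::real} - emeasure lborel bad"
    using bad_borel bad_sub by (intro emeasure_Diff) (simp_all add: bad_null)
  then have 1: "emeasure lborel ({0..1} - bad) = 1" by (simp add: bad_null)
  have "emeasure (lborel \<Otimes>\<^sub>M lborel) (({0..1} - bad) \<times> {0..1::real}) = emeasure lborel ({0..1} - bad) * emeasure lborel {0..1::real}"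
    using bad_borel by (intro lborel.emeasure_pair_measure_Times) auto
  then have "emeasure lborel (({0..1} - bad) \<times> {0..1::real}) = 1" by (simp add: lborel_prod 1)
  then show "0 < emeasure lebesgue (ergodic_basin F \<mu>)" unfolding basin_eq using s by simp
qed

text \<open>The basin of another physical measure has positive area, so it has a point over a base
  point outside \<open>bad\<close>. The averages at this point converge to the integrals of both
  measures.\<close>

lemma physical_unique: assumes p: "physical_measure F \<mu>'" shows "\<mu>' = \<mu>"
proof -
  have mu': "prob_space \<mu>'" "sets \<mu>' = sets QB" using p by (auto simp: physical_measure_def invariant_prob_def)
  have "\<not> ergodic_basin F \<mu>' \<subseteq> bad \<times> {0..1}"
  proof
    assume "ergodic_basin F \<mu>' \<subseteq> bad \<times> {0..1}"
    then have "emeasure lebesgue (ergodic_basin F \<mu>') \<le> emeasure lebesgue (bad \<times> {0..1::real})"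
      using bad_strip(1) by (intro emeasure_mono) auto
    then show False using bad_strip p by (simp add: physical_measure_def)
  qed
  then obtain q where q: "q \<in> ergodic_basin F \<mu>'" "q \<notin> bad \<times> {0..1}" by blast
  have q1: "q \<in> unit_square" using q(1) unfolding ergodic_basin_def by blast
  have q2: "q \<in> ergodic_basin F \<mu>" using q(2) q1 unfolding basin_iff by (simp add: mem_Times_iff)
  have "(\<integral>x. \<phi> x \<partial>\<mu>') = (\<integral>x. \<phi> x \<partial>\<mu>)" if phi: "continuous_on UNIV \<phi>" for \<phi> :: "real \<times> real \<Rightarrow> real"
  proof -
    have c: "continuous_on unit_square \<phi>" by (rule continuous_on_subset[OF phi subset_UNIV])
    have "(\<lambda>n. birk \<phi> n q) \<longlonglongrightarrow> (\<integral>x. \<phi> x \<partial>\<mu>')" using q(1) c unfolding ergodic_basin_def birk_def by blast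
    moreover have "(\<lambda>n. birk \<phi> n q) \<longlonglongrightarrow> (\<integral>x. \<phi> x \<partial>\<mu>)" using q2 c unfolding ergodic_basin_def birk_def by blast
    ultimately show ?thesis by (rule LIMSEQ_unique)
  qed
  moreover have "unit_square \<in> sets borel" by (intro borel_closed closed_Times closed_atLeastAtMost)
  moreover have "finite_measure \<mu>'" "finite_measure \<mu>" using mu' mu_prob by (simp_all add: prob_space_def)
  ultimately show ?thesis using mu'(2) sets_mu by (intro measure_eq_continuous[of unit_square]) 
qed

end

section \<open>From the norms and variations of the statement to the locales\<close>

lemma (in skew) Lip_lipf:
  assumes f: "f \<in> Lip" obtains A B where "lipf A B f" "0 \<le> A + B" "ennreal (A + B) = lip_norm f"
proof -
  define s where "s = (SUP q\<in>unit_square. ennreal \<bar>f q\<bar>)"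
  have fin: "s < \<infinity>" "lip_seminorm f < \<infinity>" using f by (auto simp: Lip_def lip_norm_def s_def)
  define A where "A = enn2real s"
  define B where "B = enn2real (lip_seminorm f)"
  have AB: "ennreal A = s" "ennreal B = lip_seminorm f" "0 \<le> A" "0 \<le> B" using fin by (simp_all add: A_def B_def)
  have "\<bar>f q\<bar> \<le> A" if "q \<in> unit_square" for q
  proof -
    have "ennreal \<bar>f q\<bar> \<le> ennreal A" unfolding AB s_def by (rule SUP_upper[OF that])
    then show ?thesis by (simp only: ennreal_le_iff[OF AB(3)])
  qed
  moreover have "\<bar>f q - f q'\<bar> \<le> B * (\<bar>fst q - fst q'\<bar> + \<bar>snd q - snd q'\<bar>)"
    if q: "q \<in> unit_square" "q' \<in> unit_square" for q q'
  proof (cases "q = q'")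
    case False
    have "(q, q') \<in> {(p, q). p \<in> unit_square \<and> q \<in> unit_square \<and> p \<noteq> q}" using q False by blast
    from SUP_upper[OF this, of "\<lambda>(p, q). ennreal (\<bar>f p - f q\<bar> / dist p q)"]
    have "ennreal (\<bar>f q - f q'\<bar> / dist q q') \<le> ennreal B" unfolding AB lip_seminorm_def by simp
    then have "\<bar>f q - f q'\<bar> / dist q q' \<le> B" by (simp only: ennreal_le_iff[OF AB(4)])
    then have "\<bar>f q - f q'\<bar> \<le> B * dist q q'" using False by (simp add: divide_le_eq)
    also have "dist q q' \<le> \<bar>fst q - fst q'\<bar> + \<bar>snd q - snd q'\<bar>"
      unfolding dist_prod_def dist_real_def by (rule sqrt_sum_squares_le_sum) simp_all
    then have "B * dist q q' \<le> B * (\<bar>fst q - fst q'\<bar> + \<bar>snd q - snd q'\<bar>)" using AB by (intro mult_left_mono)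
    finally show ?thesis .
  qed simp
  ultimately have "lipf A B f" using AB unfolding lipf_def by blast
  moreover have "ennreal (A + B) = lip_norm f" using AB by (simp add: lip_norm_def s_def)
  ultimately show ?thesis using AB by (intro that[of A B]) auto
qed

theorem theorem1:
  fixes F :: "real \<times> real \<Rightarrow> real \<times> real"
    and T :: "real \<Rightarrow> real" and G :: "real \<times> real \<Rightarrow> real"
    and l p :: real and m :: nat and c :: "nat \<Rightarrow> real" and \<nu> :: "real measure"
  assumes F_maps: "F \<in> unit_square \<rightarrow> unit_square"
    and F_form: "\<And>x y. x \<in> {0..1} \<Longrightarrow> y \<in> {0..1} \<Longrightarrow> F (x, y) = (T x, G (x, y))"
    and l_less: "l < 1"
    and leaf_lipschitz: "\<And>x. x \<in> {0..1} \<Longrightarrow> l-lipschitz_on ({x} \<times> {0..1}) F"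
    and G_variation: "var_square G < \<infinity>"
    and T_maps: "T \<in> {0..1} \<rightarrow> {0..1}"
    and c_ends: "c 0 = 0" "c (Suc m) = 1"
    and c_less: "\<And>i. i \<le> m \<Longrightarrow> c i < c (Suc i)"
    and T_increasing: "\<And>i. i \<le> m \<Longrightarrow> mono_on {c i<..<c (Suc i)} T"
    and T_differentiable: "\<And>i. i \<le> m \<Longrightarrow> T differentiable_on {c i<..<c (Suc i)}"
    and T_C1: "\<And>i. i \<le> m \<Longrightarrow> continuous_on {c i<..<c (Suc i)} (unit_deriv T)"
    and T_expanding: "(INF x\<in>diff_points T. \<bar>unit_deriv T x\<bar>) > 1"
    and p_ge_1: "1 \<le> p"
    and T_variation: "p_variation p (diff_points T) (\<lambda>x. 1 / unit_deriv T x) < \<infinity>"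
    and \<nu>_acip: "ac_invariant_prob T \<nu>"
    and \<nu>_unique: "\<And>\<nu>'. ac_invariant_prob T \<nu>' \<Longrightarrow> \<nu>' = \<nu>"
    and \<nu>_mixing: "weakly_mixing T \<nu>"
  shows "\<exists>\<mu>. physical_measure F \<mu> \<and> (\<forall>\<mu>'. physical_measure F \<mu>' \<longrightarrow> \<mu>' = \<mu>) \<and>
    (\<exists>C \<Lambda> :: real. 0 < C \<and> 0 < \<Lambda> \<and> \<Lambda> < 1 \<and>
      (\<forall>f\<in>Lip. \<forall>g\<in>Lip. \<forall>n\<ge>1.
        ennreal \<bar>(\<integral>q. f q * g ((F ^^ n) q) \<partial>\<mu>) - (\<integral>q. g q \<partial>\<mu>) * (\<integral>q. f q \<partial>\<mu>)\<bar>
          \<le> ennreal (C * \<Lambda> ^ n) * lip_norm g * lip_norm f))"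
proof -
  let ?d = "unit_deriv T"
  \<comment> \<open>The expansion constant; its reciprocal becomes \<open>\<kappa>\<close>.\<close>
  define M where "M = (INF x\<in>diff_points T. \<bar>?d x\<bar>)"
  have M: "1 < M" using T_expanding by (simp add: M_def)
  have c_mono: "c i \<le> c j" if "i \<le> j" "j \<le> Suc m" for i j
    using that
  proof (induction j)
    case (Suc j)
    then show ?case using c_less[of j] by (cases "i = Suc j") force+
  qed auto
  have sub: "{c i<..<c (Suc i)} \<subseteq> {0<..<1}" if "i \<le> m" for i
    using c_mono[of 0 i] c_mono[of "Suc i" "Suc m"] that c_ends by auto
  have dT: "x \<in> diff_points T \<and> (T has_real_derivative ?d x) (at x)" if i: "i \<le> m" and x: "x \<in> {c i<..<c (Suc i)}" for i x
  proof -
    have x1: "x \<in> {0<..<1}" using sub[OF i] x by blast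
    then have w: "at x within {0..1} = at x" by (intro at_within_interior) simp
    have "T differentiable (at x)"
      using T_differentiable[OF i] x by (metis differentiable_on_eq_differentiable_at open_greaterThanLessThan)
    then have "T differentiable (at x within {0..1})" "(T has_vector_derivative ?d x) (at x)"
      unfolding unit_deriv_def w by (simp_all add: vector_derivative_works)
    then show ?thesis using x1 by (simp add: diff_points_def has_real_derivative_iff_has_vector_derivative)
  qed
  \<comment> \<open>The branches increase, so the derivative is nonnegative and the bound on its
    absolute value bounds the derivative itself.\<close>
  have dM: "M \<le> ?d x" if i: "i \<le> m" and x: "x \<in> {c i<..<c (Suc i)}" for i x
  proof -
    have "M \<le> \<bar>?d x\<bar>"
      unfolding M_def using dT[OF i x] by (intro cINF_lower bdd_belowI2[of _ 0]) auto
    moreover have "0 \<le> ?d x"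
      by (rule mono_on_imp_deriv_nonneg[OF T_increasing[OF i]]) (use dT[OF i x] x in auto)
    ultimately show ?thesis by simp
  qed
  \<comment> \<open>\<open>p_variation\<close> contains the root \<open>1 / p\<close>, whereas the
    locale bounds the sum of p-th powers.\<close>
  define V where "V = enn2real (p_variation p (diff_points T) (\<lambda>x. 1 / ?d x)) powr p"
  interpret pw_expanding T "\<lambda>x. 1 / ?d x" c "Suc m" "1 / M" p V
  proof unfold_locales
    show "T x \<in> {0..1}" if "x \<in> {0..1}" for x using T_maps that by blast
    fix i assume "i < Suc m"
    then have i: "i \<le> m" by simp
    show "c i < c (Suc i)" by (rule c_less[OF i])
    fix x assume x: "x \<in> {c i<..<c (Suc i)}"
    show "(T has_real_derivative 1 / (1 / ?d x)) (at x)" using dT[OF i x] by simp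
    show "0 < 1 / ?d x" "1 / ?d x \<le> 1 / M" using dM[OF i x] M by (auto intro!: divide_left_mono)
  next
    fix i assume "i < Suc m"
    then have i: "i \<le> m" by simp
    show "continuous_on {c i<..<c (Suc i)} (\<lambda>x. 1 / ?d x)"
      using dM[OF i] M by (intro continuous_on_divide continuous_on_const T_C1[OF i]) force
  next
    fix k :: nat and x assume x: "mono_on {1..k} x" "x ` {1..k} \<subseteq> (\<Union>i<Suc m. {c i<..<c (Suc i)})"
    define S where "S = (\<Sum>i = 1..<k. \<bar>1 / ?d (x i) - 1 / ?d (x (Suc i))\<bar> powr p)"
    have S0: "0 \<le> S" unfolding S_def by (intro sum_nonneg) simp
    have "x ` {1..k} \<subseteq> diff_points T"
    proof
      fix z assume "z \<in> x ` {1..k}"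
      then obtain i where "i < Suc m" "z \<in> {c i<..<c (Suc i)}" using x(2) by blast
      then show "z \<in> diff_points T" using dT[of i z] by simp
    qed
    then have "(x, k) \<in> {(x, k). mono_on {1..k} x \<and> x ` {1..k} \<subseteq> diff_points T}" using x(1) by blast
    from SUP_upper[OF this, of "\<lambda>(x, k). ennreal ((\<Sum>i = 1..<k. \<bar>1 / ?d (x i) - 1 / ?d (x (Suc i))\<bar> powr p) powr (1 / p))"]
    have "ennreal (S powr (1 / p)) \<le> p_variation p (diff_points T) (\<lambda>x. 1 / ?d x)"
      unfolding p_variation_def S_def by simp
    then have "S powr (1 / p) \<le> enn2real (p_variation p (diff_points T) (\<lambda>x. 1 / ?d x))"
      using enn2real_mono[of "ennreal (S powr (1 / p))"] T_variation by simp
    then have "(S powr (1 / p)) powr p \<le> V" unfolding V_def using p_ge_1 by (intro powr_mono2) auto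
    then have "S \<le> V" using S0 p_ge_1 by (simp add: powr_powr)
    then show "(\<Sum>i = 1..<k. \<bar>1 / ?d (x i) - 1 / ?d (x (Suc i))\<bar> powr p) \<le> V" unfolding S_def .
  next
    \<comment> \<open>Measurability of \<open>T\<close> is contained in the invariance of \<nu>,
      which has the same measurable sets as \<open>LB\<close>.\<close>
    show "T \<in> LB \<rightarrow>\<^sub>M LB"
    proof -
      have "sets \<nu> = sets LB" using \<nu>_acip sets_LB by (simp add: ac_invariant_prob_def invariant_prob_def)
      then show ?thesis using \<nu>_acip measurable_cong_sets[of \<nu> LB \<nu> LB] by (simp add: ac_invariant_prob_def invariant_prob_def)
    qed
  qed (use c_ends M p_ge_1 in auto)
  interpret pw_mixing T "\<lambda>x. 1 / ?d x" c "Suc m" "1 / M" p V \<nu>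
    by unfold_locales (fact \<nu>_acip \<nu>_unique \<nu>_mixing)+
  interpret skew T "\<lambda>x. 1 / ?d x" c "Suc m" "1 / M" p V \<nu> F G l "enn2real (var_square G)"
  proof unfold_locales
    show "F q \<in> unit_square" if "q \<in> unit_square" for q using F_maps that by (rule funcset_mem)
    show "F (x, y) = (T x, G (x, y))" if "x \<in> {0..1}" "y \<in> {0..1}" for x y by (rule F_form[OF that])
    show "0 \<le> l" using leaf_lipschitz[of 0] by (auto intro: lipschitz_on_nonneg)
    show "l < 1" by fact
    show "\<bar>G (x, y) - G (x, y')\<bar> \<le> l * \<bar>y - y'\<bar>" if "x \<in> {0..1}" "y \<in> {0..1}" "y' \<in> {0..1}" for x y y'
    proof -
      have "dist (F (x, y)) (F (x, y')) \<le> l * dist (x, y) (x, y')"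
        by (rule lipschitz_onD[OF leaf_lipschitz[OF that(1)]]) (use that in auto)
      then show ?thesis unfolding F_form[OF that(1,2)] F_form[OF that(1,3)] by (simp add: dist_Pair_Pair dist_real_def)
    qed
    show "(\<Sum>i = 1..<k. \<bar>G (a i, b i) - G (a (Suc i), b i)\<bar>) \<le> enn2real (var_square G)"
      if "mono_on {1..k} a" "a ` {1..k} \<subseteq> {0..1}" "b ` {1..k} \<subseteq> {0..1}" for a b and k :: nat
    proof -
      have "(a, b, k) \<in> {(x, y, k). mono_on {1..k} x \<and> x ` {1..k} \<subseteq> {0..1} \<and> y ` {1..k} \<subseteq> {0..1}}" using that by blast
      from SUP_upper[OF this, of "\<lambda>(x, y, k). ennreal (\<Sum>i = 1..<k. \<bar>G (x i, y i) - G (x (Suc i), y i)\<bar>)"]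
      have "ennreal (\<Sum>i = 1..<k. \<bar>G (a i, b i) - G (a (Suc i), b i)\<bar>) \<le> var_square G"
        unfolding var_square_def by simp
      from enn2real_mono[OF this] G_variation show ?thesis by (simp add: sum_nonneg)
    qed
  qed
  obtain \<mu> where mu: "prob_space \<mu>" "sets \<mu> = sets QB" "F \<in> \<mu> \<rightarrow>\<^sub>M \<mu>" "distr \<mu> \<mu> F = \<mu>"
    "\<And>A f. bm A f \<Longrightarrow> (\<integral>q. f (fst q) \<partial>\<mu>) = (\<integral>x. f x \<partial>\<nu>)"
    using invariant_lift by blast
  interpret skew_lift T "\<lambda>x. 1 / ?d x" c "Suc m" "1 / M" p V \<nu> F G l "enn2real (var_square G)" \<mu>
    by (intro skew_lift.intro skew_lift_axioms.intro skew_axioms mu)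
  obtain C \<Lambda> where L: "0 < \<Lambda>" "\<Lambda> < 1" "0 < C" and
    dec: "\<And>A B A' B' f g n. lipf A B f \<Longrightarrow> lipf A' B' g \<Longrightarrow>
      \<bar>(\<integral>q. f q * g ((F ^^ n) q) \<partial>\<mu>) - (\<integral>q. f q \<partial>\<mu>) * (\<integral>q. g q \<partial>\<mu>)\<bar> \<le> C * \<Lambda> ^ n * (A + B) * (A' + B')"
    using mu_decay by blast
  have "ennreal \<bar>(\<integral>q. f q * g ((F ^^ n) q) \<partial>\<mu>) - (\<integral>q. g q \<partial>\<mu>) * (\<integral>q. f q \<partial>\<mu>)\<bar>
      \<le> ennreal (C * \<Lambda> ^ n) * lip_norm g * lip_norm f" if f: "f \<in> Lip" and g: "g \<in> Lip" for f g n
  proof -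
    obtain A B where A: "lipf A B f" "0 \<le> A + B" "ennreal (A + B) = lip_norm f" using Lip_lipf[OF f] .
    obtain A' B' where A': "lipf A' B' g" "0 \<le> A' + B'" "ennreal (A' + B') = lip_norm g" using Lip_lipf[OF g] .
    have "\<bar>(\<integral>q. f q * g ((F ^^ n) q) \<partial>\<mu>) - (\<integral>q. g q \<partial>\<mu>) * (\<integral>q. f q \<partial>\<mu>)\<bar> \<le> C * \<Lambda> ^ n * (A' + B') * (A + B)"
      using dec[OF A(1) A'(1), of n] by (simp only: mult_ac)
    then show ?thesis
      unfolding A(3)[symmetric] A'(3)[symmetric] using L A(2) A'(2) by (simp add: ennreal_mult[symmetric] ennreal_leI)
  qed
  then show ?thesis using physical_mu physical_unique L by blast
qed

end
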